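(* Let $(\delta,\nu)\in\gamma_+\cup\gamma_-$ and let $\sigma$ be a root of $\mathcal P(\sigma;\delta,\nu)=0$. (i) If $\mathcal P'(\sigma;\delta,\nu)\neq0$, then system (MS) has a solution $(\rho_*(\tau),\psi_*(\tau))$, defined for $\tau\ge0$, with asymptotic expansion of type (E1) with this $\sigma$. (ii) If $\mathcal P'(\sigma;\delta,\nu)=0$ and $\mathcal P''(\sigma;\delta,\nu)<0$, then system (MS) has two different solutions $(\rho_*(\tau),\psi_*(\tau))$, defined for $\tau\ge0$, with asymptotic expansions of type (E2), one with $\psi_1=\phi$ and one with $\psi_1=-\phi$. (iii) If $\mathcal P'(\sigma;\delta,\nu)=0$ and $\mathcal P''(\sigma;\delta,\nu)=0$, then system (MS) has a solution $(\rho_*(\tau),\psi_*(\tau))$, defined for $\tau\ge0$, with asymptotic expansion of type (E3).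
   Context: Let $\lambda>0$, $\nu\in[0,\pi)$, and let $\mu:[0,\infty)\to\mathbb R$ be a smooth function with asymptotic expansion $\mu(\tau)=\tau^{-1/2}\big(\mu_0+\sum_{k\ge1}\mu_k\tau^{-k}\big)$ as $\tau\to\infty$, with constants $\mu_k$. System (MS) for unknown functions $\rho(\tau),\psi(\tau)$, $\tau\ge0$, is $\frac{d\rho}{d\tau}+\mu(\tau)\rho\sin(2\psi+\nu)=\sin\psi$, $\quad\rho\big[\frac{d\psi}{d\tau}-\rho^2+\lambda\tau\big]+\mu(\tau)\rho\cos(2\psi+\nu)=\cos\psi$. Set $\delta:=\mu_0\sqrt\lambda$ and $\mathcal P(\sigma;\delta,\nu):=\delta\sin(2\sigma+\nu)-\sin\sigma$; primes on $\mathcal P$ denote derivatives in $\sigma$. Let $\gamma(\delta,\nu):=(4\delta^2-1)^3-27\delta^2\sin^2\nu$ and $\gamma_\pm:=\{(\delta,\nu)\in\mathbb R\times[0,\pi):\gamma(\delta,\nu)=0,\ \pm\delta>0\}$. Asymptotic expansion types (asymptotic series with constant coefficients as $\tau\to\infty$, $\sigma$ a root of $\mathcal P(\cdot;\delta,\nu)=0$): (E1) $\rho(\tau)\sim\sqrt\lambda\,\tau^{1/2}+\sum_{k\ge1}\rho_k\tau^{-k/2}$, $\psi(\tau)\sim\sigma+\sum_{k\ge1}\psi_k\tau^{-k/2}$ (here $\mathcal P'(\sigma;\delta,\nu)\ne0$, $\rho_1=0$, $\psi_1=-\sqrt\lambda/(2\mathcal P'(\sigma;\delta,\nu))$); (E2)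 $\rho(\tau)\sim\sqrt\lambda\,\tau^{1/2}+\sum_{k\ge2}\rho_k\tau^{-k/4}$, $\psi(\tau)\sim\sigma+\sum_{k\ge1}\psi_k\tau^{-k/4}$ with $\psi_1\in\{\phi,-\phi\}$, where $\phi:=\sqrt{-\sqrt\lambda/\mathcal P''(\sigma;\delta,\nu)}$ (requires $\mathcal P''(\sigma;\delta,\nu)<0$); (E3) $\rho(\tau)\sim\sqrt\lambda\,\tau^{1/2}+\sum_{k\ge2}\rho_k\tau^{-k/6}$, $\psi(\tau)\sim\sigma+\sum_{k\ge1}\psi_k\tau^{-k/6}$ with $\psi_1=-\chi$, $\chi:=\big(3\sqrt\lambda/\mathcal P'''(\sigma;\delta,\nu)\big)^{1/3}$. *)

theory Defs
  imports "HOL-Analysis.Analysis" "HOL-Library.Landau_Symbols"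
begin

definition Pfun :: "real \<Rightarrow> real \<Rightarrow> real \<Rightarrow> real" where
  "Pfun \<delta> \<nu> \<sigma> = \<delta> * sin (2 * \<sigma> + \<nu>) - sin \<sigma>"

definition Pder :: "nat \<Rightarrow> real \<Rightarrow> real \<Rightarrow> real \<Rightarrow> real" where
  "Pder n \<delta> \<nu> \<sigma> = (deriv ^^ n) (Pfun \<delta> \<nu>) \<sigma>"

definition gamma_fun :: "real \<Rightarrow> real \<Rightarrow> real" where
  "gamma_fun \<delta> \<nu> = (4 * \<delta>\<^sup>2 - 1) ^ 3 - 27 * \<delta>\<^sup>2 * (sin \<nu>)\<^sup>2"

definition in_gamma_pm :: "real \<Rightarrow> real \<Rightarrow> bool" where
  "in_gamma_pm \<delta> \<nu> \<longleftrightarrow> 0 \<le> \<nu> \<and> \<nu> < pi \<and> gamma_fun \<delta> \<nu> = 0 \<and> \<delta> \<noteq> 0"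

definition asymp_exp :: "real \<Rightarrow> real \<Rightarrow> (real \<Rightarrow> real) \<Rightarrow> (nat \<Rightarrow> real) \<Rightarrow> bool" where
  "asymp_exp a q f c \<longleftrightarrow>
     (\<forall>N. (\<lambda>\<tau>. f \<tau> - (\<Sum>k\<le>N. c k * \<tau> powr (a - real k / q)))
            \<in> O[at_top](\<lambda>\<tau>. \<tau> powr (a - real (Suc N) / q)))"

definition smooth_on_nonneg :: "(real \<Rightarrow> real) \<Rightarrow> bool" where
  "smooth_on_nonneg f \<longleftrightarrow>
     (\<exists>D. D 0 = f \<and> (\<forall>n. \<forall>t\<ge>0. (D n has_real_derivative D (Suc n) t) (at t within {0..})))"

definition MS_solution :: "real \<Rightarrow> real \<Rightarrow> (real \<Rightarrow> real) \<Rightarrow> (real \<Rightarrow> real) \<Rightarrow> (real \<Rightarrow> real) \<Rightarrow> bool" where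
  "MS_solution lam \<nu> \<mu> \<rho> \<psi> \<longleftrightarrow>
     (\<forall>\<tau>\<ge>0. \<exists>d\<rho> d\<psi>.
        (\<rho> has_real_derivative d\<rho>) (at \<tau> within {0..}) \<and>
        (\<psi> has_real_derivative d\<psi>) (at \<tau> within {0..}) \<and>
        d\<rho> + \<mu> \<tau> * \<rho> \<tau> * sin (2 * \<psi> \<tau> + \<nu>) = sin (\<psi> \<tau>) \<and>
        \<rho> \<tau> * (d\<psi> - (\<rho> \<tau>)\<^sup>2 + lam * \<tau>) + \<mu> \<tau> * \<rho> \<tau> * cos (2 * \<psi> \<tau> + \<nu>) = cos (\<psi> \<tau>))"

definition has_E1 :: "real \<Rightarrow> real \<Rightarrow> real \<Rightarrow> real \<Rightarrow> (real \<Rightarrow> real) \<Rightarrow> (real \<Rightarrow> real) \<Rightarrow> bool" where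
  "has_E1 lam \<delta> \<nu> \<sigma> \<rho> \<psi> \<longleftrightarrow>
     (\<exists>rc pc. asymp_exp 0 2 (\<lambda>\<tau>. \<rho> \<tau> - sqrt lam * \<tau> powr (1/2)) rc \<and> rc 0 = 0 \<and> rc 1 = 0 \<and>
             asymp_exp 0 2 \<psi> pc \<and> pc 0 = \<sigma> \<and> pc 1 = - sqrt lam / (2 * Pder 1 \<delta> \<nu> \<sigma>))"

definition has_E2 :: "real \<Rightarrow> real \<Rightarrow> real \<Rightarrow> (real \<Rightarrow> real) \<Rightarrow> (real \<Rightarrow> real) \<Rightarrow> bool" where
  "has_E2 lam \<sigma> p1 \<rho> \<psi> \<longleftrightarrow>
     (\<exists>rc pc. asymp_exp 0 4 (\<lambda>\<tau>. \<rho> \<tau> - sqrt lam * \<tau> powr (1/2)) rc \<and> rc 0 = 0 \<and> rc 1 = 0 \<and>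
             asymp_exp 0 4 \<psi> pc \<and> pc 0 = \<sigma> \<and> pc 1 = p1)"

definition has_E3 :: "real \<Rightarrow> real \<Rightarrow> real \<Rightarrow> real \<Rightarrow> (real \<Rightarrow> real) \<Rightarrow> (real \<Rightarrow> real) \<Rightarrow> bool" where
  "has_E3 lam \<delta> \<nu> \<sigma> \<rho> \<psi> \<longleftrightarrow>
     (\<exists>rc pc. asymp_exp 0 6 (\<lambda>\<tau>. \<rho> \<tau> - sqrt lam * \<tau> powr (1/2)) rc \<and> rc 0 = 0 \<and> rc 1 = 0 \<and>
             asymp_exp 0 6 \<psi> pc \<and> pc 0 = \<sigma> \<and>
             pc 1 = - root 3 (3 * sqrt lam / Pder 3 \<delta> \<nu> \<sigma>))"

end

theory Submission
  imports Defs "HOL-Computational_Algebra.Polynomial_FPS"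
begin

text \<open>Put \<open>z = \<rho> exp(i(\<psi> - \<sigma>))\<close>. The system becomes
  \<open>z' = i exp(-i\<sigma>) + i (|z|\<^sup>2 - \<lambda>\<tau>) z - i \<mu> exp(-i(2\<sigma> + \<nu>)) cnj z\<close>, which is polynomial in \<open>z\<close> and \<open>cnj z\<close> and whose
  cubic term only rotates, so that all solutions are global. Conversely, the zeros of a solution are simple
  because \<open>exp(-i\<sigma>) \<noteq> 0\<close>, hence polar coordinates with a signed modulus are differentiable across them.

  Let \<open>m = 1, 2, 3\<close> be the multiplicity of the root \<open>\<sigma>\<close> and \<open>s = \<tau> powr (-1/(2m))\<close>. A formal solution
  \<open>z = s^(-m) (x(s) + i y(s))\<close> is found as the fixed point of a contraction of power series. Linearizing at a
  truncation of it gives, after a scaling, either a slowly perturbed rotation or a slowly perturbed saddle, with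
  perturbations beyond all fixed orders as the truncation grows. A solution staying close to the formal one is
  found for a rotation as a limit of solutions with vanishing deviation at \<open>T \<rightarrow> \<infinity>\<close>, and for a saddle by
  Wazewski's principle. Its distance to every longer truncation is then estimated along the same lines, and the
  expansions of \<open>\<rho> = |z|\<close> and \<open>\<psi> = \<sigma> + arctan (Im z / Re z)\<close> follow.\<close>

section \<open>The cubic equation\<close>

text \<open>The obstacle is the half-line: a solution singled out by its behaviour at infinity has
  to exist down to time 0, while (MS) degenerates where \<rho> vanishes. The equation for
  \<open>z\<close> has no such singularity, so \<rho> may pass through 0 and change sign on the way.
  The exponents follow one budget. In scaled deviations a solution is built with
  \<open>u\<^sup>2 + v\<^sup>2 \<le> 1 / t ^ 32\<close>. Undoing the scaling gives a deviation of
  order t^-15, recorded as t^-14; scaling again, for another truncation, gives amplitudes of order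
  t^-13. These still lie in the wider tube \<open>u\<^sup>2 + v\<^sup>2 \<le> 1 / t ^ 20\<close> in
  which the perturbation is controlled. The numbers are not sharp; only the gaps between them
  matter. With y_1 = sqrt lam psi_1 the leading coefficient \<open>\<Delta>\<close> of the
  linearized determinant is 2 sqrt lam P' for m = 1, 2 P'' y_1 for m = 2 and P''' y_1^2 / sqrt lam
  for m = 3. So of the two solutions in case (ii) the one with psi_1 = phi belongs to a saddle and
  the other to a rotation.\<close>

lemma deriv_nonneg_imp_le:
  fixes f :: "real \<Rightarrow> real"
  assumes "a \<le> b"
    and "\<And>x. x \<in> {a..b} \<Longrightarrow> (f has_real_derivative f' x) (at x within {a..b})"
    and "\<And>x. x \<in> {a..b} \<Longrightarrow> 0 \<le> f' x"
  shows "f a \<le> f b"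
proof -
  have "\<exists>x\<in>{a..b}. f b - f a = (\<lambda>h. f' x * h) (b - a)"
    using assms(1,2) by (intro mvt_very_simple) (auto simp: has_field_derivative_def)
  then obtain x where "x \<in> {a..b}" "f b - f a = f' x * (b - a)" by auto
  moreover have "0 \<le> f' x * (b - a)" using assms \<open>x \<in> {a..b}\<close> by simp
  ultimately show ?thesis by linarith
qed

lemma gronwall:
  fixes f :: "real \<Rightarrow> real"
  assumes ab: "a \<le> b"
    and d: "\<And>x. x \<in> {a..b} \<Longrightarrow> (f has_real_derivative f' x) (at x within {a..b})"
    and le: "\<And>x. x \<in> {a..b} \<Longrightarrow> f' x \<le> k * f x"
  shows "f b \<le> f a * exp (k * (b - a))"
proof -
  have "- (f a * exp (- k * (a - a))) \<le> - (f b * exp (- k * (b - a)))"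
  proof (rule deriv_nonneg_imp_le[OF ab,
        where f = "\<lambda>x. - (f x * exp (- k * (x - a)))" and f' = "\<lambda>x. exp (- k * (x - a)) * (k * f x - f' x)"])
    fix x assume x: "x \<in> {a..b}"
    show "((\<lambda>x. - (f x * exp (- k * (x - a)))) has_real_derivative
        exp (- k * (x - a)) * (k * f x - f' x)) (at x within {a..b})"
      by (rule derivative_eq_intros refl d[OF x] | simp)+ (simp add: algebra_simps)
    show "0 \<le> exp (- k * (x - a)) * (k * f x - f' x)" using le[OF x] by simp
  qed
  then have "f b * exp (- k * (b - a)) * exp (k * (b - a)) \<le> f a * exp (k * (b - a))"
    by (intro mult_right_mono) simp_all
  then show ?thesis by (simp add: mult.assoc flip: exp_add)
qed

section \<open>Global existence and continuous dependence for the cubic equation\<close>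

lemma continuous_on_clamp:
  fixes g :: "real \<Rightarrow> 'a::topological_space"
  assumes "continuous_on {0..} g"
  shows "continuous_on S (\<lambda>t. g (max 0 t))"
  by (rule continuous_on_compose2[OF assms]) (intro continuous_intros, auto)

text \<open>The weight turns the Picard operator into a contraction on the whole half-line (Bielecki's norm).\<close>

lemma picard_weighted:
  fixes F :: "real \<Rightarrow> 'a::banach \<Rightarrow> 'a" and L w w' :: "real \<Rightarrow> real"
  assumes contF: "\<And>z. continuous_on {0..} z \<Longrightarrow> continuous_on {0..} (\<lambda>t. F t (z t))"
    and lip: "\<And>t x y. 0 \<le> t \<Longrightarrow> norm (F t x - F t y) \<le> L t * norm (x - y)"
    and L0: "\<And>t. 0 \<le> t \<Longrightarrow> 0 \<le> L t"
    and wpos: "\<And>t. 0 \<le> t \<Longrightarrow> 0 < w t"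
    and wd: "\<And>t. 0 \<le> t \<Longrightarrow> (w has_real_derivative w' t) (at t within {0..})"
    and wL: "\<And>t. 0 \<le> t \<Longrightarrow> 2 * L t * w t \<le> w' t"
    and bd: "\<And>t. 0 \<le> t \<Longrightarrow> norm (z0 + integral {0..t} (\<lambda>s. F s 0)) \<le> B * w t"
  shows "\<exists>z. z 0 = z0 \<and> (\<forall>t\<ge>0. (z has_vector_derivative F t (z t)) (at t within {0..}))"
proof -
  have wc: "continuous_on {0..} w"
    using wd by (meson atLeast_iff continuous_on_eq_continuous_within has_field_derivative_def has_derivative_continuous)
  have Fh: "continuous_on {0..} (\<lambda>s. F s (w s *\<^sub>R h s))" if "continuous_on {0..} h" for h
    by (intro contF continuous_intros wc that)
  have int: "(\<lambda>s. F s (w s *\<^sub>R h s)) integrable_on {0..t}" if "continuous_on {0..} h" for h t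
    by (rule integrable_continuous_real) (rule continuous_on_subset[OF Fh[OF that]], auto)
  \<comment> \<open>\<open>wL\<close> bounds the Lipschitz estimate of the integrand by
    \<open>d / 2 * w'\<close>, whose integral is at most \<open>d / 2 * w t\<close>: this is the
    factor 1/2 of the contraction.\<close>
  have key: "norm (integral {0..t} (\<lambda>s. F s (w s *\<^sub>R h s)) - integral {0..t} (\<lambda>s. F s (w s *\<^sub>R k s))) \<le> d / 2 * w t"
    if h: "continuous_on {0..} h" and k: "continuous_on {0..} k" and t: "0 \<le> t"
      and d: "\<And>s. 0 \<le> s \<Longrightarrow> norm (h s - k s) \<le> d" for h k t d
  proof -
    have d0: "0 \<le> d" by (rule order_trans[OF norm_ge_zero d[of 0]]) simp
    have w'i: "((\<lambda>s. d / 2 * w' s) has_integral d / 2 * w t - d / 2 * w 0) {0..t}"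
    proof (rule fundamental_theorem_of_calculus[OF t])
      fix x assume "x \<in> {0..t}"
      then have "(w has_real_derivative w' x) (at x within {0..t})"
        using wd[of x] by (auto intro: has_field_derivative_subset)
      from DERIV_cmult[OF this, of "d / 2"]
      show "((\<lambda>s. d / 2 * w s) has_vector_derivative d / 2 * w' x) (at x within {0..t})"
        by (simp add: has_real_derivative_iff_has_vector_derivative)
    qed
    have "norm (integral {0..t} (\<lambda>s. F s (w s *\<^sub>R h s)) - integral {0..t} (\<lambda>s. F s (w s *\<^sub>R k s)))
       = norm (integral {0..t} (\<lambda>s. F s (w s *\<^sub>R h s) - F s (w s *\<^sub>R k s)))"
      by (subst integral_diff) (auto intro: int h k)
    also have "\<dots> \<le> integral {0..t} (\<lambda>s. d / 2 * w' s)"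
    proof (rule integral_norm_bound_integral)
      show "(\<lambda>s. F s (w s *\<^sub>R h s) - F s (w s *\<^sub>R k s)) integrable_on {0..t}"
        by (intro integrable_diff int h k)
      show "(\<lambda>s. d / 2 * w' s) integrable_on {0..t}" using w'i by blast
      fix s assume s: "s \<in> {0..t}"
      have "norm (F s (w s *\<^sub>R h s) - F s (w s *\<^sub>R k s)) \<le> L s * (w s * norm (h s - k s))"
        using lip[of s "w s *\<^sub>R h s" "w s *\<^sub>R k s"] s wpos[of s] 
        by (simp flip: scaleR_diff_right)
      also have "\<dots> = (L s * w s) * norm (h s - k s)" by simp
      also have "\<dots> \<le> (L s * w s) * d"
        using L0[of s] wpos[of s] s d[of s] by (intro mult_left_mono) auto
      also have "\<dots> \<le> (w' s / 2) * d"
        using wL[of s] s d0 by (intro mult_right_mono) auto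
      also have "\<dots> = d / 2 * w' s" by simp
      finally show "norm (F s (w s *\<^sub>R h s) - F s (w s *\<^sub>R k s)) \<le> d / 2 * w' s" .
    qed
    also have "\<dots> = d / 2 * w t - d / 2 * w 0" using w'i by blast
    also have "\<dots> \<le> d / 2 * w t" using d0 wpos[of 0] by simp
    finally show ?thesis .
  qed
  \<comment> \<open>The unknown is the quotient \<open>h = z / w\<close>, which stays bounded.
    Bounded continuous functions live on the whole line, hence \<open>max 0 t\<close>, which extends
    the operator constantly to negative times.\<close>
  define \<Psi> where "\<Psi> h t = (1 / w (max 0 t)) *\<^sub>R (z0 + integral {0..max 0 t} (\<lambda>s. F s (w s *\<^sub>R h s)))"
    for h :: "real \<Rightarrow> 'a" and t
  have intd: "((\<lambda>t. integral {0..t} (\<lambda>s. F s (w s *\<^sub>R h s))) has_vector_derivative F t (w t *\<^sub>R h t)) (at t within {0..})"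
    if h: "continuous_on {0..} h" and t: "0 \<le> t" for h t
  proof -
    have "((\<lambda>t. integral {0..t} (\<lambda>s. F s (w s *\<^sub>R h s))) has_vector_derivative F t (w t *\<^sub>R h t)) (at t within {0..t+1})"
      by (rule integral_has_vector_derivative) (use t in \<open>auto intro: continuous_on_subset[OF Fh[OF h]]\<close>)
    moreover have "at t within {0..t+1} = at t within {0..}"
      by (rule at_within_nhd[where S="{..<t+1}"]) auto
    ultimately show ?thesis by simp
  qed
  have contI: "continuous_on {0..} (\<lambda>t. integral {0..t} (\<lambda>s. F s (w s *\<^sub>R h s)))"
    if h: "continuous_on {0..} h" for h
    using intd[OF h] by (meson atLeast_iff continuous_on_eq_continuous_within has_vector_derivative_continuous)
  have \<Psi>c: "continuous_on UNIV (\<Psi> h)" if h: "continuous_on {0..} h" for h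
    unfolding \<Psi>_def
    using wpos by (intro continuous_intros continuous_on_clamp[of w] continuous_on_clamp[of "\<lambda>t. integral {0..t} (\<lambda>s. F s (w s *\<^sub>R h s))"] wc contI h)
        (auto simp: less_imp_neq[symmetric])
  have \<Psi>b: "\<Psi> (apply_bcontfun h) \<in> bcontfun" for h :: "real \<Rightarrow>\<^sub>C 'a"
  proof (rule bcontfun_normI[OF \<Psi>c])
    fix t :: real
    let ?t = "max 0 t"
    have "norm (integral {0..?t} (\<lambda>s. F s (w s *\<^sub>R apply_bcontfun h s)) - integral {0..?t} (\<lambda>s. F s (w s *\<^sub>R (0::'a)))) \<le> norm h / 2 * w ?t"
      by (rule key) (auto simp: norm_bounded)
    then have "norm ((z0 + integral {0..?t} (\<lambda>s. F s 0)) + (integral {0..?t} (\<lambda>s. F s (w s *\<^sub>R apply_bcontfun h s)) - integral {0..?t} (\<lambda>s. F s 0))) \<le> (B + norm h / 2) * w ?t"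
      using bd[of ?t] by (intro norm_triangle_le) (auto simp: algebra_simps)
    then have "norm (z0 + integral {0..?t} (\<lambda>s. F s (w s *\<^sub>R apply_bcontfun h s))) \<le> (B + norm h / 2) * w ?t"
      by (simp add: algebra_simps)
    then show "norm (\<Psi> (apply_bcontfun h) t) \<le> B + norm h / 2"
      using wpos[of ?t] by (simp add: \<Psi>_def divide_simps)
  qed simp
  define \<Phi> where "\<Phi> h = Bcontfun (\<Psi> (apply_bcontfun h))" for h :: "real \<Rightarrow>\<^sub>C 'a"
  have ap: "apply_bcontfun (\<Phi> h) = \<Psi> (apply_bcontfun h)" for h
    unfolding \<Phi>_def by (rule Bcontfun_inverse[OF \<Psi>b])
  have "dist (\<Phi> h) (\<Phi> k) \<le> 1/2 * dist h k" for h k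
  proof (rule dist_bound)
    fix t :: real
    let ?t = "max 0 t"
    have "norm (integral {0..?t} (\<lambda>s. F s (w s *\<^sub>R apply_bcontfun h s)) - integral {0..?t} (\<lambda>s. F s (w s *\<^sub>R apply_bcontfun k s))) \<le> dist h k / 2 * w ?t"
      by (rule key) (auto simp flip: dist_norm simp: dist_bounded)
    then show "dist (apply_bcontfun (\<Phi> h) t) (apply_bcontfun (\<Phi> k) t) \<le> 1/2 * dist h k"
      using wpos[of ?t] unfolding ap \<Psi>_def dist_norm
      by (simp add: divide_simps flip: scaleR_diff_right)
  qed
  then have "\<exists>!h. \<Phi> h = h"
    by (intro banach_fix_type[of "1/2"]) auto
  then obtain h where "\<Phi> h = h" by blast
  then have h: "apply_bcontfun h t = \<Psi> (apply_bcontfun h) t" for t by (metis ap)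
  have hc: "continuous_on {0..} (apply_bcontfun h)" by simp
  define z where "z t = z0 + integral {0..t} (\<lambda>s. F s (w s *\<^sub>R apply_bcontfun h s))" for t
  have zh: "z t = w t *\<^sub>R apply_bcontfun h t" if "0 \<le> t" for t
    using that wpos[of t] h[of t] by (simp add: \<Psi>_def z_def)
  show ?thesis
  proof (intro exI[of _ z] conjI allI impI)
    show "z 0 = z0" by (simp add: z_def)
    fix t :: real assume t: "0 \<le> t"
    show "(z has_vector_derivative F t (z t)) (at t within {0..})"
      unfolding zh[OF t] unfolding z_def
      using intd[OF hc t] by (auto intro: derivative_eq_intros)
  qed
qed

text \<open>Capping the modulus at \<open>R\<close> makes the cubic term globally Lipschitz. By
  symmetry let \<open>z\<close> have the smaller modulus: \<open>R\<^sup>2\<close> comes from the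
  factor \<open>z - w\<close>, and \<open>2 * R\<^sup>2\<close> from the difference of the squared
  caps, which vanishes unless \<open>norm z < R\<close>.\<close>

lemma cubic_cutoff_lipschitz:
  fixes z w :: complex
  shows "norm (z * of_real ((min (norm z) R)\<^sup>2) - w * of_real ((min (norm w) R)\<^sup>2)) \<le> 3 * R\<^sup>2 * norm (z - w)"
proof -
  have *: "norm (z * of_real ((min (norm z) R)\<^sup>2) - w * of_real ((min (norm w) R)\<^sup>2)) \<le> 3 * R\<^sup>2 * norm (z - w)"
    if le: "norm z \<le> norm w" and R: "0 \<le> R" for z w :: complex and R
  proof -
    let ?h = "\<lambda>z::complex. (min (norm z) R)\<^sup>2"
    have h2: "\<bar>?h z - ?h w\<bar> * norm z \<le> 2 * R\<^sup>2 * norm (z - w)"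
    proof (cases "R \<le> norm z")
      case True
      then show ?thesis using le by (simp add: min_absorb2)
    next
      case False
      have 1: "\<bar>min (norm z) R - min (norm w) R\<bar> \<le> norm (z - w)"
        using norm_triangle_ineq3[of z w] by linarith
      have 2: "\<bar>min (norm z) R + min (norm w) R\<bar> \<le> 2 * R" using R by (simp add: min_def)
      have "\<bar>?h z - ?h w\<bar> = \<bar>min (norm z) R - min (norm w) R\<bar> * \<bar>min (norm z) R + min (norm w) R\<bar>"
        by (simp add: power2_eq_square algebra_simps flip: abs_mult)
      also have "\<dots> \<le> norm (z - w) * (2 * R)"
        by (intro mult_mono 1 2) auto
      finally have "\<bar>?h z - ?h w\<bar> * norm z \<le> (norm (z - w) * (2 * R)) * R"
        using False R by (intro mult_mono) auto
      then show ?thesis by (simp add: power2_eq_square mult_ac)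
    qed
    have "z * of_real (?h z) - w * of_real (?h w) = (z - w) * of_real (?h w) + z * of_real (?h z - ?h w)"
      by (simp add: algebra_simps)
    also have "norm \<dots> \<le> norm (z - w) * ?h w + norm z * \<bar>?h z - ?h w\<bar>"
      by (rule order_trans[OF norm_triangle_ineq]) (simp add: norm_mult del: of_real_diff of_real_power)
    also have "\<dots> \<le> norm (z - w) * R\<^sup>2 + 2 * R\<^sup>2 * norm (z - w)"
    proof (rule add_mono)
      show "norm (z - w) * ?h w \<le> norm (z - w) * R\<^sup>2"
        using R by (intro mult_left_mono power_mono) auto
      show "norm z * \<bar>?h z - ?h w\<bar> \<le> 2 * R\<^sup>2 * norm (z - w)"
        using h2 by (simp add: mult.commute)
    qed
    finally show ?thesis by (simp add: algebra_simps)
  qed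
  show ?thesis
  proof (cases "0 \<le> R")
    case True
    show ?thesis using *[OF _ True, of z w] *[OF _ True, of w z]
      by (metis linear norm_minus_commute)
  next
    case False
    then have "min (norm z) R = R" "min (norm w) R = R"
      by (auto simp: min_def) (smt (verit) norm_ge_zero)+
    then show ?thesis
      by (simp add: norm_mult norm_power flip: left_diff_distrib)
  qed
qed

text \<open>For real \<open>a\<close> the term \<open>\<i> * a * z\<close> is orthogonal to
  \<open>z\<close>, so the bound does not depend on \<open>a\<close>; hence it applies with the
  cubic term, capped or not, hidden in \<open>a\<close>. The summand 1 absorbs the constant forcing
  through \<open>2 * norm z \<le> (norm z)\<^sup>2 + 1\<close>.\<close>

lemma rotation_growth:
  fixes z g :: "real \<Rightarrow> complex" and a :: "real \<Rightarrow> real"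
  assumes ab: "t0 \<le> t1"
    and d: "\<And>t. t \<in> {t0..t1} \<Longrightarrow>
      (z has_vector_derivative c0 + \<i> * of_real (a t) * z t + g t * cnj (z t)) (at t within {t0..t1})"
    and g: "\<And>t. t \<in> {t0..t1} \<Longrightarrow> norm (g t) \<le> m0"
  shows "(norm (z t1))\<^sup>2 + 1 \<le> ((norm (z t0))\<^sup>2 + 1) * exp ((norm c0 + 2 * m0) * (t1 - t0))"
proof -
  let ?F = "\<lambda>t. c0 + \<i> * of_real (a t) * z t + g t * cnj (z t)"
  have "(z t1 \<bullet> z t1 + 1) \<le> (z t0 \<bullet> z t0 + 1) * exp ((norm c0 + 2 * m0) * (t1 - t0))"
  proof (rule gronwall[OF ab, where f = "\<lambda>t. z t \<bullet> z t + 1" and f' = "\<lambda>t. 2 * (z t \<bullet> ?F t)"])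
    fix t assume t: "t \<in> {t0..t1}"
    have "((\<lambda>t. z t \<bullet> z t + 1) has_derivative (\<lambda>h. z t \<bullet> (h *\<^sub>R ?F t) + (h *\<^sub>R ?F t) \<bullet> z t)) (at t within {t0..t1})"
      by (rule derivative_eq_intros d[OF t, unfolded has_vector_derivative_def] refl)+ simp
    then show "((\<lambda>t. z t \<bullet> z t + 1) has_real_derivative 2 * (z t \<bullet> ?F t)) (at t within {t0..t1})"
      unfolding has_field_derivative_def
      by (rule has_derivative_eq_rhs) (auto simp: fun_eq_iff inner_commute algebra_simps)
    have "z t \<bullet> (\<i> * of_real (a t) * z t) = 0"
      by (simp add: inner_complex_def algebra_simps)
    then have "z t \<bullet> ?F t = z t \<bullet> c0 + z t \<bullet> (g t * cnj (z t))" by (simp add: inner_add_right)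
    also have "\<dots> \<le> norm (z t) * norm c0 + norm (z t) * norm (g t * cnj (z t))"
      by (intro add_mono norm_cauchy_schwarz)
    also have "norm (z t) * norm (g t * cnj (z t)) = norm (g t) * (norm (z t))\<^sup>2"
      by (simp add: norm_mult power2_eq_square)
    also have "\<dots> \<le> m0 * ((norm (z t))\<^sup>2 + 1)"
      using g[OF t] norm_ge_zero[of "g t"] by (intro mult_mono) (auto simp del: norm_ge_zero)
    also have "norm (z t) * norm c0 \<le> norm c0 * (((norm (z t))\<^sup>2 + 1) / 2)"
      using zero_le_power2[of "norm (z t) - 1"]
      by (subst mult.commute, intro mult_left_mono) (auto simp: power2_eq_square algebra_simps)
    finally have "z t \<bullet> ?F t \<le> norm c0 * (((norm (z t))\<^sup>2 + 1) / 2) + m0 * ((norm (z t))\<^sup>2 + 1)"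
      by simp
    moreover have "(norm c0 + 2 * m0) * (z t \<bullet> z t + 1) =
        2 * (norm c0 * (((norm (z t))\<^sup>2 + 1) / 2) + m0 * ((norm (z t))\<^sup>2 + 1))"
      by (simp add: field_simps power2_norm_eq_inner)
    ultimately show "2 * (z t \<bullet> ?F t) \<le> (norm c0 + 2 * m0) * (z t \<bullet> z t + 1)"
      by (simp only: mult_le_cancel_left_pos zero_less_numeral)
  qed
  then show ?thesis by (simp add: power2_norm_eq_inner)
qed

text \<open>The modulus in the cubic term is capped at \<open>R t\<close>, the bound that
  \<open>rotation_growth\<close> gives for the capped equation as well, so the cap never acts on the
  solution found. The coefficient \<open>c2\<close> is left free because reversing time turns 1 into
  -1.\<close>

lemma cubic_forward_exists:
  fixes g :: "real \<Rightarrow> complex" and c1 :: "real \<Rightarrow> real"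
  assumes gc: "continuous_on {0..} g" and gb: "\<And>t. 0 \<le> t \<Longrightarrow> norm (g t) \<le> m0"
    and c1c: "continuous_on {0..} c1" and c1b: "\<And>t. 0 \<le> t \<Longrightarrow> \<bar>c1 t\<bar> \<le> A * (1 + t)"
  shows "\<exists>z. z 0 = z0 \<and> (\<forall>t\<ge>0. (z has_vector_derivative
      c0 + \<i> * of_real (c1 t + c2 * (norm (z t))\<^sup>2) * z t + g t * cnj (z t)) (at t within {0..}))"
proof -
  define \<gamma> where "\<gamma> = norm c0 + 2 * m0"
  define R where "R t = sqrt ((norm z0)\<^sup>2 + 1) * exp (\<gamma> * t / 2)" for t
  define a where "a t z = c1 t + c2 * (min (norm z) (R t))\<^sup>2" for t and z :: complex
  define F where "F t z = c0 + \<i> * of_real (a t z) * z + g t * cnj z" for t and z :: complex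
  define L where "L t = A * (1 + t) + 3 * \<bar>c2\<bar> * (R t)\<^sup>2 + m0" for t
  have m0: "0 \<le> m0" using order_trans[OF norm_ge_zero gb[of 0]] by simp
  have A0: "0 \<le> A" using order_trans[OF abs_ge_zero c1b[of 0]] by simp
  have \<gamma>0: "0 \<le> \<gamma>" using m0 by (simp add: \<gamma>_def)
  have R2: "(R t)\<^sup>2 = ((norm z0)\<^sup>2 + 1) * exp (\<gamma> * t)" for t
    by (simp add: R_def power_mult_distrib flip: exp_double)
  have L0: "0 \<le> L t" if "0 \<le> t" for t
    using that A0 m0 by (simp add: L_def)
  define \<kappa> where "\<kappa> = 1 + A + 3 * \<bar>c2\<bar> * ((norm z0)\<^sup>2 + 1) + m0 + \<gamma>"
  have \<kappa>1: "1 \<le> \<kappa>" using A0 m0 \<gamma>0 by (simp add: \<kappa>_def)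
  \<comment> \<open>The Lipschitz constant of the capped field grows like
    \<open>exp (\<gamma> * t)\<close>, so the weight is doubly exponential: its derivative is
    \<open>2 * \<kappa> * exp (\<kappa> * t)\<close> times itself.\<close>
  define w where "w t = exp (2 * exp (\<kappa> * t))" for t :: real
  have Lk: "L t \<le> \<kappa> * exp (\<kappa> * t)" if t: "0 \<le> t" for t
  proof -
    have e1: "1 + t \<le> exp (\<kappa> * t)"
      using exp_ge_add_one_self[of t] t \<kappa>1 mult_right_mono[OF \<kappa>1 t] by (smt (verit) exp_le_cancel_iff)
    have "\<gamma> \<le> \<kappa>" using A0 m0 by (simp add: \<kappa>_def)
    then have e2: "exp (\<gamma> * t) \<le> exp (\<kappa> * t)" using t by (simp add: mult_right_mono)
    have "L t \<le> A * exp (\<kappa> * t) + 3 * \<bar>c2\<bar> * (((norm z0)\<^sup>2 + 1) * exp (\<kappa> * t)) + m0 * exp (\<kappa> * t)"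
      unfolding L_def R2 using e1 e2 t A0 m0
      using \<kappa>1 by (intro add_mono mult_left_mono) (auto simp: mult_le_cancel_left1)
    also have "\<dots> = (\<kappa> - 1 - \<gamma>) * exp (\<kappa> * t)" by (simp add: \<kappa>_def algebra_simps)
    also have "\<dots> \<le> \<kappa> * exp (\<kappa> * t)" using \<gamma>0 by (intro mult_right_mono) auto
    finally show ?thesis .
  qed
  have "\<exists>z. z 0 = z0 \<and> (\<forall>t\<ge>0. (z has_vector_derivative F t (z t)) (at t within {0..}))"
  proof (rule picard_weighted[where L=L and w=w and w'="\<lambda>t. 2 * \<kappa> * exp (\<kappa> * t) * w t" and B="norm z0 + norm c0"])
    fix z :: "real \<Rightarrow> complex" assume z: "continuous_on {0..} z"
    show "continuous_on {0..} (\<lambda>t. F t (z t))"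
      unfolding F_def a_def R_def by (intro continuous_intros z gc c1c) auto
  next
    fix t :: real and x y :: complex assume t: "0 \<le> t"
    let ?h = "\<lambda>x. x * complex_of_real ((min (norm x) (R t))\<^sup>2)"
    have "F t x - F t y = \<i> * of_real (c1 t) * (x - y) + \<i> * of_real c2 * (?h x - ?h y) + g t * cnj (x - y)"
      by (simp add: F_def a_def algebra_simps)
    also have "norm \<dots> \<le> \<bar>c1 t\<bar> * norm (x - y) + \<bar>c2\<bar> * norm (?h x - ?h y) + norm (g t) * norm (x - y)"
      by (intro norm_triangle_mono) (simp_all add: norm_mult del: complex_cnj_diff)
    also have "\<dots> \<le> (A * (1 + t)) * norm (x - y) + \<bar>c2\<bar> * (3 * (R t)\<^sup>2 * norm (x - y)) + m0 * norm (x - y)"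
      by (intro add_mono mult_right_mono mult_left_mono cubic_cutoff_lipschitz c1b gb t) auto
    finally show "norm (F t x - F t y) \<le> L t * norm (x - y)" by (simp add: L_def algebra_simps)
  next
    fix t :: real assume t: "0 \<le> t"
    show "0 \<le> L t" by (rule L0[OF t])
    show "0 < w t" by (simp add: w_def)
    show "(w has_real_derivative 2 * \<kappa> * exp (\<kappa> * t) * w t) (at t within {0..})"
      unfolding w_def by (auto intro!: derivative_eq_intros)
    show "2 * L t * w t \<le> 2 * \<kappa> * exp (\<kappa> * t) * w t"
      using Lk[OF t] by (simp add: w_def)
    have "1 + t \<le> exp t" by (rule exp_ge_add_one_self)
    also have "exp t \<le> w t"
    proof -
      have "t \<le> 2 * exp (\<kappa> * t)"
        using exp_ge_add_one_self[of "\<kappa> * t"] mult_right_mono[OF \<kappa>1 t] t by linarith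
      then show ?thesis by (simp add: w_def)
    qed
    finally have tw: "1 + t \<le> w t" .
    have "norm (z0 + integral {0..t} (\<lambda>s. F s 0)) \<le> norm z0 + t * norm c0"
      using t by (intro norm_triangle_le) (simp add: F_def)
    also have "\<dots> \<le> norm z0 * w t + norm c0 * w t"
      using tw t by (intro add_mono) (auto simp: mult.commute[of t] mult_le_cancel_left1 intro!: mult_left_mono)
    finally show "norm (z0 + integral {0..t} (\<lambda>s. F s 0)) \<le> (norm z0 + norm c0) * w t"
      by (simp add: algebra_simps)
  qed
  then obtain z where z0: "z 0 = z0"
    and z: "\<And>t. 0 \<le> t \<Longrightarrow> (z has_vector_derivative F t (z t)) (at t within {0..})" by blast
  have zR: "norm (z t) \<le> R t" if t: "0 \<le> t" for t
  proof -
    have "(norm (z t))\<^sup>2 + 1 \<le> ((norm (z 0))\<^sup>2 + 1) * exp (\<gamma> * (t - 0))"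
      unfolding \<gamma>_def
    proof (rule rotation_growth[OF t, where a="\<lambda>t. a t (z t)" and g=g])
      fix s assume s: "s \<in> {0..t}"
      show "norm (g s) \<le> m0" using gb s by simp
      show "(z has_vector_derivative c0 + \<i> * of_real (a s (z s)) * z s + g s * cnj (z s)) (at s within {0..t})"
        using z[of s] s unfolding F_def by (auto intro: has_vector_derivative_within_subset)
    qed
    then have "(norm (z t))\<^sup>2 \<le> (R t)\<^sup>2" by (simp add: R2 z0)
    moreover have "0 \<le> R t" by (simp add: R_def)
    ultimately show ?thesis by (rule power2_le_imp_le)
  qed
  show ?thesis
    using z zR by (intro exI[of _ z]) (auto simp: z0 F_def a_def min_def)
qed

definition cubic_sol :: "complex \<Rightarrow> real \<Rightarrow> (real \<Rightarrow> complex) \<Rightarrow> (real \<Rightarrow> complex) \<Rightarrow> bool" where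
  "cubic_sol c0 lam g z \<longleftrightarrow> (\<forall>t\<ge>0. (z has_vector_derivative
     c0 + \<i> * of_real ((norm (z t))\<^sup>2 - lam * t) * z t + g t * cnj (z t)) (at t within {0..}))"

text \<open>Two forward problems started at \<open>t0\<close>, one shifted and one with reversed
  time, are glued at \<open>t0\<close>. The reversed solution is used only up to time
  \<open>t0\<close>, and \<open>max 0 (t0 - t)\<close> merely continues its coefficient beyond
  that.\<close>

lemma cubic_sol_exists:
  assumes gc: "continuous_on {0..} g" and gb: "\<And>t. 0 \<le> t \<Longrightarrow> norm (g t) \<le> m0" and t0: "0 \<le> t0"
  shows "\<exists>z. cubic_sol c0 lam g z \<and> z t0 = z0"
proof -
  have gm: "continuous_on {0..} (\<lambda>t. g (t0 + t))"
    by (rule continuous_on_compose2[OF gc]) (use t0 in \<open>auto intro!: continuous_intros\<close>)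
  obtain u where u0: "u 0 = z0" and u: "\<And>t. 0 \<le> t \<Longrightarrow> (u has_vector_derivative
      c0 + \<i> * of_real (- lam * (t0 + t) + 1 * (norm (u t))\<^sup>2) * u t + g (t0 + t) * cnj (u t)) (at t within {0..})"
  proof -
    have A: "\<bar>- lam * (t0 + t)\<bar> \<le> \<bar>lam\<bar> * (t0 + 1) * (1 + t)" if "0 \<le> t" for t
      using that t0 by (simp add: abs_mult mult.assoc) (intro mult_left_mono; simp add: algebra_simps)
    have c: "continuous_on {0..} (\<lambda>t. - lam * (t0 + t))" by (intro continuous_intros)
    have g: "norm (g (t0 + t)) \<le> m0" if "0 \<le> t" for t using gb t0 that by simp
    from cubic_forward_exists[OF gm g c A] show thesis using that by blast
  qed
  have gm': "continuous_on {0..} (\<lambda>t. - g (max 0 (t0 - t)))"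
    by (intro continuous_intros continuous_on_compose2[OF gc]) auto
  obtain v where v0: "v 0 = z0" and v: "\<And>t. 0 \<le> t \<Longrightarrow> (v has_vector_derivative
      - c0 + \<i> * of_real (lam * (t0 - t) + (-1) * (norm (v t))\<^sup>2) * v t + (- g (max 0 (t0 - t))) * cnj (v t)) (at t within {0..})"
  proof -
    have A: "\<bar>lam * (t0 - t)\<bar> \<le> \<bar>lam\<bar> * (t0 + 1) * (1 + t)" if "0 \<le> t" for t
      using that t0 by (simp add: abs_mult mult.assoc) (intro mult_left_mono; simp add: algebra_simps abs_le_iff)
    have c: "continuous_on {0..} (\<lambda>t. lam * (t0 - t))" by (intro continuous_intros)
    have g: "norm (- g (max 0 (t0 - t))) \<le> m0" if "0 \<le> t" for t using gb t0 that by simp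
    from cubic_forward_exists[OF gm' g c A] show thesis using that by blast
  qed
  define z where "z t = (if t \<le> t0 then v (t0 - t) else u (t - t0))" for t
  let ?F = "\<lambda>t x. c0 + \<i> * of_real ((norm x)\<^sup>2 - lam * t) * x + g t * cnj x"
  have ud: "((\<lambda>t. u (t - t0)) has_vector_derivative ?F t (u (t - t0))) (at t within {t0..})" if "t0 \<le> t" for t
  proof -
    have "((u \<circ> (\<lambda>t. t - t0)) has_vector_derivative 1 *\<^sub>R ?F t (u (t - t0))) (at t within {t0..})"
    proof (rule vector_diff_chain_within)
      show "((\<lambda>t. t - t0) has_vector_derivative 1) (at t within {t0..})"
        by (auto intro!: derivative_eq_intros)
      have "(\<lambda>t. t - t0) ` {t0..} \<subseteq> {0..}" by auto
      then show "(u has_vector_derivative ?F t (u (t - t0))) (at (t - t0) within (\<lambda>t. t - t0) ` {t0..})"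
        using has_vector_derivative_within_subset[OF u[of "t - t0"]] that by (simp add: algebra_simps)
    qed
    then show ?thesis by (simp add: o_def)
  qed
  have vd: "((\<lambda>t. v (t0 - t)) has_vector_derivative ?F t (v (t0 - t))) (at t within {0..t0})" if "0 \<le> t" "t \<le> t0" for t
  proof -
    have "((v \<circ> (\<lambda>t. t0 - t)) has_vector_derivative (- 1) *\<^sub>R (- ?F t (v (t0 - t)))) (at t within {0..t0})"
    proof (rule vector_diff_chain_within)
      show "((\<lambda>t. t0 - t) has_vector_derivative - 1) (at t within {0..t0})"
        by (auto intro!: derivative_eq_intros)
      have "(\<lambda>t. t0 - t) ` {0..t0} \<subseteq> {0..}" by auto
      moreover have "- c0 + \<i> * of_real (lam * t + (-1) * (norm x)\<^sup>2) * x + (- g t) * cnj x = - ?F t x" for x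
        by (simp add: algebra_simps)
      ultimately show "(v has_vector_derivative - ?F t (v (t0 - t))) (at (t0 - t) within (\<lambda>t. t0 - t) ` {0..t0})"
        using has_vector_derivative_within_subset[OF v[of "t0 - t"]] that by (simp add: max_def)
    qed
    then show ?thesis unfolding scaleR_minus1_left minus_minus o_def .
  qed
  have "(z has_vector_derivative ?F t (z t)) (at t within {0..})" if t: "0 \<le> t" for t
  proof -
    have U: "closure {0..t0} = {0..t0}" "closure {t0..} = {t0..}"
      by (auto intro: closure_closed)
    have I: "{0..t0} \<union> ({0..t0} \<inter> {t0..}) = {0..t0}" "{t0..} \<union> ({0..t0} \<inter> {t0..}) = {t0..}"
      by auto
    have A: "((\<lambda>t. if t \<in> {0..t0} then v (t0 - t) else u (t - t0)) has_vector_derivative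
          (if t \<in> {0..t0} then ?F t (v (t0 - t)) else ?F t (u (t - t0)))) (at t within {0..})"
    proof (rule has_vector_derivative_If_within_closures[where T="{t0..}"], unfold U I)
      show "t \<in> {0..t0} \<union> {t0..}" using t by auto
      show "{0..} = {0..t0} \<union> {t0..}" using t0 by auto
      show "t \<in> {0..t0} \<Longrightarrow> ((\<lambda>t. v (t0 - t)) has_vector_derivative ?F t (v (t0 - t))) (at t within {0..t0})"
        by (rule vd) auto
      show "t \<in> {t0..} \<Longrightarrow> ((\<lambda>t. u (t - t0)) has_vector_derivative ?F t (u (t - t0))) (at t within {t0..})"
        by (rule ud) auto
      assume "t \<in> {0..t0}" "t \<in> {t0..}"
      then have "t = t0" by auto
      then show "v (t0 - t) = u (t - t0)" "?F t (v (t0 - t)) = ?F t (u (t - t0))"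
        by (simp_all add: u0 v0)
    qed
    have B: "z s = (if s \<in> {0..t0} then v (t0 - s) else u (s - t0))" if "s \<in> {0..}" for s
      using that by (simp add: z_def)
    have C: "?F t (z t) = (if t \<in> {0..t0} then ?F t (v (t0 - t)) else ?F t (u (t - t0)))"
      using t by (simp add: z_def)
    show ?thesis
      unfolding C by (rule has_vector_derivative_transform[OF _ B A]) (use t in auto)
  qed
  moreover have "z t0 = z0" by (simp add: z_def v0)
  ultimately show ?thesis unfolding cubic_sol_def by blast
qed

text \<open>All solutions starting within distance 1 of \<open>z t0\<close> share the bound
  \<open>R2\<close> on the squared modulus up to \<open>T\<close>, so
  \<open>cubic_cutoff_lipschitz\<close> with cap \<open>sqrt R2\<close> applies to the uncapped
  cubic term. The part with \<open>lam * t\<close> only rotates the difference of two solutions and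
  drops out of the Gronwall estimate.\<close>

lemma cubic_sol_cont_dependence:
  assumes gb: "\<And>t. 0 \<le> t \<Longrightarrow> norm (g t) \<le> m0" and t0: "0 \<le> t0" and T: "t0 \<le> T"
    and z: "cubic_sol c0 lam g z" and e: "0 < e"
  shows "\<exists>d>0. \<forall>y. cubic_sol c0 lam g y \<longrightarrow> norm (y t0 - z t0) < d \<longrightarrow> (\<forall>t\<in>{t0..T}. norm (y t - z t) < e)"
proof -
  define \<gamma> where "\<gamma> = norm c0 + 2 * m0"
  define R2 where "R2 = ((norm (z t0) + 1)\<^sup>2 + 1) * exp (\<gamma> * (T - t0))"
  define k where "k = 2 * (3 * R2 + m0)"
  have m0: "0 \<le> m0" using order_trans[OF norm_ge_zero gb[of 0]] by simp
  have \<gamma>0: "0 \<le> \<gamma>" using m0 by (simp add: \<gamma>_def)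
  have R20: "0 \<le> R2" by (simp add: R2_def)
  have k0: "0 \<le> k" using R20 m0 by (simp add: k_def)
  have der: "(y has_vector_derivative
      c0 + \<i> * of_real ((norm (y t))\<^sup>2 - lam * t) * y t + g t * cnj (y t)) (at t within {a..b})"
    if "cubic_sol c0 lam g y" "t \<in> {a..b}" "0 \<le> a" for y t a b
  proof -
    have "(y has_vector_derivative
        c0 + \<i> * of_real ((norm (y t))\<^sup>2 - lam * t) * y t + g t * cnj (y t)) (at t within {0..})"
      using that unfolding cubic_sol_def by auto
    then show ?thesis by (rule has_vector_derivative_within_subset) (use that in auto)
  qed
  have bound: "(norm (y t))\<^sup>2 \<le> R2" if y: "cubic_sol c0 lam g y" and n: "norm (y t0) \<le> norm (z t0) + 1" and t: "t \<in> {t0..T}" for y t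
  proof -
    have "(norm (y t))\<^sup>2 + 1 \<le> ((norm (y t0))\<^sup>2 + 1) * exp (\<gamma> * (t - t0))"
      unfolding \<gamma>_def
    proof (rule rotation_growth[where a="\<lambda>t. (norm (y t))\<^sup>2 - lam * t" and g=g])
      show "t0 \<le> t" using t by simp
      fix s assume s: "s \<in> {t0..t}"
      show "norm (g s) \<le> m0" using gb s t0 by simp
      show "(y has_vector_derivative c0 + \<i> * of_real ((norm (y s))\<^sup>2 - lam * s) * y s + g s * cnj (y s)) (at s within {t0..t})"
        by (rule der[OF y s t0])
    qed
    also have "\<dots> \<le> R2"
      unfolding R2_def using n t \<gamma>0 by (intro mult_mono add_mono power_mono) (auto intro: mult_left_mono)
    finally show ?thesis by simp
  qed
  have main: "norm (y t - z t) \<le> norm (y t0 - z t0) * exp (k / 2 * (T - t0))"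
    if y: "cubic_sol c0 lam g y" and n: "norm (y t0 - z t0) < 1" and t: "t \<in> {t0..T}" for y t
  proof -
    let ?D = "\<lambda>t. y t - z t"
    let ?G = "\<lambda>t. (c0 + \<i> * of_real ((norm (y t))\<^sup>2 - lam * t) * y t + g t * cnj (y t))
             - (c0 + \<i> * of_real ((norm (z t))\<^sup>2 - lam * t) * z t + g t * cnj (z t))"
    have "?D t \<bullet> ?D t \<le> (?D t0 \<bullet> ?D t0) * exp (k * (t - t0))"
    proof (rule gronwall[where f="\<lambda>t. ?D t \<bullet> ?D t" and f'="\<lambda>t. 2 * (?D t \<bullet> ?G t)"])
      show "t0 \<le> t" using t by simp
      fix s assume s: "s \<in> {t0..t}"
      have Dd: "(?D has_vector_derivative ?G s) (at s within {t0..t})"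
        by (intro has_vector_derivative_diff der[OF y s t0] der[OF z s t0])
      have "((\<lambda>t. ?D t \<bullet> ?D t) has_derivative (\<lambda>h. ?D s \<bullet> (h *\<^sub>R ?G s) + (h *\<^sub>R ?G s) \<bullet> ?D s)) (at s within {t0..t})"
        by (rule has_derivative_inner Dd[unfolded has_vector_derivative_def])+
      then show "((\<lambda>t. ?D t \<bullet> ?D t) has_real_derivative 2 * (?D s \<bullet> ?G s)) (at s within {t0..t})"
        unfolding has_field_derivative_def
        by (rule has_derivative_eq_rhs) (auto simp: fun_eq_iff inner_commute algebra_simps)
      have sT: "s \<in> {t0..T}" using s t by auto
      have by2: "(norm (y s))\<^sup>2 \<le> R2"
        using norm_triangle_ineq2[of "y t0" "z t0"] n by (intro bound y sT) simp
      have bz2: "(norm (z s))\<^sup>2 \<le> R2" by (intro bound z sT) simp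
      have min: "min (norm x) (sqrt R2) = norm x" if "(norm x)\<^sup>2 \<le> R2" for x :: complex
        using that by (simp add: min_def real_le_rsqrt)
      have c: "norm (y s * of_real ((norm (y s))\<^sup>2) - z s * of_real ((norm (z s))\<^sup>2)) \<le> 3 * R2 * norm (y s - z s)"
        using cubic_cutoff_lipschitz[of "y s" "sqrt R2" "z s"] R20 by (simp add: min by2 bz2)
      have "?D s \<bullet> (\<i> * of_real (lam * s) * ?D s) = 0"
        by (simp add: inner_complex_def algebra_simps)
      moreover have "?G s = \<i> * (y s * of_real ((norm (y s))\<^sup>2) - z s * of_real ((norm (z s))\<^sup>2))
          - \<i> * of_real (lam * s) * ?D s + g s * cnj (?D s)"
        by (simp add: algebra_simps)
      ultimately have "?D s \<bullet> ?G s = ?D s \<bullet> (\<i> * (y s * of_real ((norm (y s))\<^sup>2) - z s * of_real ((norm (z s))\<^sup>2)))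
          + ?D s \<bullet> (g s * cnj (?D s))"
        by (simp only: inner_add_right inner_diff_right)
      also have "\<dots> \<le> norm (?D s) * (3 * R2 * norm (?D s)) + norm (?D s) * (m0 * norm (?D s))"
      proof (intro add_mono order_trans[OF norm_cauchy_schwarz] mult_left_mono)
        show "norm (\<i> * (y s * of_real ((norm (y s))\<^sup>2) - z s * of_real ((norm (z s))\<^sup>2))) \<le> 3 * R2 * norm (y s - z s)"
          unfolding norm_mult using c by simp
        show "norm (g s * cnj (y s - z s)) \<le> m0 * norm (y s - z s)"
          unfolding norm_mult complex_mod_cnj using gb[of s] s t0 by (intro mult_right_mono) auto
      qed auto
      also have "\<dots> = (3 * R2 + m0) * (?D s \<bullet> ?D s)"
        by (simp add: algebra_simps power2_eq_square flip: power2_norm_eq_inner)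
      finally show "2 * (?D s \<bullet> ?G s) \<le> k * (?D s \<bullet> ?D s)"
        unfolding k_def mult.assoc by (rule mult_left_mono) simp
    qed
    also have "\<dots> \<le> (?D t0 \<bullet> ?D t0) * exp (k * (T - t0))"
      using t k0 by (intro mult_left_mono) (auto intro: mult_left_mono)
    finally have "(norm (?D t))\<^sup>2 \<le> (norm (?D t0) * exp (k / 2 * (T - t0)))\<^sup>2"
      by (simp add: power2_norm_eq_inner power_mult_distrib flip: exp_double)
    then show ?thesis by (rule power2_le_imp_le) simp
  qed
  define d where "d = min 1 (e * exp (- (k / 2 * (T - t0))))"
  show ?thesis
  proof (intro exI[of _ d] conjI allI impI ballI)
    show "0 < d" using e by (simp add: d_def)
    fix y t assume y: "cubic_sol c0 lam g y" and n: "norm (y t0 - z t0) < d" and t: "t \<in> {t0..T}"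
    have "norm (y t - z t) \<le> norm (y t0 - z t0) * exp (k / 2 * (T - t0))"
      using n by (intro main y t) (simp add: d_def)
    also have "\<dots> < (e * exp (- (k / 2 * (T - t0)))) * exp (k / 2 * (T - t0))"
      using n by (intro mult_strict_right_mono) (auto simp: d_def)
    also have "\<dots> = e" by (simp add: mult.assoc flip: exp_add)
    finally show "norm (y t - z t) < e" .
  qed
qed

section \<open>Polar coordinates with a signed modulus\<close>

text \<open>Differentiability of \<open>z'\<close> at the single point \<open>a\<close> suffices:
  the second-order Taylor remainder \<open>h\<close> has a derivative of size o(|t - a|), hence is
  o(|t - a|^2) by the mean value inequality, and division by \<open>t - a\<close> leaves o(|t - a|).
  Derivatives within the half-line cover \<open>a = 0\<close>.\<close>

lemma quotient_at_simple_zero: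
  fixes z z' :: "real \<Rightarrow> complex"
  assumes d: "\<And>t. 0 \<le> t \<Longrightarrow> (z has_vector_derivative z' t) (at t within {0..})"
    and d2: "(z' has_vector_derivative z2) (at a within {0..})" and a: "0 \<le> a" "z a = 0"
  shows "((\<lambda>t. if t = a then z' a else z t /\<^sub>R (t - a)) has_vector_derivative z2 /\<^sub>R 2) (at a within {0..})"
proof -
  define h where "h t = z t - (t - a) *\<^sub>R z' a - ((t - a)\<^sup>2 / 2) *\<^sub>R z2" for t
  have hd: "(h has_vector_derivative z' t - z' a - (t - a) *\<^sub>R z2) (at t within {0..})" if "0 \<le> t" for t
  proof -
    have "((\<lambda>t. (t - a)\<^sup>2 / 2) has_real_derivative (t - a)) (at t within {0..})"
      by (auto intro!: derivative_eq_intros)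
    then have 1: "((\<lambda>t. ((t - a)\<^sup>2 / 2) *\<^sub>R z2) has_vector_derivative (t - a) *\<^sub>R z2) (at t within {0..})"
      using has_vector_derivative_scaleR[of "\<lambda>t. (t - a)\<^sup>2 / 2" "t - a" t "{0..}" "\<lambda>t. z2" 0] by simp
    have "((\<lambda>t. t - a) has_real_derivative 1) (at t within {0..})"
      by (auto intro!: derivative_eq_intros)
    then have 2: "((\<lambda>t. (t - a) *\<^sub>R z' a) has_vector_derivative z' a) (at t within {0..})"
      using has_vector_derivative_scaleR[of "\<lambda>t. t - a" 1 t "{0..}" "\<lambda>t. z' a" 0] by simp
    show ?thesis unfolding h_def
      by (intro has_vector_derivative_diff 1 2 d that)
  qed
  have small: "\<exists>\<delta>>0. \<forall>t\<ge>0. \<bar>t - a\<bar> < \<delta> \<longrightarrow> norm (h t) \<le> e * \<bar>t - a\<bar>\<^sup>2" if e: "e > 0" for e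
  proof -
    have "((\<lambda>y. (1 / norm (y - a)) *\<^sub>R (z' y - (z' a + (y - a) *\<^sub>R z2))) \<longlongrightarrow> 0) (at a within {0..})"
      using d2 unfolding has_vector_derivative_def has_derivative_within by auto
    from tendstoD[OF this e] obtain \<delta> where \<delta>: "\<delta> > 0"
      "\<And>y. 0 \<le> y \<Longrightarrow> y \<noteq> a \<Longrightarrow> dist y a < \<delta> \<Longrightarrow> norm ((1 / norm (y - a)) *\<^sub>R (z' y - (z' a + (y - a) *\<^sub>R z2))) < e"
      by (auto simp: eventually_at)
    have h': "norm (z' y - z' a - (y - a) *\<^sub>R z2) \<le> e * \<bar>y - a\<bar>" if "0 \<le> y" "\<bar>y - a\<bar> < \<delta>" for y
    proof (cases "y = a")
      case False
      have "norm (z' y - (z' a + (y - a) *\<^sub>R z2)) / \<bar>y - a\<bar> < e"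
        using \<delta>(2)[OF that(1) False] that(2) by (simp add: dist_real_def)
      then show ?thesis using False by (simp add: field_simps diff_diff_eq)
    qed simp
    have "norm (h t) \<le> e * \<bar>t - a\<bar>\<^sup>2" if t: "0 \<le> t" "\<bar>t - a\<bar> < \<delta>" for t
    proof -
      let ?S = "closed_segment a t"
      have S: "?S \<subseteq> {0..}" using t a by (auto simp: closed_segment_eq_real_ivl split: if_splits)
      have "norm (h t - h a) \<le> (e * \<bar>t - a\<bar>) * norm (t - a)"
      proof (rule differentiable_bound[where S="?S" and f'="\<lambda>x h. h *\<^sub>R (z' x - z' a - (x - a) *\<^sub>R z2)"])
        fix x assume x: "x \<in> ?S"
        then have x0: "0 \<le> x" using S by auto
        have xa: "\<bar>x - a\<bar> \<le> \<bar>t - a\<bar>" using x by (auto simp: closed_segment_eq_real_ivl split: if_splits)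
        show "(h has_derivative (\<lambda>h. h *\<^sub>R (z' x - z' a - (x - a) *\<^sub>R z2))) (at x within ?S)"
          using has_derivative_subset[OF hd[OF x0, unfolded has_vector_derivative_def] S] .
        have "norm (z' x - z' a - (x - a) *\<^sub>R z2) \<le> e * \<bar>x - a\<bar>" using xa t by (intro h' x0) auto
        also have "\<dots> \<le> e * \<bar>t - a\<bar>" using xa e by simp
        finally show "onorm (\<lambda>h. h *\<^sub>R (z' x - z' a - (x - a) *\<^sub>R z2)) \<le> e * \<bar>t - a\<bar>"
          by (intro onorm_le) (simp add: mult.commute[of "\<bar>_\<bar>"] mult_right_mono)
      qed auto
      then show ?thesis using a by (simp add: h_def power2_eq_square)
    qed
    then show ?thesis using \<delta>(1) by blast
  qed
  let ?q = "\<lambda>t. if t = a then z' a else z t /\<^sub>R (t - a)"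
  have "((\<lambda>y. (1 / norm (y - a)) *\<^sub>R (?q y - (?q a + (y - a) *\<^sub>R (z2 /\<^sub>R 2)))) \<longlongrightarrow> 0) (at a within {0..})"
  proof (rule tendstoI)
    fix e :: real assume "e > 0"
    then obtain \<delta> where \<delta>: "\<delta> > 0" "\<And>t. 0 \<le> t \<Longrightarrow> \<bar>t - a\<bar> < \<delta> \<Longrightarrow> norm (h t) \<le> e / 2 * \<bar>t - a\<bar>\<^sup>2"
      using small[of "e / 2"] by auto
    have "dist ((1 / norm (y - a)) *\<^sub>R (?q y - (?q a + (y - a) *\<^sub>R (z2 /\<^sub>R 2)))) 0 < e"
      if y: "0 \<le> y" "y \<noteq> a" "dist y a < \<delta>" for y
    proof -
      have "?q y - (?q a + (y - a) *\<^sub>R (z2 /\<^sub>R 2)) = h y /\<^sub>R (y - a)"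
      proof -
        have "inverse (y - a) * ((y - a)\<^sup>2 / 2) = (y - a) * inverse 2" using y by (simp add: power2_eq_square)
        then show ?thesis using y by (simp add: h_def scaleR_diff_right)
      qed
      then have "norm ((1 / norm (y - a)) *\<^sub>R (?q y - (?q a + (y - a) *\<^sub>R (z2 /\<^sub>R 2)))) =
          \<bar>1 / norm (y - a)\<bar> * (\<bar>inverse (y - a)\<bar> * norm (h y))"
        by (simp only: norm_scaleR)
      also have "\<dots> = norm (h y) / \<bar>y - a\<bar>\<^sup>2"
        by (simp only: power2_eq_square) (simp add: field_simps)
      also have "\<dots> \<le> e / 2" using \<delta>(2)[of y] y by (simp add: dist_real_def pos_divide_le_eq)
      also have "\<dots> < e" using \<open>e > 0\<close> by simp
      finally show ?thesis unfolding dist_norm diff_0_right .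
    qed
    then show "\<forall>\<^sub>F y in at a within {0..}. dist ((1 / norm (y - a)) *\<^sub>R (?q y - (?q a + (y - a) *\<^sub>R (z2 /\<^sub>R 2)))) 0 < e"
      using \<delta>(1) unfolding eventually_at by blast
  qed
  then show ?thesis
    unfolding has_vector_derivative_def has_derivative_within
    by (intro conjI bounded_linear_scaleR_left) simp
qed

text \<open>All zeros lie in \<open>{0..T}\<close>, so infinitely many would accumulate at some
  \<open>a\<close>; the difference quotients of \<open>z\<close> along them vanish, which forces
  \<open>z a = 0\<close> and \<open>z' a = 0\<close>.\<close>

lemma finite_simple_zeros:
  fixes z z' :: "real \<Rightarrow> complex"
  assumes d: "\<And>t. 0 \<le> t \<Longrightarrow> (z has_vector_derivative z' t) (at t within {0..})"
    and nz: "\<And>t. 0 \<le> t \<Longrightarrow> z t = 0 \<Longrightarrow> z' t \<noteq> 0"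
    and T: "\<And>t. T \<le> t \<Longrightarrow> z t \<noteq> 0"
  shows "finite {t. 0 \<le> t \<and> z t = 0}"
proof (rule ccontr)
  let ?Z = "{t. 0 \<le> t \<and> z t = 0}"
  assume inf: "infinite ?Z"
  have sub: "?Z \<subseteq> {0..T}" using T by (auto intro: ccontr less_imp_le)
  obtain a where a: "a \<in> {0..T}" "a islimpt ?Z"
    using Heine_Borel_imp_Bolzano_Weierstrass[OF compact_Icc inf sub] by blast
  have a0: "0 \<le> a" using a by simp
  have "((\<lambda>y. (1 / norm (y - a)) *\<^sub>R (z y - (z a + (y - a) *\<^sub>R z' a))) \<longlongrightarrow> 0) (at a within {0..})"
    using d[OF a0] unfolding has_vector_derivative_def has_derivative_within by auto
  then have l: "((\<lambda>y. (1 / norm (y - a)) *\<^sub>R (z y - (z a + (y - a) *\<^sub>R z' a))) \<longlongrightarrow> 0) (at a within ?Z)"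
    by (rule tendsto_within_subset) auto
  have nt: "at a within ?Z \<noteq> bot" using a(2) by (simp add: trivial_limit_within)
  have "(z \<longlongrightarrow> z a) (at a within {0..})"
    using has_vector_derivative_continuous[OF d[OF a0]] by (simp add: continuous_within)
  then have "(z \<longlongrightarrow> z a) (at a within ?Z)" by (rule tendsto_within_subset) auto
  moreover have "(z \<longlongrightarrow> 0) (at a within ?Z)"
    by (rule tendsto_eventually) (auto simp: eventually_at_filter)
  ultimately have za: "z a = 0" using tendsto_unique[OF nt] by blast
  have "((\<lambda>y. norm ((1 / norm (y - a)) *\<^sub>R (z y - (z a + (y - a) *\<^sub>R z' a)))) \<longlongrightarrow> norm (z' a)) (at a within ?Z)"
    by (rule tendsto_eventually) (auto simp: eventually_at_filter za)
  with tendsto_norm[OF l] have "norm (z' a) = 0" using tendsto_unique[OF nt] by fastforce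
  then show False using nz[OF a0 za] by simp
qed

text \<open>For \<open>s\<close> near \<open>t\<close> the imaginary part of
  \<open>g s - g t\<close> is below pi in modulus, so there \<open>g\<close> coincides with
  \<open>g t + Ln (w s / w t)\<close>, whose derivative is known.\<close>

lemma continuous_log_differentiable:
  fixes w g :: "real \<Rightarrow> complex"
  assumes g: "continuous_on {0..} g" and e: "\<And>t. 0 \<le> t \<Longrightarrow> w t = exp (g t)" and t: "0 \<le> t"
    and w: "(w has_vector_derivative w') (at t within {0..})"
  shows "(g has_vector_derivative w' / w t) (at t within {0..})"
proof -
  have wt: "w t \<noteq> 0" using e[OF t] by simp
  have q: "((\<lambda>s. w s / w t) has_vector_derivative w' / w t) (at t within {0..})"
    using has_vector_derivative_mult_left[OF w, of "1 / w t"] by simp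
  have "((Ln \<circ> (\<lambda>s. w s / w t)) has_vector_derivative (w' / w t) * 1) (at t within {0..})"
    by (rule field_vector_diff_chain_within[OF q])
      (use wt in \<open>auto intro!: derivative_eq_intros simp: complex_nonpos_Reals_iff\<close>)
  then have "((\<lambda>s. g t + Ln (w s / w t)) has_vector_derivative w' / w t) (at t within {0..})"
    by (auto intro!: derivative_eq_intros simp: o_def)
  moreover have "\<forall>\<^sub>F s in at t within {0..}. g t + Ln (w s / w t) = g s"
  proof -
    have "(g \<longlongrightarrow> g t) (at t within {0..})" using g t by (auto simp: continuous_on)
    then have "\<forall>\<^sub>F s in at t within {0..}. dist (g s) (g t) < pi" by (rule tendstoD) simp
    moreover have "\<forall>\<^sub>F s in at t within {0..}. 0 \<le> s" by (auto simp: eventually_at_filter)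
    ultimately show ?thesis
    proof eventually_elim
      case (elim s)
      have "\<bar>Im (g s - g t)\<bar> < pi" using elim(1) abs_Im_le_cmod[of "g s - g t"] by (simp add: dist_norm)
      then have "Ln (exp (g s - g t)) = g s - g t" by (intro Ln_exp) auto
      then show ?case using e[OF t] e[OF elim(2)] by (simp add: exp_diff)
    qed
  qed
  ultimately show ?thesis
    using t e[OF t] unfolding has_vector_derivative_def
    by (elim has_derivative_transform_eventually) auto
qed

text \<open>The modulus is taken with a sign: it changes sign at each (simple) zero of \<open>z\<close>.\<close>

lemma polar_lift:
  fixes z z' :: "real \<Rightarrow> complex"
  assumes d: "\<And>t. 0 \<le> t \<Longrightarrow> (z has_vector_derivative z' t) (at t within {0..})"
    and d2: "\<And>t. 0 \<le> t \<Longrightarrow> \<exists>D. (z' has_vector_derivative D) (at t within {0..})"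
    and nz: "\<And>t. 0 \<le> t \<Longrightarrow> z t = 0 \<Longrightarrow> z' t \<noteq> 0"
    and T: "0 \<le> T" "\<And>t. T \<le> t \<Longrightarrow> z t \<noteq> 0"
  shows "\<exists>\<rho> \<eta>. (\<forall>t\<ge>0. z t = of_real (\<rho> t) * cis (\<eta> t)) \<and> (\<forall>t\<ge>T. 0 < \<rho> t) \<and>
    (\<forall>t\<ge>0. \<exists>D. (\<rho> has_real_derivative D) (at t within {0..})) \<and>
    (\<forall>t\<ge>0. \<exists>D. (\<eta> has_real_derivative D) (at t within {0..}))"
proof -
  define Z where "Z = {t. 0 \<le> t \<and> z t = 0}"
  have fin: "finite Z" unfolding Z_def by (rule finite_simple_zeros[OF d nz T(2)])
  define p where "p A = (\<Prod>a\<in>A. [:-a, 1::real:])" for A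
  have pp: "poly (p A) t = (\<Prod>a\<in>A. t - a)" for A t by (simp add: p_def poly_prod)
  \<comment> \<open>\<open>w\<close> is \<open>z\<close> divided by the real polynomial with simple
    roots at the zeros of \<open>z\<close>. At a zero \<open>t\<close> the quotient of
    \<open>z\<close> by the vanishing linear factor has the limit \<open>z' t\<close>, which is then
    divided by the remaining factors. Thus \<open>w\<close> has no zeros and possesses a continuous
    logarithm.\<close>
  define w where "w t = (if t \<in> Z then z' t /\<^sub>R poly (p (Z - {t})) t else z t /\<^sub>R poly (p Z) t)" for t
  have p0: "poly (p Z) t \<noteq> 0" if "t \<notin> Z" for t using that fin by (auto simp: pp)
  have p1: "poly (p (Z - {t})) t \<noteq> 0" for t using fin by (auto simp: pp)
  have zw: "z t = poly (p Z) t *\<^sub>R w t" if "0 \<le> t" for t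
    using that p0[of t] fin by (auto simp: w_def Z_def pp)
  have w0: "w t \<noteq> 0" if "0 \<le> t" for t
    using that p0[of t] p1[of t] nz[of t] by (auto simp: w_def Z_def)
  have dinv: "((\<lambda>s. inverse (poly P s)) has_real_derivative - (inverse (poly P t) * poly (pderiv P) t * inverse (poly P t))) (at t within {0..})"
    if "poly P t \<noteq> 0" for P t
    by (rule DERIV_inverse'[OF has_field_derivative_at_within[OF poly_DERIV] that])
  have wd: "\<exists>D. (w has_vector_derivative D) (at t within {0..})" if t: "0 \<le> t" for t
  proof (cases "t \<in> Z")
    case False
    have "\<forall>\<^sub>F s in at t within {0..}. s \<notin> Z"
    proof -
      have "open (- Z)" using fin by (simp add: finite_imp_closed open_Compl)
      from eventually_at_in_open'[OF this, of t] False show ?thesis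
        by (auto simp: eventually_at_filter elim: eventually_mono)
    qed
    then have ev: "\<forall>\<^sub>F s in at t within {0..}. inverse (poly (p Z) s) *\<^sub>R z s = w s"
      by eventually_elim (simp add: w_def)
    from has_vector_derivative_scaleR[OF dinv[OF p0[OF False]] d[OF t]]
    obtain D where "((\<lambda>s. inverse (poly (p Z) s) *\<^sub>R z s) has_vector_derivative D) (at t within {0..})" by blast
    then have "(w has_vector_derivative D) (at t within {0..})"
      unfolding has_vector_derivative_def
      by (rule has_derivative_transform_eventually[OF _ ev]) (use False t in \<open>auto simp: w_def\<close>)
    then show ?thesis ..
  next
    case True
    obtain z2 where z2: "(z' has_vector_derivative z2) (at t within {0..})" using d2[OF t] by blast
    have zt: "z t = 0" using True by (simp add: Z_def)
    let ?q = "\<lambda>s. if s = t then z' t else z s /\<^sub>R (s - t)"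
    have q: "(?q has_vector_derivative z2 /\<^sub>R 2) (at t within {0..})"
      by (rule quotient_at_simple_zero[OF d z2 t zt])
    have "\<forall>\<^sub>F s in at t within {0..}. s \<notin> Z - {t}"
    proof -
      have "open (- (Z - {t}))" by (intro open_Compl finite_imp_closed) (use fin in auto)
      from eventually_at_in_open'[OF this, of t] show ?thesis
        by (auto simp: eventually_at_filter elim: eventually_mono)
    qed
    then have ev: "\<forall>\<^sub>F s in at t within {0..}. inverse (poly (p (Z - {t})) s) *\<^sub>R ?q s = w s"
    proof eventually_elim
      case (elim s)
      have "poly (p Z) s = (s - t) * poly (p (Z - {t})) s"
        using fin True by (simp add: pp prod.remove)
      then show ?case using elim by (auto simp: w_def)
    qed
    from has_vector_derivative_scaleR[OF dinv[OF p1] q]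
    obtain D where "((\<lambda>s. inverse (poly (p (Z - {t})) s) *\<^sub>R ?q s) has_vector_derivative D) (at t within {0..})" by blast
    then have "(w has_vector_derivative D) (at t within {0..})"
      unfolding has_vector_derivative_def
      by (rule has_derivative_transform_eventually[OF _ ev]) (use True t in \<open>auto simp: w_def\<close>)
    then show ?thesis ..
  qed
  then have wc: "continuous_on {0..} w"
    by (auto simp: continuous_on_eq_continuous_within intro: has_vector_derivative_continuous)
  have "contractible {0::real..}" by (intro convex_imp_contractible) auto
  from continuous_logarithm_on_contractible[OF wc this]
  obtain g where gc: "continuous_on {0..} g" and ge: "\<And>t. 0 \<le> t \<Longrightarrow> w t = exp (g t)"
    using w0 by auto
  have gd: "\<exists>D. (g has_vector_derivative D) (at t within {0..})" if "0 \<le> t" for t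
    using wd[OF that] continuous_log_differentiable[OF gc ge that] by blast
  \<comment> \<open>The polynomial carries the sign of the modulus. Beyond \<open>T\<close> all its
    roots lie to the left, so the sign is positive there.\<close>
  define \<rho> where "\<rho> t = poly (p Z) t * exp (Re (g t))" for t
  define \<eta> where "\<eta> t = Im (g t)" for t
  show ?thesis
  proof (rule exI[of _ \<rho>], rule exI[of _ \<eta>], intro conjI allI impI)
    fix t :: real assume t: "0 \<le> t"
    show "z t = of_real (\<rho> t) * cis (\<eta> t)"
      unfolding zw[OF t] ge[OF t] \<rho>_def \<eta>_def by (subst exp_eq_polar) (simp add: scaleR_conv_of_real)
    obtain D where D: "(g has_vector_derivative D) (at t within {0..})" using gd[OF t] by blast
    have re: "((\<lambda>t. Re (g t)) has_real_derivative Re D) (at t within {0..})"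
      using bounded_linear.has_vector_derivative[OF bounded_linear_Re D]
      by (simp add: has_real_derivative_iff_has_vector_derivative)
    have im: "((\<lambda>t. Im (g t)) has_real_derivative Im D) (at t within {0..})"
      using bounded_linear.has_vector_derivative[OF bounded_linear_Im D]
      by (simp add: has_real_derivative_iff_has_vector_derivative)
    show "\<exists>D. (\<eta> has_real_derivative D) (at t within {0..})" unfolding \<eta>_def using im by blast
    show "\<exists>D. (\<rho> has_real_derivative D) (at t within {0..})" unfolding \<rho>_def
      using DERIV_mult[OF has_field_derivative_at_within[OF poly_DERIV[of "p Z" t]] DERIV_chain2[OF DERIV_exp re]]
      by blast
  next
    fix t assume t: "T \<le> t"
    have "a < t" if "a \<in> Z" for a using that T(2)[of a] t by (force simp: Z_def)
    then show "0 < \<rho> t" unfolding \<rho>_def pp by (auto intro!: mult_pos_pos prod_pos)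
  qed
qed

text \<open>Beyond \<open>T\<close> positivity fixes the sign of the modulus, and
  \<open>(\<eta> - \<theta>) / (2 * pi)\<close> is continuous with integer values, hence a constant
  that can be subtracted globally. This is how the global phase inherits the asymptotics of an
  explicit phase known only near infinity.\<close>

lemma polar_lift_prescribed:
  fixes z z' :: "real \<Rightarrow> complex"
  assumes d: "\<And>t. 0 \<le> t \<Longrightarrow> (z has_vector_derivative z' t) (at t within {0..})"
    and d2: "\<And>t. 0 \<le> t \<Longrightarrow> \<exists>D. (z' has_vector_derivative D) (at t within {0..})"
    and nz: "\<And>t. 0 \<le> t \<Longrightarrow> z t = 0 \<Longrightarrow> z' t \<noteq> 0"
    and T: "0 \<le> T" "\<And>t. T \<le> t \<Longrightarrow> z t = of_real (r t) * cis (\<theta> t)" "\<And>t. T \<le> t \<Longrightarrow> 0 < r t" "continuous_on {T..} \<theta>"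
  shows "\<exists>\<rho> \<eta>. (\<forall>t\<ge>0. z t = of_real (\<rho> t) * cis (\<eta> t)) \<and> (\<forall>t\<ge>T. \<rho> t = r t \<and> \<eta> t = \<theta> t) \<and>
    (\<forall>t\<ge>0. \<exists>D. (\<rho> has_real_derivative D) (at t within {0..})) \<and>
    (\<forall>t\<ge>0. \<exists>D. (\<eta> has_real_derivative D) (at t within {0..}))"
proof -
  have zT: "z t \<noteq> 0" if "T \<le> t" for t using T(2,3)[OF that] by simp
  obtain \<rho> \<eta> where z: "\<And>t. 0 \<le> t \<Longrightarrow> z t = of_real (\<rho> t) * cis (\<eta> t)" and pos: "\<And>t. T \<le> t \<Longrightarrow> 0 < \<rho> t"
    and \<rho>d: "\<And>t. 0 \<le> t \<Longrightarrow> \<exists>D. (\<rho> has_real_derivative D) (at t within {0..})"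
    and \<eta>d: "\<And>t. 0 \<le> t \<Longrightarrow> \<exists>D. (\<eta> has_real_derivative D) (at t within {0..})"
    using polar_lift[OF d d2 nz T(1) zT] by blast
  have \<rho>r: "\<rho> t = r t" if t: "T \<le> t" for t
  proof -
    have "norm (z t) = \<rho> t" using z[of t] pos[OF t] t T(1) by (simp add: norm_mult)
    moreover have "norm (z t) = r t" using T(2)[OF t] T(3)[OF t] by (simp add: norm_mult)
    ultimately show ?thesis by simp
  qed
  define k where "k t = (\<eta> t - \<theta> t) / (2 * pi)" for t
  have kI: "\<exists>n::int. k t = of_int n" if t: "T \<le> t" for t
  proof -
    have "cis (\<eta> t) = cis (\<theta> t)" using z[of t] T(1) T(2)[OF t] T(3)[OF t] \<rho>r[OF t] t by simp
    then have "sin (\<eta> t) = sin (\<theta> t) \<and> cos (\<eta> t) = cos (\<theta> t)" by (simp add: complex_eq_iff)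
    then obtain n :: int where "\<eta> t = \<theta> t + 2 * pi * n" using sin_cos_eq_iff by blast
    then show ?thesis by (intro exI[of _ n]) (simp add: k_def)
  qed
  have "continuous_on {0..} \<eta>"
    using \<eta>d by (auto simp: continuous_on_eq_continuous_within intro: DERIV_continuous)
  then have kc: "continuous_on {T..} k"
    unfolding k_def by (intro continuous_intros T(4)) (auto elim: continuous_on_subset intro: T)
  have "k constant_on {T..}"
  proof (rule continuous_discrete_range_constant)
    fix x assume x: "x \<in> {T..}"
    have "1 \<le> norm (k y - k x)" if y: "y \<in> {T..}" "k y \<noteq> k x" for y
    proof -
      obtain n :: int where "k y = of_int n" using kI[of y] y by auto
      moreover obtain m :: int where "k x = of_int m" using kI[of x] x by auto
      ultimately show ?thesis using y by (simp flip: of_int_diff of_int_abs) 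
    qed
    then show "\<exists>e>0. \<forall>y. y \<in> {T..} \<and> k y \<noteq> k x \<longrightarrow> e \<le> norm (k y - k x)" by (intro exI[of _ 1]) auto
  qed (auto intro: kc)
  then obtain K where K: "\<And>t. T \<le> t \<Longrightarrow> k t = K" by (auto simp: constant_on_def)
  obtain n :: int where n: "K = of_int n" using kI[of T] K[of T] by auto
  show ?thesis
  proof (rule exI[of _ \<rho>], rule exI[of _ "\<lambda>t. \<eta> t - 2 * pi * n"], intro conjI allI impI \<rho>d \<rho>r)
    fix t :: real
    { assume t: "0 \<le> t"
      have "cis (\<eta> t - 2 * pi * n) = cis (\<eta> t)"
        using cis_multiple_2pi[of "real_of_int n"] by (simp add: cis_divide[symmetric])
      then show "z t = of_real (\<rho> t) * cis (\<eta> t - 2 * pi * n)" using z[OF t] by simp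
      show "\<exists>D. ((\<lambda>t. \<eta> t - 2 * pi * n) has_real_derivative D) (at t within {0..})"
        using \<eta>d[OF t] DERIV_diff[OF _ DERIV_const] by blast }
    assume "T \<le> t"
    from K[OF this] show "\<eta> t - 2 * pi * n = \<theta> t" by (simp add: k_def n field_simps)
  qed
qed

section \<open>Formal solutions\<close>

text \<open>Congruence modulo \<open>fps_X ^ n\<close>. It serves both as X-adic distance for
  contractions and as the relation between a series and its truncations.\<close>

definition agree :: "nat \<Rightarrow> 'a fps \<Rightarrow> 'a fps \<Rightarrow> bool" where
  "agree n f g \<longleftrightarrow> (\<forall>k<n. fps_nth f k = fps_nth g k)"

lemma agree_refl: "agree n f f"
  by (simp add: agree_def)

lemma agree_add: "agree n f g \<Longrightarrow> agree n f' g' \<Longrightarrow> agree n (f + f') (g + g')"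
  by (simp add: agree_def)

lemma agree_diff: "agree n f g \<Longrightarrow> agree n f' g' \<Longrightarrow> agree n (f - f') (g - g')"
  for f :: "'a::ab_group_add fps"
  by (simp add: agree_def)

lemma agree_uminus: "agree n f g \<Longrightarrow> agree n (- f) (- g)"
  for f :: "'a::ab_group_add fps"
  by (simp add: agree_def)

lemma agree_mult: "agree n f g \<Longrightarrow> agree n f' g' \<Longrightarrow> agree n (f * f') (g * g')"
  for f :: "'a::comm_ring_1 fps"
  by (auto simp: agree_def fps_mult_nth intro!: sum.cong)

lemma agree_X: "agree n f g \<Longrightarrow> agree (Suc n) (fps_X * f) (fps_X * g)"
  for f :: "'a::comm_ring_1 fps"
  by (auto simp: agree_def less_Suc_eq_0_disj)

text \<open>The Euler operator multiplies the coefficient of order k by k, so unlike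
  \<open>fps_deriv\<close> it loses no order.\<close>

lemma agree_euler: "agree n f g \<Longrightarrow> agree n (fps_X * fps_deriv f) (fps_X * fps_deriv g)"
  for f :: "'a::comm_ring_1 fps"
  by (auto simp: agree_def fps_X_mult_nth)

lemmas agree_intros = agree_refl agree_add agree_diff agree_uminus agree_mult agree_X agree_euler

lemma agree_mono: "agree n f g \<Longrightarrow> k \<le> n \<Longrightarrow> agree k f g"
  by (simp add: agree_def)

lemma agree_trans: "agree n f g \<Longrightarrow> agree n g h \<Longrightarrow> agree n f h"
  by (simp add: agree_def)

lemma agree_sym: "agree n f g \<Longrightarrow> agree n g f"
  by (simp add: agree_def)

text \<open>The n-th iterate, started at 0, is already correct modulo \<open>fps_X ^ n\<close>; the
  solution is read off diagonally.\<close>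

lemma fps_contraction_fixpoint:
  fixes T1 T2 T3 :: "'a::comm_ring_1 fps \<Rightarrow> 'a fps \<Rightarrow> 'a fps \<Rightarrow> 'a fps"
  assumes T: "\<And>n f g h f' g' h'. agree n f f' \<Longrightarrow> agree n g g' \<Longrightarrow> agree n h h' \<Longrightarrow>
      agree (Suc n) (T1 f g h) (T1 f' g' h') \<and> agree (Suc n) (T2 f g h) (T2 f' g' h') \<and> agree (Suc n) (T3 f g h) (T3 f' g' h')"
  shows "\<exists>f g h. f = T1 f g h \<and> g = T2 f g h \<and> h = T3 f g h"
proof -
  define t where "t = rec_nat (0, 0, 0) (\<lambda>_ (f, g, h). (T1 f g h, T2 f g h, T3 f g h))"
  define f where "f n = fst (t n)" for n
  define g where "g n = fst (snd (t n))" for n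
  define h where "h n = snd (snd (t n))" for n
  have tSuc: "f (Suc n) = T1 (f n) (g n) (h n)" "g (Suc n) = T2 (f n) (g n) (h n)" "h (Suc n) = T3 (f n) (g n) (h n)" for n
    by (simp_all add: f_def g_def h_def t_def case_prod_unfold)
  have step: "agree n (f n) (f (Suc n)) \<and> agree n (g n) (g (Suc n)) \<and> agree n (h n) (h (Suc n))" for n
  proof (induction n)
    case 0
    show ?case by (simp add: agree_def)
  next
    case (Suc n)
    then show ?case using T[of n "f n" "f (Suc n)" "g n" "g (Suc n)" "h n" "h (Suc n)"] unfolding tSuc by simp
  qed
  have late: "agree n (f n) (f (n + k)) \<and> agree n (g n) (g (n + k)) \<and> agree n (h n) (h (n + k))" for n k
  proof (induction k)
    case 0
    show ?case by (simp add: agree_refl)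
  next
    case (Suc k)
    have "agree n (f (n + k)) (f (Suc (n + k)))" "agree n (g (n + k)) (g (Suc (n + k)))" "agree n (h (n + k)) (h (Suc (n + k)))"
      using step[of "n + k"] by (auto intro: agree_mono[of "n + k"])
    then show ?case using Suc by (auto intro: agree_trans)
  qed
  define F where "F = Abs_fps (\<lambda>n. fps_nth (f (Suc n)) n)"
  define G where "G = Abs_fps (\<lambda>n. fps_nth (g (Suc n)) n)"
  define H where "H = Abs_fps (\<lambda>n. fps_nth (h (Suc n)) n)"
  have lim: "agree n F (f n) \<and> agree n G (g n) \<and> agree n H (h n)" for n
  proof -
    have "fps_nth (f (Suc k)) k = fps_nth (f n) k \<and> fps_nth (g (Suc k)) k = fps_nth (g n) k \<and> fps_nth (h (Suc k)) k = fps_nth (h n) k"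
      if "k < n" for k
      using late[of "Suc k" "n - Suc k"] that by (simp add: agree_def)
    then show ?thesis by (auto simp: agree_def F_def G_def H_def)
  qed
  have "agree (Suc n) F (T1 F G H) \<and> agree (Suc n) G (T2 F G H) \<and> agree (Suc n) H (T3 F G H)" for n
    using T[of n F "f n" G "g n" H "h n"] lim[of n] lim[of "Suc n"] unfolding tSuc
    by (blast intro: agree_trans agree_sym)
  then have "F = T1 F G H" "G = T2 F G H" "H = T3 F G H"
    by (auto simp: fps_eq_iff agree_def)
  then show ?thesis by blast
qed

text \<open>With \<open>s^(2m) = 1/\<tau>\<close> the series encode \<open>X = s^(-m) x\<close>, \<open>Y = s^(-m) y\<close>, \<open>\<mu> = s^m M\<close> and
  \<open>X\<^sup>2 + Y\<^sup>2 - \<lambda>\<tau> = s^m D\<close>; moreover \<open>dX/d\<tau> = s^m (x/2 - s x'/(2m))\<close>.\<close>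

definition formal_sol :: "nat \<Rightarrow> real \<Rightarrow> real \<Rightarrow> real \<Rightarrow> real \<Rightarrow> real \<Rightarrow> real fps \<Rightarrow> real fps \<Rightarrow> real fps \<Rightarrow> real fps \<Rightarrow> bool" where
  "formal_sol m lam A B S C M x y D \<longleftrightarrow>
     x * x + y * y = fps_const lam + fps_X ^ (3 * m) * D \<and>
     fps_X ^ m * (fps_const (1/2) * x - fps_const (1 / (2 * real m)) * (fps_X * fps_deriv x)) =
       fps_const A - y * D - M * (fps_const S * x + fps_const C * y) \<and>
     fps_X ^ m * (fps_const (1/2) * y - fps_const (1 / (2 * real m)) * (fps_X * fps_deriv y)) =
       fps_const B + x * D - M * (fps_const C * x - fps_const S * y)"

text \<open>The equation for \<open>x\<close> may be replaced by \<open>EA\<close>, which is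
  \<open>x\<close> times that equation plus \<open>y\<close> times the equation for
  \<open>y\<close>. In this combination the products with \<open>D\<close> cancel, and
  \<open>D\<close> survives only with the high power of \<open>fps_X\<close> that comes from
  \<open>x * x + y * y\<close>; so the equation that fixes \<open>y\<close> is decoupled, to leading
  order, from the one that fixes \<open>D\<close>. The equation for \<open>x\<close> is recovered
  because \<open>x \<noteq> 0\<close> in an integral domain.\<close>

lemma formal_solI:
  fixes x y D M :: "real fps"
  assumes m: "0 < m" and x0: "fps_nth x 0 \<noteq> 0"
    and E3: "x * x + y * y = fps_const lam + fps_X ^ (3 * m) * D"
    and E2: "fps_X ^ m * (fps_const (1/2) * y - fps_const (1 / (2 * real m)) * (fps_X * fps_deriv y)) =
       fps_const B + x * D - M * (fps_const C * x - fps_const S * y)"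
    and EA: "fps_X ^ m * (fps_const (lam / 2) - fps_X ^ (3 * m) * (fps_const (1/4) * D + fps_const (1 / (4 * real m)) * (fps_X * fps_deriv D))) =
       fps_const A * x + fps_const B * y - M * (fps_const S * (x * x - y * y) + 2 * fps_const C * x * y)"
  shows "formal_sol m lam A B S C M x y D"
proof -
  let ?e = "\<lambda>f::real fps. fps_X * fps_deriv f"
  let ?h = "fps_const (1/2) :: real fps" and ?i = "fps_const (1 / (2 * real m))"
  have h2: "2 * ?h = 1" by (simp add: numeral_fps_const)
  have e3: "?e (x * x + y * y) = ?e (fps_const lam + fps_X ^ (3 * m) * D)" using E3 by simp
  have "2 * (x * ?e x + y * ?e y) = fps_X ^ (3 * m) * (fps_const (3 * real m) * D + ?e D)"
  proof -
    have "?e (x * x + y * y) = 2 * (x * ?e x + y * ?e y)" by (simp add: algebra_simps)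
    moreover have "?e (fps_const lam + fps_X ^ (3 * m) * D) = fps_X ^ (3 * m) * (fps_const (3 * real m) * D + ?e D)"
    proof -
      have "fps_X * fps_deriv (fps_X ^ (3 * m)) = fps_const (3 * real m) * (fps_X ^ (3 * m) :: real fps)"
        by (rule fps_ext) (auto simp: fps_X_mult_nth fps_X_power_nth)
      then have "fps_X * fps_deriv (fps_X ^ (3 * m)) * D = fps_const (3 * real m) * fps_X ^ (3 * m) * D" by simp
      then show ?thesis by (simp add: algebra_simps)
    qed
    ultimately show ?thesis using e3 by simp
  qed
  then have "?h * (2 * (x * ?e x + y * ?e y)) = ?h * (fps_X ^ (3 * m) * (fps_const (3 * real m) * D + ?e D))" by (rule arg_cong)
  moreover have "?h * (2 * z) = z" for z :: "real fps"
    using h2 by (metis mult.assoc mult.commute mult_1)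
  moreover have "?h * (p * (c * D + z)) = p * (?h * c * D + ?h * z)" for p c z :: "real fps"
    by (simp only: ring_distribs mult_ac)
  ultimately have th: "x * ?e x + y * ?e y = fps_X ^ (3 * m) * (?h * fps_const (3 * real m) * D + ?h * ?e D)"
    by (simp only:)
  \<comment> \<open>The Euler operator multiplies \<open>fps_X ^ (3 * m)\<close> by
    \<open>3 * m\<close>, so \<open>D\<close> gets the coefficient 1/2 - 3/4 = -1/4 in
    \<open>EA\<close>.\<close>
  have c: "?i * (?h * fps_const (3 * real m)) = fps_const (3/4)" "?i * ?h = fps_const (1 / (4 * real m))"
    using m by simp_all
  let ?X = "fps_X ^ m * (?h * x - ?i * ?e x) - (fps_const A - y * D - M * (fps_const S * x + fps_const C * y))"
  let ?Y = "fps_X ^ m * (?h * y - ?i * ?e y) - (fps_const B + x * D - M * (fps_const C * x - fps_const S * y))"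
  have "x * ?X + y * ?Y = fps_X ^ m * (?h * (x * x + y * y) - ?i * (x * ?e x + y * ?e y))
      - (fps_const A * x + fps_const B * y - M * (fps_const S * (x * x - y * y) + 2 * fps_const C * x * y))"
    by (simp add: algebra_simps)
  also have "?h * (x * x + y * y) - ?i * (x * ?e x + y * ?e y) =
      ?h * fps_const lam + fps_X ^ (3 * m) * (?h * D - ?i * (?h * fps_const (3 * real m)) * D - (?i * ?h) * ?e D)"
    unfolding E3 th by (simp only: algebra_simps)
  also have "\<dots> = fps_const (lam / 2) - fps_X ^ (3 * m) * (fps_const (1/4) * D + fps_const (1 / (4 * real m)) * ?e D)"
  proof -
    have "?h * D - fps_const (3/4) * D = - (fps_const (1/4) * D)"
      by (simp flip: left_diff_distrib fps_const_neg)
    then have "?h * D - fps_const (3/4) * D - z = - (fps_const (1/4) * D + z)" for z by simp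
    moreover have "?h * fps_const lam = fps_const (lam / 2)" by simp
    ultimately show ?thesis unfolding c by (simp only: mult_minus_right) simp
  qed
  finally have "x * ?X + y * ?Y = 0" unfolding EA by simp
  moreover have "?Y = 0" using E2 by simp
  ultimately have "x * ?X = 0" by simp
  moreover have "x \<noteq> 0" using x0 by auto
  ultimately have "?X = 0" by (metis mult_eq_0_iff)
  then show ?thesis unfolding formal_sol_def using E2 E3 by simp
qed

text \<open>The right-hand side of \<open>EA\<close> sorted by powers of \<open>X\<close>, with
  \<open>x = l + X * X * v\<close> and \<open>y = X * h\<close>. The constant term cancels because
  \<open>A = \<mu>0 * l * S\<close>, that is, because \<sigma> is a root of P. The coefficients of
  \<open>h\<close>, of \<open>h * h\<close> and, through \<open>v\<close>, of
  \<open>h * h * h\<close> are in turn the decisive ones for m = 1, 2, 3. Working in a general ring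
  keeps the algebra free of series.\<close>

lemma formal_A_expand:
  fixes X l v h D M N \<mu>0 A B S C P Q :: "'a::comm_ring_1"
  assumes "A = \<mu>0 * l * S" and E3: "(l + X * X * v) * (l + X * X * v) + X * h * (X * h) = l * l + P * D"
    and "M = \<mu>0 + Q * N"
  shows "A * (l + X * X * v) + B * (X * h) - M * (S * ((l + X * X * v) * (l + X * X * v) - X * h * (X * h)) + 2 * C * (l + X * X * v) * (X * h))
    = X * (B - 2 * \<mu>0 * C * l) * h + X * X * (v * A + 2 * \<mu>0 * S * h * h) - \<mu>0 * S * P * D - 2 * \<mu>0 * C * X * X * X * v * h
      - Q * N * (S * ((l + X * X * v) * (l + X * X * v) - X * h * (X * h)) + 2 * C * (l + X * X * v) * (X * h))"
proof -
  let ?x = "l + X * X * v" and ?y = "X * h"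
  have e: "?x * ?x - ?y * ?y = l * l + P * D - 2 * (X * X * h * h)" using E3 by (simp add: algebra_simps)
  have "A * ?x + B * ?y - M * (S * (?x * ?x - ?y * ?y) + 2 * C * ?x * ?y)
      = A * ?x + B * ?y - \<mu>0 * (S * (?x * ?x - ?y * ?y) + 2 * C * ?x * ?y) - Q * N * (S * (?x * ?x - ?y * ?y) + 2 * C * ?x * ?y)"
    unfolding assms(3) by (simp add: algebra_simps)
  also have "A * ?x + B * ?y - \<mu>0 * (S * (?x * ?x - ?y * ?y) + 2 * C * ?x * ?y) =
      X * (B - 2 * \<mu>0 * C * l) * h + X * X * (v * A + 2 * \<mu>0 * S * h * h) - \<mu>0 * S * P * D - 2 * \<mu>0 * C * X * X * X * v * h"
    unfolding e unfolding assms(1) by (simp add: algebra_simps)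
  finally show ?thesis .
qed

text \<open>In the application \<open>p1 = B - 2 * \<mu>0 * C * l\<close> is invertible and
  \<open>hl\<close> is lam/2. Order \<open>X\<close> gives \<open>p1 * y1 = hl\<close>; the higher
  orders, divided by \<open>X ^ 2\<close> and by \<open>p1\<close>, are the equation for
  \<open>w\<close>. The terms with \<open>q\<close> have this form since the Euler derivative of
  \<open>D\<close> enters only through that of \<open>X * D\<close>, from which \<open>X * D\<close>
  is subtracted.\<close>

lemma formal_A_case1:
  fixes X v h D N \<mu>0 A S C w p1 y1 hl i1 q dD Bq :: "'a::comm_ring_1"
  assumes w: "w = i1 * (- (v * A + 2 * \<mu>0 * S * h * h) + \<mu>0 * S * (X * D) + 2 * \<mu>0 * C * (X * v) * h + N * Bq
       - X * (q * (X * D) + q * (X * (D + X * dD) - X * D)))"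
    and "p1 * i1 = 1" "p1 * y1 = hl" "h = y1 + X * w"
  shows "X * p1 * h + X * X * (v * A + 2 * \<mu>0 * S * h * h) - \<mu>0 * S * X ^ 3 * D - 2 * \<mu>0 * C * X * X * X * v * h - X ^ 2 * N * Bq
    = X * (hl - X ^ 3 * (q * D + q * (X * dD)))"
proof -
  have pw: "p1 * w = - (v * A + 2 * \<mu>0 * S * h * h) + \<mu>0 * S * (X * D) + 2 * \<mu>0 * C * (X * v) * h + N * Bq
       - X * (q * (X * D) + q * (X * (D + X * dD) - X * D))"
    by (subst w) (simp add: mult.assoc[symmetric] assms(2))
  have "p1 * h = hl + X * (p1 * w)" unfolding assms(4) by (simp add: algebra_simps assms(3)[symmetric])
  then have "X * p1 * h = X * (hl + X * (p1 * w))" by (simp add: mult.assoc)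
  then show ?thesis unfolding pw by (simp add: algebra_simps power_numeral_reduce)
qed

text \<open>The linear coefficient is gone. As \<open>v\<close> is \<open>- k * h * h\<close> to
  leading order, order \<open>X ^ 2\<close> becomes \<open>k2 * y1 * y1 = hl\<close>, and
  linearizing the square at \<open>y1\<close> puts the invertible factor \<open>2 * k2 * y1\<close>
  in front of \<open>w\<close>.\<close>

lemma formal_A_case2:
  fixes X v h D N \<mu>0 A S C w y1 hl r k k2 q q' dD Bq :: "'a::comm_ring_1"
  assumes w: "w = r * (- k * A * (X\<^sup>2 * (X * D) - X * (v * v)) + \<mu>0 * S * X\<^sup>2 * (X * D) + 2 * \<mu>0 * C * v * h + X * N * Bq
       - X ^ 4 * (q * (X * D) + q' * (X * (D + X * dD) - X * D)) - k2 * (X * (w * w)))"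
    and v: "v = k * (- (h * h) + X ^ 3 * (X * D) - (X * v) * (X * v))"
    and k2: "k2 = 2 * \<mu>0 * S - k * A"
    and "2 * k2 * y1 * r = 1" "k2 * y1 * y1 = hl" "h = y1 + X * w"
  shows "X * X * (v * A + 2 * \<mu>0 * S * h * h) - \<mu>0 * S * X ^ 6 * D - 2 * \<mu>0 * C * X * X * X * v * h - X ^ 4 * N * Bq
    = X\<^sup>2 * (hl - X ^ 6 * (q * D + q' * (X * dD)))"
proof -
  let ?G = "- k * A * (X\<^sup>2 * (X * D) - X * (v * v)) + \<mu>0 * S * X\<^sup>2 * (X * D) + 2 * \<mu>0 * C * v * h + X * N * Bq
       - X ^ 4 * (q * (X * D) + q' * (X * (D + X * dD) - X * D))"
  have kw: "2 * k2 * y1 * w = ?G - k2 * (X * (w * w))"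
    by (subst w) (simp add: mult.assoc[symmetric] assms(4))
  have "k2 * (h * h) = hl + X * (2 * k2 * y1 * w + k2 * (X * (w * w)))"
    unfolding assms(6) by (simp add: algebra_simps assms(5)[symmetric])
  then have kh: "k2 * (h * h) = hl + X * ?G" unfolding kw by simp
  have "v * A = k * A * (- (h * h) + X ^ 3 * (X * D) - (X * v) * (X * v))"
    by (subst v) (simp add: mult_ac)
  then have va: "v * A + 2 * \<mu>0 * S * h * h = k2 * (h * h) + k * A * (X ^ 3 * (X * D) - (X * v) * (X * v))"
    unfolding k2 by (simp add: algebra_simps)
  show ?thesis unfolding va kh by (simp add: algebra_simps power_numeral_reduce)
qed

text \<open>Only the product \<open>v * h\<close> is left, which is \<open>- k * h * h * h\<close>
  to leading order. This gives the cubic equation \<open>k3 * y1 * y1 * y1 = hl\<close>, whose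
  linearization at \<open>y1\<close> has the factor \<open>3 * k3 * y1 * y1\<close>.\<close>

lemma formal_A_case3:
  fixes X v h D N \<mu>0 C w y1 hl r k k3 q q' dD Bq :: "'a::comm_ring_1"
  assumes w: "w = r * (k3 * h * (X ^ 5 * (X * D) - X * (v * v)) + X\<^sup>2 * N * Bq
       - X ^ 7 * (q * (X * D) + q' * (X * (D + X * dD) - X * D)) - k3 * (3 * y1 * (X * (w * w)) + (X * w) * (X * (w * w))))"
    and v: "v = k * (- (h * h) + X ^ 6 * (X * D) - (X * v) * (X * v))"
    and k3: "k3 = 2 * \<mu>0 * C * k"
    and "3 * k3 * y1 * y1 * r = 1" "k3 * y1 * y1 * y1 = hl" "h = y1 + X * w"
  shows "- 2 * \<mu>0 * C * X * X * X * v * h - X ^ 6 * N * Bq = X ^ 3 * (hl - X ^ 9 * (q * D + q' * (X * dD)))"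
proof -
  let ?G = "k3 * h * (X ^ 5 * (X * D) - X * (v * v)) + X\<^sup>2 * N * Bq
       - X ^ 7 * (q * (X * D) + q' * (X * (D + X * dD) - X * D))"
  have kw: "3 * k3 * y1 * y1 * w = ?G - k3 * (3 * y1 * (X * (w * w)) + (X * w) * (X * (w * w)))"
    by (subst w) (simp add: mult.assoc[symmetric] assms(4))
  have "k3 * (h * h * h) = hl + X * (3 * k3 * y1 * y1 * w + k3 * (3 * y1 * (X * (w * w)) + (X * w) * (X * (w * w))))"
    unfolding assms(6) by (simp add: algebra_simps assms(5)[symmetric])
  then have kh: "k3 * (h * h * h) = hl + X * ?G" unfolding kw by simp
  have "2 * \<mu>0 * C * v * h = 2 * \<mu>0 * C * (k * (- (h * h) + X ^ 6 * (X * D) - (X * v) * (X * v))) * h"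
    by (subst v) simp
  also have "\<dots> = - (k3 * (h * h * h)) + k3 * h * (X ^ 6 * (X * D) - (X * v) * (X * v))"
    unfolding k3 by (simp add: algebra_simps)
  finally have vh: "2 * \<mu>0 * C * v * h = - (hl + X * ?G) + k3 * h * (X ^ 6 * (X * D) - (X * v) * (X * v))"
    unfolding kh .
  have "- 2 * \<mu>0 * C * X * X * X * v * h - X ^ 6 * N * Bq = - (X ^ 3) * (2 * \<mu>0 * C * v * h) - X ^ 6 * N * Bq"
    by (simp add: algebra_simps power_numeral_reduce)
  then show ?thesis unfolding vh by (simp add: algebra_simps power_numeral_reduce)
qed

text \<open>Every argument handed to a \<open>T\<close> carries a factor \<open>fps_X\<close>, so
  any combination of them by ring operations is a contraction. The squares and the Euler derivatives
  have slots of their own because the equations offer them only a single factor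
  \<open>fps_X\<close>.\<close>

lemma fps_triple_solution:
  fixes T1 T2 T3 :: "'a::comm_ring_1 fps \<Rightarrow> 'a fps \<Rightarrow> 'a fps \<Rightarrow> 'a fps \<Rightarrow> 'a fps \<Rightarrow> 'a fps \<Rightarrow> 'a fps \<Rightarrow> 'a fps"
    and y1 :: "'a fps"
  defines "P T w v D \<equiv> T (fps_X * w) (fps_X * v) (fps_X * D) (fps_X * (w * w)) (fps_X * (v * v))
    (fps_X * fps_deriv (fps_X * D)) (fps_X * fps_deriv (fps_X * (y1 + fps_X * w)))"
  assumes "\<And>n T W V E Z Z2 Th Ty W' V' E' Z' Z2' Th' Ty'. T \<in> {T1, T2, T3} \<Longrightarrow> agree n W W' \<Longrightarrow> agree n V V' \<Longrightarrow> agree n E E' \<Longrightarrow>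
     agree n Z Z' \<Longrightarrow> agree n Z2 Z2' \<Longrightarrow> agree n Th Th' \<Longrightarrow> agree n Ty Ty' \<Longrightarrow>
     agree n (T W V E Z Z2 Th Ty) (T W' V' E' Z' Z2' Th' Ty')"
  shows "\<exists>w v D. w = P T1 w v D \<and> v = P T2 w v D \<and> D = P T3 w v D"
proof (rule fps_contraction_fixpoint)
  fix n and w v D w' v' D' :: "'a fps" assume a: "agree n w w'" "agree n v v'" "agree n D D'"
  have "agree (Suc n) (P T w v D) (P T w' v' D')" if "T \<in> {T1, T2, T3}" for T
    unfolding P_def
  proof (rule assms(2)[OF that])
    show "agree (Suc n) (fps_X * fps_deriv (fps_X * (y1 + fps_X * w))) (fps_X * fps_deriv (fps_X * (y1 + fps_X * w')))"
      using a by (intro agree_euler agree_X agree_add agree_refl) (auto intro: agree_mono[OF agree_X])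
    show "agree (Suc n) (fps_X * fps_deriv (fps_X * D)) (fps_X * fps_deriv (fps_X * D'))"
      using a by (intro agree_euler agree_X)
  qed (use a in \<open>auto intro: agree_X agree_mult\<close>)
  then show "agree (Suc n) (P T1 w v D) (P T1 w' v' D') \<and> agree (Suc n) (P T2 w v D) (P T2 w' v' D') \<and> agree (Suc n) (P T3 w v D) (P T3 w' v' D')"
    by simp
qed

text \<open>The unknowns are \<open>y = X h\<close> with \<open>h = y1 + X w\<close>, \<open>x = sqrt lam + X\<^sup>2 v\<close> and \<open>x\<^sup>2 + y\<^sup>2 = lam + X^(3m) D\<close>;
  \<open>T1\<close> is the part of the fixed point equation which depends on the multiplicity of the root.\<close>

lemma formal_sol_from_fixpoint:
  fixes M N :: "real fps" and T1 :: "real fps \<Rightarrow> real fps \<Rightarrow> real fps \<Rightarrow> real fps \<Rightarrow> real fps \<Rightarrow> real fps \<Rightarrow> real fps \<Rightarrow> real fps \<Rightarrow> real fps \<Rightarrow> real fps"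
    and lam :: real
  defines "l \<equiv> fps_const (sqrt lam)"
  assumes lam: "0 < lam" and m: "0 < m" and A: "A = \<mu>0 * sqrt lam * S" and M: "M = fps_const \<mu>0 + fps_X ^ (2 * m) * N"
    and T1: "\<And>n v v' Bq Bq' W V E Z Z2 Th Ty W' V' E' Z' Z2' Th' Ty'. agree n v v' \<Longrightarrow> agree n Bq Bq' \<Longrightarrow> agree n W W' \<Longrightarrow> agree n V V' \<Longrightarrow> agree n E E' \<Longrightarrow>
     agree n Z Z' \<Longrightarrow> agree n Z2 Z2' \<Longrightarrow> agree n Th Th' \<Longrightarrow> agree n Ty Ty' \<Longrightarrow>
     agree n (T1 v Bq W V E Z Z2 Th Ty) (T1 v' Bq' W' V' E' Z' Z2' Th' Ty')"
    and EA: "\<And>w v D h x Bq. h = fps_const y1 + fps_X * w \<Longrightarrow> x = l + fps_X * fps_X * v \<Longrightarrow>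
       Bq = fps_const S * (x * x - fps_X * h * (fps_X * h)) + 2 * fps_const C * x * (fps_X * h) \<Longrightarrow>
       v = fps_const (1 / (2 * sqrt lam)) * (- (h * h) + fps_X ^ (3 * m - 3) * (fps_X * D) - (fps_X * v) * (fps_X * v)) \<Longrightarrow>
       w = T1 v Bq (fps_X * w) (fps_X * v) (fps_X * D) (fps_X * (w * w)) (fps_X * (v * v))
             (fps_X * fps_deriv (fps_X * D)) (fps_X * fps_deriv (fps_X * h)) \<Longrightarrow>
       fps_X * (fps_const B - 2 * fps_const \<mu>0 * fps_const C * l) * h + fps_X * fps_X * (v * fps_const A + 2 * fps_const \<mu>0 * fps_const S * h * h)
         - fps_const \<mu>0 * fps_const S * fps_X ^ (3 * m) * D - 2 * fps_const \<mu>0 * fps_const C * fps_X * fps_X * fps_X * v * h - fps_X ^ (2 * m) * N * Bq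
       = fps_X ^ m * (fps_const (lam / 2) - fps_X ^ (3 * m) * (fps_const (1/4) * D + fps_const (1 / (4 * real m)) * (fps_X * fps_deriv D)))"
  shows "\<exists>x y D. formal_sol m lam A B S C M x y D \<and> fps_nth x 0 = sqrt lam \<and> fps_nth x 1 = 0 \<and> fps_nth y 0 = 0 \<and> fps_nth y 1 = y1"
proof -
  let ?X = "fps_X :: real fps"
  let ?k = "fps_const (1 / (2 * sqrt lam))"
  define hh where "hh W = fps_const y1 + W" for W :: "real fps"
  define xx where "xx V = l + ?X * V" for V :: "real fps"
  \<comment> \<open>This is \<open>x * x + y * y = lam + X ^ (3 * m) * D\<close> solved for
    \<open>v\<close>: after division by \<open>X ^ 2\<close> it reads \<open>2 * sqrt lam * v = - h
    * h + X ^ (3 * m - 2) * D - (X * v) * (X * v)\<close>. One power of \<open>X\<close> stays with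
    \<open>D\<close>, whence the exponent \<open>3 * m - 3\<close>, a true difference as
    \<open>m\<close> is positive.\<close>
  define VV where "VV W V E = ?k * (- (hh W * hh W) + ?X ^ (3 * m - 3) * E - V * V)" for W V E :: "real fps"
  define BB where "BB W V = fps_const S * (xx V * xx V - ?X * hh W * (?X * hh W)) + 2 * fps_const C * xx V * (?X * hh W)" for W V
  define U1 where "U1 W V E Z Z2 Th Ty = T1 (VV W V E) (BB W V) W V E Z Z2 Th Ty" for W V E Z Z2 Th Ty
  define U2 where "U2 W V E Z Z2 Th Ty = VV W V E" for W V E and Z Z2 Th Ty :: "real fps"
  \<comment> \<open>The equation for \<open>y\<close> solved for \<open>D\<close>:
    \<open>x * D\<close> is \<open>sqrt lam * D + (X * v) * (X * D)\<close>, and the last product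
    moves to the other side.\<close>
  define U3 where "U3 W V E Z Z2 Th Ty = fps_const (1 / sqrt lam) * (?X ^ m * (fps_const (1/2) * (?X * hh W) - fps_const (1 / (2 * real m)) * Ty)
      - fps_const B + M * (fps_const C * xx V - fps_const S * (?X * hh W)) - V * E)" for W V E and Z Z2 Th Ty :: "real fps"
  have aV: "agree n (VV W V E) (VV W' V' E')" if "agree n W W'" "agree n V V'" "agree n E E'" for n W V E W' V' E'
    unfolding VV_def hh_def by (intro agree_add agree_diff agree_uminus agree_mult agree_refl that)
  have aB: "agree n (BB W V) (BB W' V')" if "agree n W W'" "agree n V V'" for n W V W' V'
    unfolding BB_def hh_def xx_def by (intro agree_add agree_diff agree_uminus agree_mult agree_refl that)
  have aU: "agree n (T W V E Z Z2 Th Ty) (T W' V' E' Z' Z2' Th' Ty')"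
    if "T \<in> {U1, U2, U3}" "agree n W W'" "agree n V V'" "agree n E E'" "agree n Z Z'" "agree n Z2 Z2'" "agree n Th Th'" "agree n Ty Ty'"
    for n T W V E Z Z2 Th Ty W' V' E' Z' Z2' Th' Ty'
  proof -
    have "agree n (U1 W V E Z Z2 Th Ty) (U1 W' V' E' Z' Z2' Th' Ty')"
      unfolding U1_def by (intro T1 aV aB that(2-))
    moreover have "agree n (U2 W V E Z Z2 Th Ty) (U2 W' V' E' Z' Z2' Th' Ty')"
      unfolding U2_def by (intro aV that(2-))
    moreover have "agree n (U3 W V E Z Z2 Th Ty) (U3 W' V' E' Z' Z2' Th' Ty')"
      unfolding U3_def hh_def xx_def by (intro agree_add agree_diff agree_uminus agree_mult agree_refl that(2-))
    ultimately show ?thesis using that(1) by auto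
  qed
  have "\<exists>w v D. w = U1 (?X * w) (?X * v) (?X * D) (?X * (w * w)) (?X * (v * v)) (?X * fps_deriv (?X * D)) (?X * fps_deriv (?X * (fps_const y1 + ?X * w))) \<and>
      v = U2 (?X * w) (?X * v) (?X * D) (?X * (w * w)) (?X * (v * v)) (?X * fps_deriv (?X * D)) (?X * fps_deriv (?X * (fps_const y1 + ?X * w))) \<and>
      D = U3 (?X * w) (?X * v) (?X * D) (?X * (w * w)) (?X * (v * v)) (?X * fps_deriv (?X * D)) (?X * fps_deriv (?X * (fps_const y1 + ?X * w)))"
    by (rule fps_triple_solution[where ?T1.0=U1 and ?T2.0=U2 and ?T3.0=U3 and ?y1.0="fps_const y1"], rule aU)
  then obtain w v D where
    w: "w = U1 (?X * w) (?X * v) (?X * D) (?X * (w * w)) (?X * (v * v)) (?X * fps_deriv (?X * D)) (?X * fps_deriv (?X * (fps_const y1 + ?X * w)))"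
    and v: "v = VV (?X * w) (?X * v) (?X * D)"
    and D: "D = U3 (?X * w) (?X * v) (?X * D) (?X * (w * w)) (?X * (v * v)) (?X * fps_deriv (?X * D)) (?X * fps_deriv (?X * (fps_const y1 + ?X * w)))"
    unfolding U2_def by blast
  define h where "h = fps_const y1 + ?X * w"
  define x where "x = l + ?X * ?X * v"
  define Bq where "Bq = fps_const S * (x * x - ?X * h * (?X * h)) + 2 * fps_const C * x * (?X * h)"
  have hx: "hh (?X * w) = h" "xx (?X * v) = x" "BB (?X * w) (?X * v) = Bq"
    by (simp_all add: hh_def h_def xx_def x_def BB_def Bq_def mult.assoc)
  have v': "v = ?k * (- (h * h) + ?X ^ (3 * m - 3) * (?X * D) - (?X * v) * (?X * v))"
    using v unfolding VV_def hx .
  have w': "w = T1 v Bq (?X * w) (?X * v) (?X * D) (?X * (w * w)) (?X * (v * v)) (?X * fps_deriv (?X * D)) (?X * fps_deriv (?X * h))"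
    using w unfolding U1_def hx v[symmetric] h_def[symmetric] .
  have ll: "l * l = fps_const lam" using lam by (simp add: l_def)
  have lk: "2 * l * ?k = 1" using lam by (simp add: l_def numeral_fps_const)
  have X3: "?X * ?X * (?X ^ (3 * m - 3) * ?X) = ?X ^ (3 * m)"
  proof -
    have "3 * m = Suc (Suc (Suc (3 * m - 3)))" using m by simp
    then show ?thesis by (metis power_Suc mult.assoc mult.commute)
  qed
  have "2 * l * v = 2 * l * ?k * (- (h * h) + ?X ^ (3 * m - 3) * (?X * D) - (?X * v) * (?X * v))"
    by (subst v') (simp only: mult.assoc)
  then have lv: "2 * l * v = - (h * h) + ?X ^ (3 * m - 3) * (?X * D) - (?X * v) * (?X * v)"
    unfolding lk by simp
  have "x * x + ?X * h * (?X * h) = l * l + ?X * ?X * (2 * l * v) + ?X * ?X * (?X * v) * (?X * v) + ?X * h * (?X * h)"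
    unfolding x_def by (simp add: algebra_simps)
  also have "\<dots> = l * l + ?X * ?X * (?X ^ (3 * m - 3) * ?X) * D"
    unfolding lv by (simp add: algebra_simps)
  finally have E3: "x * x + ?X * h * (?X * h) = l * l + ?X ^ (3 * m) * D" unfolding X3 .
  have li: "l * fps_const (1 / sqrt lam) = 1" using lam by (simp add: l_def)
  have "l * D = l * fps_const (1 / sqrt lam) * (?X ^ m * (fps_const (1/2) * (?X * h) - fps_const (1 / (2 * real m)) * (?X * fps_deriv (?X * h)))
      - fps_const B + M * (fps_const C * x - fps_const S * (?X * h)) - (?X * v) * (?X * D))"
    by (subst D) (simp only: U3_def hx h_def[symmetric] mult.assoc)
  then have lD: "l * D = ?X ^ m * (fps_const (1/2) * (?X * h) - fps_const (1 / (2 * real m)) * (?X * fps_deriv (?X * h)))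
      - fps_const B + M * (fps_const C * x - fps_const S * (?X * h)) - (?X * v) * (?X * D)"
    unfolding li by simp
  have dist: "(a + b * b * c) * d = a * d + (b * c) * (b * d)" for a b c d :: "real fps"
    by (simp only: ring_distribs mult_ac)
  have xD: "x * D = l * D + (?X * v) * (?X * D)" unfolding x_def by (rule dist)
  have rearrange: "T = b + xd - c" if "ld = T - b + c - ve" "xd = ld + ve" for T b c ve ld xd :: "real fps"
    using that by simp
  have E2: "?X ^ m * (fps_const (1/2) * (?X * h) - fps_const (1 / (2 * real m)) * (?X * fps_deriv (?X * h)))
      = fps_const B + x * D - M * (fps_const C * x - fps_const S * (?X * h))"
    by (rule rearrange[OF lD xD])
  have AA: "fps_const A = fps_const \<mu>0 * l * fps_const S" by (simp add: A l_def)
  have exp: "fps_const A * x + fps_const B * (?X * h) - M * (fps_const S * (x * x - ?X * h * (?X * h)) + 2 * fps_const C * x * (?X * h))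
    = fps_X * (fps_const B - 2 * fps_const \<mu>0 * fps_const C * l) * h + fps_X * fps_X * (v * fps_const A + 2 * fps_const \<mu>0 * fps_const S * h * h)
         - fps_const \<mu>0 * fps_const S * fps_X ^ (3 * m) * D - 2 * fps_const \<mu>0 * fps_const C * fps_X * fps_X * fps_X * v * h - fps_X ^ (2 * m) * N * Bq"
    unfolding Bq_def x_def by (rule formal_A_expand[OF AA E3[unfolded x_def] M])
  have "formal_sol m lam A B S C M x (?X * h) D"
  proof (rule formal_solI[OF m])
    show "fps_nth x 0 \<noteq> 0" using lam by (simp add: x_def l_def mult.assoc)
    show "x * x + fps_X * h * (fps_X * h) = fps_const lam + fps_X ^ (3 * m) * D" using E3 ll by simp
    show "fps_X ^ m * (fps_const (lam / 2) - fps_X ^ (3 * m) * (fps_const (1/4) * D + fps_const (1 / (4 * real m)) * (fps_X * fps_deriv D))) =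
       fps_const A * x + fps_const B * (fps_X * h) - M * (fps_const S * (x * x - fps_X * h * (fps_X * h)) + 2 * fps_const C * x * (fps_X * h))"
      unfolding exp by (rule EA[symmetric, OF h_def x_def Bq_def v' w'])
  qed (rule E2)
  moreover have "fps_nth x 0 = sqrt lam" "fps_nth x 1 = 0" "fps_nth (?X * h) 0 = 0" "fps_nth (?X * h) 1 = y1"
    by (simp_all add: x_def l_def h_def mult.assoc)
  ultimately show ?thesis by blast
qed

text \<open>For \<open>m = 1\<close> the two constants 1/4 and \<open>1 / (4 * m)\<close> of
  \<open>EA\<close> coincide. In the application \<open>B - 2 * \<mu>0 * C * sqrt lam\<close> is
  minus the first derivative of P at \<sigma>, so dividing the given coefficient of \<open>y\<close>
  by \<open>sqrt lam\<close> yields the psi_1 of (E1).\<close>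

lemma formal_exists_simple:
  fixes N :: "real fps"
  assumes lam: "0 < lam" and A: "A = \<mu>0 * sqrt lam * S" and M: "M = fps_const \<mu>0 + fps_X ^ 2 * N"
    and p1: "B - 2 * \<mu>0 * C * sqrt lam \<noteq> 0"
  shows "\<exists>x y D. formal_sol 1 lam A B S C M x y D \<and> fps_nth x 0 = sqrt lam \<and> fps_nth x 1 = 0 \<and> fps_nth y 0 = 0 \<and>
    fps_nth y 1 = lam / (2 * (B - 2 * \<mu>0 * C * sqrt lam))"
proof -
  define p where "p = B - 2 * \<mu>0 * C * sqrt lam"
  define y1 where "y1 = lam / (2 * p)"
  define T1 where "T1 v Bq W V E Z Z2 Th Ty = fps_const (1 / p) * (- (v * fps_const A + 2 * fps_const \<mu>0 * fps_const S * (fps_const y1 + W) * (fps_const y1 + W))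
      + fps_const \<mu>0 * fps_const S * E + 2 * fps_const \<mu>0 * fps_const C * V * (fps_const y1 + W) + N * Bq
      - fps_X * (fps_const (1/4) * E + fps_const (1/4) * (Th - E)))" for v Bq W V E Z Z2 Th Ty :: "real fps"
  have M': "M = fps_const \<mu>0 + fps_X ^ (2 * 1) * N" using M by simp
  show ?thesis unfolding p_def[symmetric] y1_def[symmetric]
  proof (rule formal_sol_from_fixpoint[where ?T1.0=T1, OF lam _ A M'])
    fix n and v v' Bq Bq' W V E Z Z2 Th Ty W' V' E' Z' Z2' Th' Ty' :: "real fps"
    assume "agree n v v'" "agree n Bq Bq'" "agree n W W'" "agree n V V'" "agree n E E'" "agree n Z Z'" "agree n Z2 Z2'" "agree n Th Th'" "agree n Ty Ty'"
    then show "agree n (T1 v Bq W V E Z Z2 Th Ty) (T1 v' Bq' W' V' E' Z' Z2' Th' Ty')"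
      unfolding T1_def by (intro agree_add agree_diff agree_uminus agree_mult agree_refl)
  next
    fix w v D h x Bq :: "real fps"
    assume h: "h = fps_const y1 + fps_X * w"
      and w: "w = T1 v Bq (fps_X * w) (fps_X * v) (fps_X * D) (fps_X * (w * w)) (fps_X * (v * v))
             (fps_X * fps_deriv (fps_X * D)) (fps_X * fps_deriv (fps_X * h))"
    have Th: "fps_X * fps_deriv (fps_X * D) = fps_X * (D + fps_X * fps_deriv D)" by (simp add: algebra_simps)
    have "p \<noteq> 0" using p1 by (simp add: p_def)
    then have "fps_const p * fps_const (1 / p) = 1" "fps_const p * fps_const y1 = fps_const (lam / 2)"
      by (simp_all add: y1_def)
    from formal_A_case1[OF w[unfolded T1_def Th h[symmetric]] this h]
    have "fps_X * fps_const p * h + fps_X * fps_X * (v * fps_const A + 2 * fps_const \<mu>0 * fps_const S * h * h)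
       - fps_const \<mu>0 * fps_const S * fps_X ^ 3 * D - 2 * fps_const \<mu>0 * fps_const C * fps_X * fps_X * fps_X * v * h - fps_X\<^sup>2 * N * Bq
       = fps_X * (fps_const (lam / 2) - fps_X ^ 3 * (fps_const (1/4) * D + fps_const (1/4) * (fps_X * fps_deriv D)))" .
    moreover have "fps_const p = fps_const B - 2 * fps_const \<mu>0 * fps_const C * fps_const (sqrt lam)"
      by (simp add: p_def numeral_fps_const)
    ultimately show "fps_X * (fps_const B - 2 * fps_const \<mu>0 * fps_const C * fps_const (sqrt lam)) * h
         + fps_X * fps_X * (v * fps_const A + 2 * fps_const \<mu>0 * fps_const S * h * h)
         - fps_const \<mu>0 * fps_const S * fps_X ^ (3 * 1) * D - 2 * fps_const \<mu>0 * fps_const C * fps_X * fps_X * fps_X * v * h - fps_X ^ (2 * 1) * N * Bq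
       = fps_X ^ 1 * (fps_const (lam / 2) - fps_X ^ (3 * 1) * (fps_const (1/4) * D + fps_const (1 / (4 * real 1)) * (fps_X * fps_deriv D)))"
      by (simp only: mult_1_right power_one_right of_nat_1)
  qed simp
qed

text \<open>The condition on \<open>y1\<close> is \<open>k2 * y1\<^sup>2 = lam / 2\<close> in
  disguise, as \<open>k2 = 3 * A / (2 * sqrt lam)\<close>. Either sign of \<open>y1\<close> is
  allowed, which yields the two solutions of case (ii).\<close>

lemma formal_exists_double:
  fixes N :: "real fps"
  assumes lam: "0 < lam" and A: "A = \<mu>0 * sqrt lam * S" and M: "M = fps_const \<mu>0 + fps_X ^ 4 * N"
    and p1: "B - 2 * \<mu>0 * C * sqrt lam = 0" and y1: "3 * A * y1\<^sup>2 = lam * sqrt lam"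
  shows "\<exists>x y D. formal_sol 2 lam A B S C M x y D \<and> fps_nth x 0 = sqrt lam \<and> fps_nth x 1 = 0 \<and> fps_nth y 0 = 0 \<and> fps_nth y 1 = y1"
proof -
  define k where "k = 1 / (2 * sqrt lam)"
  define k2 where "k2 = 2 * \<mu>0 * S - k * A"
  have l0: "sqrt lam > 0" "sqrt lam * sqrt lam = lam" using lam by simp_all
  have k2': "k2 = 3 * A / (2 * sqrt lam)"
    unfolding k2_def k_def A using l0 by (simp add: field_simps)
  have k2y: "k2 * y1 * y1 = lam / 2"
    unfolding k2' using y1 l0(1) by (simp add: power2_eq_square field_simps)
  have y0: "k2 * y1 \<noteq> 0" using k2y lam by auto
  define r where "r = 1 / (2 * k2 * y1)"
  define T1 where "T1 v Bq W V E Z Z2 Th Ty = fps_const r * (- fps_const k * fps_const A * (fps_X\<^sup>2 * E - Z2) + fps_const \<mu>0 * fps_const S * fps_X\<^sup>2 * E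
      + 2 * fps_const \<mu>0 * fps_const C * v * (fps_const y1 + W) + fps_X * N * Bq
      - fps_X ^ 4 * (fps_const (1/4) * E + fps_const (1/8) * (Th - E)) - fps_const k2 * Z)" for v Bq W V E Z Z2 Th Ty :: "real fps"
  have M': "M = fps_const \<mu>0 + fps_X ^ (2 * 2) * N" using M by simp
  show ?thesis
  proof (rule formal_sol_from_fixpoint[where ?T1.0=T1, OF lam _ A M'])
    fix n and v v' Bq Bq' W V E Z Z2 Th Ty W' V' E' Z' Z2' Th' Ty' :: "real fps"
    assume "agree n v v'" "agree n Bq Bq'" "agree n W W'" "agree n V V'" "agree n E E'" "agree n Z Z'" "agree n Z2 Z2'" "agree n Th Th'" "agree n Ty Ty'"
    then show "agree n (T1 v Bq W V E Z Z2 Th Ty) (T1 v' Bq' W' V' E' Z' Z2' Th' Ty')"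
      unfolding T1_def by (intro agree_add agree_diff agree_uminus agree_mult agree_refl)
  next
    fix w v D h x Bq :: "real fps"
    assume h: "h = fps_const y1 + fps_X * w"
      and v: "v = fps_const (1 / (2 * sqrt lam)) * (- (h * h) + fps_X ^ (3 * 2 - 3) * (fps_X * D) - (fps_X * v) * (fps_X * v))"
      and w: "w = T1 v Bq (fps_X * w) (fps_X * v) (fps_X * D) (fps_X * (w * w)) (fps_X * (v * v))
             (fps_X * fps_deriv (fps_X * D)) (fps_X * fps_deriv (fps_X * h))"
    have Th: "fps_X * fps_deriv (fps_X * D) = fps_X * (D + fps_X * fps_deriv D)" by (simp add: algebra_simps)
    have e: "(3::nat) * 2 - 3 = 3" by simp
    have 1: "fps_const k2 = 2 * fps_const \<mu>0 * fps_const S - fps_const k * fps_const A"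
      by (simp add: k2_def numeral_fps_const)
    have 2: "2 * fps_const k2 * fps_const y1 * fps_const r = 1"
      using y0 by (simp add: r_def numeral_fps_const)
    have 3: "fps_const k2 * fps_const y1 * fps_const y1 = fps_const (lam / 2)" by (simp add: k2y)
    from formal_A_case2[OF w[unfolded T1_def Th h[symmetric]] v[folded k_def, unfolded e] 1 2 3 h]
    have "fps_X * fps_X * (v * fps_const A + 2 * fps_const \<mu>0 * fps_const S * h * h)
       - fps_const \<mu>0 * fps_const S * fps_X ^ 6 * D - 2 * fps_const \<mu>0 * fps_const C * fps_X * fps_X * fps_X * v * h - fps_X ^ 4 * N * Bq
       = fps_X\<^sup>2 * (fps_const (lam / 2) - fps_X ^ 6 * (fps_const (1/4) * D + fps_const (1/8) * (fps_X * fps_deriv D)))" .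
    note E = this
    have Z: "fps_const B - 2 * fps_const \<mu>0 * fps_const C * fps_const (sqrt lam) = 0"
      using p1 by (simp add: numeral_fps_const)
    show "fps_X * (fps_const B - 2 * fps_const \<mu>0 * fps_const C * fps_const (sqrt lam)) * h
         + fps_X * fps_X * (v * fps_const A + 2 * fps_const \<mu>0 * fps_const S * h * h)
         - fps_const \<mu>0 * fps_const S * fps_X ^ (3 * 2) * D - 2 * fps_const \<mu>0 * fps_const C * fps_X * fps_X * fps_X * v * h - fps_X ^ (2 * 2) * N * Bq
       = fps_X ^ 2 * (fps_const (lam / 2) - fps_X ^ (3 * 2) * (fps_const (1/4) * D + fps_const (1 / (4 * real 2)) * (fps_X * fps_deriv D)))"
      unfolding Z using E by simp
  qed simp
qed

text \<open>Here \<open>k3 = B / (2 * lam)\<close>, and the condition on \<open>y1\<close> says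
  \<open>k3 * y1 ^ 3 = lam / 2\<close>. The zeros in the places of \<open>A\<close> and
  \<open>S\<close> are what removes the quadratic terms.\<close>

lemma formal_exists_triple:
  fixes N :: "real fps"
  assumes lam: "0 < lam" and M: "M = fps_const \<mu>0 + fps_X ^ 6 * N"
    and p1: "B - 2 * \<mu>0 * C * sqrt lam = 0" and y1: "B * y1 ^ 3 = lam\<^sup>2"
  shows "\<exists>x y D. formal_sol 3 lam 0 B 0 C M x y D \<and> fps_nth x 0 = sqrt lam \<and> fps_nth x 1 = 0 \<and> fps_nth y 0 = 0 \<and> fps_nth y 1 = y1"
proof -
  define k where "k = 1 / (2 * sqrt lam)"
  define k3 where "k3 = 2 * \<mu>0 * C * k"
  have l0: "sqrt lam > 0" "sqrt lam * sqrt lam = lam" using lam by simp_all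
  have k3': "k3 = B / (2 * lam)"
    unfolding k3_def k_def using p1 l0 lam by (simp add: field_simps)
  have k3y: "k3 * y1 * y1 * y1 = lam / 2"
    unfolding k3' using y1 lam by (simp add: power2_eq_square power3_eq_cube field_simps)
  have y0: "k3 * y1 * y1 \<noteq> 0" using k3y lam by auto
  define r where "r = 1 / (3 * k3 * y1 * y1)"
  define T1 where "T1 v Bq W V E Z Z2 Th Ty = fps_const r * (fps_const k3 * (fps_const y1 + W) * (fps_X ^ 5 * E - Z2) + fps_X\<^sup>2 * N * Bq
      - fps_X ^ 7 * (fps_const (1/4) * E + fps_const (1/12) * (Th - E)) - fps_const k3 * (3 * fps_const y1 * Z + W * Z))" for v Bq W V E Z Z2 Th Ty :: "real fps"
  have M': "M = fps_const \<mu>0 + fps_X ^ (2 * 3) * N" using M by simp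
  have A: "0 = \<mu>0 * sqrt lam * 0" by simp
  show ?thesis
  proof (rule formal_sol_from_fixpoint[where ?T1.0=T1, OF lam _ A M'])
    fix n and v v' Bq Bq' W V E Z Z2 Th Ty W' V' E' Z' Z2' Th' Ty' :: "real fps"
    assume "agree n v v'" "agree n Bq Bq'" "agree n W W'" "agree n V V'" "agree n E E'" "agree n Z Z'" "agree n Z2 Z2'" "agree n Th Th'" "agree n Ty Ty'"
    then show "agree n (T1 v Bq W V E Z Z2 Th Ty) (T1 v' Bq' W' V' E' Z' Z2' Th' Ty')"
      unfolding T1_def by (intro agree_add agree_diff agree_uminus agree_mult agree_refl)
  next
    fix w v D h x Bq :: "real fps"
    assume h: "h = fps_const y1 + fps_X * w"
      and v: "v = fps_const (1 / (2 * sqrt lam)) * (- (h * h) + fps_X ^ (3 * 3 - 3) * (fps_X * D) - (fps_X * v) * (fps_X * v))"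
      and w: "w = T1 v Bq (fps_X * w) (fps_X * v) (fps_X * D) (fps_X * (w * w)) (fps_X * (v * v))
             (fps_X * fps_deriv (fps_X * D)) (fps_X * fps_deriv (fps_X * h))"
    have Th: "fps_X * fps_deriv (fps_X * D) = fps_X * (D + fps_X * fps_deriv D)" by (simp add: algebra_simps)
    have e: "(3::nat) * 3 - 3 = 6" by simp
    have 1: "fps_const k3 = 2 * fps_const \<mu>0 * fps_const C * fps_const k"
      by (simp add: k3_def numeral_fps_const)
    have 2: "3 * fps_const k3 * fps_const y1 * fps_const y1 * fps_const r = 1"
      using y0 by (simp add: r_def numeral_fps_const)
    have 3: "fps_const k3 * fps_const y1 * fps_const y1 * fps_const y1 = fps_const (lam / 2)" by (simp add: k3y)
    from formal_A_case3[OF w[unfolded T1_def Th h[symmetric]] v[folded k_def, unfolded e] 1 2 3 h]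
    have "- 2 * fps_const \<mu>0 * fps_const C * fps_X * fps_X * fps_X * v * h - fps_X ^ 6 * N * Bq
       = fps_X ^ 3 * (fps_const (lam / 2) - fps_X ^ 9 * (fps_const (1/4) * D + fps_const (1/12) * (fps_X * fps_deriv D)))" .
    note E = this
    have Z: "fps_const B - 2 * fps_const \<mu>0 * fps_const C * fps_const (sqrt lam) = 0"
      using p1 by (simp add: numeral_fps_const)
    show "fps_X * (fps_const B - 2 * fps_const \<mu>0 * fps_const C * fps_const (sqrt lam)) * h
         + fps_X * fps_X * (v * fps_const 0 + 2 * fps_const \<mu>0 * fps_const 0 * h * h)
         - fps_const \<mu>0 * fps_const 0 * fps_X ^ (3 * 3) * D - 2 * fps_const \<mu>0 * fps_const C * fps_X * fps_X * fps_X * v * h - fps_X ^ (2 * 3) * N * Bq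
       = fps_X ^ 3 * (fps_const (lam / 2) - fps_X ^ (3 * 3) * (fps_const (1/4) * D + fps_const (1 / (4 * real 3)) * (fps_X * fps_deriv D)))"
      unfolding Z using E by simp
  qed simp
qed

text \<open>Up to the factor \<open>s^(-m)\<close> this is the determinant of the linearization along the formal solution; the
  sign of its leading coefficient separates rotations from saddles.\<close>

definition char_series :: "nat \<Rightarrow> real \<Rightarrow> real \<Rightarrow> real \<Rightarrow> real fps \<Rightarrow> real fps \<Rightarrow> real fps \<Rightarrow> real fps \<Rightarrow> real fps" where
  "char_series m lam S C M x y D = 2 * D * (fps_const lam + fps_X ^ (3 * m) * D)
     + 2 * M * (fps_const C * (x * x - y * y) - 2 * fps_const S * x * y)
     + fps_X ^ (3 * m) * (D * D - M * M * fps_const (C * C + S * S))"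

definition leading :: "nat \<Rightarrow> real \<Rightarrow> real fps \<Rightarrow> bool" where
  "leading n c F \<longleftrightarrow> (\<forall>k<n. fps_nth F k = 0) \<and> fps_nth F n = c"

lemma fps_mult_nth_2: "fps_nth (f * g) 2 = fps_nth f 0 * fps_nth g 2 + fps_nth f 1 * fps_nth g 1 + fps_nth f 2 * fps_nth g 0"
  for f g :: "real fps"
  by (simp add: fps_mult_nth numeral_2_eq_2)

text \<open>Order 0 of the equation for \<open>y\<close> yields the constant term of
  \<open>D\<close>. In the application the result is \<open>2 * sqrt lam\<close> times the first
  derivative of P at \<sigma>.\<close>

lemma leading_char_1:
  assumes fs: "formal_sol 1 lam A B S C M x y D" and lam: "0 < lam"
    and x: "fps_nth x 0 = sqrt lam" and y: "fps_nth y 0 = 0"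
  shows "leading 0 (2 * sqrt lam * (2 * fps_nth M 0 * C * sqrt lam - B)) (char_series 1 lam S C M x y D)"
proof -
  have l: "sqrt lam * sqrt lam = lam" using lam by simp
  have "0 = B + sqrt lam * fps_nth D 0 - fps_nth M 0 * (C * sqrt lam)"
    using arg_cong[OF fs[unfolded formal_sol_def, THEN conjunct2, THEN conjunct2], of "\<lambda>f. fps_nth f 0"] x y by simp
  then have "sqrt lam * fps_nth D 0 = fps_nth M 0 * (C * sqrt lam) - B" by simp
  then have "sqrt lam * (sqrt lam * fps_nth D 0) = sqrt lam * (fps_nth M 0 * (C * sqrt lam) - B)" by simp
  then have "lam * fps_nth D 0 = sqrt lam * (fps_nth M 0 * (C * sqrt lam) - B)" by (simp only: l mult.assoc[symmetric])
  then show ?thesis using l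
    by (simp add: leading_def char_series_def x y numeral_fps_const algebra_simps)
qed

text \<open>Order 0 of the determinant cancels because the hypothesis on \<open>B\<close> says that
  the first derivative of P vanishes; the equation for \<open>y\<close> at orders 0 and 1 supplies
  what is needed of \<open>D\<close>. For \<open>A > 0\<close> the two admissible values of
  \<open>y1\<close>, of opposite sign, produce one rotation and one saddle.\<close>

lemma leading_char_2:
  assumes fs: "formal_sol 2 lam A B S C M x y D" and lam: "0 < lam"
    and x: "fps_nth x 0 = sqrt lam" "fps_nth x 1 = 0" and y: "fps_nth y 0 = 0" "fps_nth y 1 = y1"
    and M: "fps_nth M 1 = 0" and AB: "A = fps_nth M 0 * sqrt lam * S" "B = 2 * fps_nth M 0 * C * sqrt lam"
  shows "leading 1 (- 6 * A * y1) (char_series 2 lam S C M x y D)"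
proof -
  have l: "sqrt lam * sqrt lam = lam" "sqrt lam \<noteq> 0" using lam by simp_all
  note E2 = fs[unfolded formal_sol_def, THEN conjunct2, THEN conjunct2]
  have "0 = B + sqrt lam * fps_nth D 0 - fps_nth M 0 * (C * sqrt lam)"
    using arg_cong[OF E2, of "\<lambda>f. fps_nth f 0"] x y by simp
  then have "sqrt lam * fps_nth D 0 = sqrt lam * (- fps_nth M 0 * C)" using AB(2) by (simp add: algebra_simps)
  then have D0: "fps_nth D 0 = - fps_nth M 0 * C" using l(2) mult_left_cancel by blast
  have "0 = sqrt lam * fps_nth D 1 + fps_nth M 0 * (S * y1)"
    using arg_cong[OF E2, of "\<lambda>f. fps_nth f 1"] x y M by (simp add: fps_mult_nth_1 power2_eq_square)
  then have "sqrt lam * fps_nth D 1 = - (fps_nth M 0 * (S * y1))" by linarith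
  then have "sqrt lam * (sqrt lam * fps_nth D 1) = sqrt lam * - (fps_nth M 0 * (S * y1))" by simp
  then have "lam * fps_nth D 1 = sqrt lam * - (fps_nth M 0 * (S * y1))" by (simp only: l mult.assoc[symmetric])
  then have D1: "lam * fps_nth D 1 = - sqrt lam * fps_nth M 0 * S * y1" by simp
  have z: "fps_nth (char_series 2 lam S C M x y D) 0 = 0"
    using l by (simp add: char_series_def x y D0 numeral_fps_const algebra_simps)
  have "fps_nth (char_series 2 lam S C M x y D) 1 = 2 * (lam * fps_nth D 1) - 4 * sqrt lam * fps_nth M 0 * S * y1"
    using x y M by (simp add: char_series_def fps_mult_nth_1 numeral_fps_const fps_X_power_nth)
  also have "\<dots> = - 6 * A * y1" unfolding D1 AB by simp
  finally show ?thesis using z by (simp add: leading_def)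
qed

text \<open>Two orders cancel now. Order 2 also involves the coefficient of order 2 of
  \<open>x\<close>, which \<open>x * x + y * y = lam\<close> modulo \<open>fps_X ^ 9\<close>
  determines as \<open>- y1\<^sup>2 / (2 * sqrt lam)\<close>. For \<open>y1 \<noteq> 0\<close> the
  sign of the result is opposite to that of \<open>B\<close>.\<close>

lemma leading_char_3:
  assumes fs: "formal_sol 3 lam 0 B 0 C M x y D" and lam: "0 < lam"
    and x: "fps_nth x 0 = sqrt lam" "fps_nth x 1 = 0" and y: "fps_nth y 0 = 0" "fps_nth y 1 = y1"
    and M: "fps_nth M 1 = 0" "fps_nth M 2 = 0" and B: "B = 2 * fps_nth M 0 * C * sqrt lam"
  shows "leading 2 (- 3 * B * y1\<^sup>2 / sqrt lam) (char_series 3 lam 0 C M x y D)"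
proof -
  have l: "sqrt lam * sqrt lam = lam" "sqrt lam \<noteq> 0" using lam by simp_all
  note E2 = fs[unfolded formal_sol_def, THEN conjunct2, THEN conjunct2]
  note E3 = fs[unfolded formal_sol_def, THEN conjunct1]
  define x2 where "x2 = fps_nth x 2"
  have "2 * sqrt lam * x2 + y1 * y1 = 0"
    using arg_cong[OF E3, of "\<lambda>f. fps_nth f 2"] x y by (simp add: fps_mult_nth_2 fps_X_power_nth fps_X_power_mult_nth x2_def)
  then have x2: "2 * sqrt lam * x2 = - (y1 * y1)" by linarith
  have "0 = B + sqrt lam * fps_nth D 0 - fps_nth M 0 * (C * sqrt lam)"
    using arg_cong[OF E2, of "\<lambda>f. fps_nth f 0"] x y by simp
  then have "sqrt lam * fps_nth D 0 = sqrt lam * (- fps_nth M 0 * C)" using B by (simp add: algebra_simps)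
  then have D0: "fps_nth D 0 = - fps_nth M 0 * C" using l(2) mult_left_cancel by blast
  have "0 = sqrt lam * fps_nth D 1"
    using arg_cong[OF E2, of "\<lambda>f. fps_nth f 1"] x y M by (simp add: fps_mult_nth_1 fps_X_power_mult_nth)
  then have D1: "fps_nth D 1 = 0" using l(2) by simp
  have "0 = sqrt lam * fps_nth D 2 + x2 * fps_nth D 0 - fps_nth M 0 * (C * x2)"
    using arg_cong[OF E2, of "\<lambda>f. fps_nth f 2"] x y M D1 by (simp add: fps_mult_nth_2 fps_X_power_mult_nth x2_def)
  then have "sqrt lam * fps_nth D 2 = 2 * fps_nth M 0 * C * x2" unfolding D0 by (simp add: algebra_simps)
  then have "sqrt lam * (sqrt lam * fps_nth D 2) = sqrt lam * (2 * fps_nth M 0 * C * x2)" by simp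
  then have "lam * fps_nth D 2 = sqrt lam * (2 * fps_nth M 0 * C * x2)" by (simp only: l mult.assoc[symmetric])
  then have D2: "lam * fps_nth D 2 = B * x2" unfolding B by (simp add: mult_ac)
  have c0: "fps_nth (char_series 3 lam 0 C M x y D) 0 = 0"
    using l by (simp add: char_series_def x y D0 numeral_fps_const algebra_simps)
  have c1: "fps_nth (char_series 3 lam 0 C M x y D) 1 = 0"
    using x y M D1 by (simp add: char_series_def fps_mult_nth_1 numeral_fps_const fps_X_power_mult_nth mult.assoc)
  have c2: "fps_nth (char_series 3 lam 0 C M x y D) 2 = 2 * (lam * fps_nth D 2) + 2 * fps_nth M 0 * C * (2 * sqrt lam * x2 - y1 * y1)"
    using x y M D1 by (simp add: char_series_def fps_mult_nth_2 numeral_fps_const fps_X_power_mult_nth mult.assoc x2_def fps_mult_nth_1)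
  also have "\<dots> = - 3 * B * y1\<^sup>2 / sqrt lam"
  proof -
    have "sqrt lam * (2 * (lam * fps_nth D 2) + 2 * fps_nth M 0 * C * (2 * sqrt lam * x2 - y1 * y1)) =
        2 * sqrt lam * B * x2 + B * (2 * sqrt lam * x2 - y1 * y1)"
      unfolding D2 B by (simp add: algebra_simps)
    also have "\<dots> = B * (2 * (2 * sqrt lam * x2) - y1 * y1)" by (simp add: algebra_simps)
    also have "\<dots> = B * (2 * - (y1 * y1) - y1 * y1)" by (simp only: x2)
    finally have E: "sqrt lam * (2 * (lam * fps_nth D 2) + 2 * fps_nth M 0 * C * (2 * sqrt lam * x2 - y1 * y1)) =
        B * (2 * - (y1 * y1) - y1 * y1)" .
    have "c = - 3 * B * y1\<^sup>2 / sqrt lam" if "sqrt lam * c = B * (2 * - (y1 * y1) - y1 * y1)" for c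
      using that l(2) by (simp add: field_simps power2_eq_square)
    from this[OF E] show ?thesis .
  qed
  finally show ?thesis using c0 c1 by (auto simp: leading_def less_2_cases_iff)
qed

section \<open>Slowly perturbed rotations and saddles\<close>

lemma closed_ge_sublevel:
  fixes f :: "real \<Rightarrow> real"
  assumes "continuous_on {a..b} f"
  shows "compact {x\<in>{a..b}. c \<le> f x}" "compact {x\<in>{a..b}. f x \<le> c}"
proof -
  have "closed {x\<in>{a..b}. c \<le> f x}" "closed {x\<in>{a..b}. f x \<le> c}"
    using continuous_closed_preimage[OF assms closed_atLeastAtMost, of "{c..}"]
      continuous_closed_preimage[OF assms closed_atLeastAtMost, of "{..c}"]
    by (simp_all add: vimage_def Int_def)
  moreover have "bounded {x\<in>{a..b}. c \<le> f x}" "bounded {x\<in>{a..b}. f x \<le> c}"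
    by (rule bounded_subset[of "{a..b}"], auto)+
  ultimately show "compact {x\<in>{a..b}. c \<le> f x}" "compact {x\<in>{a..b}. f x \<le> c}"
    by (auto simp: compact_eq_bounded_closed)
qed

text \<open>Growth is known only above the level \<open>B\<close>, which lies below
  \<open>f a\<close>. At the last time \<open>s\<close> with \<open>f a \<le> f s\<close> the
  function remains above \<open>B\<close> for a while, hence does not decrease, contradicting that
  \<open>s\<close> is last.\<close>

lemma barrier_mono:
  fixes f :: "real \<Rightarrow> real"
  assumes d: "\<And>t. a \<le> t \<Longrightarrow> (f has_real_derivative f' t) (at t)"
    and B: "B < f a" and up: "\<And>t. a \<le> t \<Longrightarrow> B < f t \<Longrightarrow> 0 \<le> f' t" and t: "a \<le> t"
  shows "f a \<le> f t"
proof (rule ccontr)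
  assume lt: "\<not> f a \<le> f t"
  have c: "continuous_on {a..t} f"
    by (intro continuous_at_imp_continuous_on ballI DERIV_isCont[OF d]) auto
  have "{x\<in>{a..t}. f a \<le> f x} \<noteq> {}" using t by auto
  from compact_attains_sup[OF closed_ge_sublevel(1)[OF c] this]
  obtain s where s: "s \<in> {a..t}" "f a \<le> f s" and sup: "\<And>x. x \<in> {a..t} \<Longrightarrow> f a \<le> f x \<Longrightarrow> x \<le> s" by auto
  have "isCont f s" using s d DERIV_isCont by auto
  then have "\<forall>\<^sub>F x in at s. B < f x"
    using B s by (intro order_tendstoD(1)[of f "f s"]) (auto simp: isCont_def)
  then obtain \<delta> where \<delta>: "\<delta> > 0" "\<And>x. x \<noteq> s \<Longrightarrow> dist x s < \<delta> \<Longrightarrow> B < f x"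
    by (auto simp: eventually_at)
  have st: "s < t" using s lt by (cases "s = t") auto
  define r where "r = min t (s + \<delta> / 2)"
  have r: "s < r" "r \<le> t" using st \<delta> by (auto simp: r_def)
  have "f s \<le> f r"
  proof (rule deriv_nonneg_imp_le[where f=f and f'=f'])
    show "s \<le> r" using r by simp
    fix x assume x: "x \<in> {s..r}"
    show "(f has_real_derivative f' x) (at x within {s..r})"
      by (rule has_field_derivative_at_within[OF d]) (use x s in auto)
    have "B < f x" using \<delta>(2)[of x] x s B \<delta>(1) by (cases "x = s") (auto simp: r_def dist_real_def)
    then show "0 \<le> f' x" using up x s by auto
  qed
  then have "r \<le> s" using sup[of r] r s by auto
  then show False using r by simp
qed

text \<open>After the last time \<open>s\<close> with \<open>f s \<le> B\<close> the function is
  above \<open>B\<close> and therefore nonincreasing, so its value at \<open>t\<close> cannot exceed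
  its limit at \<open>s\<close>.\<close>

lemma barrier_upper:
  fixes f :: "real \<Rightarrow> real"
  assumes d: "\<And>t. a \<le> t \<Longrightarrow> (f has_real_derivative f' t) (at t)"
    and B: "f a \<le> B" and dn: "\<And>t. a \<le> t \<Longrightarrow> B < f t \<Longrightarrow> f' t \<le> 0" and t: "a \<le> t"
  shows "f t \<le> B"
proof (rule ccontr)
  assume gt: "\<not> f t \<le> B"
  have c: "continuous_on {a..t} f"
    by (intro continuous_at_imp_continuous_on ballI DERIV_isCont[OF d]) auto
  have "{x\<in>{a..t}. f x \<le> B} \<noteq> {}" using t B by auto
  from compact_attains_sup[OF closed_ge_sublevel(2)[OF c] this]
  obtain s where s: "s \<in> {a..t}" "f s \<le> B" and sup: "\<And>x. x \<in> {a..t} \<Longrightarrow> f x \<le> B \<Longrightarrow> x \<le> s" by auto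
  have st: "s < t" using s gt by (cases "s = t") auto
  have "f t \<le> f r" if r: "r \<in> {s<..t}" for r
  proof -
    have "- f r \<le> - f t"
    proof (rule deriv_nonneg_imp_le[where f="\<lambda>x. - f x" and f'="\<lambda>x. - f' x"])
      show "r \<le> t" using r by simp
      fix x assume x: "x \<in> {r..t}"
      show "((\<lambda>x. - f x) has_real_derivative - f' x) (at x within {r..t})"
        by (intro DERIV_minus has_field_derivative_at_within[OF d]) (use x r s in auto)
      have "B < f x" using sup[of x] x r s by fastforce
      then show "0 \<le> - f' x" using dn x r s by auto
    qed
    then show ?thesis by simp
  qed
  then have "\<forall>\<^sub>F r in at_right s. f t \<le> f r"
    using st by (auto simp: eventually_at_right[OF st])
  moreover have "(f \<longlongrightarrow> f s) (at_right s)"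
    using DERIV_isCont[OF d, of s] s by (auto simp: isCont_def intro: filterlim_mono at_le)
  ultimately have "f t \<le> f s" by (intro tendsto_lowerbound[of f "f s" "at_right s"]) auto
  then show False using s gt by simp
qed

text \<open>The data sit at the right end. At the first time \<open>s\<close> after \<open>t\<close>
  with \<open>f s \<le> B\<close> the level is attained with positive slope, so \<open>f\<close> was
  below it shortly before, which contradicts the choice of \<open>s\<close>.\<close>

lemma barrier_backward:
  fixes f :: "real \<Rightarrow> real"
  assumes d: "\<And>t. t \<in> {a..b} \<Longrightarrow> (f has_real_derivative f' t) (at t)"
    and B: "f b \<le> B" and up: "\<And>t. t \<in> {a..b} \<Longrightarrow> f t = B \<Longrightarrow> 0 < f' t" and t: "t \<in> {a..b}"
  shows "f t \<le> B"
proof (rule ccontr)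
  assume gt: "\<not> f t \<le> B"
  have c: "continuous_on {t..b} f"
    by (intro continuous_at_imp_continuous_on ballI DERIV_isCont[OF d]) (use t in auto)
  have "{x\<in>{t..b}. f x \<le> B} \<noteq> {}" using t B by auto
  from compact_attains_inf[OF closed_ge_sublevel(2)[OF c] this]
  obtain s where s: "s \<in> {t..b}" "f s \<le> B" and inf: "\<And>x. x \<in> {t..b} \<Longrightarrow> f x \<le> B \<Longrightarrow> s \<le> x" by auto
  have ts: "t < s" using s gt by (cases "s = t") auto
  have "continuous_on {t..s} f" by (rule continuous_on_subset[OF c]) (use s in auto)
  then obtain y where y: "t \<le> y" "y \<le> s" "f y = B"
    using IVT2'[of f s B t] s gt ts by auto
  then have "s = y" using inf[of y] s by auto
  then have "f s = B" using y by simp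
  then have "0 < f' s" using up s t by auto
  moreover have "(f has_real_derivative f' s) (at s)" using s t by (intro d) auto
  ultimately obtain \<delta> where \<delta>: "\<delta> > 0" "\<And>h. 0 < h \<Longrightarrow> h < \<delta> \<Longrightarrow> f (s - h) < f s"
    using DERIV_pos_inc_left by blast
  define h where "h = min (\<delta> / 2) (s - t)"
  have h: "0 < h" "h < \<delta>" "h \<le> s - t" using \<delta>(1) ts by (auto simp: h_def)
  from \<delta>(2)[OF h(1,2)] have "s \<le> s - h" using h s by (intro inf) auto
  then show False using h by simp
qed

text \<open>A rotation for \<open>\<epsilon> = 1\<close> and a saddle for \<open>\<epsilon> = -1\<close>. The perturbation is controlled only in a tube
  that is narrow enough for the nonlinear terms to be harmless.\<close>

definition planar_at :: "real \<Rightarrow> nat \<Rightarrow> (real \<Rightarrow> real) \<Rightarrow> (real \<Rightarrow> real) \<Rightarrow> real \<Rightarrow> bool" where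
  "planar_at \<epsilon> L u v t \<longleftrightarrow> (\<exists>om gu gv. 1 \<le> om \<and>
     (u has_real_derivative - \<epsilon> * om * v t + gu) (at t) \<and>
     (v has_real_derivative om * u t + gv) (at t) \<and>
     ((u t)\<^sup>2 + (v t)\<^sup>2 \<le> 1 / t ^ 20 \<longrightarrow>
        \<bar>gu\<bar> \<le> \<bar>u t\<bar> / t + t ^ 5 * ((u t)\<^sup>2 + (v t)\<^sup>2) + 1 / t ^ L \<and>
        \<bar>gv\<bar> \<le> \<bar>v t\<bar> / t + t ^ 5 * ((u t)\<^sup>2 + (v t)\<^sup>2) + 1 / t ^ L))"

text \<open>Only a lower bound is stated: the energy of a rotation is either followed backwards from
  a late time or kept from decaying too fast.\<close>

lemma energy_rate:
  fixes u v t :: real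
  assumes "1 \<le> t" "0 \<le> R" "\<bar>gu\<bar> \<le> \<bar>u\<bar> / t + R" "\<bar>gv\<bar> \<le> \<bar>v\<bar> / t + R"
  shows "- (2 * (u\<^sup>2 + v\<^sup>2) / t + 4 * sqrt (u\<^sup>2 + v\<^sup>2) * R) \<le> 2 * u * gu + 2 * v * gv"
proof -
  have *: "- (2 * x\<^sup>2 / t + 2 * sqrt (u\<^sup>2 + v\<^sup>2) * R) \<le> 2 * x * g"
    if "\<bar>g\<bar> \<le> \<bar>x\<bar> / t + R" "\<bar>x\<bar> \<le> sqrt (u\<^sup>2 + v\<^sup>2)" for x g
  proof -
    have "- (x * g) \<le> \<bar>x\<bar> * \<bar>g\<bar>" by (simp flip: abs_mult)
    also have "\<dots> \<le> \<bar>x\<bar> * (\<bar>x\<bar> / t + R)" using that by (intro mult_left_mono) auto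
    also have "\<dots> = x\<^sup>2 / t + \<bar>x\<bar> * R" by (simp add: algebra_simps power2_eq_square)
    also have "\<dots> \<le> x\<^sup>2 / t + sqrt (u\<^sup>2 + v\<^sup>2) * R" using that assms by (intro add_left_mono mult_right_mono) auto
    finally show ?thesis by simp
  qed
  have "\<bar>u\<bar> \<le> sqrt (u\<^sup>2 + v\<^sup>2)" "\<bar>v\<bar> \<le> sqrt (u\<^sup>2 + v\<^sup>2)"
    by (auto intro: real_le_rsqrt)
  from *[OF assms(3) this(1)] *[OF assms(4) this(2)] show ?thesis
    by (simp add: add_divide_distrib algebra_simps)
qed

text \<open>For \<epsilon> = 1 the terms with \<open>om\<close> cancel in the derivative of
  \<open>u\<^sup>2 + v\<^sup>2\<close>, however fast the rotation is.\<close>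

lemma planar_energy:
  assumes p: "planar_at 1 L u v t" and t: "1 \<le> t" and E: "(u t)\<^sup>2 + (v t)\<^sup>2 \<le> 1 / t ^ 20"
  shows "\<exists>E'. ((\<lambda>t. (u t)\<^sup>2 + (v t)\<^sup>2) has_real_derivative E') (at t) \<and>
    - (2 * ((u t)\<^sup>2 + (v t)\<^sup>2) / t + 4 * sqrt ((u t)\<^sup>2 + (v t)\<^sup>2) * (t ^ 5 * ((u t)\<^sup>2 + (v t)\<^sup>2) + 1 / t ^ L)) \<le> E'"
proof -
  obtain om gu gv where
    d: "(u has_real_derivative - om * v t + gu) (at t)" "(v has_real_derivative om * u t + gv) (at t)"
    and g: "\<bar>gu\<bar> \<le> \<bar>u t\<bar> / t + (t ^ 5 * ((u t)\<^sup>2 + (v t)\<^sup>2) + 1 / t ^ L)"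
       "\<bar>gv\<bar> \<le> \<bar>v t\<bar> / t + (t ^ 5 * ((u t)\<^sup>2 + (v t)\<^sup>2) + 1 / t ^ L)"
    using p E unfolding planar_at_def by (auto simp: add.assoc)
  have "((\<lambda>t. (u t)\<^sup>2 + (v t)\<^sup>2) has_real_derivative 2 * u t * gu + 2 * v t * gv) (at t)"
    by (rule derivative_eq_intros d refl | simp)+ (simp add: algebra_simps)
  then show ?thesis
    using energy_rate[OF t _ g] t by (intro exI conjI) auto
qed

lemma planar_energy_within:
  assumes p: "planar_at \<epsilon> L u v t"
  shows "\<exists>E'. ((\<lambda>t. (u t)\<^sup>2 + (v t)\<^sup>2) has_real_derivative E') (at t)"
proof -
  obtain u' v' where "(u has_real_derivative u') (at t)" "(v has_real_derivative v') (at t)"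
    using p unfolding planar_at_def by blast
  then show ?thesis by (auto intro!: exI derivative_eq_intros)
qed

section \<open>Rotations: the tube and the rate of decay\<close>

lemma power_quotient_le:
  fixes t :: real
  assumes "1 \<le> t" "k \<le> n" shows "1 / t ^ n \<le> 1 / t ^ k"
  using assms by (auto intro!: divide_left_mono power_increasing zero_less_power mult_pos_pos)

text \<open>On the boundary, where \<open>t ^ 32\<close> times the energy is 1, the weight
  contributes \<open>32 / t\<close> to the derivative, while the energy loses at most
  \<open>10 / t\<close>: 2 from the linear terms and 8 from nonlinearity and forcing, each of which
  is at most \<open>1 / t ^ 17\<close> as \<open>17 \<le> L\<close>. So the boundary is never
  crossed backwards in time, and the bound does not depend on \<open>T\<close>.\<close>

lemma elliptic_tube:
  assumes p: "\<And>t. t \<in> {t1..T} \<Longrightarrow> planar_at 1 L u v t" and t1: "1 \<le> t1" and L: "17 \<le> L"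
    and z: "u T = 0" "v T = 0" and t: "t \<in> {t1..T}"
  shows "(u t)\<^sup>2 + (v t)\<^sup>2 \<le> 1 / t ^ 32"
proof -
  let ?E = "\<lambda>t. (u t)\<^sup>2 + (v t)\<^sup>2"
  obtain E' where E': "\<And>t. t \<in> {t1..T} \<Longrightarrow> (?E has_real_derivative E' t) (at t)"
    using planar_energy_within[OF p] by metis
  have "t ^ 32 * ?E t \<le> 1"
  proof (rule barrier_backward[where f="\<lambda>t. t ^ 32 * ?E t" and f'="\<lambda>t. t ^ 32 * E' t + 32 * t ^ 31 * ?E t" and a=t1 and b=T])
    fix t assume t: "t \<in> {t1..T}"
    show "((\<lambda>t. t ^ 32 * ?E t) has_real_derivative t ^ 32 * E' t + 32 * t ^ 31 * ?E t) (at t)"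
      by (rule derivative_eq_intros refl E'[OF t] | simp)+
    assume eq: "t ^ 32 * ?E t = 1"
    have t1': "1 \<le> t" using t t1 by simp
    then have E: "?E t = 1 / t ^ 32" using eq by (simp add: field_simps)
    have E20: "?E t \<le> 1 / t ^ 20" unfolding E by (intro power_quotient_le t1') simp
    have sq: "sqrt (?E t) = 1 / t ^ 16"
      unfolding E by (rule real_sqrt_unique) (use t1' in \<open>auto simp: power_divide simp flip: power_mult\<close>)
    obtain E'' where d: "(?E has_real_derivative E'') (at t)"
      and le: "- (2 * ?E t / t + 4 * sqrt (?E t) * (t ^ 5 * ?E t + 1 / t ^ L)) \<le> E''"
      using planar_energy[OF p[OF t] t1' E20] by blast
    have "E'' = E' t" using DERIV_unique[OF d E'[OF t]] .
    have "4 * sqrt (?E t) * (t ^ 5 * ?E t + 1 / t ^ L) \<le> 4 * (1 / t ^ 16) * (1 / t ^ 17 + 1 / t ^ 17)"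
    proof -
      have "t ^ 5 * ?E t = 1 / t ^ 27" unfolding E using t1' by (simp add: field_simps flip: power_add)
      also have "\<dots> \<le> 1 / t ^ 17" by (intro power_quotient_le t1') simp
      finally show ?thesis unfolding sq
        by (intro mult_left_mono add_mono power_quotient_le t1' L) (use t1' in auto)
    qed
    also have "\<dots> = 8 / t ^ 33" by (simp flip: power_add)
    finally have "- (2 * ?E t / t + 8 / t ^ 33) \<le> E' t" using le \<open>E'' = E' t\<close> by linarith
    moreover have "2 * ?E t / t = 2 / t ^ 33" unfolding E by (simp add: power_numeral_reduce)
    ultimately have "- (10 / t ^ 33) \<le> E' t" by (simp add: add_divide_distrib[symmetric])
    then have "t ^ 32 * - (10 / t ^ 33) \<le> t ^ 32 * E' t" using t1' by (intro mult_left_mono) auto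
    moreover have "t ^ 32 * - (10 / t ^ 33) = - 10 / t" using t1' by (simp add: field_simps power_numeral_reduce)
    moreover have "32 * t ^ 31 * ?E t = 32 / t" unfolding E using t1' by (simp add: field_simps power_numeral_reduce)
    moreover have "- 10 / t + 32 / t > 0" using t1' by (simp add: field_simps)
    ultimately show "0 < t ^ 32 * E' t + 32 * t ^ 31 * ?E t" by linarith
  qed (use z t in auto)
  then show ?thesis using t t1 by (simp add: field_simps)
qed

text \<open>Suppose the bound fails at \<open>t\<close>. While \<open>t ^ (2 * K)\<close> times the
  energy exceeds 1, with \<open>K = L - 2\<close>, the energy dominates forcing and nonlinearity and
  decays at most at the relative rate \<open>14 / t\<close>. Because \<open>14 \<le> 2 * K\<close>
  this state persists for ever, and then \<open>t ^ 14\<close> times the energy never decreases,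
  which the tube \<open>1 / t ^ 20\<close> forbids.\<close>

lemma elliptic_bootstrap:
  assumes p: "\<And>t. t1 \<le> t \<Longrightarrow> planar_at 1 L u v t" and t1: "1 \<le> t1" and L: "17 \<le> L"
    and E20: "\<And>t. t1 \<le> t \<Longrightarrow> (u t)\<^sup>2 + (v t)\<^sup>2 \<le> 1 / t ^ 20" and t: "t1 \<le> t"
  shows "(u t)\<^sup>2 + (v t)\<^sup>2 \<le> 1 / t ^ (2 * (L - 2))"
proof (rule ccontr)
  let ?E = "\<lambda>t. (u t)\<^sup>2 + (v t)\<^sup>2"
  define K where "K = L - 2"
  have K: "15 \<le> K" "L = K + 2" using L by (auto simp: K_def)
  assume "\<not> ?E t \<le> 1 / t ^ (2 * (L - 2))"
  then have gt: "1 < t ^ (2 * K) * ?E t" using t t1 by (simp add: field_simps K_def)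
  obtain E' where E': "\<And>t. t1 \<le> t \<Longrightarrow> (?E has_real_derivative E' t) (at t)"
    using planar_energy_within[OF p] by metis
  have rate: "- (14 * ?E s / s) \<le> E' s" if s: "t1 \<le> s" and gt: "1 < s ^ (2 * K) * ?E s" for s
  proof -
    have s1: "1 \<le> s" using s t1 by simp
    obtain E'' where d: "(?E has_real_derivative E'') (at s)"
      and le: "- (2 * ?E s / s + 4 * sqrt (?E s) * (s ^ 5 * ?E s + 1 / s ^ L)) \<le> E''"
      using planar_energy[OF p[OF s] s1 E20[OF s]] by blast
    have "E'' = E' s" using DERIV_unique[OF d E'[OF s]] .
    define n where "n = sqrt (?E s)"
    have n0: "0 \<le> n" by (simp add: n_def)
    have nn: "?E s = n * n" by (simp add: n_def)
    have n10: "n \<le> 1 / s ^ 10"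
      unfolding n_def using E20[OF s] s1 by (intro real_le_lsqrt) (auto simp: power_divide simp flip: power_mult)
    have nK: "1 / s ^ K \<le> n"
      unfolding n_def using gt s1 by (intro real_le_rsqrt) (auto simp: power_divide field_simps simp flip: power_mult)
    have "s ^ 5 * ?E s = (s ^ 5 * n) * n" by (simp add: nn)
    also have "\<dots> \<le> (s ^ 5 * (1 / s ^ 10)) * n" using n10 n0 s1 by (intro mult_right_mono mult_left_mono) auto
    also have "s ^ 5 * (1 / s ^ 10) = 1 / s ^ 5" using s1 by (simp add: field_simps flip: power_add)
    also have "1 / s ^ 5 * n \<le> 1 / s ^ 1 * n" using n0 by (intro mult_right_mono power_quotient_le s1) auto
    finally have a: "s ^ 5 * ?E s \<le> n / s" by simp
    have "1 / s ^ L = (1 / s ^ K) * (1 / s ^ 2)" using K by (simp add: power_add power2_eq_square)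
    also have "\<dots> \<le> n * (1 / s ^ 1)" using n0 s1 nK by (intro mult_mono power_quotient_le) auto
    finally have b: "1 / s ^ L \<le> n / s" by simp
    have "4 * n * (s ^ 5 * ?E s + 1 / s ^ L) \<le> 4 * n * (n / s + n / s)"
      using a b n0 by (intro mult_left_mono add_mono) auto
    also have "\<dots> = 8 * ?E s / s" by (simp add: nn)
    finally have "4 * n * (s ^ 5 * ?E s + 1 / s ^ L) \<le> 8 * ?E s / s" .
    then have "- (2 * ?E s / s + 8 * ?E s / s) \<le> E' s" using le \<open>E'' = E' s\<close> by (simp add: n_def)
    moreover have "2 * ?E s / s + 8 * ?E s / s \<le> 14 * ?E s / s" using s1 by (simp add: field_simps)
    ultimately show ?thesis by linarith
  qed
  have stay: "1 < s ^ (2 * K) * ?E s" if s: "t \<le> s" for s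
  proof -
    have "t ^ (2 * K) * ?E t \<le> s ^ (2 * K) * ?E s"
    proof (rule barrier_mono[where f="\<lambda>s. s ^ (2 * K) * ?E s" and B=1
        and f'="\<lambda>s. s ^ (2 * K) * E' s + (2 * K) * s ^ (2 * K - 1) * ?E s"])
      show "t \<le> s" by fact
      show "1 < t ^ (2 * K) * ?E t" by fact
      fix s assume s: "t \<le> s"
      then have s': "t1 \<le> s" and s1: "1 \<le> s" using t t1 by auto
      show "((\<lambda>s. s ^ (2 * K) * ?E s) has_real_derivative s ^ (2 * K) * E' s + (2 * K) * s ^ (2 * K - 1) * ?E s) (at s)"
        by (rule derivative_eq_intros refl E'[OF s'] | simp)+
      assume "1 < s ^ (2 * K) * ?E s"
      from rate[OF s' this] have r: "- (14 * ?E s / s) \<le> E' s" .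
      have e: "s ^ (2 * K) = s ^ (2 * K - 1) * s" using K by (simp flip: power_Suc2)
      have "s ^ (2 * K) * - (14 * ?E s / s) \<le> s ^ (2 * K) * E' s" using s1 r by (intro mult_left_mono) auto
      moreover have "s ^ (2 * K) * - (14 * ?E s / s) = - 14 * (s ^ (2 * K - 1) * ?E s)"
        unfolding e using s1 by simp
      moreover have "14 * (s ^ (2 * K - 1) * ?E s) \<le> (2 * K) * (s ^ (2 * K - 1) * ?E s)"
        using K s1 by (intro mult_right_mono) auto
      ultimately show "0 \<le> s ^ (2 * K) * E' s + (2 * K) * s ^ (2 * K - 1) * ?E s" by (simp add: mult.assoc)
    qed
    then show ?thesis using gt by linarith
  qed
  define c where "c = t ^ 14 * ?E t"
  have tt: "1 \<le> t" using t t1 by simp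
  have "?E t \<noteq> 0" using gt by auto
  then have c0: "0 < c" using tt unfolding c_def by (simp add: sum_power2_gt_zero_iff sum_power2_eq_zero_iff)
  have grow: "c \<le> s ^ 14 * ?E s" if s: "t \<le> s" for s
    unfolding c_def
  proof (rule deriv_nonneg_imp_le[where f="\<lambda>s. s ^ 14 * ?E s" and f'="\<lambda>s. s ^ 14 * E' s + 14 * s ^ 13 * ?E s"])
    show "t \<le> s" by fact
    fix x assume x: "x \<in> {t..s}"
    then have s': "t1 \<le> x" and s1: "1 \<le> x" using t t1 by auto
    show "((\<lambda>s. s ^ 14 * ?E s) has_real_derivative x ^ 14 * E' x + 14 * x ^ 13 * ?E x) (at x within {t..s})"
      by (rule derivative_eq_intros refl has_field_derivative_at_within[OF E'[OF s']] | simp)+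
    have "x ^ 14 * - (14 * ?E x / x) \<le> x ^ 14 * E' x"
      using rate[OF s' stay] x s1 by (intro mult_left_mono) auto
    moreover have "x ^ 14 * - (14 * ?E x / x) = - (14 * x ^ 13 * ?E x)"
      using s1 by (simp add: field_simps power_numeral_reduce)
    ultimately show "0 \<le> x ^ 14 * E' x + 14 * x ^ 13 * ?E x" by linarith
  qed
  \<comment> \<open>At this time the tube would give
    \<open>c \<le> 1 / s ^ 6 \<le> 1 / s \<le> c / 2\<close>.\<close>
  define s where "s = max t (2 / c)"
  have s: "t \<le> s" "1 \<le> s" "t1 \<le> s" using t t1 by (auto simp: s_def)
  have "c \<le> s ^ 14 * ?E s" by (rule grow[OF s(1)])
  also have "\<dots> \<le> s ^ 14 * (1 / s ^ 20)" using s by (intro mult_left_mono E20) auto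
  also have "\<dots> = 1 / s ^ 6" using s by (simp add: field_simps flip: power_add)
  also have "\<dots> \<le> 1 / s ^ 1" by (intro power_quotient_le s) simp
  also have "\<dots> \<le> 1 / (2 / c)" using c0 s by (intro divide_left_mono) (auto simp: s_def)
  also have "\<dots> < c" using c0 by simp
  finally show False by simp
qed

section \<open>Saddles: Wazewski's principle and the rate of decay\<close>

lemma dependence_on_compact:
  fixes f :: "real \<Rightarrow> real \<Rightarrow> real"
  assumes cd: "\<And>c T e. c \<in> I \<Longrightarrow> t1 \<le> T \<Longrightarrow> 0 < e \<Longrightarrow> \<exists>d>0. \<forall>c'\<in>I. \<bar>c' - c\<bar> < d \<longrightarrow> (\<forall>t\<in>{t1..T}. \<bar>f c' t - f c t\<bar> < e)"
    and cont: "continuous_on {t1..} (f c)" and c: "c \<in> I" and T: "t1 \<le> T"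
    and pos: "\<And>t. t \<in> {t1..T} \<Longrightarrow> 0 < f c t"
  shows "\<exists>d>0. \<forall>c'\<in>I. \<bar>c' - c\<bar> < d \<longrightarrow> (\<forall>t\<in>{t1..T}. 0 < f c' t)"
proof -
  have "\<exists>x\<in>{t1..T}. \<forall>y\<in>{t1..T}. f c x \<le> f c y"
    by (rule continuous_attains_inf) (use T continuous_on_subset[OF cont] in auto)
  then obtain x where x: "x \<in> {t1..T}" "\<And>y. y \<in> {t1..T} \<Longrightarrow> f c x \<le> f c y" by auto
  obtain d where d: "d > 0" "\<forall>c'\<in>I. \<bar>c' - c\<bar> < d \<longrightarrow> (\<forall>t\<in>{t1..T}. \<bar>f c' t - f c t\<bar> < f c x)"
    using cd[OF c T pos[OF x(1)]] by blast
  show ?thesis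
    using d x(2) by (intro exI[of _ d]) force
qed

text \<open>Wazewski's principle in the strip: \<open>p\<close> leaves outwards, \<open>q\<close> is confined, and the two
  sets of parameters that leave through \<open>p = 1\<close> and \<open>p = -1\<close> cannot cover the connected interval.\<close>

lemma wazewski_strip:
  fixes p q :: "real \<Rightarrow> real \<Rightarrow> real"
  defines "I \<equiv> {-2..2::real}"
  assumes cdp: "\<And>c T e. c \<in> I \<Longrightarrow> t1 \<le> T \<Longrightarrow> 0 < e \<Longrightarrow> \<exists>d>0. \<forall>c'\<in>I. \<bar>c' - c\<bar> < d \<longrightarrow> (\<forall>t\<in>{t1..T}. \<bar>p c' t - p c t\<bar> < e)"
    and cdq: "\<And>c T e. c \<in> I \<Longrightarrow> t1 \<le> T \<Longrightarrow> 0 < e \<Longrightarrow> \<exists>d>0. \<forall>c'\<in>I. \<bar>c' - c\<bar> < d \<longrightarrow> (\<forall>t\<in>{t1..T}. \<bar>q c' t - q c t\<bar> < e)"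
    and contp: "\<And>c. c \<in> I \<Longrightarrow> continuous_on {t1..} (p c)"
    and contq: "\<And>c. c \<in> I \<Longrightarrow> continuous_on {t1..} (q c)"
    and init: "\<And>c. c \<in> I \<Longrightarrow> p c t1 = c" "\<And>c. c \<in> I \<Longrightarrow> q c t1 = 0"
    and out: "\<And>c t. c \<in> I \<Longrightarrow> t1 \<le> t \<Longrightarrow> \<bar>p c t\<bar> = 1 \<Longrightarrow> \<bar>q c t\<bar> \<le> 1 \<Longrightarrow> \<exists>p'. (p c has_real_derivative p') (at t) \<and> 0 < p c t * p'"
    and inn: "\<And>c t. c \<in> I \<Longrightarrow> t1 \<le> t \<Longrightarrow> \<bar>p c t\<bar> \<le> 1 \<Longrightarrow> \<bar>q c t\<bar> = 1 \<Longrightarrow> \<exists>q'. (q c has_real_derivative q') (at t) \<and> q c t * q' < 0"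
  shows "\<exists>c\<in>I. \<forall>t\<ge>t1. \<bar>p c t\<bar> \<le> 1 \<and> \<bar>q c t\<bar> \<le> 1"
proof -
  \<comment> \<open>Parameters whose \<open>p\<close> leaves through the side \<open>s\<close>, with
    \<open>q\<close> inside and the opposite side not reached up to then. All inequalities are
    strict and concern a compact time interval, so continuous dependence makes these sets
    open.\<close>
  define A where "A s = {c\<in>I. \<exists>t\<ge>t1. 1 < s * p c t \<and> (\<forall>x\<in>{t1..t}. \<bar>q c x\<bar> < 1 \<and> -1 < s * p c x)}" for s :: real
  have disj: "A 1 \<inter> A (-1) = {}"
  proof -
    have False if c: "c \<in> A 1" "c \<in> A (-1)" for c
    proof -
      from c(1) obtain t where t: "t1 \<le> t" "1 < p c t" "\<And>x. x \<in> {t1..t} \<Longrightarrow> -1 < p c x" by (auto simp: A_def)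
      from c(2) obtain r where r: "t1 \<le> r" "1 < - p c r" "\<And>x. x \<in> {t1..r} \<Longrightarrow> -1 < - p c x" by (auto simp: A_def)
      show False
      proof (cases "t \<le> r")
        case True then show ?thesis using r(3)[of t] t by auto
      next
        case False then show ?thesis using t(3)[of r] r by auto
      qed
    qed
    then show ?thesis by auto
  qed
  have open_A: "openin (top_of_set I) (A s)" if s: "s = 1 \<or> s = -1" for s
    unfolding openin_euclidean_subtopology_iff
  proof (intro conjI ballI)
    show "A s \<subseteq> I" by (auto simp: A_def)
    fix c assume "c \<in> A s"
    then obtain t where c: "c \<in> I" and t: "t1 \<le> t" "1 < s * p c t"
      and x: "\<And>x. x \<in> {t1..t} \<Longrightarrow> \<bar>q c x\<bar> < 1 \<and> -1 < s * p c x"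
      by (auto simp: A_def)
    obtain d1 where d1: "d1 > 0" "\<forall>c'\<in>I. \<bar>c' - c\<bar> < d1 \<longrightarrow> (\<forall>x\<in>{t1..t}. \<bar>p c' x - p c x\<bar> < s * p c t - 1)"
      using cdp[OF c t(1), of "s * p c t - 1"] t by auto
    have "\<exists>d>0. \<forall>c'\<in>I. \<bar>c' - c\<bar> < d \<longrightarrow> (\<forall>x\<in>{t1..t}. 0 < 1 + s * p c' x)"
    proof (rule dependence_on_compact[of I t1 "\<lambda>c x. 1 + s * p c x"])
      fix c T and e :: real assume a: "c \<in> I" "t1 \<le> T" "0 < e"
      have eq: "\<bar>(1 + s * p c2 x) - (1 + s * p c x)\<bar> = \<bar>p c2 x - p c x\<bar>" for c2 c x
        using s by auto
      show "\<exists>d>0. \<forall>c'\<in>I. \<bar>c' - c\<bar> < d \<longrightarrow> (\<forall>x\<in>{t1..T}. \<bar>(1 + s * p c' x) - (1 + s * p c x)\<bar> < e)"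
        unfolding eq by (rule cdp[OF a])
    next
      show "continuous_on {t1..} (\<lambda>x. 1 + s * p c x)" by (intro continuous_intros contp c)
      fix y assume "y \<in> {t1..t}"
      then show "0 < 1 + s * p c y" using x[of y] by auto
    qed (use c t in auto)
    then obtain d2 where d2: "d2 > 0" "\<forall>c'\<in>I. \<bar>c' - c\<bar> < d2 \<longrightarrow> (\<forall>x\<in>{t1..t}. 0 < 1 + s * p c' x)" by blast
    have "\<exists>d>0. \<forall>c'\<in>I. \<bar>c' - c\<bar> < d \<longrightarrow> (\<forall>x\<in>{t1..t}. 0 < 1 + q c' x)"
    proof (rule dependence_on_compact[of I t1 "\<lambda>c x. 1 + q c x"])
      fix c T and e :: real assume a: "c \<in> I" "t1 \<le> T" "0 < e"
      have eq: "\<bar>(1 + q c2 x) - (1 + q c x)\<bar> = \<bar>q c2 x - q c x\<bar>" for c2 c x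
        using s by auto
      show "\<exists>d>0. \<forall>c'\<in>I. \<bar>c' - c\<bar> < d \<longrightarrow> (\<forall>x\<in>{t1..T}. \<bar>(1 + q c' x) - (1 + q c x)\<bar> < e)"
        unfolding eq by (rule cdq[OF a])
    next
      show "continuous_on {t1..} (\<lambda>x. 1 + q c x)" by (intro continuous_intros contq c)
      fix y assume "y \<in> {t1..t}"
      then show "0 < 1 + q c y" using x[of y] by auto
    qed (use c t in auto)
    then obtain d3 where d3: "d3 > 0" "\<forall>c'\<in>I. \<bar>c' - c\<bar> < d3 \<longrightarrow> (\<forall>x\<in>{t1..t}. 0 < 1 + q c' x)" by blast
    have "\<exists>d>0. \<forall>c'\<in>I. \<bar>c' - c\<bar> < d \<longrightarrow> (\<forall>x\<in>{t1..t}. 0 < 1 - q c' x)"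
    proof (rule dependence_on_compact[of I t1 "\<lambda>c x. 1 - q c x"])
      fix c T and e :: real assume a: "c \<in> I" "t1 \<le> T" "0 < e"
      have eq: "\<bar>(1 - q c2 x) - (1 - q c x)\<bar> = \<bar>q c2 x - q c x\<bar>" for c2 c x
        using s by auto
      show "\<exists>d>0. \<forall>c'\<in>I. \<bar>c' - c\<bar> < d \<longrightarrow> (\<forall>x\<in>{t1..T}. \<bar>(1 - q c' x) - (1 - q c x)\<bar> < e)"
        unfolding eq by (rule cdq[OF a])
    next
      show "continuous_on {t1..} (\<lambda>x. 1 - q c x)" by (intro continuous_intros contq c)
      fix y assume "y \<in> {t1..t}"
      then show "0 < 1 - q c y" using x[of y] by auto
    qed (use c t in auto)
    then obtain d4 where d4: "d4 > 0" "\<forall>c'\<in>I. \<bar>c' - c\<bar> < d4 \<longrightarrow> (\<forall>x\<in>{t1..t}. 0 < 1 - q c' x)" by blast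
    have "c' \<in> A s" if c': "c' \<in> I" "\<bar>c' - c\<bar> < Min {d1, d2, d3, d4}" for c'
    proof -
      have "\<bar>p c' t - p c t\<bar> < s * p c t - 1" using d1 c' t by auto
      then have "1 < s * p c' t" using s by auto
      moreover have "\<bar>q c' x\<bar> < 1 \<and> -1 < s * p c' x" if "x \<in> {t1..t}" for x
        using d2(2) d3(2) d4(2) c' that by fastforce
      ultimately show ?thesis using c' t by (auto simp: A_def)
    qed
    then show "\<exists>e>0. \<forall>x'\<in>I. dist x' c < e \<longrightarrow> x' \<in> A s"
      using d1 d2 d3 d4 by (intro exI[of _ "Min {d1, d2, d3, d4}"]) (auto simp: dist_real_def)
  qed
  \<comment> \<open>The ends 2 and -2 of the interval start outside the strip, so they have left at
    the initial time.\<close>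
  have ne: "2 \<in> A 1" "-2 \<in> A (-1)"
    using init[of 2] init[of "-2"] by (auto simp: A_def I_def intro!: exI[of _ t1])
  have "connected I" by (simp add: I_def)
  then have "\<not> I \<subseteq> A 1 \<union> A (-1)"
    using open_A[of 1] open_A[of "-1"] disj ne unfolding connected_openin by blast
  then obtain c where c: "c \<in> I" "c \<notin> A 1" "c \<notin> A (-1)" by auto
  \<comment> \<open>For a parameter outside both sets consider the first time at which
    \<open>p\<close> or \<open>q\<close> reaches modulus 1. There \<open>q\<close> cannot be on the
    boundary, since its square would have been larger just before; and \<open>p\<close> cannot
    either, since it would get out just after and put \<open>c\<close> into one of the two
    sets.\<close>
  define B where "B = {t. t1 \<le> t \<and> (1 \<le> \<bar>p c t\<bar> \<or> 1 \<le> \<bar>q c t\<bar>)}"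
  have "B = {}"
  proof (rule ccontr)
    assume "B \<noteq> {}"
    then obtain T where T: "T \<in> B" by auto
    have "continuous_on {t1..T} (\<lambda>t. max \<bar>p c t\<bar> \<bar>q c t\<bar>)"
      by (intro continuous_intros continuous_on_subset[OF contp[OF c(1)]] continuous_on_subset[OF contq[OF c(1)]]) auto
    note comp = closed_ge_sublevel(1)[OF this, of 1]
    have "{x \<in> {t1..T}. 1 \<le> max \<bar>p c x\<bar> \<bar>q c x\<bar>} \<noteq> {}" using T by (auto simp: B_def le_max_iff_disj)
    from compact_attains_inf[OF comp this]
    obtain s where s: "t1 \<le> s" "s \<le> T" "1 \<le> max \<bar>p c s\<bar> \<bar>q c s\<bar>"
      and inf: "\<And>x. x \<in> {t1..T} \<Longrightarrow> 1 \<le> max \<bar>p c x\<bar> \<bar>q c x\<bar> \<Longrightarrow> s \<le> x" by auto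
    have before: "\<bar>p c x\<bar> < 1" "\<bar>q c x\<bar> < 1" if "t1 \<le> x" "x < s" for x
    proof -
      have "\<not> 1 \<le> max \<bar>p c x\<bar> \<bar>q c x\<bar>" using inf[of x] that s by fastforce
      then show "\<bar>p c x\<bar> < 1" "\<bar>q c x\<bar> < 1" by auto
    qed
    have at_s: "\<bar>p c s\<bar> \<le> 1 \<and> \<bar>q c s\<bar> \<le> 1"
    proof (cases "s = t1")
      case True
      have "c \<in> A 1" if "1 < p c t1"
        unfolding A_def using c(1) init[OF c(1)] that by (auto intro!: exI[of _ t1])
      moreover have "c \<in> A (-1)" if "1 < - p c t1"
        unfolding A_def using c(1) init[OF c(1)] that by (auto intro!: exI[of _ t1])
      ultimately have "\<not> 1 < p c t1" "\<not> 1 < - p c t1" using c by auto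
      then show ?thesis using init[OF c(1)] True by auto
    next
      case False
      then have st: "t1 < s" using s by simp
      have "(p c \<longlongrightarrow> p c s) (at s within {t1..})" "(q c \<longlongrightarrow> q c s) (at s within {t1..})"
        using contp[OF c(1)] contq[OF c(1)] s by (auto simp: continuous_on)
      then have "(p c \<longlongrightarrow> p c s) (at s within {t1..s})" "(q c \<longlongrightarrow> q c s) (at s within {t1..s})"
        by (metis atLeastatMost_subset_iff atLeast_iff atLeastAtMost_iff subsetI tendsto_within_subset)+
      then have l: "(p c \<longlongrightarrow> p c s) (at_left s)" "(q c \<longlongrightarrow> q c s) (at_left s)"
        unfolding at_within_Icc_at_left[OF st] .
      have ev: "\<forall>\<^sub>F x in at_left s. \<bar>p c x\<bar> \<le> 1" "\<forall>\<^sub>F x in at_left s. \<bar>q c x\<bar> \<le> 1"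
        using before by (auto simp: eventually_at_left[OF st] intro!: exI[of _ t1] less_imp_le st)
      show ?thesis
        using tendsto_upperbound[OF tendsto_rabs[OF l(1)] ev(1)] tendsto_upperbound[OF tendsto_rabs[OF l(2)] ev(2)] by auto
    qed
    show False
    proof (cases "\<bar>q c s\<bar> = 1")
      case True
      then have st: "t1 < s" using init[OF c(1)] s by (cases "s = t1") auto
      obtain q' where q': "(q c has_real_derivative q') (at s)" "q c s * q' < 0" using inn[OF c(1) s(1) _ True] at_s by auto
      have "((\<lambda>x. q c x * q c x) has_real_derivative 2 * (q' * q c s)) (at s)"
        by (rule derivative_eq_intros q' | simp)+
      from DERIV_neg_dec_left[OF this] q'(2)[unfolded mult.commute[of "q c s"]] obtain d where d: "d > 0" "\<And>h. 0 < h \<Longrightarrow> h < d \<Longrightarrow> q c s * q c s < q c (s - h) * q c (s - h)" by auto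
      define h where "h = min (d / 2) (s - t1)"
      have h: "0 < h" "h < d" "t1 \<le> s - h" using d st by (auto simp: h_def)
      have "1 < q c (s - h) * q c (s - h)" using d(2)[OF h(1,2)] True by (metis abs_mult_self_eq mult_1)
      moreover have "\<bar>q c (s - h)\<bar> < 1" using before h by auto
      ultimately show False by (metis abs_ge_zero abs_mult_self_eq less_eq_real_def mult_le_one not_less)
    next
      case False
      then have q1: "\<bar>q c s\<bar> < 1" and p1: "\<bar>p c s\<bar> = 1" using at_s s(3) by (auto simp: le_max_iff_disj)
      define \<sigma> where "\<sigma> = p c s"
      have \<sigma>: "\<sigma> = 1 \<or> \<sigma> = -1" using p1 by (auto simp: \<sigma>_def)
      obtain p' where p': "(p c has_real_derivative p') (at s)" "0 < \<sigma> * p'" using out[OF c(1) s(1) p1] at_s by (auto simp: \<sigma>_def)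
      have "((\<lambda>x. \<sigma> * p c x) has_real_derivative \<sigma> * p') (at s)" by (rule DERIV_cmult[OF p'(1)])
      from DERIV_pos_inc_right[OF this p'(2)]
      obtain d where d: "d > 0" "\<And>h. 0 < h \<Longrightarrow> h < d \<Longrightarrow> \<sigma> * p c s < \<sigma> * p c (s + h)" by auto
      have ss: "\<sigma> * p c s = 1" using \<sigma> by (auto simp: \<sigma>_def)
      have "(q c \<longlongrightarrow> q c s) (at s within {t1..})"
        using contq[OF c(1)] s by (auto simp: continuous_on)
      then have "\<forall>\<^sub>F x in at s within {t1..}. \<bar>q c x\<bar> < 1"
        using q1 by (intro order_tendstoD(2)[OF tendsto_rabs]) auto
      then obtain d' where d': "d' > 0" "\<And>x. t1 \<le> x \<Longrightarrow> x \<noteq> s \<Longrightarrow> dist x s < d' \<Longrightarrow> \<bar>q c x\<bar> < 1"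
        by (auto simp: eventually_at)
      define h where "h = min d d' / 2"
      have h: "0 < h" "h < d" "h < d'" using d d' by (auto simp: h_def)
      have "c \<in> A \<sigma>"
        unfolding A_def
      proof (intro CollectI conjI c(1) exI[of _ "s + h"] ballI)
        show "t1 \<le> s + h" using s h by simp
        show "1 < \<sigma> * p c (s + h)" using d(2)[OF h(1,2)] ss by simp
        fix x assume x: "x \<in> {t1..s + h}"
        consider "x < s" | "x = s" | "s < x" by linarith
        then show "\<bar>q c x\<bar> < 1"
          by cases (use before x q1 d'(2)[of x] h in \<open>auto simp: dist_real_def\<close>)
        consider "x < s" | "x = s" | "s < x" by linarith
        then show "- 1 < \<sigma> * p c x"
        proof cases
          case 1 then show ?thesis using before(1)[of x] x \<sigma> by auto
        next
          case 2 then show ?thesis using ss by simp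
        next
          case 3 then show ?thesis using d(2)[of "x - s"] x h ss by auto
        qed
      qed
      then show False using c \<sigma> by auto
    qed
  qed
  then show ?thesis using c by (intro bexI[of _ c]) (force simp: B_def)+
qed

text \<open>For the saddle \<open>u * v\<close> grows and \<open>(u - v)\<^sup>2\<close> shrinks. If
  \<open>u * v\<close> ever exceeded \<open>4 * x\<^sup>2\<close>, with \<open>x = 1 / t ^ L\<close>
  the size of the forcing, it would never decrease again, which the decay of the energy excludes. So
  the energy is at most \<open>(u - v)\<^sup>2 + 8 * x\<^sup>2\<close>, and the first part is
  contracted at a fixed rate down to a multiple of \<open>x\<^sup>2\<close>.\<close>

lemma hyperbolic_bootstrap:
  assumes p: "\<And>t. t1 \<le> t \<Longrightarrow> planar_at (-1) L u v t" and t1: "16 \<le> t1" "4 * real L \<le> t1"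
    and E20: "\<And>t. t1 \<le> t \<Longrightarrow> (u t)\<^sup>2 + (v t)\<^sup>2 \<le> 1 / t ^ 20"
  shows "\<exists>C. \<forall>t\<ge>t1. (u t)\<^sup>2 + (v t)\<^sup>2 \<le> C / t ^ (2 * L)"
proof -
  let ?E = "\<lambda>t. (u t)\<^sup>2 + (v t)\<^sup>2"
  have "\<forall>t. \<exists>om gu gv. t1 \<le> t \<longrightarrow> 1 \<le> om \<and>
     (u has_real_derivative om * v t + gu) (at t) \<and> (v has_real_derivative om * u t + gv) (at t) \<and>
     \<bar>gu\<bar> \<le> \<bar>u t\<bar> / t + t ^ 5 * ?E t + 1 / t ^ L \<and> \<bar>gv\<bar> \<le> \<bar>v t\<bar> / t + t ^ 5 * ?E t + 1 / t ^ L"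
    using p E20 unfolding planar_at_def by fastforce
  then obtain om gu gv where om: "\<And>t. t1 \<le> t \<Longrightarrow> 1 \<le> om t"
    and du: "\<And>t. t1 \<le> t \<Longrightarrow> (u has_real_derivative om t * v t + gu t) (at t)"
    and dv: "\<And>t. t1 \<le> t \<Longrightarrow> (v has_real_derivative om t * u t + gv t) (at t)"
    and gu: "\<And>t. t1 \<le> t \<Longrightarrow> \<bar>gu t\<bar> \<le> \<bar>u t\<bar> / t + t ^ 5 * ?E t + 1 / t ^ L"
    and gv: "\<And>t. t1 \<le> t \<Longrightarrow> \<bar>gv t\<bar> \<le> \<bar>v t\<bar> / t + t ^ 5 * ?E t + 1 / t ^ L"
    by metis
  define x where "x t = 1 / t ^ L" for t :: real
  have g: "\<bar>gu t\<bar> + \<bar>gv t\<bar> \<le> sqrt (?E t) / 4 + 2 * x t" "\<bar>u t\<bar> \<le> sqrt (?E t)" "\<bar>v t\<bar> \<le> sqrt (?E t)" if t: "t1 \<le> t" for t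
  proof -
    have t16: "16 \<le> t" using t t1 by simp
    define n where "n = sqrt (?E t)"
    have n0: "0 \<le> n" by (simp add: n_def)
    have nn: "?E t = n * n" by (simp add: n_def)
    have n10: "n \<le> 1 / t ^ 10"
      unfolding n_def using E20[OF t] t16 by (intro real_le_lsqrt) (auto simp: power_divide simp flip: power_mult)
    have uv: "\<bar>u t\<bar> \<le> n" "\<bar>v t\<bar> \<le> n" by (auto simp: n_def intro: real_le_rsqrt)
    have "t ^ 5 * ?E t = (t ^ 5 * n) * n" by (simp add: nn)
    also have "\<dots> \<le> (t ^ 5 * (1 / t ^ 10)) * n" using n10 n0 t16 by (intro mult_right_mono mult_left_mono) auto
    also have "t ^ 5 * (1 / t ^ 10) = 1 / t ^ 5" using t16 by (simp add: field_simps flip: power_add)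
    also have "1 / t ^ 5 * n \<le> 1 / t ^ 1 * n" using n0 t16 by (intro mult_right_mono power_quotient_le) auto
    finally have a: "t ^ 5 * ?E t \<le> n / t" by simp
    have b: "\<bar>u t\<bar> / t \<le> n / t" "\<bar>v t\<bar> / t \<le> n / t" using uv t16 by (auto intro: divide_right_mono)
    have c: "n / t \<le> n / 16" using t16 n0 by (intro divide_left_mono) auto
    have "\<bar>gu t\<bar> + \<bar>gv t\<bar> \<le> n / 4 + 2 * x t"
      using gu[OF t] gv[OF t] a b c unfolding x_def by linarith
    then show "\<bar>gu t\<bar> + \<bar>gv t\<bar> \<le> sqrt (?E t) / 4 + 2 * x t" "\<bar>u t\<bar> \<le> sqrt (?E t)" "\<bar>v t\<bar> \<le> sqrt (?E t)"
      using uv by (auto simp: n_def)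
  qed
  have young: "2 * a * y \<le> k * a\<^sup>2 + y\<^sup>2 / k" if "k > 0" for a y k :: real
  proof -
    have "0 \<le> (k * a - y)\<^sup>2 / k" using that by simp
    also have "\<dots> = k * a\<^sup>2 + y\<^sup>2 / k - 2 * a * y" using that by (simp add: power2_eq_square field_simps)
    finally show ?thesis by simp
  qed
  have x2: "(x t)\<^sup>2 = 1 / t ^ (2 * L)" for t by (simp add: x_def power_divide power_mult[symmetric] mult.commute)
  have xpos: "0 < x t" if "t1 \<le> t" for t using that t1 by (simp add: x_def)
  define W' where "W' t = (om t * v t + gu t) * v t + (om t * u t + gv t) * u t" for t
  have dW: "((\<lambda>t. u t * v t) has_real_derivative W' t) (at t)" if t: "t1 \<le> t" for t
    unfolding W'_def by (rule derivative_eq_intros refl du[OF t] dv[OF t])+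
  have W': "?E t / 2 - 4 * (x t)\<^sup>2 \<le> W' t" if t: "t1 \<le> t" for t
  proof -
    let ?n = "sqrt (?E t)"
    have "- (gu t * v t + gv t * u t) \<le> \<bar>gu t\<bar> * \<bar>v t\<bar> + \<bar>gv t\<bar> * \<bar>u t\<bar>"
      by (simp flip: abs_mult)
    also have "\<dots> \<le> \<bar>gu t\<bar> * ?n + \<bar>gv t\<bar> * ?n" using g[OF t] by (intro add_mono mult_left_mono) auto
    also have "\<dots> = (\<bar>gu t\<bar> + \<bar>gv t\<bar>) * ?n" by (simp add: algebra_simps)
    also have "\<dots> \<le> (?n / 4 + 2 * x t) * ?n" using g[OF t] by (intro mult_right_mono) auto
    also have "\<dots> = ?E t / 4 + 2 * ?n * x t" by (simp add: algebra_simps)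
    also have "2 * ?n * x t \<le> 1 / 4 * ?n\<^sup>2 + (x t)\<^sup>2 / (1 / 4)" by (rule young) simp
    finally have "- (gu t * v t + gv t * u t) \<le> ?E t / 2 + 4 * (x t)\<^sup>2" by simp
    moreover have "?E t \<le> om t * ?E t" using mult_right_mono[OF om[OF t], of "?E t"] by simp
    moreover have "W' t = om t * ?E t + (gu t * v t + gv t * u t)"
      by (simp add: W'_def algebra_simps power2_eq_square)
    moreover have "e / 2 - 4 * y \<le> w" if "- g \<le> e / 2 + 4 * y" "e \<le> oe" "w = oe + g" for e g oe w y :: real
      using that by linarith
    ultimately show ?thesis by blast
  qed
  have uvE: "2 * (u t * v t) \<le> ?E t" for t using sum_squares_bound[of "u t" "v t"] by (simp add: mult.assoc)
  have W: "u t * v t \<le> 4 * (x t)\<^sup>2" if t: "t1 \<le> t" for t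
  proof (rule ccontr)
    assume gt: "\<not> u t * v t \<le> 4 * (x t)\<^sup>2"
    have grow: "u t * v t \<le> u s * v s" if s: "t \<le> s" for s
    proof (rule barrier_mono[where f="\<lambda>t. u t * v t" and f'=W' and B="4 * (x t)\<^sup>2"])
      show "4 * (x t)\<^sup>2 < u t * v t" using gt by simp
      fix r assume r: "t \<le> r"
      then show "((\<lambda>t. u t * v t) has_real_derivative W' r) (at r)" using t by (intro dW) auto
      assume "4 * (x t)\<^sup>2 < u r * v r"
      moreover have "(x r)\<^sup>2 \<le> (x t)\<^sup>2" unfolding x2 using r t t1 by (intro divide_left_mono power_mono mult_pos_pos) auto
      moreover have "0 \<le> w" if "4 * X < m" "Y \<le> X" "e / 2 - 4 * Y \<le> w" "2 * m \<le> e" for X Y m e w :: real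
        using that by linarith
      moreover have "t1 \<le> r" using r t by simp
      ultimately show "0 \<le> W' r" using W'[of r] uvE[of r] by blast
    qed (fact s)
    define c where "c = u t * v t"
    have c: "0 < c" using gt xpos[OF t] unfolding c_def by (smt (verit) zero_le_power2)
    define s where "s = max t (1 / c)"
    have s: "t \<le> s" "1 \<le> s" "t1 \<le> s" using t t1 by (auto simp: s_def)
    have "2 * c \<le> ?E s" using grow[OF s(1)] uvE[of s] by (simp add: c_def)
    also have "\<dots> \<le> 1 / s ^ 20" by (rule E20[OF s(3)])
    also have "\<dots> \<le> 1 / s ^ 1" by (intro power_quotient_le s) simp
    also have "\<dots> \<le> 1 / (1 / c)" using c s by (intro divide_left_mono) (auto simp: s_def)
    finally show False using c by simp
  qed
  define Q where "Q t = (u t - v t)\<^sup>2" for t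
  have EQ: "?E t \<le> Q t + 8 * (x t)\<^sup>2" if "t1 \<le> t" for t
    using W[OF that] by (simp add: Q_def power2_eq_square algebra_simps)
  define Q' where "Q' t = 2 * (u t - v t) * ((om t * v t + gu t) - (om t * u t + gv t))" for t
  have dQ: "(Q has_real_derivative Q' t) (at t)" if t: "t1 \<le> t" for t
    unfolding Q_def Q'_def
    by (rule derivative_eq_intros refl du[OF t] dv[OF t])+ simp
  have Q'le: "Q' t \<le> - Q t + 18 * (x t)\<^sup>2" if t: "t1 \<le> t" for t
  proof -
    let ?q = "\<bar>u t - v t\<bar>"
    have qq: "?q\<^sup>2 = Q t" by (simp add: Q_def)
    have "(?q + 3 * x t)\<^sup>2 = Q t + 9 * (x t)\<^sup>2 + 6 * (?q * x t)"
      unfolding qq[symmetric] by (simp only: power2_eq_square) (simp add: algebra_simps)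
    moreover have "0 \<le> ?q * x t" "0 \<le> (x t)\<^sup>2" using xpos[OF t] by auto
    ultimately have "?E t \<le> (?q + 3 * x t)\<^sup>2"
      using EQ[OF t] by linarith
    then have n: "sqrt (?E t) \<le> ?q + 3 * x t" using xpos[OF t] by (intro real_le_lsqrt) auto
    have "(u t - v t) * (gu t - gv t) \<le> ?q * (\<bar>gu t\<bar> + \<bar>gv t\<bar>)"
    proof -
      have "(u t - v t) * (gu t - gv t) \<le> \<bar>u t - v t\<bar> * \<bar>gu t - gv t\<bar>" by (simp flip: abs_mult)
      also have "\<dots> \<le> ?q * (\<bar>gu t\<bar> + \<bar>gv t\<bar>)" by (intro mult_left_mono) auto
      finally show ?thesis .
    qed
    also have "\<dots> \<le> ?q * (?q / 4 + 3 * x t)"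
      using g(1)[OF t] n xpos[OF t] by (intro mult_left_mono) auto
    finally have "2 * ((u t - v t) * (gu t - gv t)) \<le> ?q\<^sup>2 / 2 + 2 * ?q * (3 * x t)"
      by (simp add: power2_eq_square algebra_simps)
    also have "2 * ?q * (3 * x t) \<le> 1 / 2 * ?q\<^sup>2 + (3 * x t)\<^sup>2 / (1 / 2)" by (rule young) simp
    finally have "2 * ((u t - v t) * (gu t - gv t)) \<le> Q t + 18 * (x t)\<^sup>2" by (simp add: Q_def power_mult_distrib)
    moreover have "Q t \<le> om t * Q t" using om[OF t] by (simp add: Q_def mult_le_cancel_right1)
    moreover have "Q' t = - 2 * (om t * Q t) + 2 * ((u t - v t) * (gu t - gv t))"
      by (simp add: Q'_def Q_def power2_eq_square algebra_simps)
    ultimately show ?thesis by linarith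
  qed
  \<comment> \<open>For \<open>F = t ^ (2 * L) * Q\<close> the estimate of \<open>Q'\<close> reads
    \<open>F' \<le> - F + 18 + F / 2\<close>, since \<open>4 * L \<le> t\<close> bounds the relative
    rate of the weight by 1/2. Above 36 the right-hand side is negative.\<close>
  define B where "B = max (t1 ^ (2 * L) * Q t1) 36"
  have F: "t ^ (2 * L) * Q t \<le> B" if t: "t1 \<le> t" for t
  proof (rule barrier_upper[where f="\<lambda>t. t ^ (2 * L) * Q t" and a=t1
        and f'="\<lambda>t. t ^ (2 * L) * Q' t + real (2 * L) * t ^ (2 * L - 1) * Q t"])
    show "t1 ^ (2 * L) * Q t1 \<le> B" by (simp add: B_def)
    fix s assume s: "t1 \<le> s"
    then have s1: "16 \<le> s" "4 * real L \<le> s" using t1 by auto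
    show "((\<lambda>t. t ^ (2 * L) * Q t) has_real_derivative s ^ (2 * L) * Q' s + real (2 * L) * s ^ (2 * L - 1) * Q s) (at s)"
      by (rule derivative_eq_intros refl dQ[OF s] | simp)+
    assume gt: "B < s ^ (2 * L) * Q s"
    have "s ^ (2 * L) * Q' s \<le> s ^ (2 * L) * (- Q s + 18 * (x s)\<^sup>2)"
      using Q'le[OF s] s1 by (intro mult_left_mono) auto
    also have "\<dots> = - (s ^ (2 * L) * Q s) + 18" unfolding x2 using s1 by (simp add: algebra_simps)
    finally have 1: "s ^ (2 * L) * Q' s \<le> - (s ^ (2 * L) * Q s) + 18" .
    have "real (2 * L) * s ^ (2 * L - 1) * Q s \<le> s ^ (2 * L) * Q s / 2"
    proof (cases "L = 0")
      case True
      then show ?thesis by (simp add: Q_def)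
    next
      case False
      have "real (2 * L) * (s ^ (2 * L - 1) * Q s) \<le> (s / 2) * (s ^ (2 * L - 1) * Q s)"
        using s1 by (intro mult_right_mono) (auto simp: Q_def)
      also have "\<dots> = s ^ (2 * L) * Q s / 2" using False by (simp add: power_eq_if[of s "2 * L"])
      finally show ?thesis by (simp add: mult.assoc)
    qed
    then show "s ^ (2 * L) * Q' s + real (2 * L) * s ^ (2 * L - 1) * Q s \<le> 0"
      using 1 gt by (simp add: B_def)
  qed (fact t)
  show ?thesis
  proof (intro exI[of _ "B + 8"] allI impI)
    fix t assume t: "t1 \<le> t"
    then have "0 < t ^ (2 * L)" using t1 by simp
    then have "Q t \<le> B / t ^ (2 * L)" using F[OF t] by (simp add: field_simps)
    then show "?E t \<le> (B + 8) / t ^ (2 * L)" using EQ[OF t] by (simp add: x2 add_divide_distrib)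
  qed
qed

text \<open>\<open>P 1\<close> and \<open>P (-1)\<close> are the expanding coordinate
  \<open>u + v\<close> and the contracting one \<open>u - v\<close>, magnified by
  \<open>t ^ 16\<close> so that the tube becomes the unit strip. In the strip the linear, nonlinear
  and forcing terms of both components amount to at most \<open>6 / t\<close>, and the weight
  contributes \<open>16 / t\<close>; for \<open>32 \<le> t\<close> their sum is below 1 and cannot
  upset the signs given by \<open>1 \<le> om\<close>. The initial data make \<open>P 1\<close> equal
  to \<open>c\<close> and \<open>P (-1)\<close> equal to 0.\<close>

lemma hyperbolic_tube:
  fixes u v :: "real \<Rightarrow> real \<Rightarrow> real"
  defines "I \<equiv> {-2..2::real}"
  assumes p: "\<And>c t. c \<in> I \<Longrightarrow> t1 \<le> t \<Longrightarrow> planar_at (-1) L (u c) (v c) t" and t1: "32 \<le> t1" and L: "17 \<le> L"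
    and cd: "\<And>c T e. c \<in> I \<Longrightarrow> t1 \<le> T \<Longrightarrow> 0 < e \<Longrightarrow> \<exists>d>0. \<forall>c'\<in>I. \<bar>c' - c\<bar> < d \<longrightarrow>
       (\<forall>t\<in>{t1..T}. \<bar>u c' t - u c t\<bar> < e \<and> \<bar>v c' t - v c t\<bar> < e)"
    and init: "\<And>c. c \<in> I \<Longrightarrow> u c t1 = c / (2 * t1 ^ 16)" "\<And>c. c \<in> I \<Longrightarrow> v c t1 = c / (2 * t1 ^ 16)"
  shows "\<exists>c\<in>I. \<forall>t\<ge>t1. (u c t)\<^sup>2 + (v c t)\<^sup>2 \<le> 1 / t ^ 32"
proof -
  define P where "P s c t = t ^ 16 * (u c t + s * v c t)" for s c t :: real
  have cdP: "\<exists>d>0. \<forall>c'\<in>I. \<bar>c' - c\<bar> < d \<longrightarrow> (\<forall>t\<in>{t1..T}. \<bar>P s c' t - P s c t\<bar> < e)"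
    if c: "c \<in> I" and T: "t1 \<le> T" and e: "0 < e" and s: "\<bar>s\<bar> = 1" for c T e s
  proof -
    have T0: "0 < T ^ 16" using T t1 by simp
    then have "0 < e / (2 * T ^ 16)" using e by simp
    from cd[OF c T this] obtain d where d: "d > 0"
      and D: "\<And>c' t. c' \<in> I \<Longrightarrow> \<bar>c' - c\<bar> < d \<Longrightarrow> t \<in> {t1..T} \<Longrightarrow>
          \<bar>u c' t - u c t\<bar> < e / (2 * T ^ 16) \<and> \<bar>v c' t - v c t\<bar> < e / (2 * T ^ 16)" by blast
    have "\<bar>P s c' t - P s c t\<bar> < e" if "c' \<in> I" "\<bar>c' - c\<bar> < d" "t \<in> {t1..T}" for c' t
    proof -
      have "P s c' t - P s c t = t ^ 16 * ((u c' t - u c t) + s * (v c' t - v c t))"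
        by (simp add: P_def algebra_simps)
      then have "\<bar>P s c' t - P s c t\<bar> = t ^ 16 * \<bar>(u c' t - u c t) + s * (v c' t - v c t)\<bar>"
        using t1 that by (simp add: abs_mult)
      also have "\<dots> \<le> T ^ 16 * (\<bar>u c' t - u c t\<bar> + \<bar>v c' t - v c t\<bar>)"
      proof (intro mult_mono power_mono)
        have "\<bar>(u c' t - u c t) + s * (v c' t - v c t)\<bar> \<le> \<bar>u c' t - u c t\<bar> + \<bar>s * (v c' t - v c t)\<bar>"
          by (rule abs_triangle_ineq)
        then show "\<bar>(u c' t - u c t) + s * (v c' t - v c t)\<bar> \<le> \<bar>u c' t - u c t\<bar> + \<bar>v c' t - v c t\<bar>"
          using s by (simp add: abs_mult)
      qed (use that t1 T in auto)
      also have "\<dots> < T ^ 16 * (e / (2 * T ^ 16) + e / (2 * T ^ 16))"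
        using D[OF that] T0 by (intro mult_strict_left_mono add_strict_mono) auto
      also have "\<dots> = e" using T0 by simp
      finally show ?thesis .
    qed
    then show ?thesis using d by blast
  qed
  have der: "\<exists>om gu gv. 1 \<le> om \<and> (u c has_real_derivative om * v c t + gu) (at t) \<and> (v c has_real_derivative om * u c t + gv) (at t)
      \<and> (\<bar>P 1 c t\<bar> \<le> 1 \<longrightarrow> \<bar>P (-1) c t\<bar> \<le> 1 \<longrightarrow> \<bar>gu\<bar> + \<bar>gv\<bar> \<le> 6 / t ^ 17)"
    if c: "c \<in> I" and t: "t1 \<le> t" for c t
  proof -
    obtain om gu gv where om: "1 \<le> om" and d: "(u c has_real_derivative om * v c t + gu) (at t)" "(v c has_real_derivative om * u c t + gv) (at t)"
      and g: "(u c t)\<^sup>2 + (v c t)\<^sup>2 \<le> 1 / t ^ 20 \<longrightarrow>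
        \<bar>gu\<bar> \<le> \<bar>u c t\<bar> / t + t ^ 5 * ((u c t)\<^sup>2 + (v c t)\<^sup>2) + 1 / t ^ L \<and>
        \<bar>gv\<bar> \<le> \<bar>v c t\<bar> / t + t ^ 5 * ((u c t)\<^sup>2 + (v c t)\<^sup>2) + 1 / t ^ L"
      using p[OF c t] unfolding planar_at_def by auto
    have t1': "1 \<le> t" "0 < t ^ 16" using t t1 by auto
    have "\<bar>gu\<bar> + \<bar>gv\<bar> \<le> 6 / t ^ 17" if "\<bar>P 1 c t\<bar> \<le> 1" "\<bar>P (-1) c t\<bar> \<le> 1"
    proof -
      have ab: "\<bar>u c t + v c t\<bar> \<le> 1 / t ^ 16" "\<bar>u c t - v c t\<bar> \<le> 1 / t ^ 16"
        using that t1' by (simp_all add: P_def abs_mult pos_le_divide_eq mult.commute)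
      have uv: "\<bar>u c t\<bar> \<le> 1 / t ^ 16" "\<bar>v c t\<bar> \<le> 1 / t ^ 16" using ab by linarith+
      have "(u c t)\<^sup>2 + (v c t)\<^sup>2 = ((u c t + v c t)\<^sup>2 + (u c t - v c t)\<^sup>2) / 2"
        by (simp add: power2_eq_square algebra_simps)
      also have "\<dots> \<le> ((1 / t ^ 16)\<^sup>2 + (1 / t ^ 16)\<^sup>2) / 2"
        using power_mono[OF ab(1) abs_ge_zero, of 2] power_mono[OF ab(2) abs_ge_zero, of 2] by simp
      also have "\<dots> = 1 / t ^ 32" by (simp add: power_divide flip: power_mult)
      finally have E: "(u c t)\<^sup>2 + (v c t)\<^sup>2 \<le> 1 / t ^ 32" .
      also have "\<dots> \<le> 1 / t ^ 20" by (intro power_quotient_le t1') simp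
      finally have g': "\<bar>gu\<bar> \<le> \<bar>u c t\<bar> / t + t ^ 5 * ((u c t)\<^sup>2 + (v c t)\<^sup>2) + 1 / t ^ L"
        "\<bar>gv\<bar> \<le> \<bar>v c t\<bar> / t + t ^ 5 * ((u c t)\<^sup>2 + (v c t)\<^sup>2) + 1 / t ^ L" using g by auto
      have "t ^ 5 * ((u c t)\<^sup>2 + (v c t)\<^sup>2) \<le> t ^ 5 * (1 / t ^ 32)" using E t1' by (intro mult_left_mono) auto
      also have "\<dots> = 1 / t ^ 27" using t1' by (simp add: field_simps flip: power_add)
      also have "\<dots> \<le> 1 / t ^ 17" by (intro power_quotient_le t1') simp
      finally have a: "t ^ 5 * ((u c t)\<^sup>2 + (v c t)\<^sup>2) \<le> 1 / t ^ 17" .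
      have b: "1 / t ^ L \<le> 1 / t ^ 17" by (intro power_quotient_le t1' L)
      have "\<bar>u c t\<bar> / t \<le> (1 / t ^ 16) / t" "\<bar>v c t\<bar> / t \<le> (1 / t ^ 16) / t" using divide_right_mono[OF uv(1), of t] divide_right_mono[OF uv(2), of t] t1' by auto
      moreover have "(1 / t ^ 16) / t = 1 / t ^ 17" by (simp add: power_numeral_reduce)
      moreover have "6 / t ^ 17 = 6 * (1 / t ^ 17)" by simp
      ultimately show ?thesis using g' a b by linarith
    qed
    then show ?thesis using om d by blast
  qed
  have dP: "\<exists>om P'. 1 \<le> om \<and> (P s c has_real_derivative P') (at t) \<and>
      (\<bar>P 1 c t\<bar> \<le> 1 \<longrightarrow> \<bar>P (-1) c t\<bar> \<le> 1 \<longrightarrow> \<bar>P' - (s * om * P s c t + 16 / t * P s c t)\<bar> \<le> 6 / t)"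
    if c: "c \<in> I" and t: "t1 \<le> t" and s: "s = 1 \<or> s = -1" for c t s
  proof -
    obtain om gu gv where om: "1 \<le> om" and d: "(u c has_real_derivative om * v c t + gu) (at t)" "(v c has_real_derivative om * u c t + gv) (at t)"
      and g: "\<bar>P 1 c t\<bar> \<le> 1 \<longrightarrow> \<bar>P (-1) c t\<bar> \<le> 1 \<longrightarrow> \<bar>gu\<bar> + \<bar>gv\<bar> \<le> 6 / t ^ 17"
      using der[OF c t] by blast
    have t0: "0 < t" using t t1 by simp
    let ?P' = "s * om * P s c t + 16 / t * P s c t + t ^ 16 * (gu + s * gv)"
    have "(P s c has_real_derivative ?P') (at t)"
      unfolding P_def
      by (rule derivative_eq_intros d refl | simp)+ (use s t0 in \<open>auto simp: field_simps power_numeral_reduce\<close>)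
    moreover have "\<bar>t ^ 16 * (gu + s * gv)\<bar> \<le> 6 / t" if "\<bar>gu\<bar> + \<bar>gv\<bar> \<le> 6 / t ^ 17"
    proof -
      have "\<bar>t ^ 16 * (gu + s * gv)\<bar> = t ^ 16 * \<bar>gu + s * gv\<bar>" using t0 by (simp add: abs_mult)
      also have "\<dots> \<le> t ^ 16 * (6 / t ^ 17)" using that s t0 by (intro mult_left_mono) auto
      also have "\<dots> = 6 / t" using t0 by (simp add: field_simps power_numeral_reduce)
      finally show ?thesis .
    qed
    ultimately show ?thesis using om g by (intro exI[of _ om] exI[of _ ?P']) auto
  qed
  have "\<exists>c\<in>I. \<forall>t\<ge>t1. \<bar>P 1 c t\<bar> \<le> 1 \<and> \<bar>P (-1) c t\<bar> \<le> 1"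
    unfolding I_def
  proof (rule wazewski_strip, fold I_def)
    fix c T e :: real assume a: "c \<in> I" "t1 \<le> T" "0 < e"
    show "\<exists>d>0. \<forall>c'\<in>I. \<bar>c' - c\<bar> < d \<longrightarrow> (\<forall>t\<in>{t1..T}. \<bar>P 1 c' t - P 1 c t\<bar> < e)"
      by (rule cdP[OF a]) simp
    show "\<exists>d>0. \<forall>c'\<in>I. \<bar>c' - c\<bar> < d \<longrightarrow> (\<forall>t\<in>{t1..T}. \<bar>P (-1) c' t - P (-1) c t\<bar> < e)"
      by (rule cdP[OF a]) simp
  next
    fix c assume c: "c \<in> I"
    show "continuous_on {t1..} (P 1 c)" "continuous_on {t1..} (P (-1) c)"
      using dP[OF c] by (auto intro!: continuous_at_imp_continuous_on dest!: DERIV_isCont)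
    show "P 1 c t1 = c" "P (-1) c t1 = 0" using t1 by (simp_all add: P_def init[OF c])
    fix t assume t: "t1 \<le> t"
    have t0: "32 \<le> t" using t t1 by simp
    { assume 1: "\<bar>P 1 c t\<bar> = 1" "\<bar>P (-1) c t\<bar> \<le> 1"
      obtain om P' where om: "1 \<le> om" and P': "(P 1 c has_real_derivative P') (at t)"
        "\<bar>P' - (1 * om * P 1 c t + 16 / t * P 1 c t)\<bar> \<le> 6 / t" using dP[OF c t, of 1] 1 by auto
      have "6 / t < 1" "0 < 16 / t" using t0 by auto
      then show "\<exists>p'. (P 1 c has_real_derivative p') (at t) \<and> 0 < P 1 c t * p'"
        using P' om 1(1) by (intro exI[of _ P']) (auto simp: abs_if split: if_splits)
    }
    { assume 1: "\<bar>P 1 c t\<bar> \<le> 1" "\<bar>P (-1) c t\<bar> = 1"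
      obtain om P' where om: "1 \<le> om" and P': "(P (-1) c has_real_derivative P') (at t)"
        "\<bar>P' - (-1 * om * P (-1) c t + 16 / t * P (-1) c t)\<bar> \<le> 6 / t" using dP[OF c t, of "-1"] 1 by auto
      have "6 / t + 16 / t < 1" using t0 by (simp flip: add_divide_distrib)
      then show "\<exists>q'. (P (-1) c has_real_derivative q') (at t) \<and> P (-1) c t * q' < 0"
        using P' om 1(2) by (intro exI[of _ P']) (auto simp: abs_if split: if_splits)
    }
  qed
  then obtain c where c: "c \<in> I" "\<And>t. t1 \<le> t \<Longrightarrow> \<bar>P 1 c t\<bar> \<le> 1" "\<And>t. t1 \<le> t \<Longrightarrow> \<bar>P (-1) c t\<bar> \<le> 1" by auto
  have "(u c t)\<^sup>2 + (v c t)\<^sup>2 \<le> 1 / t ^ 32" if t: "t1 \<le> t" for t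
  proof -
    have t0: "0 < t ^ 16" using t t1 by auto
    have ab: "\<bar>u c t + v c t\<bar> \<le> 1 / t ^ 16" "\<bar>u c t - v c t\<bar> \<le> 1 / t ^ 16"
      using c(2,3)[OF t] t0 by (simp_all add: P_def abs_mult pos_le_divide_eq mult.commute)
    have "(u c t)\<^sup>2 + (v c t)\<^sup>2 = ((u c t + v c t)\<^sup>2 + (u c t - v c t)\<^sup>2) / 2"
      by (simp add: power2_eq_square algebra_simps)
    also have "\<dots> \<le> ((1 / t ^ 16)\<^sup>2 + (1 / t ^ 16)\<^sup>2) / 2"
      using power_mono[OF ab(1) abs_ge_zero, of 2] power_mono[OF ab(2) abs_ge_zero, of 2] by simp
    also have "\<dots> = 1 / t ^ 32" by (simp add: power_divide flip: power_mult)
    finally show ?thesis .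
  qed
  then show ?thesis using c(1) by blast
qed

section \<open>Linearization at a truncated formal solution\<close>

lemma deviation_algebra:
  fixes Xh Yh a b :: real
  assumes "X = Xh + a" "Y = Yh + b"
  shows "(A - Y * (X\<^sup>2 + Y\<^sup>2 - T) - mu * (S * X + C * Y)) - (A - Yh * (Xh\<^sup>2 + Yh\<^sup>2 - T) - muh * (S * Xh + C * Yh))
     = - (2 * Xh * Yh + muh * S) * a - ((Xh\<^sup>2 + Yh\<^sup>2 - T) + 2 * Yh\<^sup>2 + muh * C) * b
       - (Yh * (a\<^sup>2 + b\<^sup>2) + b * (2 * Xh * a + 2 * Yh * b + a\<^sup>2 + b\<^sup>2)) - (mu - muh) * (S * X + C * Y)"
    and "(B + X * (X\<^sup>2 + Y\<^sup>2 - T) - mu * (C * X - S * Y)) - (B + Xh * (Xh\<^sup>2 + Yh\<^sup>2 - T) - muh * (C * Xh - S * Yh))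
     = ((Xh\<^sup>2 + Yh\<^sup>2 - T) + 2 * Xh\<^sup>2 - muh * C) * a + (2 * Xh * Yh + muh * S) * b
       + (Xh * (a\<^sup>2 + b\<^sup>2) + a * (2 * Xh * a + 2 * Yh * b + a\<^sup>2 + b\<^sup>2)) - (mu - muh) * (C * X - S * Y)"
  unfolding assms by (simp_all add: power2_eq_square algebra_simps)

text \<open>Serves both components: the pair \<open>z\<close>, \<open>c\<close> is
  \<open>Yh\<close>, \<open>b\<close> in the equation for \<open>a\<close> and \<open>Xh\<close>,
  \<open>a\<close> in the equation for \<open>b\<close>.\<close>

lemma nonlinear_bound:
  fixes a b x y z c t :: real
  assumes "1 \<le> t" "\<bar>x\<bar> \<le> t" "\<bar>y\<bar> \<le> t" "\<bar>z\<bar> \<le> t" "\<bar>c\<bar> \<le> 1" "c\<^sup>2 \<le> a\<^sup>2 + b\<^sup>2"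
  shows "\<bar>z * (a\<^sup>2 + b\<^sup>2) + c * (2 * x * a + 2 * y * b + a\<^sup>2 + b\<^sup>2)\<bar> \<le> 8 * t * (a\<^sup>2 + b\<^sup>2)"
proof -
  let ?n = "a\<^sup>2 + b\<^sup>2"
  have ca: "\<bar>c\<bar> * \<bar>w\<bar> \<le> ?n" if "w\<^sup>2 \<le> ?n" for w
  proof -
    have "2 * (\<bar>c\<bar> * \<bar>w\<bar>) \<le> c\<^sup>2 + w\<^sup>2" using sum_squares_bound[of "\<bar>c\<bar>" "\<bar>w\<bar>"] by (simp add: mult.assoc)
    then show ?thesis using that assms(6) by linarith
  qed
  have 1: "\<bar>z * ?n\<bar> \<le> t * ?n" using assms by (simp add: abs_mult mult_right_mono)
  have 2: "\<bar>c * (2 * w * d)\<bar> \<le> 2 * (t * ?n)" if "\<bar>w\<bar> \<le> t" "d\<^sup>2 \<le> ?n" for w d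
  proof -
    have "\<bar>c * (2 * w * d)\<bar> = 2 * (\<bar>w\<bar> * (\<bar>c\<bar> * \<bar>d\<bar>))" by (simp add: abs_mult)
    also have "\<dots> \<le> 2 * (t * ?n)" using assms that by (intro mult_mono ca) auto
    finally show ?thesis .
  qed
  have 3: "\<bar>c * ?n\<bar> \<le> 1 * ?n" unfolding abs_mult using assms by (intro mult_mono) auto
  have 4: "1 * ?n \<le> t * ?n" using assms by (intro mult_right_mono) auto
  have "\<bar>i + j + k + l\<bar> \<le> 8 * T" if "\<bar>i\<bar> \<le> T" "\<bar>j\<bar> \<le> 2 * T" "\<bar>k\<bar> \<le> 2 * T" "\<bar>l\<bar> \<le> N" "N \<le> T" for i j k l T N :: real
    using that by linarith
  from this[OF 1 2[OF assms(2)] 2[OF assms(3)] 3 4, of a b]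
  have "\<bar>z * ?n + c * (2 * x * a) + c * (2 * y * b) + c * ?n\<bar> \<le> 8 * (t * ?n)" by simp
  moreover have "z * ?n + c * (2 * x * a + 2 * y * b + a\<^sup>2 + b\<^sup>2) = z * ?n + c * (2 * x * a) + c * (2 * y * b) + c * ?n"
    by (simp add: algebra_simps)
  ultimately show ?thesis by (simp only: mult.assoc)
qed

text \<open>The deviations \<open>a = X - Xh\<close>, \<open>b = Y - Yh\<close> satisfy \<open>a' = - p a - q b\<close>, \<open>b' = r a + p b\<close> to first order. The
  shift \<open>k = p/r\<close> removes the diagonal, and \<open>P\<close>, \<open>Q\<close> balance the two off-diagonal entries.\<close>

lemma planar_from_deviation:
  fixes X Y Xh Yh k P Q :: "real \<Rightarrow> real" and t lam muh S C :: real
  defines "u \<equiv> \<lambda>t. P t * ((X t - Xh t) + k t * (Y t - Yh t))" and "v \<equiv> \<lambda>t. Q t * (Y t - Yh t)"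
  defines "D \<equiv> (Xh t)\<^sup>2 + (Yh t)\<^sup>2 - lam * t"
  defines "p \<equiv> 2 * Xh t * Yh t + muh * S" and "q \<equiv> D + 2 * (Yh t)\<^sup>2 + muh * C" and "r \<equiv> D + 2 * (Xh t)\<^sup>2 - muh * C"
  assumes dX: "(X has_real_derivative A - Y t * ((X t)\<^sup>2 + (Y t)\<^sup>2 - lam * t) - mu * (S * X t + C * Y t)) (at t)"
    and dY: "(Y has_real_derivative B + X t * ((X t)\<^sup>2 + (Y t)\<^sup>2 - lam * t) - mu * (C * X t - S * Y t)) (at t)"
    and dXh: "(Xh has_real_derivative A - Yh t * D - muh * (S * Xh t + C * Yh t) + R1) (at t)"
    and dYh: "(Yh has_real_derivative B + Xh t * D - muh * (C * Xh t - S * Yh t) + R2) (at t)"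
    and dk: "(k has_real_derivative kd) (at t)"
    and dP: "(P has_real_derivative P t * lP) (at t)" and dQ: "(Q has_real_derivative Q t * lQ) (at t)"
    and kr: "k t * r = p" and rP: "r = (P t)\<^sup>2" and th: "q - k t * p - kd = \<epsilon> * (Q t)\<^sup>2"
    and t: "64 \<le> t" and P: "1 \<le> P t" "P t \<le> t" and Q: "0 < Q t" "Q t \<le> t" "1 \<le> t * (Q t)\<^sup>2" and PQ: "1 \<le> P t * Q t"
    and k1: "\<bar>k t\<bar> \<le> 1" and l: "\<bar>lP\<bar> \<le> 1 / t" "\<bar>lQ\<bar> \<le> 1 / t" and XY: "\<bar>Xh t\<bar> \<le> t" "\<bar>Yh t\<bar> \<le> t"
    and SC: "\<bar>S\<bar> \<le> 1" "\<bar>C\<bar> \<le> 1" and mu: "\<bar>mu - muh\<bar> \<le> 1 / t ^ (L + 4)" and R: "\<bar>R1\<bar> \<le> 1 / t ^ (L + 3)" "\<bar>R2\<bar> \<le> 1 / t ^ (L + 3)"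
  shows "planar_at \<epsilon> L u v t"
proof -
  define a where "a = X t - Xh t"
  define b where "b = Y t - Yh t"
  define e where "e = a + k t * b"
  define N1 where "N1 = - (Yh t * (a\<^sup>2 + b\<^sup>2) + b * (2 * Xh t * a + 2 * Yh t * b + a\<^sup>2 + b\<^sup>2))"
  define N2 where "N2 = Xh t * (a\<^sup>2 + b\<^sup>2) + a * (2 * Xh t * a + 2 * Yh t * b + a\<^sup>2 + b\<^sup>2)"
  define \<rho>1 where "\<rho>1 = - R1 - (mu - muh) * (S * X t + C * Y t)"
  define \<rho>2 where "\<rho>2 = - R2 - (mu - muh) * (C * X t - S * Y t)"
  have XYt: "X t = Xh t + a" "Y t = Yh t + b" by (simp_all add: a_def b_def)
  have da: "((\<lambda>t. X t - Xh t) has_real_derivative - p * a - q * b + N1 + \<rho>1) (at t)"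
  proof (rule DERIV_cong[OF DERIV_diff[OF dX dXh]])
    show "A - Y t * ((X t)\<^sup>2 + (Y t)\<^sup>2 - lam * t) - mu * (S * X t + C * Y t) - (A - Yh t * D - muh * (S * Xh t + C * Yh t) + R1)
       = - p * a - q * b + N1 + \<rho>1"
      using deviation_algebra(1)[OF XYt, of A "lam * t" mu S C muh] unfolding D_def p_def q_def N1_def \<rho>1_def by linarith
  qed
  have db: "((\<lambda>t. Y t - Yh t) has_real_derivative r * a + p * b + N2 + \<rho>2) (at t)"
  proof (rule DERIV_cong[OF DERIV_diff[OF dY dYh]])
    show "B + X t * ((X t)\<^sup>2 + (Y t)\<^sup>2 - lam * t) - mu * (C * X t - S * Y t) - (B + Xh t * D - muh * (C * Xh t - S * Yh t) + R2)
       = r * a + p * b + N2 + \<rho>2"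
      using deviation_algebra(2)[OF XYt, of B "lam * t" mu C S muh] unfolding D_def p_def r_def N2_def \<rho>2_def by linarith
  qed
  define g1 where "g1 = N1 + \<rho>1 + k t * (N2 + \<rho>2)"
  define g2 where "g2 = N2 + \<rho>2"
  have db': "((\<lambda>t. Y t - Yh t) has_real_derivative r * e + g2) (at t)"
    by (rule DERIV_cong[OF db]) (simp add: e_def g2_def kr[symmetric] algebra_simps)
  \<comment> \<open>In \<open>e = a + k * b\<close> the terms with \<open>a\<close> cancel because
    \<open>k * r = p\<close>, and \<open>b\<close> keeps the coefficient
    \<open>- (q - k * p - kd)\<close>. As \<open>P\<^sup>2 = r\<close> and
    \<open>\<epsilon> * Q\<^sup>2 = q - k * p - kd\<close>, the scaled components share the
    frequency \<open>P * Q\<close>.\<close>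
  have de: "((\<lambda>t. (X t - Xh t) + k t * (Y t - Yh t)) has_real_derivative - (\<epsilon> * (Q t)\<^sup>2) * b + g1) (at t)"
  proof (rule DERIV_cong[OF DERIV_add[OF da DERIV_mult[OF dk db]]])
    have "- p * a - q * b + N1 + \<rho>1 + (kd * (Y t - Yh t) + (r * a + p * b + N2 + \<rho>2) * k t)
       = (k t * r - p) * a - (q - k t * p - kd) * b + g1"
      unfolding g1_def b_def[symmetric] by (simp add: algebra_simps)
    then show "- p * a - q * b + N1 + \<rho>1 + (kd * (Y t - Yh t) + (r * a + p * b + N2 + \<rho>2) * k t) = - (\<epsilon> * (Q t)\<^sup>2) * b + g1"
      unfolding kr th by simp
  qed
  have ut: "u t = P t * e" and vt: "v t = Q t * b" by (simp_all add: u_def v_def e_def a_def b_def)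
  have du: "(u has_real_derivative - \<epsilon> * (P t * Q t) * v t + (lP * u t + P t * g1)) (at t)"
    unfolding u_def
    by (rule DERIV_cong[OF DERIV_mult[OF dP de]])
       (simp add: v_def e_def a_def b_def power2_eq_square algebra_simps)
  have dv: "(v has_real_derivative (P t * Q t) * u t + (lQ * v t + Q t * g2)) (at t)"
    unfolding v_def
    by (rule DERIV_cong[OF DERIV_mult[OF dQ db']])
       (simp add: ut rP power2_eq_square algebra_simps)
  \<comment> \<open>The scale \<open>Q\<close> may be as small as t^(-1/2), so undoing it costs a
    factor \<open>t\<close> in the squares: \<open>a\<^sup>2 + b\<^sup>2\<close> is at most
    \<open>3 * t\<close> times the energy. The narrow tube makes this at most 1, whence the
    quadratic bound on the nonlinear terms. Finally \<open>64 \<le> t\<close> absorbs the constants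
    48 and 10 into spare powers of \<open>t\<close>.\<close>
  have bounds: "P t * \<bar>g1\<bar> \<le> t ^ 5 * ((u t)\<^sup>2 + (v t)\<^sup>2) + 1 / t ^ L" "Q t * \<bar>g2\<bar> \<le> t ^ 5 * ((u t)\<^sup>2 + (v t)\<^sup>2) + 1 / t ^ L"
    if E: "(u t)\<^sup>2 + (v t)\<^sup>2 \<le> 1 / t ^ 20"
  proof -
    let ?E = "(u t)\<^sup>2 + (v t)\<^sup>2"
    have E0: "0 \<le> ?E" by simp
    have e2: "e\<^sup>2 \<le> (u t)\<^sup>2"
    proof -
      have "1\<^sup>2 * e\<^sup>2 \<le> (P t)\<^sup>2 * e\<^sup>2" using P by (intro mult_right_mono power_mono) auto
      then show ?thesis by (simp add: ut power_mult_distrib)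
    qed
    have b2: "b\<^sup>2 \<le> t * (v t)\<^sup>2"
      using mult_right_mono[OF Q(3), of "b\<^sup>2"] by (simp add: vt power_mult_distrib mult.assoc)
    have a2: "a\<^sup>2 \<le> 2 * e\<^sup>2 + 2 * b\<^sup>2"
    proof -
      have "a\<^sup>2 \<le> 2 * e\<^sup>2 + 2 * (k t * b)\<^sup>2"
      proof -
        have "0 \<le> (e + k t * b)\<^sup>2" by simp
        moreover have "2 * e\<^sup>2 + 2 * (k t * b)\<^sup>2 - a\<^sup>2 = (e + k t * b)\<^sup>2"
          unfolding e_def by (simp add: power2_eq_square algebra_simps)
        ultimately show ?thesis by linarith
      qed
      moreover have "(k t * b)\<^sup>2 \<le> b\<^sup>2"
        using mult_right_mono[of "(k t)\<^sup>2" 1 "b\<^sup>2"] k1 by (simp add: power_mult_distrib abs_square_le_1)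
      ultimately show ?thesis by linarith
    qed
    have n: "a\<^sup>2 + b\<^sup>2 \<le> 3 * t * ?E"
    proof -
      have "e\<^sup>2 \<le> t * (u t)\<^sup>2" using e2 mult_right_mono[of 1 t "(u t)\<^sup>2"] t by simp
      then have "a\<^sup>2 + b\<^sup>2 \<le> 2 * (t * (u t)\<^sup>2) + 3 * (t * (v t)\<^sup>2)" using a2 b2 by linarith
      also have "\<dots> \<le> 3 * (t * (u t)\<^sup>2) + 3 * (t * (v t)\<^sup>2)" using t by simp
      finally show ?thesis by (simp add: algebra_simps)
    qed
    have n1: "a\<^sup>2 + b\<^sup>2 \<le> 1"
    proof -
      have "3 * t * ?E \<le> 3 * t * (1 / t ^ 20)" using E t by (intro mult_left_mono) auto
      also have "\<dots> = 3 / t ^ 19" using t by (simp add: power_numeral_reduce)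
      also have "\<dots> \<le> 3 / t ^ 1" using power_quotient_le[of t 1 19] t by simp
      also have "\<dots> \<le> 1" using t by simp
      finally show ?thesis using n by linarith
    qed
    have ab1: "\<bar>a\<bar> \<le> 1" "\<bar>b\<bar> \<le> 1"
      using n1 by (auto simp: abs_square_le_1[symmetric] intro: order_trans[rotated])
    have t1: "1 \<le> t" using t by simp
    have N: "\<bar>N1\<bar> \<le> 8 * t * (a\<^sup>2 + b\<^sup>2)" "\<bar>N2\<bar> \<le> 8 * t * (a\<^sup>2 + b\<^sup>2)"
      unfolding N1_def N2_def abs_minus_cancel
      by (rule nonlinear_bound[OF t1 XY _ ab1(2)], use XY in auto)
         (rule nonlinear_bound[OF t1 XY _ ab1(1)], use XY in auto)
    have N': "8 * t * (a\<^sup>2 + b\<^sup>2) \<le> 24 * t\<^sup>2 * ?E"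
      using mult_left_mono[OF n, of "8 * t"] t by (simp add: power2_eq_square mult_ac)
    have XYb: "\<bar>X t\<bar> \<le> 2 * t" "\<bar>Y t\<bar> \<le> 2 * t" using XYt ab1 XY t by auto
    have "\<bar>S * X t\<bar> \<le> 1 * (2 * t)" "\<bar>C * Y t\<bar> \<le> 1 * (2 * t)" "\<bar>C * X t\<bar> \<le> 1 * (2 * t)" "\<bar>S * Y t\<bar> \<le> 1 * (2 * t)"
      unfolding abs_mult using SC XYb by (intro mult_mono; simp)+
    then have sc: "\<bar>S * X t + C * Y t\<bar> \<le> 4 * t" "\<bar>C * X t - S * Y t\<bar> \<le> 4 * t" by linarith+
    have m4: "1 / t ^ (L + 4) * (4 * t) = 4 / t ^ (L + 3)" using t by (simp add: power_add power_numeral_reduce)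
    have "\<bar>(mu - muh) * (S * X t + C * Y t)\<bar> \<le> 1 / t ^ (L + 4) * (4 * t)" "\<bar>(mu - muh) * (C * X t - S * Y t)\<bar> \<le> 1 / t ^ (L + 4) * (4 * t)"
      unfolding abs_mult using sc mu t by (intro mult_mono; simp)+
    then have \<rho>: "\<bar>\<rho>1\<bar> \<le> 5 / t ^ (L + 3)" "\<bar>\<rho>2\<bar> \<le> 5 / t ^ (L + 3)"
      using R unfolding m4 \<rho>1_def \<rho>2_def by (simp_all add: abs_le_iff)
    have kk: "\<bar>k t * (N2 + \<rho>2)\<bar> \<le> \<bar>N2\<bar> + \<bar>\<rho>2\<bar>"
    proof -
      have "\<bar>k t * (N2 + \<rho>2)\<bar> \<le> 1 * \<bar>N2 + \<rho>2\<bar>" unfolding abs_mult using k1 by (intro mult_right_mono) auto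
      also have "\<dots> \<le> \<bar>N2\<bar> + \<bar>\<rho>2\<bar>" using abs_triangle_ineq[of N2 \<rho>2] by simp
      finally show ?thesis .
    qed
    let ?G = "48 * t\<^sup>2 * ?E + 10 / t ^ (L + 3)"
    have g: "\<bar>g1\<bar> \<le> ?G" "\<bar>g2\<bar> \<le> ?G"
    proof -
      have five: "10 / t ^ (L + 3) = 5 / t ^ (L + 3) + 5 / t ^ (L + 3)" by simp
      have pos: "0 \<le> 5 / t ^ (L + 3)" "0 \<le> 24 * t\<^sup>2 * ?E" using t by auto
      have "\<bar>g1\<bar> \<le> \<bar>N1\<bar> + \<bar>\<rho>1\<bar> + \<bar>k t * (N2 + \<rho>2)\<bar>" unfolding g1_def by linarith
      then show "\<bar>g1\<bar> \<le> ?G" using N N' \<rho> kk unfolding five by linarith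
      show "\<bar>g2\<bar> \<le> ?G" using N N' \<rho> pos unfolding five g2_def by linarith
    qed
    have G: "t * ?G \<le> t ^ 5 * ?E + 1 / t ^ L"
    proof -
      have "t * ?G = (48 * t ^ 3) * ?E + 10 / t ^ (L + 2)" using t
        by (simp add: algebra_simps power_add power_numeral_reduce)
      also have "\<dots> \<le> t ^ 5 * ?E + 1 / t ^ L"
      proof (intro add_mono mult_right_mono)
        have "48 * t ^ 3 \<le> t * t ^ 3" using t by (intro mult_right_mono) auto
        also have "\<dots> \<le> t * t * t ^ 3" using t by (simp add: mult.assoc)
        finally show "48 * t ^ 3 \<le> t ^ 5" by (simp add: power_numeral_reduce)
        have "10 / t ^ (L + 2) = (10 / t\<^sup>2) / t ^ L" by (simp add: power_add power2_eq_square)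
        also have "\<dots> \<le> 1 / t ^ L"
        proof (intro divide_right_mono)
          have "64 * 1 \<le> t * t" using t by (intro mult_mono) auto
          then show "10 / t\<^sup>2 \<le> 1" using t by (simp add: power2_eq_square)
        qed (use t in auto)
        finally show "10 / t ^ (L + 2) \<le> 1 / t ^ L" .
      qed simp
      finally show ?thesis .
    qed
    have "P t * \<bar>g1\<bar> \<le> t * ?G" "Q t * \<bar>g2\<bar> \<le> t * ?G" using g P Q t by (auto intro!: mult_mono)
    then show "P t * \<bar>g1\<bar> \<le> t ^ 5 * ?E + 1 / t ^ L" "Q t * \<bar>g2\<bar> \<le> t ^ 5 * ?E + 1 / t ^ L" using G by linarith+
  qed
  have lin: "\<bar>lP * u t + P t * g1\<bar> \<le> \<bar>u t\<bar> / t + P t * \<bar>g1\<bar>" "\<bar>lQ * v t + Q t * g2\<bar> \<le> \<bar>v t\<bar> / t + Q t * \<bar>g2\<bar>"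
  proof -
    have "\<bar>lP * u t\<bar> \<le> 1 / t * \<bar>u t\<bar>" "\<bar>lQ * v t\<bar> \<le> 1 / t * \<bar>v t\<bar>" unfolding abs_mult using l by (intro mult_right_mono; simp)+
    moreover have "\<bar>P t * g1\<bar> = P t * \<bar>g1\<bar>" "\<bar>Q t * g2\<bar> = Q t * \<bar>g2\<bar>" using P Q by (auto simp: abs_mult)
    ultimately show "\<bar>lP * u t + P t * g1\<bar> \<le> \<bar>u t\<bar> / t + P t * \<bar>g1\<bar>" "\<bar>lQ * v t + Q t * g2\<bar> \<le> \<bar>v t\<bar> / t + Q t * \<bar>g2\<bar>"
      using abs_triangle_ineq[of "lP * u t" "P t * g1"] abs_triangle_ineq[of "lQ * v t" "Q t * g2"] by simp_all
  qed
  show ?thesis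
    unfolding planar_at_def
  proof (rule exI[of _ "P t * Q t"], rule exI[of _ "lP * u t + P t * g1"], rule exI[of _ "lQ * v t + Q t * g2"], intro conjI impI)
    assume E: "(u t)\<^sup>2 + (v t)\<^sup>2 \<le> 1 / t ^ 20"
    show "\<bar>lP * u t + P t * g1\<bar> \<le> \<bar>u t\<bar> / t + t ^ 5 * ((u t)\<^sup>2 + (v t)\<^sup>2) + 1 / t ^ L"
      "\<bar>lQ * v t + Q t * g2\<bar> \<le> \<bar>v t\<bar> / t + t ^ 5 * ((u t)\<^sup>2 + (v t)\<^sup>2) + 1 / t ^ L"
      using order_trans[OF lin(1) add_left_mono[OF bounds(1)[OF E]]] order_trans[OF lin(2) add_left_mono[OF bounds(2)[OF E]]]
      by (simp_all add: add.assoc)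
  qed (use du dv PQ in auto)
qed

text \<open>Every amplitude below is a product of powers of \<open>\<tau>\<close> and of values of
  polynomials, so that its relative rate of change is read off factor by factor.\<close>

definition log_deriv :: "(real \<Rightarrow> real) \<Rightarrow> real \<Rightarrow> real \<Rightarrow> bool" where
  "log_deriv f l t \<longleftrightarrow> (f has_real_derivative f t * l) (at t)"

lemma log_deriv_mult: "log_deriv f l t \<Longrightarrow> log_deriv g k t \<Longrightarrow> log_deriv (\<lambda>t. f t * g t) (l + k) t"
  unfolding log_deriv_def by (rule DERIV_cong[OF DERIV_mult], assumption, assumption) (simp add: algebra_simps)

lemma log_deriv_inverse: "log_deriv f l t \<Longrightarrow> f t \<noteq> 0 \<Longrightarrow> log_deriv (\<lambda>t. inverse (f t)) (- l) t"
  unfolding log_deriv_def by (rule DERIV_cong[OF DERIV_inverse'], assumption, assumption) (simp add: field_simps)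

lemma log_deriv_power: "log_deriv f l t \<Longrightarrow> log_deriv (\<lambda>t. f t ^ n) (n * l) t"
proof (induction n)
  case 0
  show ?case by (simp add: log_deriv_def)
next
  case (Suc n)
  from log_deriv_mult[OF Suc.prems Suc.IH[OF Suc.prems]] show ?case by (simp add: algebra_simps)
qed

lemma log_deriv_ident: "t \<noteq> 0 \<Longrightarrow> log_deriv (\<lambda>t. t) (1 / t) t"
  unfolding log_deriv_def by simp

lemma log_deriv_sqrt: "log_deriv f l t \<Longrightarrow> 0 < f t \<Longrightarrow> log_deriv (\<lambda>t. sqrt (f t)) (l / 2) t"
  unfolding log_deriv_def
  by (rule DERIV_cong[OF DERIV_chain2[OF DERIV_real_sqrt]], assumption, assumption) (simp add: field_simps)

lemma log_deriv_poly:
  assumes "log_deriv f l t" "poly p (f t) \<noteq> 0"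
  shows "log_deriv (\<lambda>t. poly p (f t)) (poly (pderiv p) (f t) * f t * l / poly p (f t)) t"
  using assms unfolding log_deriv_def
  by (intro DERIV_cong[OF DERIV_chain2[OF poly_DERIV]]) auto

lemma agree_truncate: "agree K (fps_of_poly (truncate_fps K F)) F"
  by (simp add: agree_def coeff_truncate_fps)

lemma agree_zero_dvd:
  fixes p :: "real poly"
  assumes "agree K (fps_of_poly p) 0"
  shows "\<exists>q. p = monom 1 K * q"
  using assms monom_1_dvd_iff'[of K p] by (auto simp: agree_def elim: dvdE)

text \<open>In the application \<open>A\<close>, \<open>B\<close> are sine and cosine of \<sigma>,
  \<open>S\<close>, \<open>C\<close> those of 2 \<sigma> + \<nu>, and \<open>M\<close> is the series
  of \<open>\<mu> / s ^ m\<close>. As \<open>s ^ (2 * m) = 1 / t\<close>, truncation at index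
  \<open>2 * m * (L + 5)\<close> leaves errors of relative size t^-(L+5); the surplus over
  \<open>L\<close> pays for the powers of \<open>t\<close> lost in the linearization. The
  determinant may vanish to order \<open>m - 1\<close>, but no further because
  \<open>\<Delta> \<noteq> 0\<close>.\<close>

locale expansion =
  fixes m :: nat and lam A B S C \<Delta> :: real and \<mu> :: "real \<Rightarrow> real" and M x y D :: "real fps"
  assumes m: "0 < m" and lam: "0 < lam" and fs: "formal_sol m lam A B S C M x y D"
    and x0: "fps_nth x 0 = sqrt lam" and y0: "fps_nth y 0 = 0"
    and lead: "leading (m - 1) \<Delta> (char_series m lam S C M x y D)" and \<Delta>: "\<Delta> \<noteq> 0"
    and SC: "\<bar>S\<bar> \<le> 1" "\<bar>C\<bar> \<le> 1"
    and mu: "\<And>L. \<exists>T\<ge>1. \<forall>t\<ge>T. \<bar>\<mu> t - (t powr (- 1 / (2 * real m))) ^ m * poly (truncate_fps (2 * m * (L + 5)) M) (t powr (- 1 / (2 * real m)))\<bar> \<le> 1 / t ^ (L + 4)"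
begin

section \<open>The scale variable and polynomials in it\<close>

definition s :: "real \<Rightarrow> real" where "s t = t powr (- 1 / (2 * real m))"

lemma s_pos: "0 < t \<Longrightarrow> 0 < s t"
  by (simp add: s_def)

lemma s_power: "0 < t \<Longrightarrow> s t ^ (2 * m) = 1 / t"
  using m by (simp add: s_def powr_power)

lemma s_power_m: "0 < t \<Longrightarrow> s t ^ m * s t ^ m = 1 / t"
  using s_power[of t] by (simp add: mult_2 power_add)

lemma s_tendsto: "(s \<longlongrightarrow> 0) at_top"
  unfolding s_def using m by (intro tendsto_neg_powr filterlim_ident) (simp add: divide_neg_pos)

lemma log_deriv_s: "0 < t \<Longrightarrow> log_deriv s (- 1 / (2 * real m * t)) t"
  unfolding s_def log_deriv_def using m
  by (intro DERIV_cong[OF has_real_derivative_powr]) (auto simp: powr_diff)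

lemma poly_s_tendsto: "((\<lambda>t. poly p (s t)) \<longlongrightarrow> poly p 0) at_top"
  for p :: "real poly"
  by (rule isCont_tendsto_compose[OF poly_isCont s_tendsto])

lemma ev_poly_less: "poly p 0 < c \<Longrightarrow> \<forall>\<^sub>F t in at_top. poly p (s t) < c" for p :: "real poly"
  using order_tendstoD(2)[OF poly_s_tendsto] .

lemma ev_poly_greater: "c < poly p 0 \<Longrightarrow> \<forall>\<^sub>F t in at_top. c < poly p (s t)" for p :: "real poly"
  using order_tendstoD(1)[OF poly_s_tendsto] .

lemma ev_poly_bound: "\<forall>\<^sub>F t in at_top. \<bar>poly p (s t)\<bar> \<le> \<bar>poly p 0\<bar> + 1"
  for p :: "real poly"
proof -
  have "\<forall>\<^sub>F t in at_top. poly p (s t) < \<bar>poly p 0\<bar> + 1" by (rule ev_poly_less) simp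
  moreover have "\<forall>\<^sub>F t in at_top. - (\<bar>poly p 0\<bar> + 1) < poly p (s t)" by (rule ev_poly_greater) simp
  ultimately show ?thesis by eventually_elim auto
qed

text \<open>The relative rate of \<open>poly p (s t)\<close> is a multiple of \<open>1 / t\<close>
  times \<open>s\<close> times the logarithmic derivative of \<open>p\<close>, and the latter
  product tends to 0 with \<open>s\<close>.\<close>

lemma ev_poly_rate:
  fixes p :: "real poly"
  assumes "poly p 0 \<noteq> 0"
  shows "\<forall>\<^sub>F t in at_top. \<bar>poly (pderiv p) (s t) * s t * (- 1 / (2 * real m * t)) / poly p (s t)\<bar> \<le> 1 / (4 * t)"
proof -
  have "((\<lambda>t. poly ([:0, 1:] * pderiv p) (s t) / poly p (s t)) \<longlongrightarrow> poly ([:0, 1:] * pderiv p) 0 / poly p 0) at_top"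
    by (intro tendsto_divide poly_s_tendsto assms)
  then have "((\<lambda>t. \<bar>poly ([:0, 1:] * pderiv p) (s t) / poly p (s t)\<bar>) \<longlongrightarrow> 0) at_top"
    by (intro tendsto_rabs_zero) simp
  then have "\<forall>\<^sub>F t in at_top. \<bar>poly ([:0, 1:] * pderiv p) (s t) / poly p (s t)\<bar> < 1/4"
    by (rule order_tendstoD(2)) simp
  then show ?thesis
    using eventually_gt_at_top[of 0]
  proof eventually_elim
    case (elim t)
    have "\<bar>poly (pderiv p) (s t) * s t * (- 1 / (2 * real m * t)) / poly p (s t)\<bar>
       = \<bar>poly ([:0, 1:] * pderiv p) (s t) / poly p (s t)\<bar> * (1 / (2 * real m * t))"
      using elim by (simp add: abs_mult field_simps)
    also have "\<dots> \<le> (1/4) * (1 / t)"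
      using elim m by (intro mult_mono) (auto intro!: divide_left_mono simp: mult_le_cancel_right1)
    finally show ?case by simp
  qed
qed

text \<open>\<open>dp\<close>, \<open>ph\<close>, \<open>qh\<close> and \<open>rh\<close> below are
  \<open>D\<close>, \<open>p\<close>, \<open>q\<close> and \<open>r\<close> of the linearization
  divided by \<open>t\<close>. The powers \<open>3 * m\<close> arise from
  \<open>s ^ m = t * s ^ (3 * m)\<close>. \<open>dp\<close> is formed from the truncated
  \<open>x\<close> and \<open>y\<close> rather than by truncating the series \<open>D\<close>, so
  that it matches the modulus of the approximate solution exactly.\<close>

definition xp where "xp K = truncate_fps K x"
definition yp where "yp K = truncate_fps K y"
definition Mp where "Mp K = truncate_fps K M"
definition dp where "dp K = xp K * xp K + yp K * yp K - [:lam:]"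
definition ph where "ph K = 2 * xp K * yp K + monom 1 (3 * m) * Mp K * [:S:]"
definition qh where "qh K = dp K + 2 * (yp K * yp K) + monom 1 (3 * m) * Mp K * [:C:]"
definition rh where "rh K = dp K + 2 * (xp K * xp K) - monom 1 (3 * m) * Mp K * [:C:]"

lemma agree_xyM: "agree K (fps_of_poly (xp K)) x" "agree K (fps_of_poly (yp K)) y" "agree K (fps_of_poly (Mp K)) M"
  unfolding xp_def yp_def Mp_def by (rule agree_truncate)+

lemma agree_eq: "agree n f h \<Longrightarrow> h = g \<Longrightarrow> agree n f g" by simp

text \<open>These are the formal equations multiplied by \<open>fps_X ^ (3 * m)\<close>. Then
  \<open>fps_X ^ (3 * m) * D\<close> can be replaced by \<open>x * x + y * y - lam\<close>, so that
  only \<open>x\<close>, \<open>y\<close> and \<open>M\<close> have to be truncated, and the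
  identities survive modulo \<open>fps_X ^ K\<close>.\<close>

lemma residual_polys:
  "\<exists>q. monom 1 (4 * m) * ([:1/2:] * xp K - [:1 / (2 * real m):] * ([:0, 1:] * pderiv (xp K))) - monom 1 (3 * m) * [:A:]
     + yp K * dp K + monom 1 (3 * m) * (Mp K * ([:S:] * xp K + [:C:] * yp K)) = monom 1 K * q"
  "\<exists>q. monom 1 (4 * m) * ([:1/2:] * yp K - [:1 / (2 * real m):] * ([:0, 1:] * pderiv (yp K))) - monom 1 (3 * m) * [:B:]
     - xp K * dp K + monom 1 (3 * m) * (Mp K * ([:C:] * xp K - [:S:] * yp K)) = monom 1 K * q"
proof -
  have four: "(fps_X :: real fps) ^ (4 * m) = fps_X ^ (3 * m) * fps_X ^ m"
    by (simp flip: power_add add: mult.commute[of m])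
  note E3 = fs[unfolded formal_sol_def, THEN conjunct1] and E1 = fs[unfolded formal_sol_def, THEN conjunct2, THEN conjunct1]
    and E2 = fs[unfolded formal_sol_def, THEN conjunct2, THEN conjunct2]
  have d: "x * x + y * y - fps_const lam = fps_X ^ (3 * m) * D" unfolding E3 by simp
  have X: "fps_of_poly [:0, 1:] = fps_X" by simp
  have z1: "fps_X ^ (4 * m) * (fps_const (1/2) * x - fps_const (1 / (2 * real m)) * (fps_X * fps_deriv x)) - fps_X ^ (3 * m) * fps_const A
      + y * (x * x + y * y - fps_const lam) + fps_X ^ (3 * m) * (M * (fps_const S * x + fps_const C * y)) = 0"
    unfolding four d mult.assoc[of "fps_X ^ (3 * m)" "fps_X ^ m"] E1 by (simp add: algebra_simps)
  have z2: "fps_X ^ (4 * m) * (fps_const (1/2) * y - fps_const (1 / (2 * real m)) * (fps_X * fps_deriv y)) - fps_X ^ (3 * m) * fps_const B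
      - x * (x * x + y * y - fps_const lam) + fps_X ^ (3 * m) * (M * (fps_const C * x - fps_const S * y)) = 0"
    unfolding four d mult.assoc[of "fps_X ^ (3 * m)" "fps_X ^ m"] E2 by (simp add: algebra_simps)
  show "\<exists>q. monom 1 (4 * m) * ([:1/2:] * xp K - [:1 / (2 * real m):] * ([:0, 1:] * pderiv (xp K))) - monom 1 (3 * m) * [:A:]
     + yp K * dp K + monom 1 (3 * m) * (Mp K * ([:S:] * xp K + [:C:] * yp K)) = monom 1 K * q"
    unfolding dp_def
    by (rule agree_zero_dvd, rule agree_eq[OF _ z1],
        simp only: fps_of_poly_mult fps_of_poly_add fps_of_poly_diff fps_of_poly_monom' fps_of_poly_const fps_of_poly_pderiv X)
       (intro agree_add agree_diff agree_euler agree_mult[OF agree_refl agree_euler] agree_mult agree_refl agree_xyM)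
  show "\<exists>q. monom 1 (4 * m) * ([:1/2:] * yp K - [:1 / (2 * real m):] * ([:0, 1:] * pderiv (yp K))) - monom 1 (3 * m) * [:B:]
     - xp K * dp K + monom 1 (3 * m) * (Mp K * ([:C:] * xp K - [:S:] * yp K)) = monom 1 K * q"
    unfolding dp_def
    by (rule agree_zero_dvd, rule agree_eq[OF _ z2],
        simp only: fps_of_poly_mult fps_of_poly_add fps_of_poly_diff fps_of_poly_monom' fps_of_poly_const fps_of_poly_pderiv X)
       (intro agree_add agree_diff agree_euler agree_mult[OF agree_refl agree_euler] agree_mult agree_refl agree_xyM)
qed

text \<open>The determinant \<open>r * q - p * p\<close> is \<open>fps_X ^ (3 * m)\<close> times
  \<open>char_series\<close> modulo \<open>fps_X ^ K\<close>. Its first nonzero coefficient has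
  index \<open>3 * m + (m - 1)\<close>, which \<open>4 * m \<le> K\<close> leaves intact.\<close>

lemma char_poly:
  assumes K: "4 * m \<le> K"
  shows "\<exists>q. rh K * qh K - ph K * ph K = monom 1 (4 * m - 1) * q \<and> poly q 0 = \<Delta>"
proof -
  note E3 = fs[unfolded formal_sol_def, THEN conjunct1]
  let ?d = "x * x + y * y - fps_const lam" and ?P = "fps_X ^ (3 * m) :: real fps"
  have d: "?d = ?P * D" unfolding E3 by simp
  have "agree K (fps_of_poly (rh K * qh K - ph K * ph K))
     ((?d + 2 * (x * x) - ?P * M * fps_const C) * (?d + 2 * (y * y) + ?P * M * fps_const C)
       - (2 * x * y + ?P * M * fps_const S) * (2 * x * y + ?P * M * fps_const S))"
    unfolding rh_def qh_def ph_def dp_def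
    by (simp only: fps_of_poly_mult fps_of_poly_add fps_of_poly_diff fps_of_poly_monom' fps_of_poly_const fps_of_poly_numeral)
       (intro agree_add agree_diff agree_mult agree_refl agree_xyM)
  also have "(?d + 2 * (x * x) - ?P * M * fps_const C) * (?d + 2 * (y * y) + ?P * M * fps_const C)
       - (2 * x * y + ?P * M * fps_const S) * (2 * x * y + ?P * M * fps_const S)
     = ?P * char_series m lam S C M x y D"
  proof -
    have "(e + 2 * (a * a) - P * N * c) * (e + 2 * (b * b) + P * N * c) - (2 * a * b + P * N * g) * (2 * a * b + P * N * g)
      = e * e + 2 * e * (a * a + b * b) + 2 * P * N * (c * (a * a - b * b) - 2 * g * a * b) - P * N * (P * N) * (c * c + g * g)"
      for e a b P N c g :: "real fps"
      by (simp add: algebra_simps)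
    note this[of ?d x ?P M "fps_const C" y "fps_const S"]
    also have "x * x + y * y = fps_const lam + ?P * D" by (rule E3)
    finally show ?thesis unfolding d char_series_def by (simp add: algebra_simps)
  qed
  finally have ag: "agree K (fps_of_poly (rh K * qh K - ph K * ph K)) (?P * char_series m lam S C M x y D)" .
  have coeff: "coeff (rh K * qh K - ph K * ph K) k = (if k < 3 * m then 0 else fps_nth (char_series m lam S C M x y D) (k - 3 * m))" if "k < 4 * m" for k
    using ag that K by (simp add: agree_def fps_X_power_mult_nth)
  have "agree (4 * m - 1) (fps_of_poly (rh K * qh K - ph K * ph K)) 0"
    unfolding agree_def fps_of_poly_nth
  proof (intro allI impI)
    fix k assume k: "k < 4 * m - 1"
    then have "k < 4 * m" by simp
    then show "coeff (rh K * qh K - ph K * ph K) k = fps_nth 0 k"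
      using k lead unfolding coeff[OF \<open>k < 4 * m\<close>] by (auto simp: leading_def)
  qed
  from agree_zero_dvd[OF this] obtain q where q: "rh K * qh K - ph K * ph K = monom 1 (4 * m - 1) * q" by blast
  have "coeff (rh K * qh K - ph K * ph K) (4 * m - 1) = coeff q 0" unfolding q by (simp add: coeff_monom_mult)
  moreover have "coeff (rh K * qh K - ph K * ph K) (4 * m - 1) = \<Delta>"
    using coeff[of "4 * m - 1"] m lead by (simp add: leading_def)
  ultimately show ?thesis using q by (auto simp: poly_0_coeff_0)
qed

lemma poly_at_0:
  assumes "0 < K"
  shows "poly (rh K) 0 = 2 * lam" "poly (ph K) 0 = 0"
proof -
  have "poly (xp K) 0 = sqrt lam" "poly (yp K) 0 = 0"
    using assms x0 y0 by (simp_all add: xp_def yp_def poly_0_coeff_0 coeff_truncate_fps)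
  then show "poly (rh K) 0 = 2 * lam" "poly (ph K) 0 = 0"
    using m lam by (simp_all add: rh_def ph_def dp_def poly_monom power_0_left)
qed

definition Xh where "Xh K t = poly (xp K) (s t) * inverse (s t ^ m)"
definition Yh where "Yh K t = poly (yp K) (s t) * inverse (s t ^ m)"

definition rates :: "(real \<Rightarrow> real) \<Rightarrow> (real \<Rightarrow> real) \<Rightarrow> real \<Rightarrow> bool" where
  "rates X Y t \<longleftrightarrow>
     (X has_real_derivative A - Y t * ((X t)\<^sup>2 + (Y t)\<^sup>2 - lam * t) - \<mu> t * (S * X t + C * Y t)) (at t) \<and>
     (Y has_real_derivative B + X t * ((X t)\<^sup>2 + (Y t)\<^sup>2 - lam * t) - \<mu> t * (C * X t - S * Y t)) (at t)"

lemma DERIV_poly_s: "0 < t \<Longrightarrow> ((\<lambda>t. poly p (s t)) has_real_derivative poly (pderiv p) (s t) * (s t * (- 1 / (2 * real m * t)))) (at t)"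
  using log_deriv_s[of t] unfolding log_deriv_def by (intro DERIV_chain2[OF poly_DERIV])

text \<open>Since \<open>inverse (s ^ m) / t = s ^ m\<close>, the derivative takes the shape of the
  left-hand sides in \<open>formal_sol\<close>.\<close>

lemma DERIV_scaled:
  assumes t: "0 < t"
  shows "((\<lambda>t. poly p (s t) * inverse (s t ^ m)) has_real_derivative
    s t ^ m * (1/2 * poly p (s t) - 1 / (2 * real m) * (s t * poly (pderiv p) (s t)))) (at t)"
proof -
  have "log_deriv (\<lambda>t. inverse (s t ^ m)) (- (m * (- 1 / (2 * real m * t)))) t"
    using s_pos[OF t] by (intro log_deriv_inverse log_deriv_power log_deriv_s t) auto
  then have "((\<lambda>t. inverse (s t ^ m)) has_real_derivative inverse (s t ^ m) * (1 / (2 * t))) (at t)"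
    using m by (simp add: log_deriv_def)
  from DERIV_mult[OF DERIV_poly_s[OF t] this]
  show ?thesis
  proof (rule DERIV_cong)
    have i: "inverse (s t ^ m) * (1 / t) = s t ^ m"
      unfolding s_power_m[OF t, symmetric] using s_pos[OF t] by simp
    have "poly (pderiv p) (s t) * (s t * (- 1 / (2 * real m * t))) * inverse (s t ^ m) + inverse (s t ^ m) * (1 / (2 * t)) * poly p (s t)
       = (inverse (s t ^ m) * (1 / t)) * (1/2 * poly p (s t) - 1 / (2 * real m) * (s t * poly (pderiv p) (s t)))"
    proof -
      have "- 1 / (2 * real m * t) = - ((1 / t) * (1 / (2 * real m)))" "1 / (2 * t) = (1 / t) * (1/2)" by simp_all
      moreover have "d * (w * - (j * h)) * g + g * (j * (1/2)) * v = (g * j) * (1/2 * v - h * (w * d))" for d w j h g v :: real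
        by (simp add: algebra_simps)
      ultimately show ?thesis by (simp only:)
    qed
    then show "poly (pderiv p) (s t) * (s t * (- 1 / (2 * real m * t))) * inverse (s t ^ m) + inverse (s t ^ m) * (1 / (2 * t)) * poly p (s t)
       = s t ^ m * (1/2 * poly p (s t) - 1 / (2 * real m) * (s t * poly (pderiv p) (s t)))"
      unfolding i .
  qed
qed

text \<open>Returning from the polynomial identity to the differential equation means dividing by
  \<open>s ^ (3 * m)\<close>, that is, multiplying by \<open>s ^ m * t\<^sup>2\<close>. The error
  t^-(L+5) becomes t^-(L+3), and the factor \<open>s ^ m\<close> is left to swallow the polynomial
  \<open>q\<close>.\<close>

lemma residual_ev:
  assumes q: "monom 1 (4 * m) * ([:1/2:] * p - [:1 / (2 * real m):] * ([:0, 1:] * pderiv p)) - monom 1 (3 * m) * [:a:]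
     + g * dp K + monom 1 (3 * m) * (Mp K * h) = monom 1 (2 * m * (L + 5)) * q"
  shows "\<forall>\<^sub>F t in at_top. \<bar>s t ^ m * (1/2 * poly p (s t) - 1 / (2 * real m) * (s t * poly (pderiv p) (s t))) -
     (a - poly g (s t) * inverse (s t ^ m) * (t * poly (dp K) (s t)) - poly (Mp K) (s t) * poly h (s t))\<bar> \<le> 1 / t ^ (L + 3)"
proof -
  have "\<forall>\<^sub>F t in at_top. poly (monom 1 m * q) (s t) < 1" "\<forall>\<^sub>F t in at_top. - 1 < poly (monom 1 m * q) (s t)"
    using m by (intro ev_poly_less ev_poly_greater; simp add: poly_monom power_0_left)+
  then show ?thesis
    using eventually_gt_at_top[of 0]
  proof eventually_elim
    case (elim t)
    define z where "z = s t ^ m"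
    define i where "i = inverse z"
    define w where "w = 1/2 * poly p (s t) - 1 / (2 * real m) * (s t * poly (pderiv p) (s t))"
    have z: "0 < z" "z * z * t = 1" using s_power_m[OF elim(3)] s_pos[OF elim(3)] elim(3) by (auto simp: z_def)
    have zi: "z * i = 1" using z by (simp add: i_def)
    have it: "i = z * t" using z zi by (metis mult.assoc mult.commute mult_1 mult_cancel_left)
    have pw: "s t ^ (4 * m) = z ^ 4" "s t ^ (3 * m) = z ^ 3"
      unfolding z_def by (simp_all add: power_mult[symmetric] mult.commute)
    have zt: "s t ^ (2 * m * (L + 5)) = 1 / t ^ (L + 5)"
      unfolding power_mult[of "s t" "2 * m"] s_power[OF elim(3)] by (simp add: power_divide)
    let ?R = "z * w - (a - poly g (s t) * i * (t * poly (dp K) (s t)) - poly (Mp K) (s t) * poly h (s t))"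
    have "poly (monom 1 (4 * m) * ([:1/2:] * p - [:1 / (2 * real m):] * ([:0, 1:] * pderiv p)) - monom 1 (3 * m) * [:a:]
     + g * dp K + monom 1 (3 * m) * (Mp K * h)) (s t) = z ^ 4 * w - z ^ 3 * a + poly g (s t) * poly (dp K) (s t) + z ^ 3 * (poly (Mp K) (s t) * poly h (s t))"
      by (simp add: poly_monom pw w_def)
    then have r: "z ^ 4 * w - z ^ 3 * a + poly g (s t) * poly (dp K) (s t) + z ^ 3 * (poly (Mp K) (s t) * poly h (s t)) = 1 / t ^ (L + 5) * poly q (s t)"
      unfolding q by (simp add: poly_monom zt)
    have "z ^ 3 * ?R = z ^ 4 * w - z ^ 3 * a + (z * z * t) * (z * i) * (poly g (s t) * poly (dp K) (s t)) + z ^ 3 * (poly (Mp K) (s t) * poly h (s t))"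
      by (simp add: algebra_simps power_numeral_reduce)
    then have "z ^ 3 * ?R = 1 / t ^ (L + 5) * poly q (s t)" unfolding z zi using r by simp
    then have "(i ^ 3 * z ^ 3) * ?R = i ^ 3 * (1 / t ^ (L + 5) * poly q (s t))" by (simp add: mult.assoc)
    moreover have "i ^ 3 * z ^ 3 = 1" using zi by (simp add: power_mult_distrib[symmetric] mult.commute)
    moreover have "i ^ 3 = z * t ^ 2"
    proof -
      have "i ^ 3 = (z * z * t) * (z * t ^ 2)" unfolding it by (simp add: algebra_simps power_numeral_reduce)
      then show ?thesis unfolding z by simp
    qed
    ultimately have R: "?R = z * t ^ 2 * (1 / t ^ (L + 5) * poly q (s t))" by simp
    have "t ^ (L + 5) = t ^ (L + 3) * t ^ 2" by (subst power_add[symmetric]) (simp add: add.commute)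
    then have "?R = (1 / t ^ (L + 3)) * poly (monom 1 m * q) (s t)"
      unfolding R using elim(3) by (simp add: poly_monom z_def field_simps)
    then have "\<bar>?R\<bar> = (1 / t ^ (L + 3)) * \<bar>poly (monom 1 m * q) (s t)\<bar>" using elim(3) by (simp add: abs_mult)
    also have "\<dots> \<le> (1 / t ^ (L + 3)) * 1" using elim by (intro mult_left_mono) auto
    finally show ?case unfolding z_def i_def w_def by simp
  qed
qed

lemma scaled_identities:
  fixes K t
  assumes t: "0 < t"
  defines "muh \<equiv> s t ^ m * poly (Mp K) (s t)" and "Dh \<equiv> (Xh K t)\<^sup>2 + (Yh K t)\<^sup>2 - lam * t"
  shows "Dh = t * poly (dp K) (s t)" and "2 * Xh K t * Yh K t + muh * S = t * poly (ph K) (s t)"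
    and "Dh + 2 * (Yh K t)\<^sup>2 + muh * C = t * poly (qh K) (s t)" and "Dh + 2 * (Xh K t)\<^sup>2 - muh * C = t * poly (rh K) (s t)"
    and "muh * (S * Xh K t + C * Yh K t) = poly (Mp K) (s t) * (S * poly (xp K) (s t) + C * poly (yp K) (s t))"
    and "muh * (C * Xh K t - S * Yh K t) = poly (Mp K) (s t) * (C * poly (xp K) (s t) - S * poly (yp K) (s t))"
proof -
  define z where "z = s t ^ m"
  have z: "0 < z" "z * z * t = 1" using s_power_m[OF t] s_pos[OF t] t by (auto simp: z_def)
  have ii: "inverse z * inverse z = t" using z by (simp add: field_simps)
  have zi: "z * inverse z = 1" using z by simp
  have z3: "t * s t ^ (3 * m) = z"
  proof -
    have "s t ^ (3 * m) = z * z * z" unfolding z_def by (simp add: power_add[symmetric] mult_2 numeral_3_eq_3 add.assoc)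
    then have "t * s t ^ (3 * m) = (z * z * t) * z" by simp
    then show ?thesis unfolding z by simp
  qed
  have XX: "(Xh K t)\<^sup>2 = t * (poly (xp K) (s t))\<^sup>2" "(Yh K t)\<^sup>2 = t * (poly (yp K) (s t))\<^sup>2"
    "Xh K t * Yh K t = t * (poly (xp K) (s t) * poly (yp K) (s t))"
  proof -
    have "(a * inverse z) * (b * inverse z) = (inverse z * inverse z) * (a * b)" for a b by (simp only: mult_ac)
    then have aux: "(a * inverse z) * (b * inverse z) = t * (a * b)" for a b unfolding ii .
    show "(Xh K t)\<^sup>2 = t * (poly (xp K) (s t))\<^sup>2" "(Yh K t)\<^sup>2 = t * (poly (yp K) (s t))\<^sup>2"
      "Xh K t * Yh K t = t * (poly (xp K) (s t) * poly (yp K) (s t))"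
      unfolding Xh_def Yh_def z_def[symmetric] power2_eq_square by (rule aux)+
  qed
  show D: "Dh = t * poly (dp K) (s t)"
    unfolding Dh_def XX by (simp add: dp_def power2_eq_square algebra_simps)
  have mu: "muh * c = t * (s t ^ (3 * m) * poly (Mp K) (s t) * c)" for c
    unfolding muh_def z_def[symmetric] z3[symmetric] by simp
  show "2 * Xh K t * Yh K t + muh * S = t * poly (ph K) (s t)"
    unfolding mu mult.assoc[of 2] XX by (simp add: ph_def poly_monom algebra_simps)
  show "Dh + 2 * (Yh K t)\<^sup>2 + muh * C = t * poly (qh K) (s t)"
    unfolding mu D XX by (simp add: qh_def poly_monom power2_eq_square algebra_simps)
  show "Dh + 2 * (Xh K t)\<^sup>2 - muh * C = t * poly (rh K) (s t)"
    unfolding mu D XX by (simp add: rh_def poly_monom power2_eq_square algebra_simps)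
  have "muh * (a * Xh K t + b * Yh K t) = (z * inverse z) * (poly (Mp K) (s t) * (a * poly (xp K) (s t) + b * poly (yp K) (s t)))" for a b
    unfolding muh_def Xh_def Yh_def z_def[symmetric] by (simp add: algebra_simps)
  then have e: "muh * (a * Xh K t + b * Yh K t) = poly (Mp K) (s t) * (a * poly (xp K) (s t) + b * poly (yp K) (s t))" for a b
    unfolding zi by simp
  show "muh * (S * Xh K t + C * Yh K t) = poly (Mp K) (s t) * (S * poly (xp K) (s t) + C * poly (yp K) (s t))" by (rule e)
  show "muh * (C * Xh K t - S * Yh K t) = poly (Mp K) (s t) * (C * poly (xp K) (s t) - S * poly (yp K) (s t))"
    using e[of C "- S"] by simp
qed

text \<open>The amplitudes are \<open>P\<^sup>2 = t * rh\<close> and \<open>Q\<^sup>2\<close> of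
  order \<open>s ^ (2 * m - 1)\<close>. Their product is of order \<open>1 / s\<close>, so the
  frequency \<open>P * Q\<close> even tends to infinity, while \<open>P\<close> and \<open>Q\<close>
  change at a relative rate of at most \<open>1 / t\<close>; this separation makes the time
  dependence of the coefficients harmless.\<close>

lemma planar_reduction:
  "\<exists>T\<ge>64. \<exists>k P Q. (\<forall>t\<ge>T. 1 \<le> P t \<and> P t \<le> t \<and> 0 < Q t \<and> Q t \<le> t \<and> 1 \<le> t * (Q t)\<^sup>2 \<and> \<bar>k t\<bar> \<le> 1) \<and>
    (\<forall>X Y t. T \<le> t \<longrightarrow> rates X Y t \<longrightarrow> planar_at (sgn \<Delta>) L
       (\<lambda>t. P t * ((X t - Xh (2 * m * (L + 5)) t) + k t * (Y t - Yh (2 * m * (L + 5)) t)))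
       (\<lambda>t. Q t * (Y t - Yh (2 * m * (L + 5)) t)) t)"
proof -
  define K where "K = 2 * m * (L + 5)"
  have K: "4 * m \<le> K" "0 < K" using m by (auto simp: K_def algebra_simps)
  obtain Qd where Qd: "rh K * qh K - ph K * ph K = monom 1 (4 * m - 1) * Qd" "poly Qd 0 = \<Delta>"
    using char_poly[OF K(1)] by blast
  define \<epsilon> where "\<epsilon> = sgn \<Delta>"
  have \<epsilon>: "\<epsilon> * \<epsilon> = 1" "\<epsilon> * \<Delta> = \<bar>\<Delta>\<bar>" using \<Delta> by (auto simp: \<epsilon>_def sgn_if)
  define W where "W = pderiv (ph K) * rh K - ph K * pderiv (rh K)"
  \<comment> \<open>Up to the factor \<open>s ^ (2 * m - 1) / rh\<^sup>2\<close>, \<open>Ae\<close>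
    is \<epsilon> times \<open>q - k * p - kd\<close>. The determinant contributes
    \<open>Qd * rh\<close>; the derivative \<open>kd\<close> of the shift contains the Wronskian
    \<open>W\<close> and the factor \<open>s / t = s\<^sup>2 * s ^ (2 * m - 1)\<close>, hence enters
    two orders later. So the value at 0 is positive.\<close>
  define Ae where "Ae = smult \<epsilon> (Qd * rh K + [:1 / (2 * real m):] * (monom 1 2 * W))"
  have Ae0: "poly Ae 0 = 2 * lam * \<bar>\<Delta>\<bar>"
    using \<epsilon> poly_at_0[OF K(2)] Qd(2) by (simp add: Ae_def poly_monom mult_ac)
  have Ae0': "0 < poly Ae 0" unfolding Ae0 using lam \<Delta> by simp
  define k where "k t = poly (ph K) (s t) * inverse (poly (rh K) (s t))" for t
  define P2 where "P2 t = t * poly (rh K) (s t)" for t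
  define Q2 where "Q2 t = s t ^ (2 * m - 1) * poly Ae (s t) * inverse (poly (rh K) (s t)) * inverse (poly (rh K) (s t))" for t
  define P where "P t = sqrt (P2 t)" for t
  define Q where "Q t = sqrt (Q2 t)" for t
  have rh0: "poly (rh K) 0 \<noteq> 0" unfolding poly_at_0[OF K(2)] using lam by simp
  obtain q1 where q1: "monom 1 (4 * m) * ([:1/2:] * xp K - [:1 / (2 * real m):] * ([:0, 1:] * pderiv (xp K))) - monom 1 (3 * m) * [:A:]
     + yp K * dp K + monom 1 (3 * m) * (Mp K * ([:S:] * xp K + [:C:] * yp K)) = monom 1 (2 * m * (L + 5)) * q1"
    using residual_polys(1)[of K] unfolding K_def by blast
  obtain q2 where "monom 1 (4 * m) * ([:1/2:] * yp K - [:1 / (2 * real m):] * ([:0, 1:] * pderiv (yp K))) - monom 1 (3 * m) * [:B:]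
     - xp K * dp K + monom 1 (3 * m) * (Mp K * ([:C:] * xp K - [:S:] * yp K)) = monom 1 (2 * m * (L + 5)) * q2"
    using residual_polys(2)[of K] unfolding K_def by blast
  then have q2: "monom 1 (4 * m) * ([:1/2:] * yp K - [:1 / (2 * real m):] * ([:0, 1:] * pderiv (yp K))) - monom 1 (3 * m) * [:B:]
     + (- xp K) * dp K + monom 1 (3 * m) * (Mp K * ([:C:] * xp K - [:S:] * yp K)) = monom 1 (2 * m * (L + 5)) * q2"
    by simp
  define cx where "cx = \<bar>poly (xp K) 0\<bar> + 1"
  define cy where "cy = \<bar>poly (yp K) 0\<bar> + 1"
  \<comment> \<open>Thresholds: \<open>c1\<close> for \<open>Q t \<le> t\<close>, \<open>c0\<close>
    for \<open>1 \<le> t * (Q t)\<^sup>2\<close> and \<open>c2\<close> for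
    \<open>1 \<le> P t * Q t\<close>. They rest on keeping \<open>rh\<close> between
    \<open>lam\<close> and \<open>4 * lam\<close>, and \<open>Ae\<close> between 1 and 4 times
    \<open>lam * \<bar>\<Delta>\<bar>\<close>.\<close>
  define c1 where "c1 = 4 * lam * \<bar>\<Delta>\<bar> / lam\<^sup>2"
  define c0 where "c0 = lam * \<bar>\<Delta>\<bar> / (16 * lam\<^sup>2)"
  define c2 where "c2 = lam * \<bar>\<Delta>\<bar> / (4 * lam)"
  have c: "0 < c0" "0 < c2" using lam \<Delta> by (auto simp: c0_def c2_def)
  obtain Tm where Tm: "\<And>t. Tm \<le> t \<Longrightarrow> \<bar>\<mu> t - s t ^ m * poly (Mp K) (s t)\<bar> \<le> 1 / t ^ (L + 4)"
    using mu[of L] unfolding s_def Mp_def K_def by blast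
  define R1 where "R1 t = s t ^ m * (1/2 * poly (xp K) (s t) - 1 / (2 * real m) * (s t * poly (pderiv (xp K)) (s t))) -
     (A - poly (yp K) (s t) * inverse (s t ^ m) * (t * poly (dp K) (s t)) - poly (Mp K) (s t) * poly ([:S:] * xp K + [:C:] * yp K) (s t))" for t
  define R2 where "R2 t = s t ^ m * (1/2 * poly (yp K) (s t) - 1 / (2 * real m) * (s t * poly (pderiv (yp K)) (s t))) -
     (B - poly (- xp K) (s t) * inverse (s t ^ m) * (t * poly (dp K) (s t)) - poly (Mp K) (s t) * poly ([:C:] * xp K - [:S:] * yp K) (s t))" for t
  define r_rate where "r_rate t = poly (pderiv (rh K)) (s t) * s t * (- 1 / (2 * real m * t)) / poly (rh K) (s t)" for t
  define A_rate where "A_rate t = poly (pderiv Ae) (s t) * s t * (- 1 / (2 * real m * t)) / poly Ae (s t)" for t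
  have "\<forall>\<^sub>F t in at_top. 64 \<le> t \<and> Tm \<le> t \<and> 1 / lam \<le> t \<and> 4 * lam \<le> t \<and> c1 \<le> t \<and> cx\<^sup>2 \<le> t \<and> cy\<^sup>2 \<le> t"
    by (intro eventually_conj eventually_ge_at_top)
  moreover have "\<forall>\<^sub>F t in at_top. s t < 1" "\<forall>\<^sub>F t in at_top. s t < c0" "\<forall>\<^sub>F t in at_top. s t < c2"
    using c by (intro order_tendstoD(2)[OF s_tendsto]; simp)+
  moreover have "\<forall>\<^sub>F t in at_top. lam < poly (rh K) (s t)" "\<forall>\<^sub>F t in at_top. poly (rh K) (s t) < 4 * lam"
    using lam by (intro ev_poly_greater ev_poly_less; simp add: poly_at_0[OF K(2)])+
  moreover have "\<forall>\<^sub>F t in at_top. lam * \<bar>\<Delta>\<bar> < poly Ae (s t)" "\<forall>\<^sub>F t in at_top. poly Ae (s t) < 4 * lam * \<bar>\<Delta>\<bar>"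
    using lam \<Delta> by (intro ev_poly_greater ev_poly_less; simp add: Ae0)+
  moreover have "\<forall>\<^sub>F t in at_top. poly (ph K) (s t) < lam" "\<forall>\<^sub>F t in at_top. - lam < poly (ph K) (s t)"
    using lam by (intro ev_poly_greater ev_poly_less; simp add: poly_at_0[OF K(2)])+
  moreover have "\<forall>\<^sub>F t in at_top. \<bar>poly (xp K) (s t)\<bar> \<le> cx" "\<forall>\<^sub>F t in at_top. \<bar>poly (yp K) (s t)\<bar> \<le> cy"
    unfolding cx_def cy_def by (intro ev_poly_bound)+
  moreover have "\<forall>\<^sub>F t in at_top. \<bar>r_rate t\<bar> \<le> 1 / (4 * t)" "\<forall>\<^sub>F t in at_top. \<bar>A_rate t\<bar> \<le> 1 / (4 * t)"
    unfolding r_rate_def A_rate_def using Ae0' by (intro ev_poly_rate rh0; simp)+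
  moreover have "\<forall>\<^sub>F t in at_top. \<bar>R1 t\<bar> \<le> 1 / t ^ (L + 3)" "\<forall>\<^sub>F t in at_top. \<bar>R2 t\<bar> \<le> 1 / t ^ (L + 3)"
    unfolding R1_def R2_def by (rule residual_ev[OF q1], rule residual_ev[OF q2])
  ultimately have "\<forall>\<^sub>F t in at_top. (1 \<le> P t \<and> P t \<le> t \<and> 0 < Q t \<and> Q t \<le> t \<and> 1 \<le> t * (Q t)\<^sup>2 \<and> \<bar>k t\<bar> \<le> 1) \<and> 64 \<le> t \<and>
    (\<forall>X Y. rates X Y t \<longrightarrow> planar_at \<epsilon> L (\<lambda>t. P t * ((X t - Xh K t) + k t * (Y t - Yh K t))) (\<lambda>t. Q t * (Y t - Yh K t)) t)"
  proof eventually_elim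
    case (elim t)
    have t64: "64 \<le> t" and tl: "1 / lam \<le> t" "4 * lam \<le> t" "c1 \<le> t" and tc: "cx\<^sup>2 \<le> t" "cy\<^sup>2 \<le> t" and tT: "Tm \<le> t" using elim(1) by auto
    have t: "0 < t" using t64 by simp
    define \<sigma> where "\<sigma> = s t"
    have \<sigma>: "0 < \<sigma>" "\<sigma> < 1" "\<sigma> < c0" "\<sigma> < c2" using s_pos[OF t] elim(2-4) by (auto simp: \<sigma>_def)
    define \<r> where "\<r> = poly (rh K) \<sigma>"
    define \<a> where "\<a> = poly Ae \<sigma>"
    have r: "lam < \<r>" "\<r> < 4 * lam" "0 < \<r>" using elim(5,6) lam by (auto simp: \<r>_def \<sigma>_def)
    have a: "lam * \<bar>\<Delta>\<bar> < \<a>" "\<a> < 4 * lam * \<bar>\<Delta>\<bar>" using elim(7,8) by (auto simp: \<a>_def \<sigma>_def)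
    have a0: "0 < \<a>" using a(1) lam by (smt (verit) mult_nonneg_nonneg abs_ge_zero)
    have p: "\<bar>poly (ph K) \<sigma>\<bar> \<le> \<r>" using elim(9,10) r by (auto simp: \<sigma>_def)
    have P2t: "P2 t = t * \<r>" by (simp add: P2_def \<r>_def \<sigma>_def)
    have Q2t: "Q2 t = \<sigma> ^ (2 * m - 1) * \<a> * inverse \<r> * inverse \<r>" by (simp add: Q2_def \<r>_def \<sigma>_def \<a>_def)
    have P2pos: "0 < P2 t" unfolding P2t using t r by simp
    have Q2pos: "0 < Q2 t" unfolding Q2t using \<sigma> a0 r by simp
    have PP: "(P t)\<^sup>2 = P2 t" "(Q t)\<^sup>2 = Q2 t" using P2pos Q2pos by (simp_all add: P_def Q_def)
    have P1: "1 \<le> P t"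
    proof -
      have "1 \<le> lam * t" using tl(1) lam by (simp add: field_simps)
      also have "\<dots> \<le> \<r> * t" using r t by (intro mult_right_mono) auto
      finally show ?thesis by (simp add: P_def P2t mult.commute)
    qed
    have Pt: "P t \<le> t"
    proof -
      have "P2 t \<le> t * t" unfolding P2t using r tl t by (intro mult_left_mono) auto
      then show ?thesis unfolding P_def using t by (intro real_le_lsqrt) (auto simp: power2_eq_square)
    qed
    have st: "t * \<sigma> ^ (2 * m - 1) = inverse \<sigma>"
    proof -
      have "\<sigma> ^ (2 * m) = \<sigma> * \<sigma> ^ (2 * m - 1)" using m by (simp add: power_eq_if)
      then have "\<sigma> * (t * \<sigma> ^ (2 * m - 1)) = 1" using s_power[OF t] t unfolding \<sigma>_def[symmetric] by (simp add: field_simps)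
      then show ?thesis using \<sigma>(1) by (simp add: field_simps)
    qed
    have tQ: "1 \<le> t * Q2 t"
    proof -
      have "\<sigma> * (\<r> * \<r>) \<le> c0 * ((4 * lam) * (4 * lam))" using \<sigma> r by (intro mult_mono) auto
      also have "\<dots> = lam * \<bar>\<Delta>\<bar>" using lam by (simp add: c0_def power2_eq_square)
      finally have "\<sigma> * (\<r> * \<r>) \<le> \<a>" using a by simp
      then have "1 \<le> inverse \<sigma> * \<a> * inverse \<r> * inverse \<r>" using \<sigma> r by (simp add: field_simps)
      then show ?thesis unfolding Q2t st[symmetric] by (simp add: mult_ac)
    qed
    have PQ: "1 \<le> P2 t * Q2 t"
    proof -
      have "\<sigma> * \<r> \<le> c2 * (4 * lam)" using \<sigma> r by (intro mult_mono) auto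
      also have "\<dots> = lam * \<bar>\<Delta>\<bar>" using lam by (simp add: c2_def)
      finally have "\<sigma> * \<r> \<le> \<a>" using a by simp
      then have "1 \<le> inverse \<sigma> * \<a> * inverse \<r>" using \<sigma> r by (simp add: field_simps)
      moreover have "P2 t * Q2 t = inverse \<sigma> * \<a> * inverse \<r>" unfolding P2t Q2t st[symmetric] using r by (simp add: field_simps)
      ultimately show ?thesis by simp
    qed
    have Qt: "Q t \<le> t"
    proof -
      have "Q2 t \<le> 1 * (4 * lam * \<bar>\<Delta>\<bar>) * inverse lam * inverse lam"
        unfolding Q2t using \<sigma> a a0 r lam by (intro mult_mono power_le_one le_imp_inverse_le) auto
      also have "\<dots> = c1" using lam by (simp add: c1_def field_simps power2_eq_square)
      also have "\<dots> \<le> t * 1" using tl by simp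
      also have "\<dots> \<le> t * t" using t64 by (intro mult_left_mono) auto
      finally show ?thesis unfolding Q_def using t by (intro real_le_lsqrt) (auto simp: power2_eq_square)
    qed
    have k1: "\<bar>k t\<bar> \<le> 1"
      using p r by (simp add: k_def \<sigma>_def[symmetric] \<r>_def[symmetric] abs_mult field_simps)
    have Q0: "0 < Q t" using Q2pos by (simp add: Q_def)
    have first: "1 \<le> P t \<and> P t \<le> t \<and> 0 < Q t \<and> Q t \<le> t \<and> 1 \<le> t * (Q t)\<^sup>2 \<and> \<bar>k t\<bar> \<le> 1"
      using P1 Pt Q0 Qt tQ k1 PP by simp
    have PQ1: "1 \<le> P t * Q t" using PQ by (simp add: P_def Q_def flip: real_sqrt_mult)
    have rnz: "poly (rh K) (s t) \<noteq> 0" using r by (simp add: \<r>_def \<sigma>_def)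
    have anz: "poly Ae (s t) \<noteq> 0" using a0 by (simp add: \<a>_def \<sigma>_def)
    define lP where "lP = (1 / t + r_rate t) / 2"
    define lQ where "lQ = ((2 * m - 1) * (- 1 / (2 * real m * t)) + A_rate t + - r_rate t + - r_rate t) / 2"
    have ld_r: "log_deriv (\<lambda>t. poly (rh K) (s t)) (r_rate t) t" unfolding r_rate_def by (rule log_deriv_poly[OF log_deriv_s[OF t] rnz])
    have ld_a: "log_deriv (\<lambda>t. poly Ae (s t)) (A_rate t) t" unfolding A_rate_def by (rule log_deriv_poly[OF log_deriv_s[OF t] anz])
    have "log_deriv P2 (1 / t + r_rate t) t"
      unfolding P2_def using t by (intro log_deriv_mult log_deriv_ident ld_r) simp
    from log_deriv_sqrt[OF this P2pos] have dP: "(P has_real_derivative P t * lP) (at t)"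
      unfolding log_deriv_def P_def lP_def .
    have "log_deriv Q2 ((2 * m - 1) * (- 1 / (2 * real m * t)) + A_rate t + - r_rate t + - r_rate t) t"
      unfolding Q2_def by (intro log_deriv_mult log_deriv_power log_deriv_inverse log_deriv_s t ld_r ld_a rnz)
    from log_deriv_sqrt[OF this Q2pos] have dQ: "(Q has_real_derivative Q t * lQ) (at t)"
      unfolding log_deriv_def Q_def lQ_def .
    have lP: "\<bar>lP\<bar> \<le> 1 / t"
    proof -
      have "\<bar>1 / t + r_rate t\<bar> \<le> 1 / t + 1 / (4 * t)" using elim(13) t by (simp add: abs_le_iff)
      also have "\<dots> \<le> 2 * (1 / t)" using t by (simp add: field_simps)
      finally show ?thesis by (simp add: lP_def)
    qed
    have lQ: "\<bar>lQ\<bar> \<le> 1 / t"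
    proof -
      have "\<bar>(2 * m - 1) * (- 1 / (2 * real m * t))\<bar> \<le> 1 / t"
        using m t by (simp add: abs_mult field_simps of_nat_diff)
      moreover have "1 / (4 * t) = (1 / t) / 4" by simp
      ultimately have "\<bar>(2 * m - 1) * (- 1 / (2 * real m * t)) + A_rate t + - r_rate t + - r_rate t\<bar> \<le> 2 * (1 / t)"
        using elim(13,14) t by linarith
      then show ?thesis by (simp add: lQ_def)
    qed
    define kd where "kd = poly (pderiv (ph K)) (s t) * (s t * (- 1 / (2 * real m * t))) * inverse (poly (rh K) (s t))
        + (inverse (poly (rh K) (s t)) * - r_rate t) * poly (ph K) (s t)"
    have dk: "(k has_real_derivative kd) (at t)"
      unfolding k_def kd_def
      by (intro DERIV_mult DERIV_poly_s t log_deriv_inverse[OF ld_r rnz, unfolded log_deriv_def])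
    have kdW: "kd = - (\<sigma> / (2 * real m * t)) * (poly W \<sigma> * inverse \<r> * inverse \<r>)"
      unfolding kd_def r_rate_def \<sigma>_def[symmetric] \<r>_def[symmetric] using r t m
      by (simp add: W_def field_simps \<r>_def[symmetric])
    note ids = scaled_identities[OF t, of K]
    let ?muh = "s t ^ m * poly (Mp K) (s t)"
    let ?Dh = "(Xh K t)\<^sup>2 + (Yh K t)\<^sup>2 - lam * t"
    have th: "(?Dh + 2 * (Yh K t)\<^sup>2 + ?muh * C) - k t * (2 * Xh K t * Yh K t + ?muh * S) - kd = \<epsilon> * (Q t)\<^sup>2"
    proof -
      have q: "\<r> * poly (qh K) \<sigma> - poly (ph K) \<sigma> * poly (ph K) \<sigma> = \<sigma> ^ (4 * m - 1) * poly Qd \<sigma>"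
        using arg_cong[OF Qd(1), of "\<lambda>p. poly p \<sigma>"] by (simp add: \<r>_def poly_monom)
      have "4 * m - 1 = 2 * m + (2 * m - 1)" using m by simp
      then have pw: "t * \<sigma> ^ (4 * m - 1) = \<sigma> ^ (2 * m - 1)"
        using s_power[OF t] t unfolding \<sigma>_def[symmetric] by (simp add: power_add)
      have "\<sigma> * \<sigma> ^ (2 * m - 1) = 1 / t"
        using s_power[OF t] m unfolding \<sigma>_def[symmetric] by (simp add: power_eq_if[of \<sigma> "2 * m"])
      moreover have "\<sigma> / (2 * real m * t) = 1 / (2 * real m) * \<sigma> * (1 / t)" by simp
      ultimately have pw2: "\<sigma> / (2 * real m * t) = 1 / (2 * real m) * \<sigma>\<^sup>2 * \<sigma> ^ (2 * m - 1)"
        by (simp only: power2_eq_square mult.assoc)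
      let ?B = "poly Qd \<sigma> * \<r> + 1 / (2 * real m) * \<sigma>\<^sup>2 * poly W \<sigma>"
      have "\<a> = \<epsilon> * ?B" by (simp add: \<a>_def Ae_def poly_monom \<r>_def)
      then have "\<epsilon> * Q2 t = (\<epsilon> * \<epsilon>) * (\<sigma> ^ (2 * m - 1) * ?B * inverse \<r> * inverse \<r>)"
        unfolding Q2t by (simp only: mult_ac)
      then have "\<epsilon> * Q2 t = \<sigma> ^ (2 * m - 1) * ?B * inverse \<r> * inverse \<r>" unfolding \<epsilon>(1) by simp
      also have "\<dots> = (\<sigma> ^ (2 * m - 1) * poly Qd \<sigma>) * inverse \<r> + 1 / (2 * real m) * \<sigma>\<^sup>2 * \<sigma> ^ (2 * m - 1) * (poly W \<sigma> * inverse \<r> * inverse \<r>)"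
        using r by (simp add: algebra_simps)
      also have "\<dots> = t * (\<r> * poly (qh K) \<sigma> - poly (ph K) \<sigma> * poly (ph K) \<sigma>) * inverse \<r> - kd"
        unfolding kdW pw2 q mult.assoc[of t, symmetric] pw by simp
      also have "t * (\<r> * poly (qh K) \<sigma> - poly (ph K) \<sigma> * poly (ph K) \<sigma>) * inverse \<r> = t * poly (qh K) \<sigma> - k t * (t * poly (ph K) \<sigma>)"
        unfolding k_def \<sigma>_def[symmetric] \<r>_def[symmetric] using r by (simp add: field_simps)
      finally show ?thesis unfolding ids(2,3) PP \<sigma>_def by simp
    qed
    have XYb: "\<bar>Xh K t\<bar> \<le> t" "\<bar>Yh K t\<bar> \<le> t"
    proof -
      have "inverse (s t ^ m) * inverse (s t ^ m) = t" using s_power_m[OF t] t by (simp flip: inverse_mult_distrib)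
      then have i2: "(inverse (s t ^ m))\<^sup>2 = t" by (simp add: power2_eq_square)
      have b: "\<bar>w * inverse (s t ^ m)\<bar> \<le> t" if "\<bar>w\<bar> \<le> c" "c\<^sup>2 \<le> t" for w c
      proof -
        have "w\<^sup>2 \<le> c\<^sup>2" using power_mono[OF that(1) abs_ge_zero, of 2] by simp
        then have "w\<^sup>2 \<le> t" using that by simp
        then have "(w * inverse (s t ^ m))\<^sup>2 \<le> t\<^sup>2" unfolding power_mult_distrib i2 using t by (simp add: power2_eq_square mult_right_mono)
        then show ?thesis using t by (metis abs_le_square_iff abs_of_pos)
      qed
      show "\<bar>Xh K t\<bar> \<le> t" "\<bar>Yh K t\<bar> \<le> t" unfolding Xh_def Yh_def using elim(11,12) tc by (auto intro: b)
    qed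
    have "planar_at \<epsilon> L (\<lambda>t. P t * ((X t - Xh K t) + k t * (Y t - Yh K t))) (\<lambda>t. Q t * (Y t - Yh K t)) t" if "rates X Y t" for X Y
    proof (rule planar_from_deviation[where lam=lam and muh="?muh" and S=S and C=C and A=A and B=B and mu="\<mu> t" and kd=kd and lP=lP and lQ=lQ and ?R1.0="R1 t" and ?R2.0="R2 t"])
      show "(X has_real_derivative A - Y t * ((X t)\<^sup>2 + (Y t)\<^sup>2 - lam * t) - \<mu> t * (S * X t + C * Y t)) (at t)"
        "(Y has_real_derivative B + X t * ((X t)\<^sup>2 + (Y t)\<^sup>2 - lam * t) - \<mu> t * (C * X t - S * Y t)) (at t)"
        using that by (auto simp: rates_def)
      show "(Xh K has_real_derivative A - Yh K t * ?Dh - ?muh * (S * Xh K t + C * Yh K t) + R1 t) (at t)"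
        unfolding ids(5) ids(1) unfolding Xh_def[abs_def] Yh_def
        by (rule DERIV_cong[OF DERIV_scaled[OF t]]) (simp add: R1_def)
      show "(Yh K has_real_derivative B + Xh K t * ?Dh - ?muh * (C * Xh K t - S * Yh K t) + R2 t) (at t)"
        unfolding ids(6) ids(1) unfolding Yh_def[abs_def] Xh_def
        by (rule DERIV_cong[OF DERIV_scaled[OF t]]) (simp add: R2_def)
      show "k t * (?Dh + 2 * (Xh K t)\<^sup>2 - ?muh * C) = 2 * Xh K t * Yh K t + ?muh * S"
        unfolding ids(2,4) k_def using rnz by simp
      show "?Dh + 2 * (Xh K t)\<^sup>2 - ?muh * C = (P t)\<^sup>2"
        unfolding ids(4) PP P2_def ..
    qed (rule th dk dP dQ t64 P1 Pt Q0 Qt tQ[folded PP] PQ1 k1 lP lQ XYb SC Tm[OF tT] elim(15) elim(16))+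
    then show ?case using first t64 by blast
  qed
  then obtain T where T: "\<And>t. T \<le> t \<Longrightarrow> (1 \<le> P t \<and> P t \<le> t \<and> 0 < Q t \<and> Q t \<le> t \<and> 1 \<le> t * (Q t)\<^sup>2 \<and> \<bar>k t\<bar> \<le> 1) \<and> 64 \<le> t \<and>
    (\<forall>X Y. rates X Y t \<longrightarrow> planar_at \<epsilon> L (\<lambda>t. P t * ((X t - Xh K t) + k t * (Y t - Yh K t))) (\<lambda>t. Q t * (Y t - Yh K t)) t)"
    unfolding eventually_at_top_linorder by blast
  show ?thesis
    unfolding K_def[symmetric] \<epsilon>_def[symmetric]
  proof (rule exI[of _ T], intro conjI)
    show "64 \<le> T" using T[of T] by simp
  next
    show "\<exists>k P Q. (\<forall>t\<ge>T. 1 \<le> P t \<and> P t \<le> t \<and> 0 < Q t \<and> Q t \<le> t \<and> 1 \<le> t * (Q t)\<^sup>2 \<and> \<bar>k t\<bar> \<le> 1) \<and>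
      (\<forall>X Y t. T \<le> t \<longrightarrow> rates X Y t \<longrightarrow> planar_at \<epsilon> L (\<lambda>t. P t * ((X t - Xh K t) + k t * (Y t - Yh K t))) (\<lambda>t. Q t * (Y t - Yh K t)) t)"
      by (rule exI[of _ k], rule exI[of _ P], rule exI[of _ Q]) (use T in simp)
  qed
qed

end

section \<open>Solutions close to a formal solution\<close>

locale expansion_flow = expansion +
  fixes m0 :: real
  assumes mu_cont: "continuous_on {0..} \<mu>" and mu_bound: "\<And>t. 0 \<le> t \<Longrightarrow> \<bar>\<mu> t\<bar> \<le> m0"
begin

definition sol :: "(real \<Rightarrow> complex) \<Rightarrow> bool" where
  "sol z \<longleftrightarrow> cubic_sol (Complex A B) lam (\<lambda>t. Complex (- \<mu> t * S) (- \<mu> t * C)) z"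

lemma coupling_bound: "0 \<le> t \<Longrightarrow> norm (Complex (- \<mu> t * S) (- \<mu> t * C)) \<le> 2 * m0"
proof -
  assume t: "0 \<le> t"
  have "\<bar>\<mu> t\<bar> * \<bar>S\<bar> \<le> m0 * 1" "\<bar>\<mu> t\<bar> * \<bar>C\<bar> \<le> m0 * 1"
    using mu_bound[OF t] SC by (intro mult_mono; simp)+
  then show ?thesis
    using cmod_le[of "Complex (- \<mu> t * S) (- \<mu> t * C)"] by (simp add: abs_mult)
qed

lemma sol_exists: "0 \<le> t0 \<Longrightarrow> \<exists>z. sol z \<and> z t0 = z0"
  unfolding sol_def
proof (rule cubic_sol_exists[where ?m0.0="2 * m0"])
  show "continuous_on {0..} (\<lambda>t. Complex (- \<mu> t * S) (- \<mu> t * C))"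
    unfolding complex_eq_iff Complex_eq by (intro continuous_intros mu_cont)
qed (assumption | rule coupling_bound)+

lemma sol_dependence:
  assumes "0 \<le> t0" "t0 \<le> T" "sol z" "0 < e"
  shows "\<exists>d>0. \<forall>y. sol y \<longrightarrow> norm (y t0 - z t0) < d \<longrightarrow> (\<forall>t\<in>{t0..T}. norm (y t - z t) < e)"
  using cubic_sol_cont_dependence[OF coupling_bound assms(1,2) assms(3)[unfolded sol_def] assms(4)]
  unfolding sol_def by blast

lemma sol_rates:
  assumes z: "sol z" and t: "0 < t"
  shows "rates (\<lambda>t. Re (z t)) (\<lambda>t. Im (z t)) t"
proof -
  have "at t within {0..} = at t" using t by (intro at_within_interior) simp
  then have d: "(z has_vector_derivative
     Complex A B + \<i> * of_real ((norm (z t))\<^sup>2 - lam * t) * z t + Complex (- \<mu> t * S) (- \<mu> t * C) * cnj (z t)) (at t)"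
    using z t unfolding sol_def cubic_sol_def by (metis less_imp_le)
  have n: "(norm (z t))\<^sup>2 = (Re (z t))\<^sup>2 + (Im (z t))\<^sup>2" by (simp add: cmod_power2)
  show ?thesis
    unfolding rates_def
    using bounded_linear.has_vector_derivative[OF bounded_linear_Re d] bounded_linear.has_vector_derivative[OF bounded_linear_Im d]
    unfolding n has_real_derivative_iff_has_vector_derivative
    by (simp add: algebra_simps)
qed

definition close :: "(real \<Rightarrow> complex) \<Rightarrow> nat \<Rightarrow> nat \<Rightarrow> bool" where
  "close z L N \<longleftrightarrow> (\<exists>c T. \<forall>t\<ge>T. \<bar>Re (z t) - Xh (2 * m * (L + 5)) t\<bar> \<le> c / t ^ N \<and> \<bar>Im (z t) - Yh (2 * m * (L + 5)) t\<bar> \<le> c / t ^ N)"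

text \<open>As \<open>Q\<close> may be as small as t^(-1/2), dividing by it costs half a power of
  \<open>t\<close>; this is rounded up to a full power, which is why \<open>Suc N\<close> stands in
  the hypothesis.\<close>

lemma deviation_from_amplitude:
  fixes a b k P Q t c :: real
  assumes b: "1 \<le> P" "0 < Q" "1 \<le> t * Q\<^sup>2" "\<bar>k\<bar> \<le> 1" "1 \<le> t" and c: "0 \<le> c"
    and E: "(P * (a + k * b))\<^sup>2 + (Q * b)\<^sup>2 \<le> c\<^sup>2 / t ^ (2 * Suc N)"
  shows "\<bar>a\<bar> \<le> 2 * c / t ^ N" "\<bar>b\<bar> \<le> 2 * c / t ^ N"
proof -
  have tN: "0 < t ^ N" "0 < t" using b by auto
  have "b\<^sup>2 \<le> t * (Q * b)\<^sup>2" using mult_right_mono[OF b(3), of "b\<^sup>2"] by (simp add: power_mult_distrib mult.assoc)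
  also have "\<dots> \<le> t * (c\<^sup>2 / t ^ (2 * Suc N))" using E b by (intro mult_left_mono) (auto intro: order_trans[rotated])
  also have "\<dots> \<le> t * t * (c\<^sup>2 / t ^ (2 * Suc N))"
    using b by (intro mult_right_mono) auto
  also have "\<dots> = (c / t ^ N)\<^sup>2"
  proof -
    have "t ^ (2 * Suc N) = t * t * (t ^ N)\<^sup>2" by (simp add: power_mult[symmetric] mult.commute)
    then show ?thesis using tN by (simp add: power_divide)
  qed
  finally have b1: "\<bar>b\<bar> \<le> c / t ^ N" using abs_le_square_iff[of b "c / t ^ N"] c tN by simp
  have "1\<^sup>2 * (a + k * b)\<^sup>2 \<le> P\<^sup>2 * (a + k * b)\<^sup>2" using b by (intro mult_right_mono power_mono) auto
  then have "(a + k * b)\<^sup>2 \<le> (P * (a + k * b))\<^sup>2" by (simp add: power_mult_distrib)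
  also have "\<dots> \<le> c\<^sup>2 / t ^ (2 * Suc N)" using E by (auto intro: order_trans[rotated])
  also have "\<dots> \<le> c\<^sup>2 / t ^ (2 * N)" using b c by (intro divide_left_mono power_increasing mult_pos_pos) auto
  also have "\<dots> = (c / t ^ N)\<^sup>2" by (simp add: power_divide power_mult[symmetric] mult.commute)
  finally have e1: "\<bar>a + k * b\<bar> \<le> c / t ^ N" using abs_le_square_iff[of "a + k * b" "c / t ^ N"] c tN by simp
  have "\<bar>k * b\<bar> \<le> 1 * \<bar>b\<bar>" unfolding abs_mult using b by (intro mult_right_mono) auto
  then have "\<bar>a\<bar> \<le> \<bar>a + k * b\<bar> + \<bar>b\<bar>" by linarith
  then show "\<bar>a\<bar> \<le> 2 * c / t ^ N" using e1 b1 by simp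
  show "\<bar>b\<bar> \<le> 2 * c / t ^ N" using b1 c tN by (simp add: divide_right_mono order_trans)
qed

lemma amplitude_from_deviation:
  fixes a b k P Q t d :: real
  assumes b: "0 \<le> P" "P \<le> t" "0 < Q" "Q \<le> t" "\<bar>k\<bar> \<le> 1" and ab: "\<bar>a\<bar> \<le> d" "\<bar>b\<bar> \<le> d"
  shows "(P * (a + k * b))\<^sup>2 + (Q * b)\<^sup>2 \<le> 8 * (t * d)\<^sup>2"
proof -
  have d: "0 \<le> d" using ab by linarith
  have "\<bar>k * b\<bar> \<le> 1 * \<bar>b\<bar>" unfolding abs_mult using b by (intro mult_right_mono) auto
  then have "\<bar>a + k * b\<bar> \<le> 2 * d" using ab by linarith
  then have "P * \<bar>a + k * b\<bar> \<le> t * (2 * d)" using b by (intro mult_mono) auto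
  then have "\<bar>P * (a + k * b)\<bar> \<le> 2 * (t * d)" using b by (simp add: abs_mult)
  then have 1: "(P * (a + k * b))\<^sup>2 \<le> (2 * (t * d))\<^sup>2" using power_mono[of "\<bar>P * (a + k * b)\<bar>" "2 * (t * d)" 2] by simp
  have "Q * \<bar>b\<bar> \<le> t * d" using b ab by (intro mult_mono) auto
  then have "\<bar>Q * b\<bar> \<le> t * d" using b by (simp add: abs_mult)
  then have 2: "(Q * b)\<^sup>2 \<le> (t * d)\<^sup>2" using power_mono[of "\<bar>Q * b\<bar>" "t * d" 2] by simp
  have "0 \<le> (t * d)\<^sup>2" by simp
  moreover have "(2 * (t * d))\<^sup>2 = 4 * (t * d)\<^sup>2" by (simp add: power_mult_distrib)
  ultimately show ?thesis using 1 2 by linarith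
qed

text \<open>The difference is a polynomial multiple of \<open>1 / t ^ (L + 5)\<close>, the first
  power of \<open>s\<close> dropped by the shorter truncation; the factor
  \<open>inverse (s t ^ m)\<close> and the polynomial cost at most one power of \<open>t\<close>
  each.\<close>

lemma truncation_difference:
  fixes F :: "real fps"
  assumes L: "L \<le> L'"
  shows "\<exists>T. \<forall>t\<ge>T. \<bar>poly (truncate_fps (2 * m * (L + 5)) F) (s t) * inverse (s t ^ m) - poly (truncate_fps (2 * m * (L' + 5)) F) (s t) * inverse (s t ^ m)\<bar> \<le> 1 / t ^ L"
proof -
  let ?K = "2 * m * (L + 5)" and ?K' = "2 * m * (L' + 5)"
  have K: "?K \<le> ?K'" using L by simp
  have "agree k (fps_of_poly (truncate_fps k F - truncate_fps k' F)) 0" if "k \<le> k'" for k k'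
    using that by (simp add: agree_def coeff_truncate_fps)
  note this[OF K]
  from agree_zero_dvd[OF this] obtain q where q: "truncate_fps ?K F - truncate_fps ?K' F = monom 1 ?K * q" by blast
  have "\<forall>\<^sub>F t in at_top. \<bar>poly q (s t)\<bar> \<le> \<bar>poly q 0\<bar> + 1 \<and> 1 \<le> t \<and> \<bar>poly q 0\<bar> + 1 \<le> t"
    by (intro eventually_conj ev_poly_bound eventually_ge_at_top)
  then have "\<forall>\<^sub>F t in at_top. \<bar>poly (truncate_fps ?K F) (s t) * inverse (s t ^ m) - poly (truncate_fps ?K' F) (s t) * inverse (s t ^ m)\<bar> \<le> 1 / t ^ L"
  proof eventually_elim
    case (elim t)
    then have t: "1 \<le> t" and t0: "0 < t" and q1: "\<bar>poly q (s t)\<bar> \<le> t" by auto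
    have "poly (truncate_fps ?K F) (s t) * inverse (s t ^ m) - poly (truncate_fps ?K' F) (s t) * inverse (s t ^ m)
      = poly (truncate_fps ?K F - truncate_fps ?K' F) (s t) * inverse (s t ^ m)" by (simp add: algebra_simps)
    also have "\<dots> = (1 / t ^ (L + 5) * inverse (s t ^ m)) * poly q (s t)"
      unfolding q using s_power[OF t0] by (simp add: poly_monom power_mult power_divide)
    also have "\<bar>\<dots>\<bar> = (1 / t ^ (L + 5) * inverse (s t ^ m)) * \<bar>poly q (s t)\<bar>"
      using s_pos[OF t0] t0 by (simp add: abs_mult)
    also have "\<dots> \<le> (1 / t ^ (L + 5) * t) * t"
    proof (intro mult_mono q1)
      have "s t \<le> 1" unfolding s_def using powr_mono[of "- 1 / (2 * real m)" 0 t] t by simp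
      then have "s t ^ m \<le> 1" using s_pos[OF t0] by (intro power_le_one) auto
      have "inverse (s t ^ m) = t * s t ^ m" using s_power_m[OF t0] s_pos[OF t0] t0 by (simp add: field_simps)
      also have "\<dots> \<le> t * 1" using \<open>s t ^ m \<le> 1\<close> t0 by (intro mult_left_mono) auto
      finally show "inverse (s t ^ m) \<le> t" by simp
    qed (use t0 s_pos[OF t0] in auto)
    also have "\<dots> = 1 / t ^ (L + 3)"
    proof -
      have "t ^ (L + 5) = t ^ (L + 3) * (t * t)" by (simp add: power_add power_numeral_reduce)
      then show ?thesis using t0 by simp
    qed
    also have "\<dots> \<le> 1 / t ^ L" by (rule power_quotient_le[OF t]) simp
    finally show ?case .
  qed
  then show ?thesis by (simp add: eventually_at_top_linorder)
qed

text \<open>Closeness at the single level 25 puts the solution into the tube of every finer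
  truncation: deviations of order t^-14 give amplitudes of order t^-13, and in their squares one
  power of \<open>t\<close> absorbs the constant, leaving \<open>1 / t ^ 25\<close>. The decay
  lemmas for rotations and saddles then supply the rate belonging to \<open>L\<close>.\<close>

lemma bootstrap:
  assumes z: "sol z" and cl: "close z 25 14" and L: "25 \<le> L"
  shows "close z L (L - 4)"
proof -
  let ?Xh = "Xh (2 * m * (L + 5))" and ?Yh = "Yh (2 * m * (L + 5))"
  obtain T0 k P Q where T0: "64 \<le> T0"
    and bd: "\<And>t. T0 \<le> t \<Longrightarrow> 1 \<le> P t \<and> P t \<le> t \<and> 0 < Q t \<and> Q t \<le> t \<and> 1 \<le> t * (Q t)\<^sup>2 \<and> \<bar>k t\<bar> \<le> 1"
    and pl: "\<And>X Y t. T0 \<le> t \<Longrightarrow> rates X Y t \<Longrightarrow> planar_at (sgn \<Delta>) L (\<lambda>t. P t * ((X t - ?Xh t) + k t * (Y t - ?Yh t))) (\<lambda>t. Q t * (Y t - ?Yh t)) t"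
    using planar_reduction[of L] by blast
  define u where "u t = P t * ((Re (z t) - ?Xh t) + k t * (Im (z t) - ?Yh t))" for t
  define v where "v t = Q t * (Im (z t) - ?Yh t)" for t
  have pl': "planar_at (sgn \<Delta>) L u v t" if "T0 \<le> t" for t
    unfolding u_def v_def using pl[OF that sol_rates[OF z]] that T0 by auto
  obtain c T1 where c: "\<And>t. T1 \<le> t \<Longrightarrow> \<bar>Re (z t) - Xh (2 * m * (25 + 5)) t\<bar> \<le> c / t ^ 14 \<and> \<bar>Im (z t) - Yh (2 * m * (25 + 5)) t\<bar> \<le> c / t ^ 14"
    using cl unfolding close_def by blast
  obtain T2 where T2: "\<And>t. T2 \<le> t \<Longrightarrow> \<bar>Xh (2 * m * (25 + 5)) t - ?Xh t\<bar> \<le> 1 / t ^ 25"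
    using truncation_difference[OF L, of x] unfolding Xh_def xp_def by blast
  obtain T3 where T3: "\<And>t. T3 \<le> t \<Longrightarrow> \<bar>Yh (2 * m * (25 + 5)) t - ?Yh t\<bar> \<le> 1 / t ^ 25"
    using truncation_difference[OF L, of y] unfolding Yh_def yp_def by blast
  define c' where "c' = \<bar>c\<bar> + 1"
  define t1 where "t1 = Max {T0, T1, T2, T3, 4 * real L, 8 * c'\<^sup>2}"
  have t1: "T0 \<le> t1" "T1 \<le> t1" "T2 \<le> t1" "T3 \<le> t1" "4 * real L \<le> t1" "8 * c'\<^sup>2 \<le> t1" by (auto simp: t1_def)
  have E20: "(u t)\<^sup>2 + (v t)\<^sup>2 \<le> 1 / t ^ 20" if t: "t1 \<le> t" for t
  proof -
    have tt: "T0 \<le> t" "T1 \<le> t" "T2 \<le> t" "T3 \<le> t" "8 * c'\<^sup>2 \<le> t" "1 \<le> t" using t t1 T0 by linarith+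
    have "c / t ^ 14 + 1 / t ^ 25 \<le> c' / t ^ 14"
    proof -
      have "1 / t ^ 25 \<le> 1 / t ^ 14" by (intro power_quotient_le tt) simp
      moreover have "c / t ^ 14 \<le> \<bar>c\<bar> / t ^ 14" using tt by (intro divide_right_mono) auto
      ultimately show ?thesis by (simp add: c'_def add_divide_distrib)
    qed
    then have ab: "\<bar>Re (z t) - ?Xh t\<bar> \<le> c' / t ^ 14" "\<bar>Im (z t) - ?Yh t\<bar> \<le> c' / t ^ 14"
      using c[OF tt(2)] T2[OF tt(3)] T3[OF tt(4)] by linarith+
    have "(u t)\<^sup>2 + (v t)\<^sup>2 \<le> 8 * (t * (c' / t ^ 14))\<^sup>2"
      unfolding u_def v_def using bd[OF tt(1)] by (intro amplitude_from_deviation ab) auto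
    also have "\<dots> = 8 * c'\<^sup>2 / t ^ 26"
      using tt by (simp add: power_mult_distrib power_divide field_simps flip: power_add power_mult)
    also have "\<dots> \<le> t / t ^ 26" using tt by (intro divide_right_mono) auto
    also have "\<dots> = 1 / t ^ 25" using tt by (simp add: power_numeral_reduce)
    also have "\<dots> \<le> 1 / t ^ 20" by (intro power_quotient_le tt) simp
    finally show ?thesis .
  qed
  have "\<exists>c\<ge>0. \<forall>t\<ge>t1. (u t)\<^sup>2 + (v t)\<^sup>2 \<le> c\<^sup>2 / t ^ (2 * (L - 2))"
  proof (cases "0 < \<Delta>")
    case True
    have "(u t)\<^sup>2 + (v t)\<^sup>2 \<le> 1\<^sup>2 / t ^ (2 * (L - 2))" if "t1 \<le> t" for t
    proof -
      have "(u t)\<^sup>2 + (v t)\<^sup>2 \<le> 1 / t ^ (2 * (L - 2))"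
        by (rule elliptic_bootstrap[of t1]) (use pl' t1 T0 L E20 that True in auto)
      then show ?thesis by simp
    qed
    then show ?thesis by (intro exI[of _ 1]) auto
  next
    case False
    then have sg: "sgn \<Delta> = -1" using \<Delta> by simp
    have "\<exists>c. \<forall>t\<ge>t1. (u t)\<^sup>2 + (v t)\<^sup>2 \<le> c / t ^ (2 * L)"
      by (rule hyperbolic_bootstrap) (use pl' t1 T0 L E20 sg in auto)
    then obtain c where c: "\<And>t. t1 \<le> t \<Longrightarrow> (u t)\<^sup>2 + (v t)\<^sup>2 \<le> c / t ^ (2 * L)" by blast
    have "(u t)\<^sup>2 + (v t)\<^sup>2 \<le> (sqrt \<bar>c\<bar>)\<^sup>2 / t ^ (2 * (L - 2))" if "t1 \<le> t" for t
    proof -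
      have t: "1 \<le> t" using that t1 T0 by simp
      have "(u t)\<^sup>2 + (v t)\<^sup>2 \<le> c / t ^ (2 * L)" by (rule c[OF that])
      also have "\<dots> \<le> \<bar>c\<bar> / t ^ (2 * L)" using t by (intro divide_right_mono) auto
      also have "\<dots> \<le> \<bar>c\<bar> / t ^ (2 * (L - 2))" using t by (intro divide_left_mono power_increasing mult_pos_pos) auto
      finally show ?thesis by simp
    qed
    then show ?thesis by (intro exI[of _ "sqrt \<bar>c\<bar>"]) auto
  qed
  then obtain c2 where c2: "0 \<le> c2" "\<And>t. t1 \<le> t \<Longrightarrow> (u t)\<^sup>2 + (v t)\<^sup>2 \<le> c2\<^sup>2 / t ^ (2 * (L - 2))" by blast
  have LL: "L - 2 = Suc (L - 3)" using L by simp
  have fin: "\<bar>Re (z t) - ?Xh t\<bar> \<le> 2 * c2 / t ^ (L - 4) \<and> \<bar>Im (z t) - ?Yh t\<bar> \<le> 2 * c2 / t ^ (L - 4)" if t: "t1 \<le> t" for t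
  proof -
    have tt: "T0 \<le> t" "1 \<le> t" using t t1 T0 by linarith+
    have "2 * c2 / t ^ (L - 3) \<le> 2 * c2 / t ^ (L - 4)"
      using tt c2(1) by (intro divide_left_mono power_increasing mult_pos_pos) auto
    moreover have "\<bar>Re (z t) - ?Xh t\<bar> \<le> 2 * c2 / t ^ (L - 3)" "\<bar>Im (z t) - ?Yh t\<bar> \<le> 2 * c2 / t ^ (L - 3)"
      using deviation_from_amplitude[of "P t" "Q t" t "k t" c2 "Re (z t) - ?Xh t" "Im (z t) - ?Yh t" "L - 3"]
        bd[OF tt(1)] tt c2(1) c2(2)[OF t] unfolding u_def v_def LL by blast+
    ultimately show ?thesis by linarith
  qed
  show ?thesis unfolding close_def by (rule exI[of _ "2 * c2"], rule exI[of _ t1]) (use fin in blast)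
qed

lemma tube_close:
  assumes T: "1 \<le> T"
    and bd: "\<And>t. T \<le> t \<Longrightarrow> 1 \<le> P t \<and> P t \<le> t \<and> 0 < Q t \<and> Q t \<le> t \<and> 1 \<le> t * (Q t)\<^sup>2 \<and> \<bar>k t\<bar> \<le> 1"
    and E: "\<And>t. T \<le> t \<Longrightarrow> (P t * ((Re (z t) - Xh (2 * m * (25 + 5)) t) + k t * (Im (z t) - Yh (2 * m * (25 + 5)) t)))\<^sup>2
       + (Q t * (Im (z t) - Yh (2 * m * (25 + 5)) t))\<^sup>2 \<le> 1 / t ^ 32"
  shows "close z 25 14"
  unfolding close_def
proof (rule exI[of _ 2], rule exI[of _ T], intro allI impI)
  fix t assume t: "T \<le> t"
  have t1: "1 \<le> t" using t T by simp
  have "2 * 1 / t ^ 15 \<le> 2 / t ^ 14" using power_quotient_le[OF t1, of 14 15] by simp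
  moreover have "\<bar>Re (z t) - Xh (2 * m * (25 + 5)) t\<bar> \<le> 2 * 1 / t ^ 15" "\<bar>Im (z t) - Yh (2 * m * (25 + 5)) t\<bar> \<le> 2 * 1 / t ^ 15"
    using deviation_from_amplitude[of "P t" "Q t" t "k t" 1 "Re (z t) - Xh (2 * m * (25 + 5)) t" "Im (z t) - Yh (2 * m * (25 + 5)) t" 15]
      bd[OF t] t1 E[OF t] by simp_all
  ultimately show "\<bar>Re (z t) - Xh (2 * m * (25 + 5)) t\<bar> \<le> 2 / t ^ 14 \<and> \<bar>Im (z t) - Yh (2 * m * (25 + 5)) t\<bar> \<le> 2 / t ^ 14"
    by linarith
qed

text \<open>The tube around solutions matched to the formal one at \<open>T + n\<close> does not
  depend on \<open>n\<close>, so their values at the fixed time \<open>T\<close> are bounded and a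
  subsequence converges. By continuous dependence the solution through the limit inherits the tube
  at every later time.\<close>

lemma close_solution_elliptic:
  assumes \<Delta>0: "0 < \<Delta>"
  shows "\<exists>z. sol z \<and> close z 25 14"
proof -
  let ?Xh = "Xh (2 * m * (25 + 5))" and ?Yh = "Yh (2 * m * (25 + 5))"
  obtain T k P Q where T: "64 \<le> T"
    and bd: "\<And>t. T \<le> t \<Longrightarrow> 1 \<le> P t \<and> P t \<le> t \<and> 0 < Q t \<and> Q t \<le> t \<and> 1 \<le> t * (Q t)\<^sup>2 \<and> \<bar>k t\<bar> \<le> 1"
    and pl: "\<And>X Y t. T \<le> t \<Longrightarrow> rates X Y t \<Longrightarrow> planar_at (sgn \<Delta>) 25 (\<lambda>t. P t * ((X t - ?Xh t) + k t * (Y t - ?Yh t))) (\<lambda>t. Q t * (Y t - ?Yh t)) t"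
    using planar_reduction[of 25] by blast
  define u where "u z t = P t * ((Re (z t) - ?Xh t) + k t * (Im (z t) - ?Yh t))" for z t
  define v where "v z t = Q t * (Im (z t) - ?Yh t)" for z t
  have pl': "planar_at (sgn \<Delta>) 25 (u z) (v z) t" if "sol z" "T \<le> t" for z t
    unfolding u_def[abs_def] v_def[abs_def] using pl[OF that(2) sol_rates[OF that(1)]] that T by auto
  have "\<forall>n. \<exists>z. sol z \<and> z (T + real n) = Complex (?Xh (T + real n)) (?Yh (T + real n))"
    using T by (intro allI sol_exists) simp
  then obtain zn where zn: "\<And>n. sol (zn n)" "\<And>n. zn n (T + real n) = Complex (?Xh (T + real n)) (?Yh (T + real n))" by metis
  have tube: "(u (zn n) t)\<^sup>2 + (v (zn n) t)\<^sup>2 \<le> 1 / t ^ 32" if t: "t \<in> {T..T + real n}" for n t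
  proof (rule elliptic_tube[where ?t1.0=T and T="T + real n" and L=25])
    show "planar_at 1 25 (u (zn n)) (v (zn n)) t" if "t \<in> {T..T + real n}" for t
      using pl'[OF zn(1)[of n], of t] that \<Delta>0 by simp
    show "u (zn n) (T + real n) = 0" "v (zn n) (T + real n) = 0" by (simp_all add: u_def v_def zn(2))
  qed (use t T in auto)
  have "bounded (range (\<lambda>n. zn n T))"
    unfolding bounded_iff
  proof (intro exI ballI)
    fix w assume "w \<in> range (\<lambda>n. zn n T)"
    then obtain n where w: "w = zn n T" by auto
    have TT: "T \<le> T" by simp
    have "(u (zn n) T)\<^sup>2 + (v (zn n) T)\<^sup>2 \<le> 1\<^sup>2 / T ^ (2 * Suc 15)" using tube[of T n] by simp
    then have "\<bar>Re w - ?Xh T\<bar> \<le> 2 * 1 / T ^ 15" "\<bar>Im w - ?Yh T\<bar> \<le> 2 * 1 / T ^ 15"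
      using deviation_from_amplitude[of "P T" "Q T" T "k T" 1 "Re w - ?Xh T" "Im w - ?Yh T" 15] bd[OF TT] T
      unfolding w u_def v_def by simp_all
    moreover have "2 * 1 / T ^ 15 \<le> 2" using one_le_power[of T 15] T by (simp add: divide_le_eq)
    ultimately have "\<bar>Re w\<bar> \<le> \<bar>?Xh T\<bar> + 2" "\<bar>Im w\<bar> \<le> \<bar>?Yh T\<bar> + 2" by linarith+
    then show "norm w \<le> (\<bar>?Xh T\<bar> + 2) + (\<bar>?Yh T\<bar> + 2)" using cmod_le[of w] by linarith
  qed
  from bounded_imp_convergent_subsequence[OF this] obtain l r where r: "strict_mono r" "((\<lambda>n. zn n T) \<circ> r) \<longlonglongrightarrow> l" by blast
  have T0: "0 \<le> T" using T by simp
  obtain z where z: "sol z" "z T = l" using sol_exists[OF T0] by blast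
  have conv: "(\<lambda>n. zn (r n) t) \<longlonglongrightarrow> z t" if t: "T \<le> t" for t
  proof (rule tendstoI)
    fix e :: real assume e: "0 < e"
    obtain d where d: "d > 0" "\<And>y. sol y \<Longrightarrow> norm (y T - z T) < d \<Longrightarrow> norm (y t - z t) < e"
      using sol_dependence[OF T0 t z(1) e] t by fastforce
    have "\<forall>\<^sub>F n in sequentially. dist (((\<lambda>n. zn n T) \<circ> r) n) l < d" by (rule tendstoD[OF r(2) d(1)])
    then show "\<forall>\<^sub>F n in sequentially. dist (zn (r n) t) (z t) < e"
      by eventually_elim (use d(2)[OF zn(1)] z(2) in \<open>simp add: dist_norm\<close>)
  qed
  have "(u z t)\<^sup>2 + (v z t)\<^sup>2 \<le> 1 / t ^ 32" if t: "T \<le> t" for t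
  proof (rule tendsto_upperbound)
    show "(\<lambda>n. (u (zn (r n)) t)\<^sup>2 + (v (zn (r n)) t)\<^sup>2) \<longlonglongrightarrow> (u z t)\<^sup>2 + (v z t)\<^sup>2"
      unfolding u_def v_def by (intro tendsto_intros conv t)
    have "\<forall>\<^sub>F n in sequentially. t - T \<le> real n"
      by (metis eventually_at_top_linorder le_nat_iff nat_ceiling_le_eq real_nat_ceiling_ge order_trans of_nat_le_iff)
    then show "\<forall>\<^sub>F n in sequentially. (u (zn (r n)) t)\<^sup>2 + (v (zn (r n)) t)\<^sup>2 \<le> 1 / t ^ 32"
    proof eventually_elim
      case (elim n)
      have "real n \<le> real (r n)" using seq_suble[OF r(1)] by simp
      then show ?case using elim t by (intro tube) auto
    qed
  qed simp
  then have "close z 25 14" using T unfolding u_def v_def by (intro tube_close[OF _ bd]) auto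
  then show ?thesis using z(1) by blast
qed

lemma close_solution_hyperbolic:
  assumes \<Delta>0: "\<Delta> < 0"
  shows "\<exists>z. sol z \<and> close z 25 14"
proof -
  let ?Xh = "Xh (2 * m * (25 + 5))" and ?Yh = "Yh (2 * m * (25 + 5))"
  obtain T k P Q where T: "64 \<le> T"
    and bd: "\<And>t. T \<le> t \<Longrightarrow> 1 \<le> P t \<and> P t \<le> t \<and> 0 < Q t \<and> Q t \<le> t \<and> 1 \<le> t * (Q t)\<^sup>2 \<and> \<bar>k t\<bar> \<le> 1"
    and pl: "\<And>X Y t. T \<le> t \<Longrightarrow> rates X Y t \<Longrightarrow> planar_at (sgn \<Delta>) 25 (\<lambda>t. P t * ((X t - ?Xh t) + k t * (Y t - ?Yh t))) (\<lambda>t. Q t * (Y t - ?Yh t)) t"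
    using planar_reduction[of 25] by blast
  have T0: "0 \<le> T" "0 < T" using T by auto
  have PQ0: "P T \<noteq> 0" "Q T \<noteq> 0" using bd[of T] by auto
  \<comment> \<open>\<open>\<alpha>\<close> and \<open>\<beta>\<close> are the deviations per unit
    of \<open>c\<close> that realize \<open>u = v = c / (2 * T ^ 16)\<close>, a segment in the
    expanding direction.\<close>
  define \<beta> where "\<beta> = 1 / (2 * T ^ 16) / Q T"
  define \<alpha> where "\<alpha> = 1 / (2 * T ^ 16) / P T - k T * \<beta>"
  define w where "w c = Complex (?Xh T + c * \<alpha>) (?Yh T + c * \<beta>)" for c
  have "\<forall>c. \<exists>z. sol z \<and> z T = w c" by (intro allI sol_exists T0)
  then obtain zc where zc: "\<And>c. sol (zc c)" "\<And>c. zc c T = w c" by metis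
  define u where "u c t = P t * ((Re (zc c t) - ?Xh t) + k t * (Im (zc c t) - ?Yh t))" for c t
  define v where "v c t = Q t * (Im (zc c t) - ?Yh t)" for c t
  have pl': "planar_at (-1) 25 (u c) (v c) t" if "T \<le> t" for c t
    unfolding u_def[abs_def] v_def[abs_def] using pl[OF that sol_rates[OF zc(1)]] that T \<Delta>0 by auto
  have init: "u c T = c / (2 * T ^ 16)" "v c T = c / (2 * T ^ 16)" for c
  proof -
    have "u c T = P T * (c * \<alpha> + k T * (c * \<beta>))" by (simp add: u_def zc(2) w_def)
    also have "\<dots> = c * (P T * (\<alpha> + k T * \<beta>))" by (simp add: algebra_simps)
    also have "P T * (\<alpha> + k T * \<beta>) = 1 / (2 * T ^ 16)" using PQ0 by (simp add: \<alpha>_def)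
    finally show "u c T = c / (2 * T ^ 16)" by simp
    show "v c T = c / (2 * T ^ 16)" using PQ0 by (simp add: v_def zc(2) w_def \<beta>_def)
  qed
  have cd: "\<exists>d>0. \<forall>c'\<in>{-2..2}. \<bar>c' - c\<bar> < d \<longrightarrow> (\<forall>t\<in>{T..T'}. \<bar>u c' t - u c t\<bar> < e \<and> \<bar>v c' t - v c t\<bar> < e)"
    if T': "T \<le> T'" and e: "0 < e" for c T' e
  proof -
    have T'0: "0 < T'" using T' T0 by simp
    then have e': "0 < e / (2 * T')" using e by simp
    obtain d where d: "d > 0" "\<And>y t. sol y \<Longrightarrow> norm (y T - zc c T) < d \<Longrightarrow> t \<in> {T..T'} \<Longrightarrow> norm (y t - zc c t) < e / (2 * T')"
      using sol_dependence[OF T0(1) T' zc(1) e'] by blast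
    define N where "N = \<bar>\<alpha>\<bar> + \<bar>\<beta>\<bar> + 1"
    have N: "0 < N" by (simp add: N_def add_nonneg_pos)
    have uv: "\<bar>u c' t - u c t\<bar> < e \<and> \<bar>v c' t - v c t\<bar> < e" if c': "\<bar>c' - c\<bar> < d / N" and t: "t \<in> {T..T'}" for c' t
    proof -
      have "norm (zc c' T - zc c T) \<le> \<bar>Re (zc c' T - zc c T)\<bar> + \<bar>Im (zc c' T - zc c T)\<bar>" by (rule cmod_le)
      also have "\<dots> = \<bar>c' - c\<bar> * (\<bar>\<alpha>\<bar> + \<bar>\<beta>\<bar>)"
        by (simp add: zc(2) w_def algebra_simps flip: left_diff_distrib abs_mult)
      also have "\<dots> \<le> \<bar>c' - c\<bar> * N" by (intro mult_left_mono) (auto simp: N_def)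
      also have "\<dots> < d" using c' N by (simp add: pos_less_divide_eq)
      finally have n: "norm (zc c' t - zc c t) < e / (2 * T')" by (rule d(2)[OF zc(1) _ t])
      define p where "p = Re (zc c' t) - Re (zc c t)"
      define q where "q = Im (zc c' t) - Im (zc c t)"
      have pq: "\<bar>p\<bar> < e / (2 * T')" "\<bar>q\<bar> < e / (2 * T')"
        using n abs_Re_le_cmod[of "zc c' t - zc c t"] abs_Im_le_cmod[of "zc c' t - zc c t"] by (auto simp: p_def q_def)
      have b: "0 < P t" "P t \<le> T'" "0 < Q t" "Q t \<le> T'" "\<bar>k t\<bar> \<le> 1" using bd[of t] t by auto
      have "\<bar>k t * q\<bar> \<le> 1 * \<bar>q\<bar>" unfolding abs_mult using b by (intro mult_right_mono) auto
      then have pk: "\<bar>p + k t * q\<bar> < e / T'" using pq by (simp add: field_simps)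
      have "u c' t - u c t = P t * (p + k t * q)" by (simp add: u_def p_def q_def algebra_simps)
      then have "\<bar>u c' t - u c t\<bar> = P t * \<bar>p + k t * q\<bar>" using b by (simp add: abs_mult)
      also have "\<dots> \<le> T' * \<bar>p + k t * q\<bar>" using b by (intro mult_right_mono) auto
      also have "\<dots> < T' * (e / T')" using pk T'0 by (intro mult_strict_left_mono)
      finally have 1: "\<bar>u c' t - u c t\<bar> < e" using T'0 by simp
      have "v c' t - v c t = Q t * q" by (simp add: v_def q_def algebra_simps)
      then have "\<bar>v c' t - v c t\<bar> = Q t * \<bar>q\<bar>" using b by (simp add: abs_mult)
      also have "\<dots> \<le> T' * \<bar>q\<bar>" using b by (intro mult_right_mono) auto
      also have "\<dots> < T' * (e / (2 * T'))" using pq T'0 by (intro mult_strict_left_mono)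
      also have "\<dots> \<le> e" using T'0 e by simp
      finally show ?thesis using 1 by simp
    qed
    show ?thesis using d(1) N uv by (intro exI[of _ "d / N"]) auto
  qed
  have "\<exists>c\<in>{-2..2}. \<forall>t\<ge>T. (u c t)\<^sup>2 + (v c t)\<^sup>2 \<le> 1 / t ^ 32"
    by (rule hyperbolic_tube[where L=25]) (use T in \<open>auto intro: pl' cd init\<close>)
  then obtain c where c: "\<And>t. T \<le> t \<Longrightarrow> (u c t)\<^sup>2 + (v c t)\<^sup>2 \<le> 1 / t ^ 32" by blast
  then have "close (zc c) 25 14" using T unfolding u_def v_def by (intro tube_close[OF _ bd]) auto
  then show ?thesis using zc(1) by blast
qed

text \<open>One and the same solution serves all levels, since \<open>bootstrap\<close> starts from
  level 25 only; solutions built separately for each \<open>L\<close> might differ from one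
  another.\<close>

theorem close_solution: "\<exists>z. sol z \<and> (\<forall>L\<ge>25. close z L (L - 4))"
  using close_solution_elliptic close_solution_hyperbolic bootstrap \<Delta> by (metis linorder_neqE_linordered_idom)

end

section \<open>Asymptotic power series\<close>

text \<open>A variant of \<open>asymp_exp\<close> in integer powers of a small scale
  \<open>s\<close>, with the coefficients gathered in one formal series, so that calculations with
  expansions become calculations with series.\<close>

definition asy :: "(real \<Rightarrow> real) \<Rightarrow> (real \<Rightarrow> real) \<Rightarrow> real fps \<Rightarrow> bool" where
  "asy s f F \<longleftrightarrow> (\<forall>N. (\<lambda>t. f t - poly (truncate_fps N F) (s t)) \<in> O[at_top](\<lambda>t. s t ^ N))"

locale scale =
  fixes s :: "real \<Rightarrow> real"
  assumes pos: "\<forall>\<^sub>F t in at_top. 0 < s t" and lim0: "(s \<longlongrightarrow> 0) at_top"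
begin

lemma poly_tendsto: "((\<lambda>t. poly p (s t)) \<longlongrightarrow> poly p 0) at_top"
  by (rule isCont_tendsto_compose[OF poly_isCont lim0])

lemma poly_bigo_1: "(\<lambda>t. poly p (s t)) \<in> O[at_top](\<lambda>_. 1)"
  by (rule bigoI_tendsto[OF _ always_eventually]) (use poly_tendsto[of p] in auto)

lemma agree_bigo:
  assumes "agree N (fps_of_poly p) (fps_of_poly q)"
  shows "(\<lambda>t. poly p (s t) - poly q (s t)) \<in> O[at_top](\<lambda>t. s t ^ N)"
proof -
  have "agree N (fps_of_poly (p - q)) 0" using assms by (simp add: agree_def)
  from agree_zero_dvd[OF this] obtain r where r: "p - q = monom 1 N * r" by blast
  have "(\<lambda>t. s t ^ N * poly r (s t)) \<in> O[at_top](\<lambda>t. s t ^ N * 1)"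
    by (intro landau_o.big.mult landau_o.big_refl poly_bigo_1)
  moreover have "poly p u - poly q u = u ^ N * poly r u" for u
    using arg_cong[OF r, of "\<lambda>p. poly p u"] by (simp add: poly_monom)
  ultimately show ?thesis by simp
qed

lemma asyD:
  assumes f: "asy s f F" and p: "agree N (fps_of_poly p) F"
  shows "(\<lambda>t. f t - poly p (s t)) \<in> O[at_top](\<lambda>t. s t ^ N)"
proof -
  have "agree N (fps_of_poly (truncate_fps N F)) (fps_of_poly p)"
    using p agree_truncate[of N F] by (simp add: agree_def)
  from sum_in_bigo(1)[OF f[unfolded asy_def, rule_format, of N] agree_bigo[OF this]] show ?thesis by simp
qed

text \<open>Any polynomial congruent to the series may stand in for its truncation, so products of
  truncations need not be truncated again.\<close>

lemma asyI:
  assumes "\<And>N. \<exists>p. agree N (fps_of_poly p) F \<and> (\<lambda>t. f t - poly p (s t)) \<in> O[at_top](\<lambda>t. s t ^ N)"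
  shows "asy s f F"
  unfolding asy_def
proof
  fix N
  obtain p where p: "agree N (fps_of_poly p) F" "(\<lambda>t. f t - poly p (s t)) \<in> O[at_top](\<lambda>t. s t ^ N)" using assms by blast
  have "agree N (fps_of_poly p) (fps_of_poly (truncate_fps N F))"
    using p(1) agree_truncate[of N F] by (simp add: agree_def)
  from sum_in_bigo(1)[OF p(2) agree_bigo[OF this]] show "(\<lambda>t. f t - poly (truncate_fps N F) (s t)) \<in> O[at_top](\<lambda>t. s t ^ N)" by simp
qed

lemma asy_bounded: "asy s f F \<Longrightarrow> f \<in> O[at_top](\<lambda>_. 1)"
  using asyD[of f F 0 0] by (simp add: agree_def)

lemma asy_tendsto: 
  assumes "asy s f F"
  shows "(f \<longlongrightarrow> fps_nth F 0) at_top"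
proof -
  have "agree 1 (fps_of_poly [:fps_nth F 0:]) F" by (simp add: agree_def)
  from asyD[OF assms this] have "(\<lambda>t. f t - fps_nth F 0) \<in> O[at_top](s)" by simp
  moreover have "s \<in> o[at_top](\<lambda>_. 1)" using lim0 by (intro smalloI_tendsto) auto
  ultimately have "(\<lambda>t. f t - fps_nth F 0) \<in> o[at_top](\<lambda>_. 1)" by (rule landau_o.big_small_trans)
  from smalloD_tendsto[OF this] have "((\<lambda>t. f t - fps_nth F 0) \<longlongrightarrow> 0) at_top" by simp
  then show ?thesis by (rule LIM_zero_cancel)
qed

lemma asy_poly: "asy s (\<lambda>t. poly p (s t)) (fps_of_poly p)"
  by (rule asyI) (auto intro!: exI[of _ p] agree_refl)

lemma asy_const: "asy s (\<lambda>_. c) (fps_const c)"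
  using asy_poly[of "[:c:]"] by (simp add: fps_of_poly_const)

lemma asy_add:
  assumes "asy s f F" "asy s g G"
  shows "asy s (\<lambda>t. f t + g t) (F + G)"
proof (rule asyI)
  fix N
  have "(\<lambda>t. (f t - poly (truncate_fps N F) (s t)) + (g t - poly (truncate_fps N G) (s t))) \<in> O[at_top](\<lambda>t. s t ^ N)"
    by (intro sum_in_bigo asyD[OF assms(1)] asyD[OF assms(2)] agree_truncate)
  moreover have "agree N (fps_of_poly (truncate_fps N F + truncate_fps N G)) (F + G)"
    unfolding fps_of_poly_add by (intro agree_add agree_truncate)
  ultimately show "\<exists>p. agree N (fps_of_poly p) (F + G) \<and> (\<lambda>t. f t + g t - poly p (s t)) \<in> O[at_top](\<lambda>t. s t ^ N)"
    by (intro exI[of _ "truncate_fps N F + truncate_fps N G"]) (simp add: algebra_simps)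
qed

lemma asy_mult:
  assumes "asy s f F" "asy s g G"
  shows "asy s (\<lambda>t. f t * g t) (F * G)"
proof (rule asyI)
  fix N
  let ?p = "truncate_fps N F" and ?q = "truncate_fps N G"
  have "(\<lambda>t. (f t - poly ?p (s t)) * g t + poly ?p (s t) * (g t - poly ?q (s t))) \<in> O[at_top](\<lambda>t. s t ^ N)"
  proof (rule sum_in_bigo)
    show "(\<lambda>t. (f t - poly ?p (s t)) * g t) \<in> O[at_top](\<lambda>t. s t ^ N)"
      using landau_o.big.mult[OF asyD[OF assms(1) agree_truncate] asy_bounded[OF assms(2)]] by simp
    show "(\<lambda>t. poly ?p (s t) * (g t - poly ?q (s t))) \<in> O[at_top](\<lambda>t. s t ^ N)"
      using landau_o.big.mult[OF poly_bigo_1 asyD[OF assms(2) agree_truncate]] by simp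
  qed
  moreover have "agree N (fps_of_poly (?p * ?q)) (F * G)"
    unfolding fps_of_poly_mult by (intro agree_mult agree_truncate)
  ultimately show "\<exists>p. agree N (fps_of_poly p) (F * G) \<and> (\<lambda>t. f t * g t - poly p (s t)) \<in> O[at_top](\<lambda>t. s t ^ N)"
    by (intro exI[of _ "?p * ?q"]) (simp add: algebra_simps)
qed

lemma inverse_bigo_1:
  assumes "(f \<longlongrightarrow> l) at_top" "l \<noteq> (0::real)"
  shows "(\<lambda>t. inverse (f t)) \<in> O[at_top](\<lambda>_. 1)"
  by (rule bigoI_tendsto[of _ _ "inverse l"]) (use tendsto_inverse[OF assms] in auto)

lemma asy_inverse:
  assumes f: "asy s f F" and F0: "fps_nth F 0 \<noteq> 0"
  shows "asy s (\<lambda>t. inverse (f t)) (inverse F)"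
proof (rule asyI)
  fix N
  let ?p = "truncate_fps N F" and ?q = "truncate_fps N (inverse F)"
  have lim: "(f \<longlongrightarrow> fps_nth F 0) at_top" by (rule asy_tendsto[OF f])
  have "agree N (fps_of_poly 1) (fps_of_poly (?p * ?q))"
  proof -
    have "agree N (fps_of_poly (?p * ?q)) (F * inverse F)"
      unfolding fps_of_poly_mult by (intro agree_mult agree_truncate)
    then show ?thesis using F0 by (simp add: inverse_mult_eq_1' agree_def)
  qed
  from agree_bigo[OF this] have 1: "(\<lambda>t. 1 - poly ?p (s t) * poly ?q (s t)) \<in> O[at_top](\<lambda>t. s t ^ N)" by simp
  have 2: "(\<lambda>t. (f t - poly ?p (s t)) * poly ?q (s t)) \<in> O[at_top](\<lambda>t. s t ^ N)"
    using landau_o.big.mult[OF asyD[OF f agree_truncate] poly_bigo_1] by simp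
  have "(\<lambda>t. ((1 - poly ?p (s t) * poly ?q (s t)) - (f t - poly ?p (s t)) * poly ?q (s t)) * inverse (f t)) \<in> O[at_top](\<lambda>t. s t ^ N)"
    using landau_o.big.mult[OF sum_in_bigo(2)[OF 1 2] inverse_bigo_1[OF lim F0]] by simp
  moreover have "\<forall>\<^sub>F t in at_top. ((1 - poly ?p (s t) * poly ?q (s t)) - (f t - poly ?p (s t)) * poly ?q (s t)) * inverse (f t) = inverse (f t) - poly ?q (s t)"
    using tendsto_imp_eventually_ne[OF lim F0] by eventually_elim (simp add: field_simps)
  ultimately have "(\<lambda>t. inverse (f t) - poly ?q (s t)) \<in> O[at_top](\<lambda>t. s t ^ N)"
    by (simp cong: landau_o.big.in_cong)
  then show "\<exists>p. agree N (fps_of_poly p) (inverse F) \<and> (\<lambda>t. inverse (f t) - poly p (s t)) \<in> O[at_top](\<lambda>t. s t ^ N)"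
    using agree_truncate by blast
qed

lemma asy_sqrt:
  assumes f: "asy s f F" and G: "G * G = F" "0 < fps_nth G 0"
  shows "asy s (\<lambda>t. sqrt (f t)) G"
proof (rule asyI)
  fix N
  show "\<exists>p. agree N (fps_of_poly p) G \<and> (\<lambda>t. sqrt (f t) - poly p (s t)) \<in> O[at_top](\<lambda>t. s t ^ N)"
  proof (cases "N = 0")
    \<comment> \<open>The truncation of length 0 misses the constant term, so the divisor used in
      the other case would have a different limit; boundedness is enough here.\<close>
    case True
    have "((\<lambda>t. sqrt (f t)) \<longlongrightarrow> sqrt (fps_nth F 0)) at_top" by (intro tendsto_real_sqrt asy_tendsto f)
    then have "(\<lambda>t. sqrt (f t)) \<in> O[at_top](\<lambda>_. 1)" by (intro bigoI_tendsto) auto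
    then show ?thesis using True by (intro exI[of _ 0]) (simp add: agree_def)
  next
    case False
    let ?q = "truncate_fps N G"
    have F0: "fps_nth F 0 = (fps_nth G 0)\<^sup>2" using G(1) by (auto simp: power2_eq_square)
    have lim: "((\<lambda>t. sqrt (f t) + poly ?q (s t)) \<longlongrightarrow> fps_nth G 0 + fps_nth G 0) at_top"
    proof (rule tendsto_add)
      have "((\<lambda>t. sqrt (f t)) \<longlongrightarrow> sqrt (fps_nth F 0)) at_top" by (intro tendsto_real_sqrt asy_tendsto f)
      then show "((\<lambda>t. sqrt (f t)) \<longlongrightarrow> fps_nth G 0) at_top" using F0 G(2) by simp
      show "((\<lambda>t. poly ?q (s t)) \<longlongrightarrow> fps_nth G 0) at_top"
        using poly_tendsto[of ?q] False by (simp add: poly_0_coeff_0 coeff_truncate_fps)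
    qed
    have "agree N (fps_of_poly (?q * ?q)) F"
      unfolding fps_of_poly_mult G(1)[symmetric] by (intro agree_mult agree_truncate)
    from asyD[OF f this] have 1: "(\<lambda>t. f t - poly ?q (s t) * poly ?q (s t)) \<in> O[at_top](\<lambda>t. s t ^ N)" by simp
    have ne: "fps_nth G 0 + fps_nth G 0 \<noteq> 0" using G(2) by simp
    have 2: "(\<lambda>t. (f t - poly ?q (s t) * poly ?q (s t)) * inverse (sqrt (f t) + poly ?q (s t))) \<in> O[at_top](\<lambda>t. s t ^ N)"
      using landau_o.big.mult[OF 1 inverse_bigo_1[OF lim ne]] by simp
    have "\<forall>\<^sub>F t in at_top. 0 < f t" using order_tendstoD(1)[OF asy_tendsto[OF f], of 0] F0 G(2) by simp
    then have "\<forall>\<^sub>F t in at_top. (f t - poly ?q (s t) * poly ?q (s t)) * inverse (sqrt (f t) + poly ?q (s t)) = sqrt (f t) - poly ?q (s t)"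
      using tendsto_imp_eventually_ne[OF lim ne]
    proof eventually_elim
      case (elim t)
      have "f t - poly ?q (s t) * poly ?q (s t) = (sqrt (f t) - poly ?q (s t)) * (sqrt (f t) + poly ?q (s t))"
        using elim(1) by (simp add: algebra_simps)
      then show ?case using elim(2) by simp
    qed
    then have "(\<lambda>t. sqrt (f t) - poly ?q (s t)) \<in> O[at_top](\<lambda>t. s t ^ N)"
      using 2 by (simp cong: landau_o.big.in_cong)
    then show ?thesis using agree_truncate by blast
  qed
qed

lemma asy_shift:
  assumes f: "asy s f (fps_X ^ k * F)"
  shows "asy s (\<lambda>t. f t / s t ^ k) F"
proof (rule asyI)
  fix N
  let ?p = "truncate_fps N F"
  have "agree (N + k) (fps_of_poly (monom 1 k * ?p)) (fps_X ^ k * F)"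
    by (auto simp: agree_def fps_X_power_mult_nth coeff_monom_mult coeff_truncate_fps)
  from asyD[OF f this] have "(\<lambda>t. f t - s t ^ k * poly ?p (s t)) \<in> O[at_top](\<lambda>t. s t ^ (N + k))" by (simp add: poly_monom)
  then have 1: "(\<lambda>t. (f t - s t ^ k * poly ?p (s t)) * inverse (s t ^ k)) \<in> O[at_top](\<lambda>t. s t ^ (N + k) * inverse (s t ^ k))"
    by (rule landau_o.big.mult) simp
  have 2: "\<forall>\<^sub>F t in at_top. (f t - s t ^ k * poly ?p (s t)) * inverse (s t ^ k) = f t / s t ^ k - poly ?p (s t)"
    using pos by eventually_elim (simp add: field_simps)
  have 3: "\<forall>\<^sub>F t in at_top. s t ^ (N + k) * inverse (s t ^ k) = s t ^ N"
    using pos by eventually_elim (simp add: power_add)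
  have "(\<lambda>t. f t / s t ^ k - poly ?p (s t)) \<in> O[at_top](\<lambda>t. s t ^ N)"
    using 1 unfolding landau_o.big.in_cong[OF 2] landau_o.big.cong[OF 3] .
  then show "\<exists>p. agree N (fps_of_poly p) F \<and> (\<lambda>t. f t / s t ^ k - poly p (s t)) \<in> O[at_top](\<lambda>t. s t ^ N)"
    using agree_truncate by blast
qed

lemma asy_poly_compose:
  assumes w: "asy s w W" and W0: "fps_nth W 0 = 0"
  shows "asy s (\<lambda>t. poly p (w t)) (fps_of_poly p oo W)"
proof (induction p)
  case 0
  show ?case using asy_const[of 0] by simp
next
  case (pCons a p)
  have "asy s (\<lambda>t. a + w t * poly p (w t)) (fps_const a + W * (fps_of_poly p oo W))"
    by (intro asy_add asy_mult asy_const w pCons.IH)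
  moreover have "fps_of_poly (pCons a p) oo W = fps_const a + W * (fps_of_poly p oo W)"
    using W0 by (simp add: fps_of_poly_pCons fps_compose_add_distrib fps_compose_mult_distrib mult.commute)
  ultimately show ?case by simp
qed

text \<open>Only local polynomial approximations of \<open>\<phi>\<close> are asked for: since
  \<open>w\<close> is of order \<open>s\<close>, an error of order \<open>w ^ N\<close> is of order
  \<open>s ^ N\<close>, and polynomials are composed by Horner's scheme.\<close>

lemma asy_compose:
  assumes w: "asy s w W" and W0: "fps_nth W 0 = 0"
    and taylor: "\<And>N. \<exists>p c d. agree N (fps_of_poly p) \<Phi> \<and> 0 < d \<and> (\<forall>u. \<bar>u\<bar> \<le> d \<longrightarrow> \<bar>\<phi> u - poly p u\<bar> \<le> c * \<bar>u\<bar> ^ N)"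
  shows "asy s (\<lambda>t. \<phi> (w t)) (\<Phi> oo W)"
proof (rule asyI)
  fix N
  obtain p c d where p: "agree N (fps_of_poly p) \<Phi>" and d: "0 < d" "\<And>u. \<bar>u\<bar> \<le> d \<Longrightarrow> \<bar>\<phi> u - poly p u\<bar> \<le> c * \<bar>u\<bar> ^ N"
    using taylor[of N] by blast
  have wlim: "(w \<longlongrightarrow> 0) at_top" using asy_tendsto[OF w] W0 by simp
  have "agree 1 (fps_of_poly 0) W" using W0 by (simp add: agree_def)
  from asyD[OF w this] have ws: "w \<in> O[at_top](s)" by simp
  have "\<forall>\<^sub>F t in at_top. norm (\<phi> (w t) - poly p (w t)) \<le> c * norm (w t ^ N)"
    using order_tendstoD(2)[OF tendsto_rabs_zero[OF wlim] d(1)]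
    by eventually_elim (use d(2) in \<open>auto simp: power_abs\<close>)
  then have "(\<lambda>t. \<phi> (w t) - poly p (w t)) \<in> O[at_top](\<lambda>t. w t ^ N)" by (rule bigoI)
  also have "(\<lambda>t. w t ^ N) \<in> O[at_top](\<lambda>t. s t ^ N)" by (rule landau_o.big_power[OF ws])
  finally have 1: "(\<lambda>t. \<phi> (w t) - poly p (w t)) \<in> O[at_top](\<lambda>t. s t ^ N)" .
  let ?q = "truncate_fps N (\<Phi> oo W)"
  have "agree N (\<Phi> oo W) (fps_of_poly p oo W)"
    using p by (auto simp: agree_def fps_compose_nth intro!: sum.cong)
  then have "agree N (fps_of_poly ?q) (fps_of_poly p oo W)"
    by (rule agree_trans[OF agree_truncate])
  from asyD[OF asy_poly_compose[OF w W0] this] have 2: "(\<lambda>t. poly p (w t) - poly ?q (s t)) \<in> O[at_top](\<lambda>t. s t ^ N)" .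
  from sum_in_bigo(1)[OF 1 2] have "(\<lambda>t. \<phi> (w t) - poly ?q (s t)) \<in> O[at_top](\<lambda>t. s t ^ N)" by simp
  then show "\<exists>p. agree N (fps_of_poly p) (\<Phi> oo W) \<and> (\<lambda>t. \<phi> (w t) - poly p (s t)) \<in> O[at_top](\<lambda>t. s t ^ N)"
    using agree_truncate by blast
qed

lemma asy_cong:
  assumes "asy s f F" "\<forall>\<^sub>F t in at_top. f t = g t"
  shows "asy s g F"
  unfolding asy_def
proof
  fix N
  have "\<forall>\<^sub>F t in at_top. f t - poly (truncate_fps N F) (s t) = g t - poly (truncate_fps N F) (s t)"
    using assms(2) by eventually_elim simp
  then show "(\<lambda>t. g t - poly (truncate_fps N F) (s t)) \<in> O[at_top](\<lambda>t. s t ^ N)"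
    using assms(1)[unfolded asy_def, rule_format, of N] by (rule landau_o.big.in_cong[THEN iffD1])
qed

end

definition arctan_series_fps :: "real fps" where
  "arctan_series_fps = Abs_fps (\<lambda>k. if odd k then (- 1) ^ (k div 2) / real k else 0)"

text \<open>The derivative of the partial sum is a finite geometric sum, which differs from
  \<open>inverse (1 + u\<^sup>2)\<close> by exactly
  \<open>u ^ (2 * N) * inverse (1 + u\<^sup>2)\<close> in modulus; the mean value inequality on the
  segment from 0 to \<open>u\<close> does the rest.\<close>

lemma arctan_taylor:
  "\<exists>p c d. agree N (fps_of_poly p) arctan_series_fps \<and> 0 < d \<and> (\<forall>u. \<bar>u\<bar> \<le> d \<longrightarrow> \<bar>arctan u - poly p u\<bar> \<le> c * \<bar>u\<bar> ^ N)"
proof -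
  define p where "p = (\<Sum>j<N. monom ((- 1) ^ j / real (2 * j + 1)) (2 * j + 1))"
  have "coeff p k = (if odd k then (- 1) ^ (k div 2) / real k else 0)" if k: "k < N" for k
  proof (cases "odd k")
    case True
    then obtain i where i: "k = 2 * i + 1" by (elim oddE)
    have "coeff p k = (\<Sum>j<N. if j = i then (- 1) ^ j / real (2 * j + 1) else 0)"
      unfolding p_def coeff_sum by (intro sum.cong) (auto simp: i)
    also have "\<dots> = (- 1) ^ i / real (2 * i + 1)" using k i by (simp add: sum.delta')
    finally show ?thesis using i by simp
  next
    case False
    have "coeff p k = (\<Sum>j<N. 0)" unfolding p_def coeff_sum using False by (intro sum.cong) (auto simp: coeff_monom)
    then show ?thesis using False by simp
  qed
  then have ag: "agree N (fps_of_poly p) arctan_series_fps"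
    by (simp add: agree_def arctan_series_fps_def)
  have dp: "poly (pderiv p) u = (\<Sum>j<N. (- (u\<^sup>2)) ^ j)" for u
    unfolding p_def by (simp add: higher_pderiv_sum[of 1, simplified] poly_sum pderiv_monom poly_monom power_mult[symmetric] power_minus[of "u\<^sup>2"])
  have rem: "inverse (1 + u\<^sup>2) - poly (pderiv p) u = (- (u\<^sup>2)) ^ N * inverse (1 + u\<^sup>2)" for u :: real
  proof -
    have ne: "1 + u\<^sup>2 \<noteq> 0" by (smt (verit) zero_le_power2)
    have "(\<Sum>j<N. (- (u\<^sup>2)) ^ j) * (1 + u\<^sup>2) = 1 - (- (u\<^sup>2)) ^ N"
      using one_diff_power_eq[of "- (u\<^sup>2)" N] by (simp add: mult.commute)
    then show ?thesis unfolding dp using ne by (simp add: field_simps)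
  qed
  have "\<bar>arctan u - poly p u\<bar> \<le> 1 * \<bar>u\<bar> ^ N" if u: "\<bar>u\<bar> \<le> 1" for u
  proof -
    have "\<bar>(arctan u - poly p u) - (arctan 0 - poly p 0)\<bar> \<le> \<bar>u\<bar> ^ N * \<bar>u - 0\<bar>"
    proof (rule field_differentiable_bound[where S="closed_segment 0 u" and f="\<lambda>u. arctan u - poly p u"
          and f'="\<lambda>x. inverse (1 + x\<^sup>2) - poly (pderiv p) x", simplified real_norm_def])
      fix x assume x: "x \<in> closed_segment 0 u"
      then have xu: "\<bar>x\<bar> \<le> \<bar>u\<bar>" by (auto simp: closed_segment_eq_real_ivl split: if_splits)
      show "((\<lambda>u. arctan u - poly p u) has_real_derivative inverse (1 + x\<^sup>2) - poly (pderiv p) x) (at x within closed_segment 0 u)"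
        by (intro DERIV_diff has_field_derivative_at_within[OF DERIV_arctan] has_field_derivative_at_within[OF poly_DERIV])
      have "0 < 1 + x\<^sup>2" by (smt (verit) zero_le_power2)
      moreover have "x ^ N * x ^ N = \<bar>x\<bar> ^ N * \<bar>x\<bar> ^ N" by (metis abs_mult_self_eq power_abs)
      ultimately have "\<bar>inverse (1 + x\<^sup>2) - poly (pderiv p) x\<bar> = \<bar>x\<bar> ^ N * \<bar>x\<bar> ^ N * inverse (1 + x\<^sup>2)"
        unfolding rem by (simp add: abs_mult power_abs[symmetric] power_minus[of "x\<^sup>2"] power_mult[symmetric] mult_2 power_add)
      also have "\<dots> \<le> \<bar>x\<bar> ^ N * 1 * 1"
      proof (intro mult_mono)
        show "\<bar>x\<bar> ^ N \<le> 1" using xu u by (intro power_le_one) auto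
        show "inverse (1 + x\<^sup>2) \<le> 1" by (intro inverse_le_1_iff[THEN iffD2]) simp
      qed auto
      also have "\<dots> \<le> \<bar>u\<bar> ^ N" using xu by (simp add: power_mono)
      finally show "\<bar>inverse (1 + x\<^sup>2) - poly (pderiv p) x\<bar> \<le> \<bar>u\<bar> ^ N" .
    qed auto
    moreover have "poly p 0 = 0" by (simp add: p_def poly_sum poly_monom)
    moreover have "\<bar>u\<bar> ^ N * \<bar>u\<bar> \<le> \<bar>u\<bar> ^ N * 1" using u by (intro mult_left_mono) auto
    ultimately show ?thesis by simp
  qed
  then show ?thesis using ag by (intro exI[of _ p] exI[of _ 1]) (auto intro!: exI[of _ "1::real"])
qed

section \<open>Solutions of the original system\<close>

lemma polar_arctan:
  assumes "0 < Re w"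
  shows "w = of_real (norm w) * cis (arctan (Im w / Re w))"
proof -
  let ?q = "Im w / Re w"
  have "(norm w)\<^sup>2 = (Re w * sqrt (1 + ?q\<^sup>2))\<^sup>2"
    using assms by (simp add: cmod_power2 power_mult_distrib add_nonneg_nonneg) (simp add: field_simps power_divide)
  then have n: "norm w = Re w * sqrt (1 + ?q\<^sup>2)"
    using assms by (simp add: power2_eq_iff_nonneg)
  have "sqrt (1 + ?q\<^sup>2) \<noteq> 0" by (smt (verit) real_sqrt_eq_zero_cancel_iff zero_le_power2)
  then show ?thesis using assms by (simp add: complex_eq_iff n cos_arctan sin_arctan)
qed

lemma fps_sqrt_exists:
  fixes F :: "real fps"
  assumes "0 < fps_nth F 0"
  shows "\<exists>G. G * G = F \<and> fps_nth G 0 = sqrt (fps_nth F 0)"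
proof (intro exI conjI)
  let ?G = "fps_radical root (Suc 1) F"
  have "?G ^ Suc 1 = F" using assms by (intro power_radical[THEN iffD1] real_root_pow_pos2) auto
  then show "?G * ?G = F" by (simp add: power2_eq_square numeral_2_eq_2)
  show "fps_nth ?G 0 = sqrt (fps_nth F 0)" by (simp add: sqrt_def numeral_2_eq_2)
qed

text \<open>The derivative of \<open>z\<close> is computed once by the product rule and once from
  the cubic equation; rotating the resulting pair of real equations by \<open>- \<eta> t\<close>
  gives (MS). Nothing is divided by \<rho>, so the argument includes the zeros of \<rho>.\<close>

lemma MS_solution_of_cubic:
  assumes z: "cubic_sol (Complex (sin \<sigma>) (cos \<sigma>)) lam (\<lambda>t. Complex (- \<mu> t * sin (2 * \<sigma> + \<nu>)) (- \<mu> t * cos (2 * \<sigma> + \<nu>))) z"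
    and polar: "\<And>t. 0 \<le> t \<Longrightarrow> z t = of_real (\<rho> t) * cis (\<eta> t)"
    and \<rho>: "\<And>t. 0 \<le> t \<Longrightarrow> \<exists>D. (\<rho> has_real_derivative D) (at t within {0..})"
    and \<eta>: "\<And>t. 0 \<le> t \<Longrightarrow> \<exists>D. (\<eta> has_real_derivative D) (at t within {0..})"
  shows "MS_solution lam \<nu> \<mu> \<rho> (\<lambda>t. \<sigma> + \<eta> t)"
  unfolding MS_solution_def
proof (intro allI impI)
  fix t :: real assume t: "0 \<le> t"
  obtain a where a: "(\<rho> has_real_derivative a) (at t within {0..})" using \<rho>[OF t] by blast
  obtain b where b: "(\<eta> has_real_derivative b) (at t within {0..})" using \<eta>[OF t] by blast
  let ?th = "2 * \<sigma> + \<nu>"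
  define z' where "z' = Complex (sin \<sigma>) (cos \<sigma>) + \<i> * of_real ((norm (z t))\<^sup>2 - lam * t) * z t + Complex (- \<mu> t * sin ?th) (- \<mu> t * cos ?th) * cnj (z t)"
  have z': "(z has_vector_derivative z') (at t within {0..})"
    using z t unfolding cubic_sol_def z'_def by blast
  have nontriv: "at t within {0..} \<noteq> bot" 
  proof -
    have "{t<..} \<subseteq> {0..}" using t by auto
    then show ?thesis using at_le[of "{t<..}" "{0..}" t] trivial_limit_at_right_real[of t] by (metis bot_unique)
  qed
  have uniq: "P' = Q'" if "(P has_vector_derivative P') (at t within {0..})" "(Q has_real_derivative Q') (at t within {0..})"
    "\<And>u. 0 \<le> u \<Longrightarrow> P u = Q u" for P Q P' Q'
  proof (rule vector_derivative_unique_within[OF nontriv that(1)])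
    show "(P has_vector_derivative Q') (at t within {0..})"
      using that(2)[unfolded has_real_derivative_iff_has_vector_derivative]
      by (rule has_vector_derivative_transform[rotated 2]) (use that(3) t in auto)
  qed
  have "Re z' = a * cos (\<eta> t) + \<rho> t * (- sin (\<eta> t) * b)"
  proof (rule uniq[OF bounded_linear.has_vector_derivative[OF bounded_linear_Re z']])
    show "((\<lambda>t. \<rho> t * cos (\<eta> t)) has_real_derivative a * cos (\<eta> t) + \<rho> t * (- sin (\<eta> t) * b)) (at t within {0..})"
      by (rule derivative_eq_intros a b refl)+ (simp add: algebra_simps)
  qed (simp add: polar)
  moreover have "Im z' = a * sin (\<eta> t) + \<rho> t * (cos (\<eta> t) * b)"
  proof (rule uniq[OF bounded_linear.has_vector_derivative[OF bounded_linear_Im z']])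
    show "((\<lambda>t. \<rho> t * sin (\<eta> t)) has_real_derivative a * sin (\<eta> t) + \<rho> t * (cos (\<eta> t) * b)) (at t within {0..})"
      by (rule derivative_eq_intros a b refl)+ (simp add: algebra_simps)
  qed (simp add: polar)
  moreover have "norm (z t) ^ 2 = (\<rho> t)\<^sup>2" by (simp add: polar t norm_mult power_mult_distrib)
  ultimately have R: "sin \<sigma> - ((\<rho> t)\<^sup>2 - lam * t) * \<rho> t * sin (\<eta> t) - \<mu> t * \<rho> t * sin (?th + \<eta> t) = a * cos (\<eta> t) - \<rho> t * b * sin (\<eta> t)"
    and I: "cos \<sigma> + ((\<rho> t)\<^sup>2 - lam * t) * \<rho> t * cos (\<eta> t) - \<mu> t * \<rho> t * cos (?th + \<eta> t) = a * sin (\<eta> t) + \<rho> t * b * cos (\<eta> t)"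
    unfolding z'_def by (simp_all add: polar t sin_add cos_add algebra_simps)
  have one: "sin (\<eta> t) * sin (\<eta> t) + cos (\<eta> t) * cos (\<eta> t) = 1" by (metis power2_eq_square sin_cos_squared_add)
  have e: "2 * (\<sigma> + \<eta> t) + \<nu> = (?th + \<eta> t) + \<eta> t" by simp
  have rot: "a = sin \<sigma> * c + cos \<sigma> * s - m * (P * c + Q * s)"
    "r * b = cos \<sigma> * c - sin \<sigma> * s + k - m * (Q * c - P * s)"
    if "sin \<sigma> - k * s - m * P = a * c - r * b * s" "cos \<sigma> + k * c - m * Q = a * s + r * b * c" "s * s + c * c = 1" for s c k m P Q r :: real
    using that by algebra+
  show "\<exists>d\<rho> d\<psi>. (\<rho> has_real_derivative d\<rho>) (at t within {0..}) \<and> ((\<lambda>t. \<sigma> + \<eta> t) has_real_derivative d\<psi>) (at t within {0..}) \<and>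
      d\<rho> + \<mu> t * \<rho> t * sin (2 * (\<sigma> + \<eta> t) + \<nu>) = sin (\<sigma> + \<eta> t) \<and>
      \<rho> t * (d\<psi> - (\<rho> t)\<^sup>2 + lam * t) + \<mu> t * \<rho> t * cos (2 * (\<sigma> + \<eta> t) + \<nu>) = cos (\<sigma> + \<eta> t)"
  proof (rule exI[of _ a], rule exI[of _ b], intro conjI)
    show "(\<rho> has_real_derivative a) (at t within {0..})" by (rule a)
    show "((\<lambda>t. \<sigma> + \<eta> t) has_real_derivative b) (at t within {0..})" using DERIV_add[OF DERIV_const b, of \<sigma>] by simp
    show "a + \<mu> t * \<rho> t * sin (2 * (\<sigma> + \<eta> t) + \<nu>) = sin (\<sigma> + \<eta> t)"
      unfolding e sin_add[of "?th + \<eta> t" "\<eta> t"] sin_add[of \<sigma> "\<eta> t"] using rot(1)[OF R I one] by simp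
    show "\<rho> t * (b - (\<rho> t)\<^sup>2 + lam * t) + \<mu> t * \<rho> t * cos (2 * (\<sigma> + \<eta> t) + \<nu>) = cos (\<sigma> + \<eta> t)"
      unfolding e cos_add[of "?th + \<eta> t" "\<eta> t"] cos_add[of \<sigma> "\<eta> t"] using rot(2)[OF R I one] by (simp add: algebra_simps)
  qed
qed

context expansion_flow
begin

sublocale scale s
  by unfold_locales (rule eventually_mono[OF eventually_gt_at_top s_pos], assumption, rule s_tendsto)

lemma asy_scaled:
  assumes close: "\<And>L. 25 \<le> L \<Longrightarrow> \<exists>c T. \<forall>t\<ge>T. \<bar>f t - poly (truncate_fps (2 * m * (L + 5)) F) (s t) * inverse (s t ^ m)\<bar> \<le> c / t ^ (L - 4)"
  shows "asy s (\<lambda>t. s t ^ m * f t) F"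
proof (rule asyI)
  fix N
  let ?K = "2 * m * (N + 25 + 5)"
  let ?p = "truncate_fps ?K F"
  obtain c T where c: "\<And>t. T \<le> t \<Longrightarrow> \<bar>f t - poly ?p (s t) * inverse (s t ^ m)\<bar> \<le> c / t ^ (N + 21)"
  proof -
    have "N + 25 - 4 = N + 21" by simp
    then show thesis using close[of "N + 25"] that by (metis le_add2)
  qed
  have "1 * N \<le> 2 * m * (N + 25 + 5)" using m by (intro mult_mono) auto
  then have ag: "agree N (fps_of_poly ?p) F" using agree_truncate[of ?K F] by (auto simp: agree_def)
  have "\<forall>\<^sub>F t in at_top. norm (s t ^ m * f t - poly ?p (s t)) \<le> \<bar>c\<bar> * norm (s t ^ N)"
    using eventually_ge_at_top[of "max T 1"]
  proof eventually_elim
    case (elim t)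
    then have t: "T \<le> t" "1 \<le> t" "0 < t" by auto
    have s1: "0 < s t" "s t \<le> 1" using t s_pos powr_mono[of "- 1 / (2 * real m)" 0 t] unfolding s_def by auto
    have le: "N \<le> 2 * m * (N + 21)"
      using mult_mono[of 1 "2 * m" N "N + 21"] m by simp
    have "s t ^ m * f t - poly ?p (s t) = s t ^ m * (f t - poly ?p (s t) * inverse (s t ^ m))"
      using s1 by (simp add: field_simps)
    then have "norm (s t ^ m * f t - poly ?p (s t)) = s t ^ m * \<bar>f t - poly ?p (s t) * inverse (s t ^ m)\<bar>"
      using s1 by (simp add: abs_mult)
    also have "\<dots> \<le> 1 * (\<bar>c\<bar> / t ^ (N + 21))"
    proof (rule mult_mono)
      show "s t ^ m \<le> 1" using s1 by (intro power_le_one) auto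
      show "\<bar>f t - poly ?p (s t) * inverse (s t ^ m)\<bar> \<le> \<bar>c\<bar> / t ^ (N + 21)"
        using t by (intro order_trans[OF c] divide_right_mono) auto
    qed auto
    also have "\<dots> = \<bar>c\<bar> * s t ^ (2 * m * (N + 21))"
      unfolding power_mult[of _ "2 * m"] s_power[OF t(3)] by (simp add: power_divide)
    also have "\<dots> \<le> \<bar>c\<bar> * norm (s t ^ N)" using s1 le by (intro mult_left_mono) (auto intro: power_decreasing)
    finally show ?case .
  qed
  then have "(\<lambda>t. s t ^ m * f t - poly ?p (s t)) \<in> O[at_top](\<lambda>t. s t ^ N)" by (rule bigoI)
  then show "\<exists>p. agree N (fps_of_poly p) F \<and> (\<lambda>t. s t ^ m * f t - poly p (s t)) \<in> O[at_top](\<lambda>t. s t ^ N)" using ag by blast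
qed

lemma polar_asymptotics:
  assumes z: "\<And>L. 25 \<le> L \<Longrightarrow> close z L (L - 4)"
  shows "\<forall>\<^sub>F t in at_top. 0 < Re (z t)"
    and "\<exists>R. asy s (\<lambda>t. norm (z t) - sqrt lam * t powr (1/2)) R \<and> fps_nth R 0 = 0 \<and> fps_nth R 1 = 0"
    and "\<exists>H. asy s (\<lambda>t. arctan (Im (z t) / Re (z t))) H \<and> fps_nth H 0 = 0 \<and> fps_nth H 1 = fps_nth y 1 / sqrt lam"
proof -
  have X: "asy s (\<lambda>t. s t ^ m * Re (z t)) x"
    by (rule asy_scaled) (use z in \<open>unfold close_def Xh_def xp_def, blast\<close>)
  have Y: "asy s (\<lambda>t. s t ^ m * Im (z t)) y"
    by (rule asy_scaled) (use z in \<open>unfold close_def Yh_def yp_def, blast\<close>)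
  have l: "0 < sqrt lam" "sqrt lam * sqrt lam = lam" using lam by simp_all
  have ev: "\<forall>\<^sub>F t in at_top. 0 < s t \<and> (0::real) < t" using pos eventually_gt_at_top[of 0] by eventually_elim simp
  have "\<forall>\<^sub>F t in at_top. 0 < s t ^ m * Re (z t)"
    using order_tendstoD(1)[OF asy_tendsto[OF X], of 0] x0 l by simp
  then show re: "\<forall>\<^sub>F t in at_top. 0 < Re (z t)"
    using pos by eventually_elim (simp add: zero_less_mult_iff)
  let ?F = "x * x + y * y"
  have F0: "fps_nth ?F 0 = lam" using x0 y0 l by simp
  obtain G where G: "G * G = ?F" "fps_nth G 0 = sqrt lam" using fps_sqrt_exists[of ?F] F0 lam by auto
  let ?l = "fps_const (sqrt lam)"
  define H where "H = D * inverse (G + ?l)"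
  \<comment> \<open>From \<open>(G - ?l) * (G + ?l) = fps_X ^ (3 * m) * D\<close> the series
    \<open>G - ?l\<close> is divisible by \<open>fps_X ^ (3 * m)\<close>. One factor
    \<open>fps_X ^ m\<close> is used up in undoing the scaling of the modulus; the remaining
    \<open>fps_X ^ (2 * m)\<close> makes the coefficients of order 0 and 1 vanish.\<close>
  have GH: "G + fps_const (- sqrt lam) = fps_X ^ m * (fps_X ^ (2 * m) * H)"
  proof -
    have ne: "fps_nth (G + ?l) 0 \<noteq> 0" using G(2) l by simp
    have "(G - ?l) * (G + ?l) = G * G - ?l * ?l" by (simp add: algebra_simps)
    also have "\<dots> = fps_X ^ (3 * m) * D"
      using fs[unfolded formal_sol_def, THEN conjunct1] unfolding G(1) by (simp add: abs_of_pos[OF lam])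
    finally have "(G - ?l) * (G + ?l) * inverse (G + ?l) = fps_X ^ (3 * m) * D * inverse (G + ?l)" by simp
    moreover have "(G + ?l) * inverse (G + ?l) = 1" using ne by (rule inverse_mult_eq_1')
    ultimately have "G - ?l = fps_X ^ (3 * m) * H" unfolding H_def by (simp add: mult.assoc)
    moreover have "fps_X ^ (3 * m) = fps_X ^ m * (fps_X ^ (2 * m) :: real fps)" by (simp add: power_add[symmetric])
    ultimately show ?thesis by (simp add: mult.assoc fps_const_neg[symmetric] del: fps_const_neg)
  qed
  have "asy s (\<lambda>t. sqrt ((s t ^ m * Re (z t)) * (s t ^ m * Re (z t)) + (s t ^ m * Im (z t)) * (s t ^ m * Im (z t)))) G"
  proof (rule asy_sqrt[OF _ G(1)])
    show "0 < fps_nth G 0" using G(2) l by simp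
  qed (rule asy_add asy_mult X Y)+
  then have "asy s (\<lambda>t. s t ^ m * norm (z t)) G"
  proof (rule asy_cong)
    show "\<forall>\<^sub>F t in at_top. sqrt ((s t ^ m * Re (z t)) * (s t ^ m * Re (z t)) + (s t ^ m * Im (z t)) * (s t ^ m * Im (z t))) = s t ^ m * norm (z t)"
      using pos
    proof eventually_elim
      case (elim t)
      have "(s t ^ m * Re (z t)) * (s t ^ m * Re (z t)) + (s t ^ m * Im (z t)) * (s t ^ m * Im (z t)) = (s t ^ m * norm (z t))\<^sup>2"
        by (simp add: power_mult_distrib cmod_power2) (simp add: power2_eq_square algebra_simps)
      then show ?case using elim by simp
    qed
  qed
  from asy_add[OF this asy_const[of "- sqrt lam"]]
  have "asy s (\<lambda>t. s t ^ m * norm (z t) + - sqrt lam) (fps_X ^ m * (fps_X ^ (2 * m) * H))"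
    unfolding GH .
  from asy_shift[OF this] have "asy s (\<lambda>t. (s t ^ m * norm (z t) + - sqrt lam) / s t ^ m) (fps_X ^ (2 * m) * H)" .
  then have "asy s (\<lambda>t. norm (z t) - sqrt lam * t powr (1/2)) (fps_X ^ (2 * m) * H)"
  proof (rule asy_cong)
    show "\<forall>\<^sub>F t in at_top. (s t ^ m * norm (z t) + - sqrt lam) / s t ^ m = norm (z t) - sqrt lam * t powr (1/2)"
      using ev
    proof eventually_elim
      case (elim t)
      have "s t ^ m * t powr (1/2) = 1"
        using elim m unfolding s_def by (simp add: powr_power powr_add[symmetric])
      then have "t powr (1/2) = 1 / s t ^ m" using elim by (simp add: field_simps)
      then show ?case using elim by (simp add: field_simps)
    qed
  qed
  moreover have "fps_nth (fps_X ^ (2 * m) * H) 0 = 0" "fps_nth (fps_X ^ (2 * m) * H) 1 = 0"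
    using m by (auto simp: fps_X_power_mult_nth)
  ultimately show "\<exists>R. asy s (\<lambda>t. norm (z t) - sqrt lam * t powr (1/2)) R \<and> fps_nth R 0 = 0 \<and> fps_nth R 1 = 0" by blast
  define W where "W = y * inverse x"
  have W: "fps_nth W 0 = 0" "fps_nth W 1 = fps_nth y 1 / sqrt lam"
    unfolding W_def using y0 x0 by (simp_all add: fps_mult_nth_1 divide_inverse)
  have "asy s (\<lambda>t. s t ^ m * Im (z t) * inverse (s t ^ m * Re (z t))) W"
    unfolding W_def by (intro asy_mult asy_inverse X Y) (use x0 l in simp)
  then have "asy s (\<lambda>t. Im (z t) / Re (z t)) W"
    by (rule asy_cong) (use pos in \<open>eventually_elim, simp add: divide_inverse\<close>)
  from asy_compose[OF this W(1) arctan_taylor]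
  have "asy s (\<lambda>t. arctan (Im (z t) / Re (z t))) (arctan_series_fps oo W)" .
  moreover have "fps_nth (arctan_series_fps oo W) 0 = 0" by (simp add: fps_compose_nth arctan_series_fps_def)
  moreover have "fps_nth (arctan_series_fps oo W) 1 = fps_nth y 1 / sqrt lam"
    using W(2) by (simp add: fps_compose_nth arctan_series_fps_def)
  ultimately show "\<exists>H. asy s (\<lambda>t. arctan (Im (z t) / Re (z t))) H \<and> fps_nth H 0 = 0 \<and> fps_nth H 1 = fps_nth y 1 / sqrt lam" by blast
qed

theorem polar_solution:
  assumes mu_diff: "\<And>t. 0 \<le> t \<Longrightarrow> \<exists>D. (\<mu> has_real_derivative D) (at t within {0..})"
    and AB: "A = sin \<sigma>" "B = cos \<sigma>" and SC: "S = sin (2 * \<sigma> + \<nu>)" "C = cos (2 * \<sigma> + \<nu>)"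
  shows "\<exists>\<rho> \<psi> R H. MS_solution lam \<nu> \<mu> \<rho> \<psi> \<and> asy s (\<lambda>t. \<rho> t - sqrt lam * t powr (1/2)) R \<and> fps_nth R 0 = 0 \<and> fps_nth R 1 = 0 \<and>
    asy s \<psi> H \<and> fps_nth H 0 = \<sigma> \<and> fps_nth H 1 = fps_nth y 1 / sqrt lam"
proof -
  obtain z where z: "sol z" "\<And>L. 25 \<le> L \<Longrightarrow> close z L (L - 4)" using close_solution by blast
  obtain R where R: "asy s (\<lambda>t. norm (z t) - sqrt lam * t powr (1/2)) R" "fps_nth R 0 = 0" "fps_nth R 1 = 0"
    using polar_asymptotics(2)[OF z(2)] by blast
  define \<theta> where "\<theta> t = arctan (Im (z t) / Re (z t))" for t
  obtain H where H: "asy s \<theta> H" "fps_nth H 0 = 0" "fps_nth H 1 = fps_nth y 1 / sqrt lam"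
    unfolding \<theta>_def[abs_def] using polar_asymptotics(3)[OF z(2)] by blast
  obtain T where T: "0 \<le> T" "\<And>t. T \<le> t \<Longrightarrow> 0 < Re (z t)"
    using polar_asymptotics(1)[OF z(2)] unfolding eventually_at_top_linorder by (metis max.bounded_iff max.cobounded1)
  define g where "g t = Complex (- \<mu> t * S) (- \<mu> t * C)" for t
  define z' where "z' t = Complex A B + \<i> * of_real ((norm (z t))\<^sup>2 - lam * t) * z t + g t * cnj (z t)" for t
  have zd: "(z has_vector_derivative z' t) (at t within {0..})" if "0 \<le> t" for t
    using z(1) that unfolding sol_def cubic_sol_def z'_def g_def by blast
  \<comment> \<open>With \<open>z * cnj z\<close> in place of the squared modulus the right-hand
    side is differentiable by the product rule, and the polar lift needs this second derivative at
    the zeros.\<close>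
  have z'_eq: "z' t = Complex A B + \<i> * (z t * cnj (z t) - of_real (lam * t)) * z t + of_real (\<mu> t) * - Complex S C * cnj (z t)" for t
    unfolding z'_def g_def of_real_diff complex_norm_square by (simp add: complex_eq_iff)
  have zd2: "\<exists>D. (z' has_vector_derivative D) (at t within {0..})" if t: "0 \<le> t" for t
  proof -
    obtain d where d: "(\<mu> has_real_derivative d) (at t within {0..})" using mu_diff[OF t] by blast
    note cd = bounded_linear.has_vector_derivative[OF bounded_linear_cnj zd[OF t]]
    note md = has_vector_derivative_of_real[OF d]
    have "((\<lambda>u. lam * u) has_real_derivative lam) (at t within {0..})"
      by (auto intro!: derivative_eq_intros)
    note ld = has_vector_derivative_of_real[OF this]
    show ?thesis
      unfolding z'_eq[abs_def]
      by (rule exI) (rule has_vector_derivative_add has_vector_derivative_mult has_vector_derivative_diff has_vector_derivative_const zd[OF t] cd md ld)+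
  qed
  \<comment> \<open>At a zero only the constant sin \<sigma> + i cos \<sigma> is left of the
    derivative.\<close>
  have zn: "z' t \<noteq> 0" if "z t = 0" for t
    using that AB unfolding z'_def by (auto simp: complex_eq_iff) (metis sin_zero_abs_cos_one abs_zero zero_neq_one)
  have zc: "continuous_on {T..} z"
    by (rule continuous_on_subset[of "{0..}"]) (use zd T in \<open>auto intro: continuous_on_vector_derivative\<close>)
  have "\<exists>\<rho> \<eta>. (\<forall>t\<ge>0. z t = of_real (\<rho> t) * cis (\<eta> t)) \<and> (\<forall>t\<ge>T. \<rho> t = norm (z t) \<and> \<eta> t = \<theta> t) \<and>
    (\<forall>t\<ge>0. \<exists>D. (\<rho> has_real_derivative D) (at t within {0..})) \<and>
    (\<forall>t\<ge>0. \<exists>D. (\<eta> has_real_derivative D) (at t within {0..}))"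
  proof (rule polar_lift_prescribed[OF zd zd2 zn T(1)])
    show "z t = of_real (norm (z t)) * cis (\<theta> t)" if "T \<le> t" for t
      unfolding \<theta>_def by (rule polar_arctan[OF T(2)[OF that]])
    show "0 < norm (z t)" if "T \<le> t" for t using T(2)[OF that] by auto
    show "continuous_on {T..} \<theta>"
      unfolding \<theta>_def[abs_def] using T(2) by (intro continuous_intros zc) (metis atLeast_iff less_irrefl)
  qed
  then obtain \<rho> \<eta> where p: "\<And>t. 0 \<le> t \<Longrightarrow> z t = of_real (\<rho> t) * cis (\<eta> t)"
    and e: "\<And>t. T \<le> t \<Longrightarrow> \<rho> t = norm (z t)" "\<And>t. T \<le> t \<Longrightarrow> \<eta> t = \<theta> t"
    and d: "\<And>t. 0 \<le> t \<Longrightarrow> \<exists>D. (\<rho> has_real_derivative D) (at t within {0..})" "\<And>t. 0 \<le> t \<Longrightarrow> \<exists>D. (\<eta> has_real_derivative D) (at t within {0..})"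
    by blast
  have "MS_solution lam \<nu> \<mu> \<rho> (\<lambda>t. \<sigma> + \<eta> t)"
    by (rule MS_solution_of_cubic[OF _ p d]) (use z(1)[unfolded sol_def, unfolded AB SC] in simp)
  moreover have "asy s (\<lambda>t. \<rho> t - sqrt lam * t powr (1/2)) R"
    by (rule asy_cong[OF R(1)]) (use eventually_ge_at_top[of T] in \<open>eventually_elim, simp add: e\<close>)
  moreover have "asy s (\<lambda>t. \<sigma> + \<eta> t) (fps_const \<sigma> + H)"
    by (rule asy_cong[OF asy_add[OF asy_const H(1)]]) (use eventually_ge_at_top[of T] in \<open>eventually_elim, simp add: e\<close>)
  ultimately show ?thesis using R(2,3) H(2,3)
    by - (rule exI[of _ \<rho>], rule exI[of _ "\<lambda>t. \<sigma> + \<eta> t"], rule exI[of _ R], rule exI[of _ "fps_const \<sigma> + H"], simp)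
qed

end

section \<open>Translation of the expansions, and the three cases\<close>

lemma asymp_exp_of_asy:
  assumes m: "0 < m" and f: "asy (\<lambda>t. t powr (- 1 / (2 * real m))) f F"
  shows "asymp_exp 0 (2 * real m) f (fps_nth F)"
  unfolding asymp_exp_def
proof
  fix N
  let ?s = "\<lambda>t. t powr (- 1 / (2 * real m)) :: real"
  \<comment> \<open>\<open>asymp_exp\<close> sums up to index \<open>N\<close> inclusively, hence
    the truncation length \<open>Suc N\<close>.\<close>
  have tr: "truncate_fps (Suc N) F = (\<Sum>k\<le>N. monom (fps_nth F k) k)"
    by (rule poly_eqI) (auto simp: coeff_truncate_fps coeff_sum sum.delta')
  have pw: "?s t ^ k = t powr (0 - real k / (2 * real m))" if "0 < t" for t k
    using that by (simp add: powr_power mult.commute)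
  have 1: "\<forall>\<^sub>F t in at_top. f t - poly (truncate_fps (Suc N) F) (?s t) = f t - (\<Sum>k\<le>N. fps_nth F k * t powr (0 - real k / (2 * real m)))"
    using eventually_gt_at_top[of 0]
    by eventually_elim (simp only: tr poly_sum poly_monom pw)
  have 2: "\<forall>\<^sub>F t in at_top. ?s t ^ Suc N = t powr (0 - real (Suc N) / (2 * real m))"
    using eventually_gt_at_top[of 0] by eventually_elim (rule pw)
  show "(\<lambda>t. f t - (\<Sum>k\<le>N. fps_nth F k * t powr (0 - real k / (2 * real m)))) \<in> O[at_top](\<lambda>t. t powr (0 - real (Suc N) / (2 * real m)))"
    using f[unfolded asy_def, rule_format, of "Suc N"] unfolding landau_o.big.in_cong[OF 1] landau_o.big.cong[OF 2] .
qed

text \<open>Otherwise t^(-1/q) would be of order t^(-2/q). This tells the two solutions of type (E2)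
  apart.\<close>

lemma asymp_exp_unique_1:
  assumes q: "0 < q" and c: "asymp_exp 0 q f c" and d: "asymp_exp 0 q f d" and 0: "c 0 = d 0"
  shows "c 1 = d 1"
proof (rule ccontr)
  assume ne: "c 1 \<noteq> d 1"
  have "(\<lambda>t. (f t - (\<Sum>k\<le>1. d k * t powr (0 - real k / q))) - (f t - (\<Sum>k\<le>1. c k * t powr (0 - real k / q)))) \<in> O[at_top](\<lambda>t. t powr (0 - real (Suc 1) / q))"
    by (rule sum_in_bigo(2)) (use c d in \<open>unfold asymp_exp_def, blast+\<close>)
  then have "(\<lambda>t. (c 1 - d 1) * t powr (- 1 / q)) \<in> O[at_top](\<lambda>t. t powr (- 2 / q))"
    using 0 by (simp add: algebra_simps)
  then have "(\<lambda>t. t powr (- 1 / q)) \<in> O[at_top](\<lambda>t::real. t powr (- 2 / q))"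
    using ne by simp
  then have "- 1 / q \<le> - 2 / q" by (subst (asm) powr_bigo_iff[OF filterlim_ident]) auto
  then show False using q by (simp add: field_simps)
qed

text \<open>As t^(-1/2) = s^m and 1/t = s^(2m), the expansion of \<mu> is s^m times a series in
  s^(2m): the coefficient \<open>c j\<close> sits at index \<open>2 * m * j\<close>.\<close>

definition coupling_series :: "nat \<Rightarrow> (nat \<Rightarrow> real) \<Rightarrow> real fps" where
  "coupling_series m c = Abs_fps (\<lambda>k. if 2 * m dvd k then c (k div (2 * m)) else 0)"

lemma coupling_series_0 [simp]: "fps_nth (coupling_series m c) 0 = c 0"
  by (simp add: coupling_series_def)

lemma coupling_series_below: "0 < k \<Longrightarrow> k < 2 * m \<Longrightarrow> fps_nth (coupling_series m c) k = 0"
  by (auto simp: coupling_series_def dest: dvd_imp_le)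

lemma coupling_series_split: "\<exists>N. coupling_series m c = fps_const (c 0) + fps_X ^ (2 * m) * N"
proof -
  have "coupling_series m c = fps_const (c 0) + fps_X ^ (2 * m) * fps_shift (2 * m) (coupling_series m c - fps_const (c 0))"
    by (rule fps_ext) (auto simp: fps_X_power_mult_nth coupling_series_below)
  then show ?thesis by blast
qed

text \<open>In the remainder half a power of \<open>t\<close> is given away, and one full power
  absorbs the Landau constant.\<close>

lemma coupling_expansion:
  assumes m: "0 < m" and \<mu>: "asymp_exp (-1/2) 1 \<mu> c"
  shows "\<exists>T\<ge>1. \<forall>t\<ge>T. \<bar>\<mu> t - (t powr (- 1 / (2 * real m))) ^ m * poly (truncate_fps (2 * m * (L + 5)) (coupling_series m c)) (t powr (- 1 / (2 * real m)))\<bar> \<le> 1 / t ^ (L + 4)"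
proof -
  let ?s = "\<lambda>t. t powr (- 1 / (2 * real m)) :: real"
  have tr: "truncate_fps (2 * m * (L + 5)) (coupling_series m c) = (\<Sum>j\<le>L+4. monom (c j) (2 * m * j))"
  proof (rule poly_eqI)
    fix k
    show "coeff (truncate_fps (2 * m * (L + 5)) (coupling_series m c)) k = coeff (\<Sum>j\<le>L+4. monom (c j) (2 * m * j)) k"
    proof (cases "2 * m dvd k")
      case True
      then obtain i where i: "k = 2 * m * i" by (elim dvdE)
      have "coeff (\<Sum>j\<le>L+4. monom (c j) (2 * m * j)) k = (\<Sum>j\<le>L+4. if j = i then c j else 0)"
        unfolding coeff_sum using m by (intro sum.cong) (auto simp: i)
      also have "\<dots> = (if i < L + 5 then c i else 0)" by (simp add: sum.delta')
      finally show ?thesis using m i by (simp add: coeff_truncate_fps coupling_series_def)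
    next
      case False
      then have "coeff (\<Sum>j\<le>L+4. monom (c j) (2 * m * j)) k = (\<Sum>j\<le>L+4. 0)"
        unfolding coeff_sum by (intro sum.cong) (auto simp: coeff_monom)
      then show ?thesis using False by (simp add: coeff_truncate_fps coupling_series_def)
    qed
  qed
  have eq: "?s t ^ m * poly (truncate_fps (2 * m * (L + 5)) (coupling_series m c)) (?s t) = (\<Sum>k\<le>L+4. c k * t powr (-1/2 - real k / 1))"
    if t: "0 < t" for t
  proof -
    have "?s t ^ m * ?s t ^ (2 * m * k) = t powr (-1/2 - real k)" for k
    proof -
      have "?s t ^ m = t powr (-1/2)" "?s t ^ (2 * m * k) = t powr (- real k)"
        using t m by (simp_all add: powr_power)
      then show ?thesis using t by (simp add: powr_add[symmetric])
    qed
    then show ?thesis unfolding tr poly_sum poly_monom sum_distrib_left by (simp add: mult.left_commute)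
  qed
  have "(\<lambda>t. \<mu> t - (\<Sum>k\<le>L+4. c k * t powr (-1/2 - real k / 1))) \<in> O[at_top](\<lambda>t. t powr (-1/2 - real (Suc (L+4)) / 1))"
    using \<mu> unfolding asymp_exp_def by blast
  then obtain K where K: "\<forall>\<^sub>F t in at_top. norm (\<mu> t - (\<Sum>k\<le>L+4. c k * t powr (-1/2 - real k / 1))) \<le> K * norm (t powr (-1/2 - real (Suc (L+4)) / 1))"
    by (elim landau_o.bigE)
  have "\<forall>\<^sub>F t in at_top. 1 \<le> t \<and> \<bar>\<mu> t - ?s t ^ m * poly (truncate_fps (2 * m * (L + 5)) (coupling_series m c)) (?s t)\<bar> \<le> 1 / t ^ (L + 4)"
    using K eventually_ge_at_top[of "max 1 \<bar>K\<bar>"]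
  proof eventually_elim
    case (elim t)
    then have t: "1 \<le> t" "\<bar>K\<bar> \<le> t" "0 < t" by auto
    have "t powr (-1/2 - real (Suc (L+4))) \<le> t powr (- real (L + 5))" using t by (intro powr_mono) auto
    also have "\<dots> = 1 / t ^ (L + 5)" using t by (simp add: powr_minus divide_inverse powr_realpow del: of_nat_add)
    finally have "K * norm (t powr (-1/2 - real (Suc (L+4)) / 1)) \<le> \<bar>K\<bar> * (1 / t ^ (L + 5))"
      by (intro mult_mono) auto
    also have "\<dots> \<le> t * (1 / t ^ (L + 5))" using t by (intro mult_right_mono) auto
    also have "\<dots> = 1 / t ^ (L + 4)" using t by (simp add: field_simps power_Suc[symmetric] del: power_Suc)
    finally show ?case using elim(1) t eq[OF t(3)] by simp
  qed
  then obtain T where "\<forall>t\<ge>T. 1 \<le> t \<and> \<bar>\<mu> t - ?s t ^ m * poly (truncate_fps (2 * m * (L + 5)) (coupling_series m c)) (?s t)\<bar> \<le> 1 / t ^ (L + 4)"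
    unfolding eventually_at_top_linorder by blast
  then show ?thesis by (intro exI[of _ "max T 1"]) auto
qed

lemma coupling_bounded:
  assumes cont: "continuous_on {0..} \<mu>" and \<mu>: "asymp_exp (-1/2) 1 \<mu> c"
  shows "\<exists>b. \<forall>t\<ge>0. \<bar>\<mu> t\<bar> \<le> (b::real)"
proof -
  have "(\<lambda>t. \<mu> t - (\<Sum>k\<le>0. c k * t powr (-1/2 - real k / 1))) \<in> O[at_top](\<lambda>t. t powr (-1/2 - real (Suc 0) / 1))"
    using \<mu> unfolding asymp_exp_def by blast
  then have "(\<lambda>t. \<mu> t - c 0 * t powr (-1/2)) \<in> O[at_top](\<lambda>t. t powr (-3/2))" by simp
  then obtain K where K: "\<forall>\<^sub>F t in at_top. norm (\<mu> t - c 0 * t powr (-1/2)) \<le> K * norm (t powr (-3/2))"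
    by (elim landau_o.bigE)
  have "\<forall>\<^sub>F t in at_top. \<bar>\<mu> t\<bar> \<le> \<bar>K\<bar> + \<bar>c 0\<bar>"
    using K eventually_ge_at_top[of 1]
  proof eventually_elim
    case (elim t)
    have p: "t powr (-3/2) \<le> 1" "t powr (-1/2) \<le> 1"
      using powr_mono[of "-3/2" 0 t] powr_mono[of "-1/2" 0 t] elim(2) by auto
    have "K * norm (t powr (-3/2)) \<le> \<bar>K\<bar> * 1" by (intro mult_mono) (use p in auto)
    moreover have "\<bar>c 0 * t powr (-1/2)\<bar> \<le> \<bar>c 0\<bar> * 1" unfolding abs_mult by (intro mult_mono) (use p in auto)
    ultimately show ?case using elim(1) by simp
  qed
  then obtain T where T: "\<And>t. T \<le> t \<Longrightarrow> \<bar>\<mu> t\<bar> \<le> \<bar>K\<bar> + \<bar>c 0\<bar>" unfolding eventually_at_top_linorder by blast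
  have "compact (\<mu> ` {0..T})" by (intro compact_continuous_image continuous_on_subset[OF cont]) auto
  then obtain b where b: "\<And>t. 0 \<le> t \<Longrightarrow> t \<le> T \<Longrightarrow> \<bar>\<mu> t\<bar> \<le> b"
    using compact_imp_bounded[of "\<mu> ` {0..T}"] unfolding bounded_iff by fastforce
  have "\<bar>\<mu> t\<bar> \<le> max b (\<bar>K\<bar> + \<bar>c 0\<bar>)" if "0 \<le> t" for t
    using b[OF that] T[of t] by (cases "t \<le> T") auto
  then show ?thesis by blast
qed

lemma solution_of_formal:
  assumes lam: "0 < lam" and smooth: "smooth_on_nonneg \<mu>" and \<mu>: "asymp_exp (-1/2) 1 \<mu> \<mu>c" and m: "0 < m"
    and fs: "formal_sol m lam (sin \<sigma>) (cos \<sigma>) (sin (2 * \<sigma> + \<nu>)) (cos (2 * \<sigma> + \<nu>)) (coupling_series m \<mu>c) x y D"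
    and x0: "fps_nth x 0 = sqrt lam" and y0: "fps_nth y 0 = 0"
    and lead: "leading (m - 1) \<Delta> (char_series m lam (sin (2 * \<sigma> + \<nu>)) (cos (2 * \<sigma> + \<nu>)) (coupling_series m \<mu>c) x y D)" and \<Delta>: "\<Delta> \<noteq> 0"
  shows "\<exists>\<rho> \<psi> rc pc. MS_solution lam \<nu> \<mu> \<rho> \<psi> \<and>
    asymp_exp 0 (2 * real m) (\<lambda>\<tau>. \<rho> \<tau> - sqrt lam * \<tau> powr (1/2)) rc \<and> rc 0 = 0 \<and> rc 1 = 0 \<and>
    asymp_exp 0 (2 * real m) \<psi> pc \<and> pc 0 = \<sigma> \<and> pc 1 = fps_nth y 1 / sqrt lam"
proof -
  have diff: "\<exists>D. (\<mu> has_real_derivative D) (at t within {0..})" if "0 \<le> t" for t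
    using smooth that unfolding smooth_on_nonneg_def by metis
  then have cont: "continuous_on {0..} \<mu>"
    by (metis DERIV_continuous_on atLeast_iff)
  obtain b where b: "\<And>t. 0 \<le> t \<Longrightarrow> \<bar>\<mu> t\<bar> \<le> b" using coupling_bounded[OF cont \<mu>] by blast
  interpret expansion_flow m lam "sin \<sigma>" "cos \<sigma>" "sin (2 * \<sigma> + \<nu>)" "cos (2 * \<sigma> + \<nu>)" \<Delta> \<mu> "coupling_series m \<mu>c" x y D b
    by unfold_locales (use assms cont b coupling_expansion[OF m \<mu>] in auto)
  obtain \<rho> \<psi> R H where *: "MS_solution lam \<nu> \<mu> \<rho> \<psi>" "asy s (\<lambda>t. \<rho> t - sqrt lam * t powr (1/2)) R" "fps_nth R 0 = 0" "fps_nth R 1 = 0"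
    "asy s \<psi> H" "fps_nth H 0 = \<sigma>" "fps_nth H 1 = fps_nth y 1 / sqrt lam"
    using polar_solution[OF diff refl refl refl refl] by blast
  show ?thesis
    using * asymp_exp_of_asy[OF m *(2)[unfolded s_def[abs_def]]] asymp_exp_of_asy[OF m *(5)[unfolded s_def[abs_def]]] by blast
qed

lemma Pder_eqs:
  "Pder 1 \<delta> \<nu> \<sigma> = 2 * \<delta> * cos (2 * \<sigma> + \<nu>) - cos \<sigma>"
  "Pder 2 \<delta> \<nu> \<sigma> = - 4 * \<delta> * sin (2 * \<sigma> + \<nu>) + sin \<sigma>"
  "Pder 3 \<delta> \<nu> \<sigma> = - 8 * \<delta> * cos (2 * \<sigma> + \<nu>) + cos \<sigma>"
proof -
  have 1: "deriv (Pfun \<delta> \<nu>) = (\<lambda>\<sigma>. 2 * \<delta> * cos (2 * \<sigma> + \<nu>) - cos \<sigma>)"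
    unfolding Pfun_def[abs_def] by (intro ext DERIV_imp_deriv) (auto intro!: derivative_eq_intros)
  have 2: "deriv (\<lambda>\<sigma>. 2 * \<delta> * cos (2 * \<sigma> + \<nu>) - cos \<sigma>) = (\<lambda>\<sigma>. - 4 * \<delta> * sin (2 * \<sigma> + \<nu>) + sin \<sigma>)"
    by (intro ext DERIV_imp_deriv) (auto intro!: derivative_eq_intros)
  have 3: "deriv (\<lambda>\<sigma>. - 4 * \<delta> * sin (2 * \<sigma> + \<nu>) + sin \<sigma>) = (\<lambda>\<sigma>. - 8 * \<delta> * cos (2 * \<sigma> + \<nu>) + cos \<sigma>)"
    by (intro ext DERIV_imp_deriv) (auto intro!: derivative_eq_intros)
  show "Pder 1 \<delta> \<nu> \<sigma> = 2 * \<delta> * cos (2 * \<sigma> + \<nu>) - cos \<sigma>"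
    "Pder 2 \<delta> \<nu> \<sigma> = - 4 * \<delta> * sin (2 * \<sigma> + \<nu>) + sin \<sigma>"
    "Pder 3 \<delta> \<nu> \<sigma> = - 8 * \<delta> * cos (2 * \<sigma> + \<nu>) + cos \<sigma>"
    unfolding Pder_def numeral_3_eq_3 numeral_2_eq_2 One_nat_def funpow.simps comp_apply id_apply 1 2 3 by (rule refl)+
qed

theorem theorem2:
  fixes lam \<nu> \<sigma> :: real and \<mu> :: "real \<Rightarrow> real" and \<mu>c :: "nat \<Rightarrow> real"
  assumes "lam > 0" and "0 \<le> \<nu>" and "\<nu> < pi"
    and "smooth_on_nonneg \<mu>"
    and "asymp_exp (-1/2) 1 \<mu> \<mu>c"
    and "in_gamma_pm (\<mu>c 0 * sqrt lam) \<nu>"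
    and "Pfun (\<mu>c 0 * sqrt lam) \<nu> \<sigma> = 0"
  shows
    "(Pder 1 (\<mu>c 0 * sqrt lam) \<nu> \<sigma> \<noteq> 0 \<longrightarrow>
        (\<exists>\<rho> \<psi>. MS_solution lam \<nu> \<mu> \<rho> \<psi> \<and> has_E1 lam (\<mu>c 0 * sqrt lam) \<nu> \<sigma> \<rho> \<psi>)) \<and>
     (Pder 1 (\<mu>c 0 * sqrt lam) \<nu> \<sigma> = 0 \<and> Pder 2 (\<mu>c 0 * sqrt lam) \<nu> \<sigma> < 0 \<longrightarrow>
        (\<exists>\<rho>1 \<psi>1 \<rho>2 \<psi>2. (\<rho>1, \<psi>1) \<noteq> (\<rho>2, \<psi>2) \<and>
           MS_solution lam \<nu> \<mu> \<rho>1 \<psi>1 \<and>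
           has_E2 lam \<sigma> (sqrt (- sqrt lam / Pder 2 (\<mu>c 0 * sqrt lam) \<nu> \<sigma>)) \<rho>1 \<psi>1 \<and>
           MS_solution lam \<nu> \<mu> \<rho>2 \<psi>2 \<and>
           has_E2 lam \<sigma> (- sqrt (- sqrt lam / Pder 2 (\<mu>c 0 * sqrt lam) \<nu> \<sigma>)) \<rho>2 \<psi>2)) \<and>
     (Pder 1 (\<mu>c 0 * sqrt lam) \<nu> \<sigma> = 0 \<and> Pder 2 (\<mu>c 0 * sqrt lam) \<nu> \<sigma> = 0 \<longrightarrow>
        (\<exists>\<rho> \<psi>. MS_solution lam \<nu> \<mu> \<rho> \<psi> \<and> has_E3 lam (\<mu>c 0 * sqrt lam) \<nu> \<sigma> \<rho> \<psi>))"
proof -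
  define l where "l = sqrt lam"
  define \<mu>0 where "\<mu>0 = \<mu>c 0"
  let ?A = "sin \<sigma>" and ?B = "cos \<sigma>" and ?S = "sin (2 * \<sigma> + \<nu>)" and ?C = "cos (2 * \<sigma> + \<nu>)"
  have l: "0 < l" "l * l = lam" using assms(1) by (simp_all add: l_def)
  have A: "?A = \<mu>0 * sqrt lam * ?S" using assms(7) by (simp add: Pfun_def \<mu>0_def)
  have P1: "Pder 1 (\<mu>c 0 * sqrt lam) \<nu> \<sigma> = 2 * \<mu>0 * ?C * sqrt lam - ?B" unfolding Pder_eqs by (simp add: \<mu>0_def)
  \<comment> \<open>The root condition \<open>A\<close> replaces \<delta> times \<open>?S\<close> by
    \<open>?A\<close>, so that \<open>- 4 * ?A + ?A\<close> remains.\<close>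
  have P2: "Pder 2 (\<mu>c 0 * sqrt lam) \<nu> \<sigma> = - 3 * ?A" unfolding Pder_eqs using A by (simp add: \<mu>0_def)
  have P3: "Pder 3 (\<mu>c 0 * sqrt lam) \<nu> \<sigma> = - 4 * (2 * \<mu>0 * ?C * sqrt lam) + ?B" unfolding Pder_eqs by (simp add: \<mu>0_def)
  note sol = solution_of_formal[OF assms(1,4,5)]
  have 1: "\<exists>\<rho> \<psi>. MS_solution lam \<nu> \<mu> \<rho> \<psi> \<and> has_E1 lam (\<mu>c 0 * sqrt lam) \<nu> \<sigma> \<rho> \<psi>"
    if p: "Pder 1 (\<mu>c 0 * sqrt lam) \<nu> \<sigma> \<noteq> 0"
  proof -
    obtain N where M: "coupling_series 1 \<mu>c = fps_const \<mu>0 + fps_X ^ 2 * N"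
      using coupling_series_split[of 1 \<mu>c] by (auto simp: \<mu>0_def)
    have ne: "?B - 2 * \<mu>0 * ?C * sqrt lam \<noteq> 0" using p P1 by simp
    from formal_exists_simple[OF assms(1) A M ne]
    obtain x y D where fs: "formal_sol 1 lam ?A ?B ?S ?C (coupling_series 1 \<mu>c) x y D"
      and x: "fps_nth x 0 = sqrt lam" and y: "fps_nth y 0 = 0" "fps_nth y 1 = lam / (2 * (?B - 2 * \<mu>0 * ?C * sqrt lam))" by blast
    have \<Delta>: "2 * sqrt lam * (2 * fps_nth (coupling_series 1 \<mu>c) 0 * ?C * sqrt lam - ?B) \<noteq> 0"
      using ne assms(1) by (simp add: \<mu>0_def)
    have y1: "fps_nth y 1 / sqrt lam = - sqrt lam / (2 * Pder 1 (\<mu>c 0 * sqrt lam) \<nu> \<sigma>)"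
    proof -
      have "l * l / (2 * (b - a)) / l = - l / (2 * (a - b))" if "b - a \<noteq> 0" for a b using that l(1) by (simp add: field_simps)
      from this[OF ne, unfolded l(2)] show ?thesis unfolding y P1 l_def .
    qed
    show ?thesis
      using sol[OF _ fs x y(1) _ \<Delta>] leading_char_1[OF fs assms(1) x y(1)] y1 unfolding has_E1_def by simp
  qed
  have 2: "\<exists>\<rho> \<psi>. MS_solution lam \<nu> \<mu> \<rho> \<psi> \<and> has_E2 lam \<sigma> p1 \<rho> \<psi>"
    if p: "Pder 1 (\<mu>c 0 * sqrt lam) \<nu> \<sigma> = 0" "Pder 2 (\<mu>c 0 * sqrt lam) \<nu> \<sigma> < 0"
      and p1: "p1\<^sup>2 = - sqrt lam / Pder 2 (\<mu>c 0 * sqrt lam) \<nu> \<sigma>" for p1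
  proof -
    obtain N where M: "coupling_series 2 \<mu>c = fps_const \<mu>0 + fps_X ^ 4 * N"
      using coupling_series_split[of 2 \<mu>c] by (auto simp: \<mu>0_def)
    have e: "?B - 2 * \<mu>0 * ?C * sqrt lam = 0" using p P1 by simp
    have A0: "0 < ?A" using p(2) P2 by simp
    \<comment> \<open>To first order \<psi> - \<sigma> is the quotient of \<open>y\<close> by
      \<open>x\<close>, and \<open>x\<close> starts with \<open>l = sqrt lam\<close>; so the
      coefficient \<open>p1\<close> of the phase corresponds to \<open>l * p1\<close> in
      \<open>y\<close>.\<close>
    have "3 * ?A * (l * p1)\<^sup>2 = lam * sqrt lam"
      unfolding power_mult_distrib p1 P2 using A0 l by (simp add: power2_eq_square l_def)
    from formal_exists_double[OF assms(1) A M e this]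
    obtain x y D where fs: "formal_sol 2 lam ?A ?B ?S ?C (coupling_series 2 \<mu>c) x y D"
      and x: "fps_nth x 0 = sqrt lam" "fps_nth x 1 = 0" and y: "fps_nth y 0 = 0" "fps_nth y 1 = l * p1" by blast
    have "p1\<^sup>2 \<noteq> 0" unfolding p1 P2 using A0 l by (simp add: l_def)
    then have \<Delta>: "- 6 * ?A * (l * p1) \<noteq> 0" using A0 l by simp
    have M1: "fps_nth (coupling_series 2 \<mu>c) 1 = 0" by (rule coupling_series_below) auto
    have "?A = fps_nth (coupling_series 2 \<mu>c) 0 * sqrt lam * ?S" "?B = 2 * fps_nth (coupling_series 2 \<mu>c) 0 * ?C * sqrt lam"
      using A e by (simp_all add: \<mu>0_def)
    note lead = leading_char_2[OF fs assms(1) x y M1 this]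
    have y1: "fps_nth y 1 / sqrt lam = p1" using y l by (simp add: l_def)
    show ?thesis
      using sol[OF _ fs x(1) y(1) _ \<Delta>] lead y1 unfolding has_E2_def by simp
  qed
  have 3: "\<exists>\<rho> \<psi>. MS_solution lam \<nu> \<mu> \<rho> \<psi> \<and> has_E3 lam (\<mu>c 0 * sqrt lam) \<nu> \<sigma> \<rho> \<psi>"
    if p: "Pder 1 (\<mu>c 0 * sqrt lam) \<nu> \<sigma> = 0" "Pder 2 (\<mu>c 0 * sqrt lam) \<nu> \<sigma> = 0"
  proof -
    obtain N where M: "coupling_series 3 \<mu>c = fps_const \<mu>0 + fps_X ^ 6 * N"
      using coupling_series_split[of 3 \<mu>c] by (auto simp: \<mu>0_def)
    have e: "?B - 2 * \<mu>0 * ?C * sqrt lam = 0" using p P1 by simp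
    have A0: "?A = 0" using p(2) P2 by simp
    \<comment> \<open>The curve condition supplies \<delta> \<noteq> 0, so \<open>?A = 0\<close>
      forces \<open>?S = 0\<close>, as \<open>formal_exists_triple\<close> demands.\<close>
    then have S0: "?S = 0" using A assms(6) by (auto simp: in_gamma_pm_def \<mu>0_def)
    have B0: "?B \<noteq> 0" using sin_cos_squared_add[of \<sigma>] A0 by auto
    have P3': "Pder 3 (\<mu>c 0 * sqrt lam) \<nu> \<sigma> = - 3 * ?B" using P3 e by simp
    \<comment> \<open>\<open>root 3\<close> is the real cube root on both half-lines, so either sign
      of \<open>cos \<sigma>\<close> is covered; with the third derivative equal to
      \<open>- 3 * ?B\<close> the cube is \<open>l / ?B\<close>.\<close>
    define y1 where "y1 = - root 3 (3 * l / Pder 3 (\<mu>c 0 * sqrt lam) \<nu> \<sigma>)"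
    have y13: "y1 ^ 3 = l / ?B" unfolding y1_def P3' using B0 by (simp add: odd_real_root_pow power_minus_odd)
    have "?B * (l * y1) ^ 3 = lam\<^sup>2"
      unfolding power_mult_distrib y13 l(2)[symmetric] using B0 by (simp add: power2_eq_square power3_eq_cube)
    from formal_exists_triple[OF assms(1) M e this]
    obtain x y D where fs: "formal_sol 3 lam 0 ?B 0 ?C (coupling_series 3 \<mu>c) x y D"
      and x: "fps_nth x 0 = sqrt lam" "fps_nth x 1 = 0" and y: "fps_nth y 0 = 0" "fps_nth y 1 = l * y1" by blast
    have "y1 \<noteq> 0" using y13 l B0 by auto
    then have \<Delta>: "- 3 * ?B * (l * y1)\<^sup>2 / sqrt lam \<noteq> 0" using B0 l assms(1) by simp
    have M12: "fps_nth (coupling_series 3 \<mu>c) 1 = 0" "fps_nth (coupling_series 3 \<mu>c) 2 = 0" by (rule coupling_series_below; simp)+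
    have "?B = 2 * fps_nth (coupling_series 3 \<mu>c) 0 * ?C * sqrt lam" using e by (simp add: \<mu>0_def)
    note lead = leading_char_3[OF fs assms(1) x y M12 this]
    have y1': "fps_nth y 1 / sqrt lam = y1" using y l by (simp add: l_def)
    have "\<exists>\<rho> \<psi> rc pc. MS_solution lam \<nu> \<mu> \<rho> \<psi> \<and>
      asymp_exp 0 (2 * real 3) (\<lambda>\<tau>. \<rho> \<tau> - sqrt lam * \<tau> powr (1/2)) rc \<and> rc 0 = 0 \<and> rc 1 = 0 \<and>
      asymp_exp 0 (2 * real 3) \<psi> pc \<and> pc 0 = \<sigma> \<and> pc 1 = fps_nth y 1 / sqrt lam"
      by (rule sol[OF _ _ x(1) y(1) _ \<Delta>]) (use fs lead A0 S0 in simp_all)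
    then show ?thesis using y1' unfolding has_E3_def y1_def l_def by simp
  qed
  have two: "\<exists>\<rho>1 \<psi>1 \<rho>2 \<psi>2. (\<rho>1, \<psi>1) \<noteq> (\<rho>2, \<psi>2) \<and> MS_solution lam \<nu> \<mu> \<rho>1 \<psi>1 \<and>
      has_E2 lam \<sigma> (sqrt (- sqrt lam / Pder 2 (\<mu>c 0 * sqrt lam) \<nu> \<sigma>)) \<rho>1 \<psi>1 \<and> MS_solution lam \<nu> \<mu> \<rho>2 \<psi>2 \<and>
      has_E2 lam \<sigma> (- sqrt (- sqrt lam / Pder 2 (\<mu>c 0 * sqrt lam) \<nu> \<sigma>)) \<rho>2 \<psi>2"
    if p: "Pder 1 (\<mu>c 0 * sqrt lam) \<nu> \<sigma> = 0" "Pder 2 (\<mu>c 0 * sqrt lam) \<nu> \<sigma> < 0"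
  proof -
    let ?q = "- sqrt lam / Pder 2 (\<mu>c 0 * sqrt lam) \<nu> \<sigma>"
    have q: "0 < ?q" using p(2) assms(1) by (simp add: divide_pos_neg)
    obtain \<rho>1 \<psi>1 where s1: "MS_solution lam \<nu> \<mu> \<rho>1 \<psi>1" "has_E2 lam \<sigma> (sqrt ?q) \<rho>1 \<psi>1"
      using 2[OF p, of "sqrt ?q"] q by (metis less_imp_le real_sqrt_pow2)
    obtain \<rho>2 \<psi>2 where s2: "MS_solution lam \<nu> \<mu> \<rho>2 \<psi>2" "has_E2 lam \<sigma> (- sqrt ?q) \<rho>2 \<psi>2"
      using 2[OF p, of "- sqrt ?q"] q by (metis less_imp_le power2_minus real_sqrt_pow2)
    \<comment> \<open>The phases alone differ, because a function determines its coefficient of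
      order one.\<close>
    have "\<psi>1 \<noteq> \<psi>2"
    proof
      assume "\<psi>1 = \<psi>2"
      then have "sqrt ?q = - sqrt ?q"
        using s1(2) s2(2) asymp_exp_unique_1[of 4] unfolding has_E2_def by (metis zero_less_numeral)
      moreover have "0 < sqrt ?q" using q by (rule real_sqrt_gt_zero)
      ultimately show False by linarith
    qed
    then show ?thesis using s1 s2 by blast
  qed
  show ?thesis using 1 two 3 by blast
qed

end
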